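(* Let $\mathbf{k}$ be an algebraically closed field of characteristic $p\ge 5$. Then there exist a symmetric tensor category $\mathcal{C}$ over $\mathbf{k}$ and an object $X\in\mathcal{C}$ such that $\mathrm{Dim}_+(X)\ne\mathrm{Dim}_-(X)$.
   Context: A symmetric tensor category over $\mathbf{k}$ is a $\mathbf{k}$-linear locally finite abelian rigid symmetric monoidal category with $\mathbf{k}$-bilinear tensor product and $\mathrm{End}(\mathbf{1})=\mathbf{k}$. The dimension of $X$ is $\dim(X):=\mathrm{ev}_X\circ c_{X,X^*}\circ\mathrm{coev}_X\in\mathbf{k}$, where $c$ is the commutativity constraint. $S^nX$ is the object of $S_n$-coinvariants of $X^{\otimes n}$, i.e. the degree $n$ part of the quotient $SX$ of the tensor algebra $TX$ by the two-sided ideal generated by the image of $c_{X,X}-1$. $\wedge^nX$ is the degree $n$ part of the quotient $\wedge X$ of $TX$ by the two-sided ideal generated by the kernel of $c_{X,X}-1$. For $t=\sum_{j\ge0}t_jp^j\in\mathbb{Z}_p$ with digits $t_j\in\{0,\dots,p-1\}$, $(1+z)^t:=\prod_{j\ge0}(1+z^{p^j})^{t_j}\in\mathbb{F}_p[[z]]$. The $p$-adic dimensions $\mathrm{Dim}_\pm(X)\in\mathbb{Z}_p$ are the unique $p$-adic integers (they are known to exist) such that $$\sum_{j\ge0}\dim(S^jX)z^j=(1-z)^{-\mathrm{Dim}_+(X)},\qquad \sum_{j\ge0}\dim(\wedge^jX)z^j=(1+z)^{\mathrm{Dim}_-(X)}.$$ *)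

theory Defs
  imports
    "HOL-Computational_Algebra.Computational_Algebra"
    "Jordan_Normal_Form.Matrix"
begin

section \<open>Linear categories\<close>

text \<open>
  A morphism is always considered together with its source and target, so the sets
  \<open>Hom C X Y\<close> are not required to be disjoint. Composition, sum, scalar multiple
  and tensor product act on the bare morphisms; only their values on correctly typed arguments
  matter.
\<close>

record ('o, 'm, 'k) lincat =
  Obj :: "'o set"
  Hom :: "'o \<Rightarrow> 'o \<Rightarrow> 'm set"
  Id :: "'o \<Rightarrow> 'm"
  Comp :: "'m \<Rightarrow> 'm \<Rightarrow> 'm" (infixr "\<cdot>\<index>" 70)
  Zero :: "'o \<Rightarrow> 'o \<Rightarrow> 'm"
  Add :: "'m \<Rightarrow> 'm \<Rightarrow> 'm" (infixl "\<boxplus>\<index>" 60)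
  Scale :: "'k \<Rightarrow> 'm \<Rightarrow> 'm"

locale category =
  fixes C :: "('o, 'm, 'k, 'z) lincat_scheme" (structure)
  assumes Id_in_Hom: "X \<in> Obj C \<Longrightarrow> Id C X \<in> Hom C X X"
    and Comp_in_Hom:
      "\<lbrakk>X \<in> Obj C; Y \<in> Obj C; Z \<in> Obj C; f \<in> Hom C X Y; g \<in> Hom C Y Z\<rbrakk> \<Longrightarrow> g \<cdot> f \<in> Hom C X Z"
    and Comp_Id: "\<lbrakk>X \<in> Obj C; Y \<in> Obj C; f \<in> Hom C X Y\<rbrakk> \<Longrightarrow> f \<cdot> Id C X = f"
    and Id_Comp: "\<lbrakk>X \<in> Obj C; Y \<in> Obj C; f \<in> Hom C X Y\<rbrakk> \<Longrightarrow> Id C Y \<cdot> f = f"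
    and Comp_assoc:
      "\<lbrakk>W \<in> Obj C; X \<in> Obj C; Y \<in> Obj C; Z \<in> Obj C;
        f \<in> Hom C W X; g \<in> Hom C X Y; h \<in> Hom C Y Z\<rbrakk> \<Longrightarrow> (h \<cdot> g) \<cdot> f = h \<cdot> (g \<cdot> f)"

locale linear_category = category C
  for C :: "('o, 'm, 'k::field, 'z) lincat_scheme" (structure) +
  assumes Zero_in_Hom: "\<lbrakk>X \<in> Obj C; Y \<in> Obj C\<rbrakk> \<Longrightarrow> Zero C X Y \<in> Hom C X Y"
    and Add_in_Hom:
      "\<lbrakk>X \<in> Obj C; Y \<in> Obj C; f \<in> Hom C X Y; g \<in> Hom C X Y\<rbrakk> \<Longrightarrow> f \<boxplus> g \<in> Hom C X Y"
    and Scale_in_Hom: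
      "\<lbrakk>X \<in> Obj C; Y \<in> Obj C; f \<in> Hom C X Y\<rbrakk> \<Longrightarrow> Scale C a f \<in> Hom C X Y"
    and Add_assoc:
      "\<lbrakk>X \<in> Obj C; Y \<in> Obj C; f \<in> Hom C X Y; g \<in> Hom C X Y; h \<in> Hom C X Y\<rbrakk>
        \<Longrightarrow> (f \<boxplus> g) \<boxplus> h = f \<boxplus> (g \<boxplus> h)"
    and Add_commute:
      "\<lbrakk>X \<in> Obj C; Y \<in> Obj C; f \<in> Hom C X Y; g \<in> Hom C X Y\<rbrakk> \<Longrightarrow> f \<boxplus> g = g \<boxplus> f"
    and Add_Zero: "\<lbrakk>X \<in> Obj C; Y \<in> Obj C; f \<in> Hom C X Y\<rbrakk> \<Longrightarrow> f \<boxplus> Zero C X Y = f"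
    and Add_inverse:
      "\<lbrakk>X \<in> Obj C; Y \<in> Obj C; f \<in> Hom C X Y\<rbrakk> \<Longrightarrow> \<exists>g\<in>Hom C X Y. f \<boxplus> g = Zero C X Y"
    and Scale_Add:
      "\<lbrakk>X \<in> Obj C; Y \<in> Obj C; f \<in> Hom C X Y; g \<in> Hom C X Y\<rbrakk>
        \<Longrightarrow> Scale C a (f \<boxplus> g) = Scale C a f \<boxplus> Scale C a g"
    and add_Scale:
      "\<lbrakk>X \<in> Obj C; Y \<in> Obj C; f \<in> Hom C X Y\<rbrakk>
        \<Longrightarrow> Scale C (a + b) f = Scale C a f \<boxplus> Scale C b f"
    and mult_Scale:
      "\<lbrakk>X \<in> Obj C; Y \<in> Obj C; f \<in> Hom C X Y\<rbrakk> \<Longrightarrow> Scale C (a * b) f = Scale C a (Scale C b f)"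
    and one_Scale: "\<lbrakk>X \<in> Obj C; Y \<in> Obj C; f \<in> Hom C X Y\<rbrakk> \<Longrightarrow> Scale C 1 f = f"
    and Comp_Add:
      "\<lbrakk>X \<in> Obj C; Y \<in> Obj C; Z \<in> Obj C; f \<in> Hom C X Y; f' \<in> Hom C X Y; g \<in> Hom C Y Z\<rbrakk>
        \<Longrightarrow> g \<cdot> (f \<boxplus> f') = (g \<cdot> f) \<boxplus> (g \<cdot> f')"
    and Add_Comp:
      "\<lbrakk>X \<in> Obj C; Y \<in> Obj C; Z \<in> Obj C; f \<in> Hom C X Y; g \<in> Hom C Y Z; g' \<in> Hom C Y Z\<rbrakk>
        \<Longrightarrow> (g \<boxplus> g') \<cdot> f = (g \<cdot> f) \<boxplus> (g' \<cdot> f)"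
    and Comp_Scale:
      "\<lbrakk>X \<in> Obj C; Y \<in> Obj C; Z \<in> Obj C; f \<in> Hom C X Y; g \<in> Hom C Y Z\<rbrakk>
        \<Longrightarrow> g \<cdot> Scale C a f = Scale C a (g \<cdot> f)"
    and Scale_Comp:
      "\<lbrakk>X \<in> Obj C; Y \<in> Obj C; Z \<in> Obj C; f \<in> Hom C X Y; g \<in> Hom C Y Z\<rbrakk>
        \<Longrightarrow> Scale C a g \<cdot> f = Scale C a (g \<cdot> f)"

definition inverse_mor :: "('o, 'm, 'k, 'z) lincat_scheme \<Rightarrow> 'o \<Rightarrow> 'o \<Rightarrow> 'm \<Rightarrow> 'm \<Rightarrow> bool" where
  "inverse_mor C X Y f g \<longleftrightarrow> f \<in> Hom C X Y \<and> g \<in> Hom C Y X \<and>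
     g \<cdot>\<^bsub>C\<^esub> f = Id C X \<and> f \<cdot>\<^bsub>C\<^esub> g = Id C Y"

definition is_iso :: "('o, 'm, 'k, 'z) lincat_scheme \<Rightarrow> 'o \<Rightarrow> 'o \<Rightarrow> 'm \<Rightarrow> bool" where
  "is_iso C X Y f \<longleftrightarrow> (\<exists>g. inverse_mor C X Y f g)"

definition Inv :: "('o, 'm, 'k, 'z) lincat_scheme \<Rightarrow> 'o \<Rightarrow> 'o \<Rightarrow> 'm \<Rightarrow> 'm" where
  "Inv C X Y f = (THE g. inverse_mor C X Y f g)"

definition is_mono :: "('o, 'm, 'k, 'z) lincat_scheme \<Rightarrow> 'o \<Rightarrow> 'o \<Rightarrow> 'm \<Rightarrow> bool" where
  "is_mono C X Y f \<longleftrightarrow> f \<in> Hom C X Y \<and>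
     (\<forall>W\<in>Obj C. \<forall>g\<in>Hom C W X. \<forall>h\<in>Hom C W X. f \<cdot>\<^bsub>C\<^esub> g = f \<cdot>\<^bsub>C\<^esub> h \<longrightarrow> g = h)"

definition is_epi :: "('o, 'm, 'k, 'z) lincat_scheme \<Rightarrow> 'o \<Rightarrow> 'o \<Rightarrow> 'm \<Rightarrow> bool" where
  "is_epi C X Y f \<longleftrightarrow> f \<in> Hom C X Y \<and>
     (\<forall>W\<in>Obj C. \<forall>g\<in>Hom C Y W. \<forall>h\<in>Hom C Y W. g \<cdot>\<^bsub>C\<^esub> f = h \<cdot>\<^bsub>C\<^esub> f \<longrightarrow> g = h)"

definition is_zero_object :: "('o, 'm, 'k, 'z) lincat_scheme \<Rightarrow> 'o \<Rightarrow> bool" where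
  "is_zero_object C Z \<longleftrightarrow> Z \<in> Obj C \<and>
     (\<forall>X\<in>Obj C. (\<exists>!f. f \<in> Hom C X Z) \<and> (\<exists>!f. f \<in> Hom C Z X))"

definition is_biproduct ::
  "('o, 'm, 'k, 'z) lincat_scheme \<Rightarrow> 'o \<Rightarrow> 'o \<Rightarrow> 'o \<Rightarrow> 'm \<Rightarrow> 'm \<Rightarrow> 'm \<Rightarrow> 'm \<Rightarrow> bool" where
  "is_biproduct C X Y S i j p q \<longleftrightarrow> S \<in> Obj C \<and>
     i \<in> Hom C X S \<and> j \<in> Hom C Y S \<and> p \<in> Hom C S X \<and> q \<in> Hom C S Y \<and>
     p \<cdot>\<^bsub>C\<^esub> i = Id C X \<and> q \<cdot>\<^bsub>C\<^esub> j = Id C Y \<and>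
     q \<cdot>\<^bsub>C\<^esub> i = Zero C X Y \<and> p \<cdot>\<^bsub>C\<^esub> j = Zero C Y X \<and>
     (i \<cdot>\<^bsub>C\<^esub> p) \<boxplus>\<^bsub>C\<^esub> (j \<cdot>\<^bsub>C\<^esub> q) = Id C S"

definition is_kernel :: "('o, 'm, 'k, 'z) lincat_scheme \<Rightarrow> 'o \<Rightarrow> 'o \<Rightarrow> 'm \<Rightarrow> 'o \<Rightarrow> 'm \<Rightarrow> bool" where
  "is_kernel C X Y f K k \<longleftrightarrow> K \<in> Obj C \<and> k \<in> Hom C K X \<and> f \<cdot>\<^bsub>C\<^esub> k = Zero C K Y \<and>
     (\<forall>W\<in>Obj C. \<forall>g\<in>Hom C W X. f \<cdot>\<^bsub>C\<^esub> g = Zero C W Y \<longrightarrow>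
        (\<exists>!h. h \<in> Hom C W K \<and> k \<cdot>\<^bsub>C\<^esub> h = g))"

definition is_cokernel :: "('o, 'm, 'k, 'z) lincat_scheme \<Rightarrow> 'o \<Rightarrow> 'o \<Rightarrow> 'm \<Rightarrow> 'o \<Rightarrow> 'm \<Rightarrow> bool" where
  "is_cokernel C X Y f Q q \<longleftrightarrow> Q \<in> Obj C \<and> q \<in> Hom C Y Q \<and> q \<cdot>\<^bsub>C\<^esub> f = Zero C X Q \<and>
     (\<forall>W\<in>Obj C. \<forall>g\<in>Hom C Y W. g \<cdot>\<^bsub>C\<^esub> f = Zero C X W \<longrightarrow>
        (\<exists>!h. h \<in> Hom C Q W \<and> h \<cdot>\<^bsub>C\<^esub> q = g))"

locale abelian_linear_category = linear_category C
  for C :: "('o, 'm, 'k::field, 'z) lincat_scheme" (structure) +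
  assumes zero_object_exists: "\<exists>Z. is_zero_object C Z"
    and biproduct_exists:
      "\<lbrakk>X \<in> Obj C; Y \<in> Obj C\<rbrakk> \<Longrightarrow> \<exists>S i j p q. is_biproduct C X Y S i j p q"
    and kernel_exists:
      "\<lbrakk>X \<in> Obj C; Y \<in> Obj C; f \<in> Hom C X Y\<rbrakk> \<Longrightarrow> \<exists>K k. is_kernel C X Y f K k"
    and cokernel_exists:
      "\<lbrakk>X \<in> Obj C; Y \<in> Obj C; f \<in> Hom C X Y\<rbrakk> \<Longrightarrow> \<exists>Q q. is_cokernel C X Y f Q q"
    and mono_is_kernel:
      "\<lbrakk>X \<in> Obj C; Y \<in> Obj C; is_mono C X Y f\<rbrakk>
        \<Longrightarrow> \<exists>Z g. Z \<in> Obj C \<and> g \<in> Hom C Y Z \<and> is_kernel C Y Z g X f"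
    and epi_is_cokernel:
      "\<lbrakk>X \<in> Obj C; Y \<in> Obj C; is_epi C X Y f\<rbrakk>
        \<Longrightarrow> \<exists>W g. W \<in> Obj C \<and> g \<in> Hom C W X \<and> is_cokernel C W X g Y f"


subsection \<open>Local finiteness\<close>

definition lin_comb ::
  "('o, 'm, 'k, 'z) lincat_scheme \<Rightarrow> 'o \<Rightarrow> 'o \<Rightarrow> 'k list \<Rightarrow> 'm list \<Rightarrow> 'm" where
  "lin_comb C X Y as fs = foldr (Add C) (map2 (Scale C) as fs) (Zero C X Y)"

definition fin_dim_Hom :: "('o, 'm, 'k, 'z) lincat_scheme \<Rightarrow> 'o \<Rightarrow> 'o \<Rightarrow> bool" where
  "fin_dim_Hom C X Y \<longleftrightarrow> (\<exists>fs. set fs \<subseteq> Hom C X Y \<and>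
     (\<forall>g\<in>Hom C X Y. \<exists>as. length as = length fs \<and> g = lin_comb C X Y as fs))"

definition is_simple :: "('o, 'm, 'k, 'z) lincat_scheme \<Rightarrow> 'o \<Rightarrow> bool" where
  "is_simple C S \<longleftrightarrow> S \<in> Obj C \<and> \<not> is_zero_object C S \<and>
     (\<forall>Y\<in>Obj C. \<forall>m. is_mono C Y S m \<longrightarrow> is_zero_object C Y \<or> is_iso C Y S m)"

text \<open>Finite length: there is a finite filtration with simple successive quotients.\<close>

inductive finite_length :: "('o, 'm, 'k, 'z) lincat_scheme \<Rightarrow> 'o \<Rightarrow> bool"
  for C :: "('o, 'm, 'k, 'z) lincat_scheme" where
  zero: "is_zero_object C Z \<Longrightarrow> finite_length C Z"
| extend: "\<lbrakk>finite_length C X'; X \<in> Obj C; is_mono C X' X m; is_cokernel C X' X m S q; is_simple C S\<rbrakk>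
    \<Longrightarrow> finite_length C X"

locale locally_finite_abelian_category = abelian_linear_category C
  for C :: "('o, 'm, 'k::field, 'z) lincat_scheme" (structure) +
  assumes Hom_finite_dimensional: "\<lbrakk>X \<in> Obj C; Y \<in> Obj C\<rbrakk> \<Longrightarrow> fin_dim_Hom C X Y"
    and objects_finite_length: "X \<in> Obj C \<Longrightarrow> finite_length C X"


section \<open>Symmetric tensor categories\<close>

record ('o, 'm, 'k) tensor_data = "('o, 'm, 'k) lincat" +
  Tensor :: "'o \<Rightarrow> 'o \<Rightarrow> 'o" (infixl "\<boxtimes>\<index>" 75)
  TensorM :: "'m \<Rightarrow> 'm \<Rightarrow> 'm" (infixl "\<star>\<index>" 75)
  Unit :: "'o"
  Assoc :: "'o \<Rightarrow> 'o \<Rightarrow> 'o \<Rightarrow> 'm"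
  LUnit :: "'o \<Rightarrow> 'm"
  RUnit :: "'o \<Rightarrow> 'm"
  Braid :: "'o \<Rightarrow> 'o \<Rightarrow> 'm"

locale monoidal_linear_category = linear_category C
  for C :: "('o, 'm, 'k::field, 'z) tensor_data_scheme" (structure) +
  assumes Unit_in_Obj: "Unit C \<in> Obj C"
    and Tensor_in_Obj: "\<lbrakk>X \<in> Obj C; Y \<in> Obj C\<rbrakk> \<Longrightarrow> X \<boxtimes> Y \<in> Obj C"
    and TensorM_in_Hom:
      "\<lbrakk>X \<in> Obj C; X' \<in> Obj C; Y \<in> Obj C; Y' \<in> Obj C; f \<in> Hom C X X'; g \<in> Hom C Y Y'\<rbrakk>
        \<Longrightarrow> f \<star> g \<in> Hom C (X \<boxtimes> Y) (X' \<boxtimes> Y')"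
    and TensorM_Id:
      "\<lbrakk>X \<in> Obj C; Y \<in> Obj C\<rbrakk> \<Longrightarrow> Id C X \<star> Id C Y = Id C (X \<boxtimes> Y)"
    and TensorM_Comp:
      "\<lbrakk>X \<in> Obj C; X' \<in> Obj C; X'' \<in> Obj C; Y \<in> Obj C; Y' \<in> Obj C; Y'' \<in> Obj C;
        f \<in> Hom C X X'; f' \<in> Hom C X' X''; g \<in> Hom C Y Y'; g' \<in> Hom C Y' Y''\<rbrakk>
        \<Longrightarrow> (f' \<cdot> f) \<star> (g' \<cdot> g) = (f' \<star> g') \<cdot> (f \<star> g)"
    and Add_TensorM:
      "\<lbrakk>X \<in> Obj C; X' \<in> Obj C; Y \<in> Obj C; Y' \<in> Obj C;
        f \<in> Hom C X X'; f' \<in> Hom C X X'; g \<in> Hom C Y Y'\<rbrakk>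
        \<Longrightarrow> (f \<boxplus> f') \<star> g = (f \<star> g) \<boxplus> (f' \<star> g)"
    and TensorM_Add:
      "\<lbrakk>X \<in> Obj C; X' \<in> Obj C; Y \<in> Obj C; Y' \<in> Obj C;
        f \<in> Hom C X X'; g \<in> Hom C Y Y'; g' \<in> Hom C Y Y'\<rbrakk>
        \<Longrightarrow> f \<star> (g \<boxplus> g') = (f \<star> g) \<boxplus> (f \<star> g')"
    and Scale_TensorM:
      "\<lbrakk>X \<in> Obj C; X' \<in> Obj C; Y \<in> Obj C; Y' \<in> Obj C; f \<in> Hom C X X'; g \<in> Hom C Y Y'\<rbrakk>
        \<Longrightarrow> Scale C a f \<star> g = Scale C a (f \<star> g)"
    and TensorM_Scale:
      "\<lbrakk>X \<in> Obj C; X' \<in> Obj C; Y \<in> Obj C; Y' \<in> Obj C; f \<in> Hom C X X'; g \<in> Hom C Y Y'\<rbrakk>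
        \<Longrightarrow> f \<star> Scale C a g = Scale C a (f \<star> g)"
    and Assoc_iso:
      "\<lbrakk>X \<in> Obj C; Y \<in> Obj C; Z \<in> Obj C\<rbrakk>
        \<Longrightarrow> is_iso C (X \<boxtimes> Y \<boxtimes> Z) (X \<boxtimes> (Y \<boxtimes> Z)) (Assoc C X Y Z)"
    and Assoc_natural:
      "\<lbrakk>X \<in> Obj C; X' \<in> Obj C; Y \<in> Obj C; Y' \<in> Obj C; Z \<in> Obj C; Z' \<in> Obj C;
        f \<in> Hom C X X'; g \<in> Hom C Y Y'; h \<in> Hom C Z Z'\<rbrakk>
        \<Longrightarrow> Assoc C X' Y' Z' \<cdot> (f \<star> g \<star> h) = (f \<star> (g \<star> h)) \<cdot> Assoc C X Y Z"
    and LUnit_iso: "X \<in> Obj C \<Longrightarrow> is_iso C (Unit C \<boxtimes> X) X (LUnit C X)"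
    and LUnit_natural:
      "\<lbrakk>X \<in> Obj C; Y \<in> Obj C; f \<in> Hom C X Y\<rbrakk>
        \<Longrightarrow> LUnit C Y \<cdot> (Id C (Unit C) \<star> f) = f \<cdot> LUnit C X"
    and RUnit_iso: "X \<in> Obj C \<Longrightarrow> is_iso C (X \<boxtimes> Unit C) X (RUnit C X)"
    and RUnit_natural:
      "\<lbrakk>X \<in> Obj C; Y \<in> Obj C; f \<in> Hom C X Y\<rbrakk>
        \<Longrightarrow> RUnit C Y \<cdot> (f \<star> Id C (Unit C)) = f \<cdot> RUnit C X"
    and pentagon:
      "\<lbrakk>W \<in> Obj C; X \<in> Obj C; Y \<in> Obj C; Z \<in> Obj C\<rbrakk>
        \<Longrightarrow> Assoc C W X (Y \<boxtimes> Z) \<cdot> Assoc C (W \<boxtimes> X) Y Z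
          = (Id C W \<star> Assoc C X Y Z) \<cdot> Assoc C W (X \<boxtimes> Y) Z \<cdot> (Assoc C W X Y \<star> Id C Z)"
    and triangle:
      "\<lbrakk>X \<in> Obj C; Y \<in> Obj C\<rbrakk>
        \<Longrightarrow> (Id C X \<star> LUnit C Y) \<cdot> Assoc C X (Unit C) Y = RUnit C X \<star> Id C Y"

locale symmetric_monoidal_linear_category = monoidal_linear_category C
  for C :: "('o, 'm, 'k::field, 'z) tensor_data_scheme" (structure) +
  assumes Braid_in_Hom:
      "\<lbrakk>X \<in> Obj C; Y \<in> Obj C\<rbrakk> \<Longrightarrow> Braid C X Y \<in> Hom C (X \<boxtimes> Y) (Y \<boxtimes> X)"
    and Braid_natural:
      "\<lbrakk>X \<in> Obj C; X' \<in> Obj C; Y \<in> Obj C; Y' \<in> Obj C; f \<in> Hom C X X'; g \<in> Hom C Y Y'\<rbrakk>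
        \<Longrightarrow> Braid C X' Y' \<cdot> (f \<star> g) = (g \<star> f) \<cdot> Braid C X Y"
    and Braid_symmetric:
      "\<lbrakk>X \<in> Obj C; Y \<in> Obj C\<rbrakk> \<Longrightarrow> Braid C Y X \<cdot> Braid C X Y = Id C (X \<boxtimes> Y)"
    and hexagon:
      "\<lbrakk>X \<in> Obj C; Y \<in> Obj C; Z \<in> Obj C\<rbrakk>
        \<Longrightarrow> Assoc C Y Z X \<cdot> Braid C X (Y \<boxtimes> Z) \<cdot> Assoc C X Y Z
          = (Id C Y \<star> Braid C X Z) \<cdot> Assoc C Y X Z \<cdot> (Braid C X Y \<star> Id C Z)"

text \<open>
  \<open>is_left_dual C X D e c\<close>: the object \<open>D\<close> is a left dual of \<open>X\<close>, with evaluation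
  \<open>e\<close> from \<open>D \<boxtimes> X\<close> to the unit and coevaluation \<open>c\<close> from the unit to \<open>X \<boxtimes> D\<close>. The zigzag
  identities are written with the unit isomorphisms moved to the other side.
\<close>

definition is_left_dual ::
  "('o, 'm, 'k, 'z) tensor_data_scheme \<Rightarrow> 'o \<Rightarrow> 'o \<Rightarrow> 'm \<Rightarrow> 'm \<Rightarrow> bool" where
  "is_left_dual C X D e c \<longleftrightarrow> X \<in> Obj C \<and> D \<in> Obj C \<and>
     e \<in> Hom C (D \<boxtimes>\<^bsub>C\<^esub> X) (Unit C) \<and> c \<in> Hom C (Unit C) (X \<boxtimes>\<^bsub>C\<^esub> D) \<and>
     RUnit C X \<cdot>\<^bsub>C\<^esub> (Id C X \<star>\<^bsub>C\<^esub> e) \<cdot>\<^bsub>C\<^esub> Assoc C X D X \<cdot>\<^bsub>C\<^esub> (c \<star>\<^bsub>C\<^esub> Id C X)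
       = LUnit C X \<and>
     LUnit C D \<cdot>\<^bsub>C\<^esub> (e \<star>\<^bsub>C\<^esub> Id C D)
       \<cdot>\<^bsub>C\<^esub> Inv C (D \<boxtimes>\<^bsub>C\<^esub> X \<boxtimes>\<^bsub>C\<^esub> D) (D \<boxtimes>\<^bsub>C\<^esub> (X \<boxtimes>\<^bsub>C\<^esub> D)) (Assoc C D X D)
       \<cdot>\<^bsub>C\<^esub> (Id C D \<star>\<^bsub>C\<^esub> c)
       = RUnit C D"

locale symmetric_tensor_category =
  locally_finite_abelian_category C + symmetric_monoidal_linear_category C
  for C :: "('o, 'm, 'k::field, 'z) tensor_data_scheme" (structure) +
  assumes left_dual_exists: "X \<in> Obj C \<Longrightarrow> \<exists>D e c. is_left_dual C X D e c"
    and right_dual_exists: "X \<in> Obj C \<Longrightarrow> \<exists>D e c. is_left_dual C D X e c"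
    and End_Unit: "bij_betw (\<lambda>a. Scale C a (Id C (Unit C))) UNIV (Hom C (Unit C) (Unit C))"

definition dimension :: "('o, 'm, 'k, 'z) tensor_data_scheme \<Rightarrow> 'o \<Rightarrow> 'k" where
  "dimension C X = (THE a. \<exists>D e c. is_left_dual C X D e c \<and>
     e \<cdot>\<^bsub>C\<^esub> Braid C X D \<cdot>\<^bsub>C\<^esub> c = Scale C a (Id C (Unit C)))"


section \<open>Symmetric and exterior powers\<close>

fun tensor_power :: "('o, 'm, 'k, 'z) tensor_data_scheme \<Rightarrow> 'o \<Rightarrow> nat \<Rightarrow> 'o" where
  "tensor_power C X 0 = Unit C"
| "tensor_power C X (Suc n) = tensor_power C X n \<boxtimes>\<^bsub>C\<^esub> X"

text \<open>
  For \<open>r\<close> from \<open>R\<close> to \<open>X \<boxtimes> X\<close>, the morphism \<open>relation_mor C X R r i j\<close> is the tensor product of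
  \<open>r\<close> with the identities of the \<open>i\<close>-th tensor power on the left and of \<open>j\<close> copies of \<open>X\<close> on the
  right, with values in \<open>tensor_power C X (i + j + 2)\<close>.
\<close>

fun relation_obj :: "('o, 'm, 'k, 'z) tensor_data_scheme \<Rightarrow> 'o \<Rightarrow> 'o \<Rightarrow> nat \<Rightarrow> nat \<Rightarrow> 'o" where
  "relation_obj C X R i 0 = tensor_power C X i \<boxtimes>\<^bsub>C\<^esub> R"
| "relation_obj C X R i (Suc j) = relation_obj C X R i j \<boxtimes>\<^bsub>C\<^esub> X"

fun relation_mor :: "('o, 'm, 'k, 'z) tensor_data_scheme \<Rightarrow> 'o \<Rightarrow> 'o \<Rightarrow> 'm \<Rightarrow> nat \<Rightarrow> nat \<Rightarrow> 'm" where
  "relation_mor C X R r i 0 =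
     (let T = tensor_power C X i in
       Inv C (T \<boxtimes>\<^bsub>C\<^esub> X \<boxtimes>\<^bsub>C\<^esub> X) (T \<boxtimes>\<^bsub>C\<^esub> (X \<boxtimes>\<^bsub>C\<^esub> X)) (Assoc C T X X) \<cdot>\<^bsub>C\<^esub> (Id C T \<star>\<^bsub>C\<^esub> r))"
| "relation_mor C X R r i (Suc j) = relation_mor C X R r i j \<star>\<^bsub>C\<^esub> Id C X"

definition factors_through ::
  "('o, 'm, 'k, 'z) lincat_scheme \<Rightarrow> 'o \<Rightarrow> 'm \<Rightarrow> 'o \<Rightarrow> 'm \<Rightarrow> bool" where
  "factors_through C W f J m \<longleftrightarrow> (\<exists>h\<in>Hom C W J. f = m \<cdot>\<^bsub>C\<^esub> h)"

text \<open>
  The sum of the images of a family of morphisms \<open>f\<close> from \<open>W\<close> to \<open>T\<close>, given as pairs \<open>(W, f)\<close>: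
  the smallest subobject of \<open>T\<close> through which all of them factor.
\<close>

definition is_image_sum ::
  "('o, 'm, 'k, 'z) lincat_scheme \<Rightarrow> 'o \<Rightarrow> ('o \<times> 'm) set \<Rightarrow> 'o \<Rightarrow> 'm \<Rightarrow> bool" where
  "is_image_sum C T F J m \<longleftrightarrow> J \<in> Obj C \<and> is_mono C J T m \<and>
     (\<forall>(W, f)\<in>F. factors_through C W f J m) \<and>
     (\<forall>J'\<in>Obj C. \<forall>m'. is_mono C J' T m' \<and> (\<forall>(W, f)\<in>F. factors_through C W f J' m')
        \<longrightarrow> factors_through C J m J' m')"

text \<open>
  \<open>Q\<close> is the degree \<open>n\<close> part of the quotient of the tensor algebra of \<open>X\<close> by the two-sided ideal
  generated by the subobject \<open>r\<close> from \<open>R\<close> to \<open>X \<boxtimes> X\<close>; the degree \<open>n\<close> part of that ideal is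
  \<open>m\<close> from \<open>J\<close> to \<open>tensor_power C X n\<close>.
\<close>

definition is_quadratic_quotient ::
  "('o, 'm, 'k, 'z) tensor_data_scheme \<Rightarrow> 'o \<Rightarrow> 'o \<Rightarrow> 'm \<Rightarrow> nat \<Rightarrow> 'o \<Rightarrow> bool" where
  "is_quadratic_quotient C X R r n Q \<longleftrightarrow>
     (\<exists>J m q. is_image_sum C (tensor_power C X n)
                {(relation_obj C X R i j, relation_mor C X R r i j) |i j. i + j + 2 = n} J m \<and>
              is_cokernel C J (tensor_power C X n) m Q q)"

definition braid_minus_id :: "('o, 'm, 'k::field, 'z) tensor_data_scheme \<Rightarrow> 'o \<Rightarrow> 'm" where
  "braid_minus_id C X = Braid C X X \<boxplus>\<^bsub>C\<^esub> Scale C (-1) (Id C (X \<boxtimes>\<^bsub>C\<^esub> X))"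

definition is_sym_power ::
  "('o, 'm, 'k::field, 'z) tensor_data_scheme \<Rightarrow> 'o \<Rightarrow> nat \<Rightarrow> 'o \<Rightarrow> bool" where
  "is_sym_power C X n Q \<longleftrightarrow>
     (\<exists>R r. is_image_sum C (X \<boxtimes>\<^bsub>C\<^esub> X) {(X \<boxtimes>\<^bsub>C\<^esub> X, braid_minus_id C X)} R r \<and>
            is_quadratic_quotient C X R r n Q)"

definition is_ext_power ::
  "('o, 'm, 'k::field, 'z) tensor_data_scheme \<Rightarrow> 'o \<Rightarrow> nat \<Rightarrow> 'o \<Rightarrow> bool" where
  "is_ext_power C X n Q \<longleftrightarrow>
     (\<exists>R r. is_kernel C (X \<boxtimes>\<^bsub>C\<^esub> X) (X \<boxtimes>\<^bsub>C\<^esub> X) (braid_minus_id C X) R r \<and>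
            is_quadratic_quotient C X R r n Q)"

text \<open>These objects are unique up to isomorphism; we pick one.\<close>

definition sym_power :: "('o, 'm, 'k::field, 'z) tensor_data_scheme \<Rightarrow> 'o \<Rightarrow> nat \<Rightarrow> 'o" where
  "sym_power C X n = (SOME Q. is_sym_power C X n Q)"

definition ext_power :: "('o, 'm, 'k::field, 'z) tensor_data_scheme \<Rightarrow> 'o \<Rightarrow> nat \<Rightarrow> 'o" where
  "ext_power C X n = (SOME Q. is_ext_power C X n Q)"


section \<open>The \<open>p\<close>-adic dimensions\<close>

text \<open>
  The ring of \<open>p\<close>-adic integers as the inverse limit of the rings of integers modulo \<open>p ^ n\<close>,
  each residue class being represented by its least nonnegative element.
\<close>

definition padic_ints :: "nat \<Rightarrow> (nat \<Rightarrow> int) set" where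
  "padic_ints p = {t. \<forall>n. 0 \<le> t n \<and> t n < int p ^ n \<and> t (Suc n) mod int p ^ n = t n}"

definition padic_uminus :: "nat \<Rightarrow> (nat \<Rightarrow> int) \<Rightarrow> (nat \<Rightarrow> int)" where
  "padic_uminus p t = (\<lambda>n. (- t n) mod int p ^ n)"

definition padic_digit :: "nat \<Rightarrow> (nat \<Rightarrow> int) \<Rightarrow> nat \<Rightarrow> nat" where
  "padic_digit p t j = nat (t (Suc j) div int p ^ j)"

text \<open>
  The power series of \<open>(1 + z) ^ t\<close>, over a field \<open>'k\<close> of characteristic \<open>p\<close> instead of its
  prime field; the infinite product is a limit in the usual topology of formal power series.
\<close>

definition one_plus_z_pow :: "nat \<Rightarrow> (nat \<Rightarrow> int) \<Rightarrow> 'k::field fps" where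
  "one_plus_z_pow p t = lim (\<lambda>N. \<Prod>j<N. (1 + fps_X ^ (p ^ j)) ^ padic_digit p t j)"

definition one_minus_z_pow :: "nat \<Rightarrow> (nat \<Rightarrow> int) \<Rightarrow> 'k::field fps" where
  "one_minus_z_pow p t = fps_compose (one_plus_z_pow p t) (- fps_X)"

definition Dim_plus :: "('o, 'm, 'k::field, 'z) tensor_data_scheme \<Rightarrow> 'o \<Rightarrow> (nat \<Rightarrow> int)" where
  "Dim_plus C X = (THE d. d \<in> padic_ints CHAR('k) \<and>
     Abs_fps (\<lambda>j. dimension C (sym_power C X j))
       = one_minus_z_pow CHAR('k) (padic_uminus CHAR('k) d))"

definition Dim_minus :: "('o, 'm, 'k::field, 'z) tensor_data_scheme \<Rightarrow> 'o \<Rightarrow> (nat \<Rightarrow> int)" where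
  "Dim_minus C X = (THE d. d \<in> padic_ints CHAR('k) \<and>
     Abs_fps (\<lambda>j. dimension C (ext_power C X j)) = one_plus_z_pow CHAR('k) d)"


section \<open>Small symmetric tensor categories over a given field\<close>

text \<open>
  Existence of a category can only be asserted with objects and morphisms in fixed types. The
  types below are no restriction: \<open>'k\<close> is infinite when algebraically closed, and in a
  symmetric tensor category the smallest full subcategory containing a given object \<open>X\<close> and closed under
  tensor products, duals, finite direct sums, subobjects and quotients has at most as many
  isomorphism classes of objects, and at most as many morphisms between two objects, as \<open>'k\<close> has
  elements. It contains the symmetric and exterior powers of \<open>X\<close>.
\<close>

type_synonym 'k concrete_obj = "'k mat list"

type_synonym 'k concrete_mor = "'k concrete_obj \<times> 'k concrete_obj \<times> 'k mat list set"

type_synonym 'k concrete_tensor_data = "('k concrete_obj, 'k concrete_mor, 'k) tensor_data"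

end

(*
Semisimplification. A square matrix E over k is a representation of the one-dimensional Lie algebra, and
the category of the example has these matrices as objects and intertwiners modulo negligible ones as
morphisms. A nilpotent matrix has trace zero, so a morphism f that is not negligible yields a composite h f
that is not nilpotent, and a polynomial in h f is a nonzero idempotent. An idempotent g f of maximal rank
therefore exhausts f modulo negligible morphisms: every morphism of the quotient splits, and the quotient is a
semisimple abelian category. In it the dimension of a matrix is its size.

The object X is the nilpotent Jordan block of size 2; it generates the Verlinde category Ver_p. For n < p the
symmetrizer on the n-th tensor power has trace n + 1. In degree p - 1 it is a commutator with the action of the
Lie algebra, hence negligible, so that S^n X = 0 for n >= p - 1 and the series of the symmetric powers is the sum of
(n + 1) z^n over n < p - 1, that is (1 - z)^(p - 2). As 6 is invertible, the third exterior power vanishes,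
and the series of the exterior powers is (1 + z)^2. Hence Dim_+(X) = 2 - p and Dim_-(X) = 2.
*)

theory Submission
  imports Defs "Jordan_Normal_Form.Determinant"
begin

section \<open>Matrices\<close>

text \<open>Both p-adic dimensions reduce modulo p to the dimension of X, so they can only differ
  from the second digit on, that is, through degrees from p on. There the vanishing of the symmetric
  powers matters: (1 - z)^(-2) = (1 - z)^(p - 2) (1 - z^p)^(-1), and cutting the series off removes
  exactly the last factor, which moves the exponent by p. The exterior powers stop in degree 2, too
  early to be affected. Two features of the definitions shape the proof. Duals, powers and p-adic
  exponents are picked by choice and description operators, so every value has to be computed for
  all candidates, not only for a convenient one. And morphisms are only known up to trace pairings,
  so relations in tensor powers cannot be tested on vectors; functionals tr(h g M) of M, with g and
  h fixed, take the place of vectors. The size of a matrix is not an invariant of the quotient (a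
  Jordan block of size p becomes a zero object), only its residue modulo p is. As a natural number
  the size serves merely as a measure for inductions.\<close>

lemma mult_index:
  "\<lbrakk>i < dim_row A; j < dim_col B; dim_col A = dim_row B\<rbrakk>
    \<Longrightarrow> (A * B) $$ (i, j) = (\<Sum>k<dim_row B. A $$ (i, k) * B $$ (k, j))"
  by (simp add: scalar_prod_def atLeast0LessThan)

text \<open>The side conditions are equations between dimensions, so that the simplifier can
  discharge them without guessing the sizes of intermediate carriers.\<close>

lemma mult_assoc_dim:
  "\<lbrakk>dim_col A = dim_row B; dim_col B = dim_row C\<rbrakk> \<Longrightarrow> A * B * C = A * (B * (C :: 'a::semiring_0 mat))"
  by (rule assoc_mult_mat[of A "dim_row A" "dim_row B" B "dim_row C" C "dim_col C"]) auto

lemma mult_add_dim: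
  "\<lbrakk>dim_col A = dim_row B; dim_row B = dim_row C; dim_col B = dim_col C\<rbrakk>
    \<Longrightarrow> A * (B + C) = A * B + A * (C :: 'a::semiring_0 mat)"
  by (rule mult_add_distrib_mat[of A "dim_row A" "dim_row B" B "dim_col B" C]) auto

lemma add_mult_dim:
  "\<lbrakk>dim_col A = dim_row C; dim_row A = dim_row B; dim_col A = dim_col B\<rbrakk>
    \<Longrightarrow> (A + B) * C = A * C + B * (C :: 'a::semiring_0 mat)"
  by (rule add_mult_distrib_mat[of A "dim_row A" "dim_row C" B C "dim_col C"]) auto

lemma mult_minus_dim:
  "\<lbrakk>dim_col A = dim_row B; dim_row B = dim_row C; dim_col B = dim_col C\<rbrakk>
    \<Longrightarrow> A * (B - C) = A * B - A * (C :: 'a::ring mat)"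
  by (rule mult_minus_distrib_mat[of A "dim_row A" "dim_row B" B "dim_col B" C]) auto

lemma minus_mult_dim:
  "\<lbrakk>dim_col A = dim_row C; dim_row A = dim_row B; dim_col A = dim_col B\<rbrakk>
    \<Longrightarrow> (A - B) * C = A * C - B * (C :: 'a::ring mat)"
  by (rule minus_mult_distrib_mat[of A "dim_row A" "dim_row C" B C "dim_col C"]) auto

lemma mult_smult_dim:
  "dim_col A = dim_row B \<Longrightarrow> A * (c \<cdot>\<^sub>m B) = c \<cdot>\<^sub>m (A * (B :: 'a::comm_semiring_0 mat))"
  by (rule mult_smult_distrib[of A "dim_row A" "dim_row B" B "dim_col B"]) auto

lemma smult_mult_dim:
  "dim_col A = dim_row B \<Longrightarrow> (c \<cdot>\<^sub>m A) * B = c \<cdot>\<^sub>m (A * (B :: 'a::comm_semiring_0 mat))"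
  by (rule mult_smult_assoc_mat[of A "dim_row A" "dim_row B" B "dim_col B"]) auto

lemmas mat_dim_simps = mult_assoc_dim mult_add_dim add_mult_dim mult_minus_dim minus_mult_dim
  mult_smult_dim smult_mult_dim

text \<open>Once products are nested to the right, an identity \<open>A * B = C\<close> applies
  inside a longer word only in this form.\<close>

lemma mult_ext:
  "\<lbrakk>A * B = C; dim_col A = dim_row B; dim_col B = dim_row X\<rbrakk> \<Longrightarrow> A * (B * X) = C * (X :: 'a::semiring_0 mat)"
  by (simp flip: mult_assoc_dim)

lemma mat_minus_self: "A - A = 0\<^sub>m (dim_row A) (dim_col (A :: 'a::group_add mat))"
  by (intro eq_matI) auto

lemma pair_index_less:
  assumes "i < n" "j < (m :: nat)"
  shows "i * m + j < n * m"
proof -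
  have "i * m + j < Suc i * m" using assms(2) by simp
  also have "\<dots> \<le> n * m" using assms(1) by (intro mult_le_mono1) simp
  finally show ?thesis .
qed

section \<open>Traces, and ranks bounded by one-sided inverses\<close>

definition tr :: "'a::comm_monoid_add mat \<Rightarrow> 'a" where
  "tr A = (\<Sum>i<dim_row A. A $$ (i, i))"

lemma tr_comm:
  fixes A B :: "'a::comm_semiring_0 mat"
  assumes "dim_col A = dim_row B" "dim_col B = dim_row A"
  shows "tr (A * B) = tr (B * A)"
proof -
  have "tr (A * B) = (\<Sum>i<dim_row A. \<Sum>k<dim_row B. A $$ (i, k) * B $$ (k, i))"
    using assms by (auto simp: tr_def mult_index simp del: index_mult_mat(1) intro!: sum.cong)
  also have "\<dots> = (\<Sum>k<dim_row B. \<Sum>i<dim_row A. A $$ (i, k) * B $$ (k, i))"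
    by (rule sum.swap)
  also have "\<dots> = tr (B * A)"
    using assms by (auto simp: tr_def mult_index mult.commute simp del: index_mult_mat(1) intro!: sum.cong)
  finally show ?thesis .
qed

lemma tr_add: "\<lbrakk>dim_row A = dim_row B; dim_col B = dim_row B\<rbrakk> \<Longrightarrow> tr (A + B) = tr A + tr B"
  by (simp add: tr_def sum.distrib)

lemma tr_minus:
  "\<lbrakk>dim_row A = dim_row B; dim_col B = dim_row B\<rbrakk> \<Longrightarrow> tr (A - B) = tr A - tr (B :: 'a::ab_group_add mat)"
  by (simp add: tr_def sum_subtractf)

lemma tr_smult: "dim_col A = dim_row A \<Longrightarrow> tr (c \<cdot>\<^sub>m A) = c * tr (A :: 'a::semiring_0 mat)"
  by (simp add: tr_def sum_distrib_left)

lemma tr_zero [simp]: "tr (0\<^sub>m n n) = 0"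
  by (simp add: tr_def)

lemma tr_one [simp]: "tr (1\<^sub>m n :: 'a::semiring_1 mat) = of_nat n"
  by (simp add: tr_def)

lemma ex_max_nat:
  fixes P :: "nat \<Rightarrow> bool"
  assumes "P a" "\<And>r. P r \<Longrightarrow> r \<le> n"
  obtains r where "P r" "\<And>s. r < s \<Longrightarrow> \<not> P s"
  using assms by (metis GreatestI_nat Greatest_le_nat linorder_not_le)

text \<open>If r were larger than n, both matrices could be padded by zeros to size r without
  changing the product \<open>A * B\<close>. For square matrices a one-sided inverse is two-sided,
  but the padded product in the other order has a zero row.\<close>

lemma left_inverse_le:
  fixes A B :: "'a::field mat"
  assumes A: "A \<in> carrier_mat r n" and B: "B \<in> carrier_mat n r" and AB: "A * B = 1\<^sub>m r"
  shows "r \<le> n"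
proof (rule ccontr)
  assume "\<not> r \<le> n"
  then have nr: "n < r" by simp
  define A' where "A' = mat r r (\<lambda>(i, k). if k < n then A $$ (i, k) else 0)"
  define B' where "B' = mat r r (\<lambda>(k, j). if k < n then B $$ (k, j) else 0)"
  have c: "A' \<in> carrier_mat r r" "B' \<in> carrier_mat r r" by (auto simp: A'_def B'_def)
  have "A' * B' = A * B"
  proof (rule eq_matI)
    fix i j assume ij: "i < dim_row (A * B)" "j < dim_col (A * B)"
    have "(A' * B') $$ (i, j) = (\<Sum>k<r. A' $$ (i, k) * B' $$ (k, j))"
      using ij A B c by (subst mult_index) auto
    also have "\<dots> = (\<Sum>k<n. A $$ (i, k) * B $$ (k, j))"
      using ij A B nr by (intro sum.mono_neutral_cong_right) (auto simp: A'_def B'_def)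
    also have "\<dots> = (A * B) $$ (i, j)"
      using ij A B by (subst mult_index) auto
    finally show "(A' * B') $$ (i, j) = (A * B) $$ (i, j)" .
  qed (use A B c in auto)
  with AB have "A' * B' = 1\<^sub>m r" by simp
  then have "B' * A' = 1\<^sub>m r" by (rule mat_mult_left_right_inverse[OF c])
  then have "(B' * A') $$ (n, n) = 1" using nr by simp
  moreover have "(B' * A') $$ (n, n) = 0"
    using nr c by (subst mult_index) (auto simp: B'_def)
  ultimately show False by simp
qed


subsection \<open>Splitting idempotent matrices\<close>

text \<open>A factorization through a space of dimension r with \<open>q * i = 1\<close> forces
  \<open>e\<close> to be an idempotent of rank r; it replaces the notion of rank throughout.\<close>

definition splits :: "nat \<Rightarrow> nat \<Rightarrow> 'a::field mat \<Rightarrow> bool" where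
  "splits n r e \<longleftrightarrow> (\<exists>i\<in>carrier_mat n r. \<exists>q\<in>carrier_mat r n. q * i = 1\<^sub>m r \<and> i * q = e)"

lemma splits_le: "splits n r e \<Longrightarrow> r \<le> n"
  unfolding splits_def using left_inverse_le by blast

lemma splits_carrier: "splits n r e \<Longrightarrow> e \<in> carrier_mat n n"
  unfolding splits_def by auto

lemma splits_zero_rank: "splits n 0 e \<longleftrightarrow> e = 0\<^sub>m n n"
proof
  assume "splits n 0 e"
  then obtain i q where iq: "i \<in> carrier_mat n 0" "q \<in> carrier_mat 0 n" "i * q = e"
    unfolding splits_def by blast
  have "i * q = 0\<^sub>m n n" using iq(1,2) by (intro eq_matI) (auto simp: scalar_prod_def)
  with iq(3) show "e = 0\<^sub>m n n" by simp
next
  assume "e = 0\<^sub>m n n"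
  then show "splits n 0 e"
    unfolding splits_def
    by (intro bexI[of _ "0\<^sub>m n 0"] bexI[of _ "0\<^sub>m 0 n"] conjI) (auto intro!: eq_matI simp: scalar_prod_def)
qed

text \<open>Orthogonality of the idempotents forces \<open>q * i' = 0\<close> and
  \<open>q' * i = 0\<close>, so the two factorizations can be put side by side.\<close>

lemma splits_add:
  fixes e e' :: "'a::field mat"
  assumes "splits n r e" "splits n r' e'" "e * e' = 0\<^sub>m n n" "e' * e = 0\<^sub>m n n"
  shows "splits n (r + r') (e + e')"
proof -
  obtain i q where i: "i \<in> carrier_mat n r" and q: "q \<in> carrier_mat r n"
    and qi: "q * i = 1\<^sub>m r" and iq: "i * q = e" using assms(1) unfolding splits_def by blast
  obtain i' q' where i': "i' \<in> carrier_mat n r'" and q': "q' \<in> carrier_mat r' n"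
    and qi': "q' * i' = 1\<^sub>m r'" and iq': "i' * q' = e'" using assms(2) unfolding splits_def by blast
  have "q * i' = (q * i) * (q * i') * (q' * i')" using qi qi' i q i' q' by simp
  also have "\<dots> = q * ((i * q) * (i' * q')) * i'" using i q i' q' by (simp add: mult_assoc_dim)
  also have "\<dots> = 0\<^sub>m r r'" using assms(3) iq iq' q i' by (simp add: mult_assoc_dim)
  finally have z1: "q * i' = 0\<^sub>m r r'" .
  have "q' * i = (q' * i') * (q' * i) * (q * i)" using qi qi' i q i' q' by simp
  also have "\<dots> = q' * ((i' * q') * (i * q)) * i" using i q i' q' by (simp add: mult_assoc_dim)
  also have "\<dots> = 0\<^sub>m r' r" using assms(4) iq iq' q' i by (simp add: mult_assoc_dim)
  finally have z2: "q' * i = 0\<^sub>m r' r" .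
  \<comment> \<open>Blocks without rows or columns turn \<open>four_block_mat\<close> into
    horizontal and vertical concatenation.\<close>
  let ?I = "four_block_mat i i' (0\<^sub>m 0 r) (0\<^sub>m 0 r')"
  let ?Q = "four_block_mat q (0\<^sub>m r 0) q' (0\<^sub>m r' 0)"
  have "?Q * ?I = four_block_mat (q * i + 0\<^sub>m r 0 * 0\<^sub>m 0 r) (q * i' + 0\<^sub>m r 0 * 0\<^sub>m 0 r')
      (q' * i + 0\<^sub>m r' 0 * 0\<^sub>m 0 r) (q' * i' + 0\<^sub>m r' 0 * 0\<^sub>m 0 r')"
    by (rule mult_four_block_mat[OF q _ q' _ i i']) auto
  also have "\<dots> = 1\<^sub>m (r + r')" using z1 z2 qi qi' by simp
  finally have 1: "?Q * ?I = 1\<^sub>m (r + r')" .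
  have "?I * ?Q = four_block_mat (i * q + i' * q') (i * 0\<^sub>m r 0 + i' * 0\<^sub>m r' 0)
      (0\<^sub>m 0 r * q + 0\<^sub>m 0 r' * q') (0\<^sub>m 0 r * 0\<^sub>m r 0 + 0\<^sub>m 0 r' * 0\<^sub>m r' 0)"
    by (rule mult_four_block_mat[OF i i' _ _ q _ q']) auto
  also have "\<dots> = i * q + i' * q'" using i q i' q' by (intro eq_matI) auto
  finally have 2: "?I * ?Q = e + e'" using iq iq' by simp
  have "?I \<in> carrier_mat n (r + r')" "?Q \<in> carrier_mat (r + r') n"
    using four_block_carrier_mat[OF i, of "0\<^sub>m 0 r'" 0 r'] four_block_carrier_mat[OF q, of "0\<^sub>m r' 0" r' 0]
    by auto
  with 1 2 show ?thesis unfolding splits_def by blast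
qed

lemma nonzero_entry:
  assumes "A \<in> carrier_mat n m" "A \<noteq> 0\<^sub>m n m"
  obtains i j where "i < n" "j < m" "A $$ (i, j) \<noteq> 0"
  using assms by (metis carrier_matD eq_matI index_zero_mat)

text \<open>Around a nonzero entry c of \<open>e\<close> take its column, divided by c, and its row.
  Since \<open>e * e = e\<close>, their scalar product is c / c = 1, and \<open>e\<close> fixes both
  of them.\<close>

lemma idempotent_rank_one_part:
  fixes e :: "'a::field mat"
  assumes e: "e \<in> carrier_mat n n" and ee: "e * e = e" and ne: "e \<noteq> 0\<^sub>m n n"
  shows "\<exists>d. splits n 1 d \<and> e * d = d \<and> d * e = d"
proof -
  obtain i0 j0 where ij: "i0 < n" "j0 < n" "e $$ (i0, j0) \<noteq> 0" using nonzero_entry[OF e ne] .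
  define c where "c = e $$ (i0, j0)"
  define u where "u = mat n 1 (\<lambda>(i, _). e $$ (i, j0) / c)"
  define w where "w = mat 1 n (\<lambda>(_, j). e $$ (i0, j))"
  have dims: "u \<in> carrier_mat n 1" "w \<in> carrier_mat 1 n" by (auto simp: u_def w_def)
  have eek: "(\<Sum>k<n. e $$ (i, k) * e $$ (k, j)) = e $$ (i, j)" if "i < n" "j < n" for i j
    using arg_cong[OF ee, of "\<lambda>A. A $$ (i, j)"] that e by (subst (asm) mult_index) auto
  have wu: "w * u = 1\<^sub>m 1"
  proof (rule eq_matI)
    fix i j assume "i < dim_row (1\<^sub>m 1 :: 'a mat)" "j < dim_col (1\<^sub>m 1 :: 'a mat)"
    then have "i = 0" "j = 0" by auto
    moreover have "(w * u) $$ (0, 0) = (\<Sum>k<n. e $$ (i0, k) * e $$ (k, j0)) / c"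
      using dims by (subst mult_index) (auto simp: u_def w_def sum_divide_distrib)
    ultimately show "(w * u) $$ (i, j) = 1\<^sub>m 1 $$ (i, j)"
      using eek[OF ij(1,2)] ij by (simp add: c_def)
  qed (use dims in auto)
  have eu: "e * u = u"
  proof (rule eq_matI)
    fix i j assume "i < dim_row u" "j < dim_col u"
    then have ij': "i < n" "j = 0" using dims by auto
    have "(e * u) $$ (i, 0) = (\<Sum>k<n. e $$ (i, k) * e $$ (k, j0)) / c"
      using dims e ij' by (subst mult_index) (auto simp: u_def sum_divide_distrib)
    then show "(e * u) $$ (i, j) = u $$ (i, j)" using eek[OF ij'(1) ij(2)] ij' by (simp add: u_def)
  qed (use e dims in auto)
  have we: "w * e = w"
  proof (rule eq_matI)
    fix i j assume "i < dim_row w" "j < dim_col w"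
    then have ij': "i = 0" "j < n" using dims by auto
    have "(w * e) $$ (0, j) = (\<Sum>k<n. e $$ (i0, k) * e $$ (k, j))"
      using dims e ij' by (subst mult_index) (auto simp: w_def)
    then show "(w * e) $$ (i, j) = w $$ (i, j)" using eek[OF ij(1) ij'(2)] ij' by (simp add: w_def)
  qed (use e dims in auto)
  have "splits n 1 (u * w)" unfolding splits_def using dims wu by blast
  moreover have "e * (u * w) = u * w"
    using eu e dims by (simp flip: mult_assoc_dim)
  moreover have "(u * w) * e = u * w"
    using we e dims by (simp add: mult_assoc_dim)
  ultimately show ?thesis by blast
qed

text \<open>Choose a split idempotent \<open>d\<close> below \<open>e\<close> of maximal rank. The
  difference \<open>e - d\<close> is idempotent and orthogonal to \<open>d\<close>; were it nonzero,
  a rank one part of it could be added to \<open>d\<close>.\<close>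

theorem idempotent_splits:
  fixes e :: "'a::field mat"
  assumes e: "e \<in> carrier_mat n n" and ee: "e * e = e"
  shows "\<exists>r. splits n r e"
proof -
  define P where "P r \<longleftrightarrow> (\<exists>d. splits n r d \<and> e * d = d \<and> d * e = d)" for r
  have P0: "P 0" unfolding P_def splits_zero_rank using e by (intro exI[of _ "0\<^sub>m n n"]) auto
  obtain r where "P r" and max: "\<And>s. r < s \<Longrightarrow> \<not> P s"
    using ex_max_nat[of P 0 n] P0 splits_le unfolding P_def by blast
  then obtain d where d: "splits n r d" "e * d = d" "d * e = d" unfolding P_def by blast
  have dc: "d \<in> carrier_mat n n" using d(1) by (rule splits_carrier)
  obtain i q where iq: "i \<in> carrier_mat n r" "q \<in> carrier_mat r n" "q * i = 1\<^sub>m r" "i * q = d"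
    using d(1) unfolding splits_def by blast
  have dd: "d * d = d"
    using iq(1,2) by (simp add: mult_assoc_dim mult_ext[OF iq(3)] flip: iq(4))
  define e1 where "e1 = e - d"
  have e1: "e1 \<in> carrier_mat n n" "e1 * e1 = e1" "d * e1 = 0\<^sub>m n n" "e1 * d = 0\<^sub>m n n" "e * e1 = e1" "e1 * e = e1"
    using e dc d dd ee by (auto simp: e1_def mat_dim_simps mat_minus_self intro!: eq_matI)
  have "e1 = 0\<^sub>m n n"
  proof (rule ccontr)
    assume "e1 \<noteq> 0\<^sub>m n n"
    then obtain d' where d': "splits n 1 d'" "e1 * d' = d'" "d' * e1 = d'"
      using idempotent_rank_one_part[OF e1(1,2)] by blast
    have d'c: "d' \<in> carrier_mat n n" using d'(1) by (rule splits_carrier)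
    have "d * d' = (d * e1) * d'" using d'(2) e1(1) dc d'c by (simp add: mult_assoc_dim)
    then have o1: "d * d' = 0\<^sub>m n n" using e1 d'c by simp
    have "d' * d = d' * (e1 * d)" using d'(3) e1(1) dc d'c by (simp flip: mult_assoc_dim)
    then have o2: "d' * d = 0\<^sub>m n n" using e1 d'c by simp
    have ed': "e * d' = d'" using d'(2) e1 e d'c
      by (metis assoc_mult_mat)
    have d'e: "d' * e = d'" using d'(3) e1 e d'c
      by (metis assoc_mult_mat)
    have "splits n (r + 1) (d + d')" by (rule splits_add[OF d(1) d'(1) o1 o2])
    moreover have "e * (d + d') = d + d'" "(d + d') * e = d + d'"
      using e dc d'c d ed' d'e by (simp_all add: mat_dim_simps)
    ultimately have "P (r + 1)" unfolding P_def by blast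
    with max[of "r + 1"] show False by simp
  qed
  then have "e = d" using e dc unfolding e1_def
    by (intro eq_matI) (auto dest!: arg_cong[where f = "\<lambda>A. A $$ (_, _)"] simp: mat_eq_iff)
  with d(1) show ?thesis by blast
qed


subsection \<open>Idempotent multiples of a matrix\<close>

text \<open>The value at \<open>a\<close> of the polynomial with the given coefficients, constant
  term first.\<close>

fun horner :: "'a::comm_ring_1 mat \<Rightarrow> 'a list \<Rightarrow> 'a mat" where
  "horner a [] = 0\<^sub>m (dim_row a) (dim_row a)"
| "horner a (c # cs) = c \<cdot>\<^sub>m 1\<^sub>m (dim_row a) + a * horner a cs"

lemma horner_carrier [simp]: "a \<in> carrier_mat n n \<Longrightarrow> horner a cs \<in> carrier_mat n n"
  by (induction cs) auto

lemma horner_dim [simp]: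
  "a \<in> carrier_mat n n \<Longrightarrow> dim_row (horner a cs) = n"
  "a \<in> carrier_mat n n \<Longrightarrow> dim_col (horner a cs) = n"
  using horner_carrier by blast+

lemma horner_commute:
  assumes a: "a \<in> carrier_mat n n" and x: "x \<in> carrier_mat n n" and xa: "x * a = a * x"
  shows "x * horner a cs = horner a cs * x"
proof (induction cs)
  case Nil then show ?case using a x by simp
next
  case (Cons c cs)
  note h = horner_carrier[OF a, of cs]
  have "x * (a * horner a cs) = a * (x * horner a cs)"
    using a x h by (simp add: mult_ext[OF xa] mult_assoc_dim)
  also have "\<dots> = a * horner a cs * x" using Cons a x h by (simp add: mult_assoc_dim)
  finally show ?case using a x h 
    by (simp add: mult_add_dim add_mult_dim mult_smult_dim smult_mult_dim mult_assoc_dim)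
qed

lemma pow_mat_commute:
  assumes "a \<in> carrier_mat n n" "x \<in> carrier_mat n n" "x * a = a * x"
  shows "x * a ^\<^sub>m k = a ^\<^sub>m k * x"
proof (induction k)
  case 0 then show ?case using assms by simp
next
  case (Suc k)
  have "x * (a ^\<^sub>m k * a) = a ^\<^sub>m k * (x * a)"
    using assms by (simp add: mult_ext[OF Suc] mult_assoc_dim)
  then show ?case using assms by (simp add: mult_assoc_dim)
qed

lemma horner_index:
  assumes a: "a \<in> carrier_mat n n" and "i < n" "j < n"
  shows "horner a cs $$ (i, j) = (\<Sum>k<length cs. cs ! k * (a ^\<^sub>m k) $$ (i, j))"
  using assms(2,3)
proof (induction cs arbitrary: i j)
  case Nil then show ?case using a by simp
next
  case (Cons c cs)
  have comm: "a * a ^\<^sub>m k = a ^\<^sub>m Suc k" for k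
    using pow_mat_commute[OF a a refl] by simp
  have "(a * horner a cs) $$ (i, j) = (\<Sum>l<n. \<Sum>k<length cs. cs ! k * (a $$ (i, l) * (a ^\<^sub>m k) $$ (l, j)))"
    using a Cons(2,3) horner_carrier[OF a, of cs]
    by (subst mult_index) (auto simp: Cons(1) sum_distrib_left mult_ac intro!: sum.cong)
  also have "\<dots> = (\<Sum>k<length cs. \<Sum>l<n. cs ! k * (a $$ (i, l) * (a ^\<^sub>m k) $$ (l, j)))"
    by (rule sum.swap)
  also have "\<dots> = (\<Sum>k<length cs. cs ! k * (a * a ^\<^sub>m k) $$ (i, j))"
    using a Cons(2,3) by (intro sum.cong refl) (subst mult_index, auto simp: sum_distrib_left)
  finally have "(a * horner a cs) $$ (i, j) = (\<Sum>k<length cs. cs ! k * (a ^\<^sub>m Suc k) $$ (i, j))"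
    unfolding comm .
  then show ?case using a Cons(2,3) horner_carrier[OF a, of cs]
    by (simp add: sum.lessThan_Suc_shift del: pow_mat.simps(2) sum.lessThan_Suc index_mult_mat(1))
qed

text \<open>The n^2 + 1 powers of \<open>a\<close> up to exponent n^2 lie in a space of dimension
  n^2, hence are linearly dependent.\<close>

lemma annihilating_list:
  fixes a :: "'a::field mat"
  assumes a: "a \<in> carrier_mat n n"
  shows "\<exists>cs. (\<exists>c\<in>set cs. c \<noteq> 0) \<and> horner a cs = 0\<^sub>m n n"
proof -
  define N where "N = Suc (n * n)"
  \<comment> \<open>The columns are the flattened powers of \<open>a\<close>; the extra last row of
    zeros makes the matrix square and singular, and a kernel vector lists the coefficients.\<close>
  define M where "M = mat N N (\<lambda>(i, j). if i < n * n then (a ^\<^sub>m j) $$ (i div n, i mod n) else 0)"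
  have M: "M \<in> carrier_mat N N" by (simp add: M_def)
  have "det M = 0"
  proof (rule ccontr)
    assume "det M \<noteq> 0"
    then have "M \<in> Units (ring_mat TYPE('a) N ())" by (rule det_non_zero_imp_unit[OF M])
    then obtain B where B: "B \<in> carrier_mat N N" "M * B = 1\<^sub>m N"
      unfolding Units_def by (auto simp: ring_mat_simps)
    have "(M * B) $$ (n * n, n * n) = 0"
      using B(1) M by (subst mult_index) (auto simp: M_def N_def)
    with B(2) show False by (simp add: N_def)
  qed
  then obtain v where v: "v \<in> carrier_vec N" "v \<noteq> 0\<^sub>v N" "M *\<^sub>v v = 0\<^sub>v N"
    using det_0_iff_vec_prod_zero_field[OF M] by blast
  define cs where "cs = map (\<lambda>k. v $ k) [0..<N]"
  have "\<exists>k<N. v $ k \<noteq> 0" using v(1,2) by (metis carrier_vecD eq_vecI index_zero_vec)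
  then have "\<exists>c\<in>set cs. c \<noteq> 0" by (auto simp: cs_def)
  moreover have "horner a cs = 0\<^sub>m n n"
  proof (rule eq_matI)
    fix i j assume "i < dim_row (0\<^sub>m n n :: 'a mat)" "j < dim_col (0\<^sub>m n n :: 'a mat)"
    then have ij: "i < n" "j < n" by auto
    have l: "i * n + j < n * n" using ij by (rule pair_index_less)
    have "(M *\<^sub>v v) $ (i * n + j) = 0" using v(3) l by (simp add: N_def)
    moreover have "(M *\<^sub>v v) $ (i * n + j) = (\<Sum>k<N. (a ^\<^sub>m k) $$ (i, j) * v $ k)"
      using l M v(1) ij by (auto simp: scalar_prod_def M_def N_def atLeast0LessThan intro!: sum.cong)
    ultimately show "horner a cs $$ (i, j) = 0\<^sub>m n n $$ (i, j)"
      using ij by (simp add: horner_index[OF a] cs_def mult.commute)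
  qed (use horner_carrier[OF a, of cs] in auto)
  ultimately show ?thesis by blast
qed


lemma horner_replicate_zero:
  assumes a: "a \<in> carrier_mat n n"
  shows "horner a (replicate m 0 @ cs) = a ^\<^sub>m m * horner a cs"
proof (induction m)
  case 0 then show ?case using a by simp
next
  case (Suc m)
  have "horner a (replicate (Suc m) 0 @ cs) = a * (a ^\<^sub>m m * horner a cs)"
    using Suc a by (auto intro!: eq_matI)
  then show ?case using a by (simp add: mult_ext[OF pow_mat_commute[OF a a refl]] mult_assoc_dim)
qed

text \<open>In an annihilating polynomial split off the power of the variable that divides it. This
  leaves \<open>a^m (c + a h) = 0\<close> with c nonzero, and dividing by -c makes
  \<open>a^m\<close> absorb a multiple of \<open>a\<close>.\<close>

lemma stabilizing_power:
  fixes a :: "'a::field mat"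
  assumes a: "a \<in> carrier_mat n n"
  shows "\<exists>m cs. a ^\<^sub>m m = a ^\<^sub>m m * (a * horner a cs)"
proof -
  obtain cs where cs: "\<exists>c\<in>set cs. c \<noteq> 0" "horner a cs = 0\<^sub>m n n"
    using annihilating_list[OF a] by blast
  define z where "z = takeWhile (\<lambda>c. c = 0) cs"
  obtain c ds where dw: "dropWhile (\<lambda>c. c = 0) cs = c # ds" and c: "c \<noteq> 0"
    using cs(1) by (metis (mono_tags, lifting) dropWhile_eq_Nil_conv hd_dropWhile list.exhaust list.sel(1))
  have "z = replicate (length z) 0"
    unfolding z_def by (metis (mono_tags) replicate_eqI set_takeWhileD)
  then have csz: "cs = replicate (length z) 0 @ c # ds"
    using takeWhile_dropWhile_id[of "\<lambda>c. c = 0" cs] dw unfolding z_def by metis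
  define m where "m = length z"
  define h where "h = horner a ds"
  have h: "h \<in> carrier_mat n n" using a by (simp add: h_def)
  have "a ^\<^sub>m m * (c \<cdot>\<^sub>m 1\<^sub>m n + a * h) = 0\<^sub>m n n"
    using cs(2) horner_replicate_zero[OF a, of m "c # ds"] a unfolding csz m_def h_def by simp
  then have z0: "c \<cdot>\<^sub>m a ^\<^sub>m m + a ^\<^sub>m m * (a * h) = 0\<^sub>m n n"
    using a h by (simp add: mult_add_dim mult_smult_dim)
  define ds' where "ds' = map (\<lambda>d. - d / c) ds"
  have "horner a ds' = (- 1 / c) \<cdot>\<^sub>m horner a ds"
    unfolding ds'_def
  proof (induction ds)
    case (Cons d ds)
    then show ?case using a
      by (simp add: mult_smult_dim) (auto intro!: eq_matI simp: algebra_simps)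
  qed (use a in auto)
  then have "a ^\<^sub>m m * (a * horner a ds') = (- 1 / c) \<cdot>\<^sub>m (a ^\<^sub>m m * (a * h))"
    using a h by (simp add: mult_smult_dim h_def)
  also have "\<dots> = a ^\<^sub>m m"
  proof (rule eq_matI)
    fix i j assume ij: "i < dim_row (a ^\<^sub>m m)" "j < dim_col (a ^\<^sub>m m)"
    then have ij': "i < n" "j < n" unfolding carrier_matD[OF pow_carrier_mat[OF a]] by auto
    have "(c \<cdot>\<^sub>m a ^\<^sub>m m + a ^\<^sub>m m * (a * h)) $$ (i, j) = 0" using z0 ij' by simp
    then have "c * (a ^\<^sub>m m) $$ (i, j) + (a ^\<^sub>m m * (a * h)) $$ (i, j) = 0"
      using ij' a h by (simp del: index_mult_mat(1))
    then have "(a ^\<^sub>m m * (a * h)) $$ (i, j) = - c * (a ^\<^sub>m m) $$ (i, j)"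
      by (simp add: eq_neg_iff_add_eq_0 add.commute del: index_mult_mat(1))
    then show "((- 1 / c) \<cdot>\<^sub>m (a ^\<^sub>m m * (a * h))) $$ (i, j) = (a ^\<^sub>m m) $$ (i, j)"
      using ij' a h c by (simp del: index_mult_mat(1))
  qed (use a h in auto)
  finally show ?thesis by metis
qed

text \<open>Induction on the size, with no eigenvalues: a nilpotent matrix kills a nonzero row
  vector from the left, so it factors through a smaller space, where the corresponding nilpotent
  matrix has the same trace by cyclicity.\<close>

lemma nilpotent_tr_zero:
  fixes a :: "'a::field mat"
  assumes "a \<in> carrier_mat n n" "a ^\<^sub>m m = 0\<^sub>m n n"
  shows "tr a = 0"
  using assms
proof (induction n arbitrary: a m rule: less_induct)
  case (less n)
  note a = less.prems(1)
  show ?case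
  proof (cases "n = 0")
    case True then show ?thesis using a by (auto simp: tr_def)
  next
    case False
    define k where "k = (LEAST k. a ^\<^sub>m k = 0\<^sub>m n n)"
    have ak: "a ^\<^sub>m k = 0\<^sub>m n n" unfolding k_def using less.prems(2) by (rule LeastI)
    have "k \<noteq> 0"
    proof
      assume "k = 0"
      then have "(1\<^sub>m n :: 'a mat) $$ (0, 0) = 0" using ak a False by simp
      then show False using False by simp
    qed
    then obtain l where l: "k = Suc l" using not0_implies_Suc by blast
    have bne: "a ^\<^sub>m l \<noteq> 0\<^sub>m n n" using not_less_Least[of l "\<lambda>k. a ^\<^sub>m k = 0\<^sub>m n n"] l unfolding k_def by auto
    define b where "b = a ^\<^sub>m l"
    have b: "b \<in> carrier_mat n n" "b * a = 0\<^sub>m n n" using a ak l by (auto simp: b_def)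
    obtain i0 j0 where ij: "i0 < n" "j0 < n" "b $$ (i0, j0) \<noteq> 0"
      using nonzero_entry[OF b(1)] bne unfolding b_def by blast
    \<comment> \<open>A nonzero row of the last nonvanishing power of \<open>a\<close>, whence
      \<open>w * a = 0\<close>; the vector \<open>u\<close> is chosen with
      \<open>w * u = 1\<close>.\<close>
    define w where "w = mat 1 n (\<lambda>(_, j). b $$ (i0, j))"
    define u where "u = mat n 1 (\<lambda>(i, _). if i = j0 then 1 / b $$ (i0, j0) else 0)"
    have w: "w \<in> carrier_mat 1 n" and u: "u \<in> carrier_mat n 1" by (auto simp: w_def u_def)
    have wu: "w * u = 1\<^sub>m 1"
      using ij w u by (intro eq_matI) (auto simp: mult_index w_def u_def if_distrib[of "\<lambda>x. _ * x"] cong: if_cong simp del: index_mult_mat(1))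
    have wa: "w * a = 0\<^sub>m 1 n"
    proof (rule eq_matI)
      fix i j assume "i < dim_row (0\<^sub>m 1 n :: 'a mat)" "j < dim_col (0\<^sub>m 1 n :: 'a mat)"
      then have "i = 0" "j < n" by auto
      moreover have "(w * a) $$ (0, j) = (b * a) $$ (i0, j)" if "j < n"
        using that ij w a b(1) by (subst (1 2) mult_index) (auto simp: w_def)
      ultimately show "(w * a) $$ (i, j) = 0\<^sub>m 1 n $$ (i, j)" using b(2) ij by simp
    qed (use w a in auto)
    \<comment> \<open>The projection onto the kernel of \<open>w\<close> along \<open>u\<close>. It
      fixes \<open>a\<close>, and its rank is less than n because \<open>w * P = 0\<close> with
      \<open>w\<close> nonzero.\<close>
    define P where "P = 1\<^sub>m n - u * w"
    have P: "P \<in> carrier_mat n n" "P * a = a" "w * P = 0\<^sub>m 1 n"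
      using w u a by (auto simp: P_def mat_dim_simps mult_ext[OF wu] wa mat_minus_self)
    have "P * P = P"
      using w u by (auto simp: P_def mat_dim_simps mult_ext[OF wu] mat_minus_self intro!: eq_matI)
    then obtain r where r: "splits n r P" using idempotent_splits[OF P(1)] by blast
    then obtain i q where iq: "i \<in> carrier_mat n r" "q \<in> carrier_mat r n" "q * i = 1\<^sub>m r" "i * q = P"
      unfolding splits_def by blast
    have "r \<noteq> n"
    proof
      assume rn: "r = n"
      then have "P = 1\<^sub>m n" using mat_mult_left_right_inverse[of q n i] iq by auto
      then have "w = 0\<^sub>m 1 n" using P(3) w by simp
      then have "w $$ (0, j0) = 0" using ij by simp
      then show False using ij by (simp add: w_def)
    qed
    then have rn: "r < n" using splits_le[OF r] by simp
    have aiq: "i * (q * a) = a" using iq(1,2) a P(2) by (simp add: mult_ext[OF iq(4)])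
    have pow: "(q * (a * i)) ^\<^sub>m t = q * (a ^\<^sub>m t * i)" for t
    proof (induction t)
      case 0 then show ?case using iq a by simp
    next
      case (Suc t)
      then have "(q * (a * i)) ^\<^sub>m Suc t = q * (a ^\<^sub>m t * (i * (q * a) * i))"
        using iq a by (simp add: mult_assoc_dim)
      then show ?case using iq a unfolding aiq by (simp add: mult_assoc_dim)
    qed
    have "(q * (a * i)) ^\<^sub>m m = 0\<^sub>m r r" unfolding pow less.prems(2) using iq by simp
    moreover have "q * (a * i) \<in> carrier_mat r r" using iq a by simp
    ultimately have "tr (q * (a * i)) = 0" using less.IH[OF rn] by blast
    moreover have "tr (q * (a * i)) = tr (i * (q * a))"
      using iq a tr_comm[of i "q * a"] by (simp add: mult_assoc_dim)
    ultimately show ?thesis unfolding aiq by simp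
  qed
qed

text \<open>The factor is even a polynomial in \<open>a\<close>; only its consequence for commutants is recorded.\<close>

theorem idempotent_multiple:
  fixes a :: "'a::field mat"
  assumes a: "a \<in> carrier_mat n n" and tra: "tr a \<noteq> 0"
  shows "\<exists>b\<in>carrier_mat n n. (\<forall>x\<in>carrier_mat n n. x * a = a * x \<longrightarrow> x * b = b * x) \<and>
    (b * a) * (b * a) = b * a \<and> b * a \<noteq> 0\<^sub>m n n"
proof -
  obtain m cs where m: "a ^\<^sub>m m = a ^\<^sub>m m * (a * horner a cs)" using stabilizing_power[OF a] by blast
  define h where "h = horner a cs"
  \<comment> \<open>The element absorbed by \<open>a^m\<close>:
    \<open>a^m * y = a^m\<close>.\<close>
  define y where "y = a * h"
  have h: "h \<in> carrier_mat n n" and y: "y \<in> carrier_mat n n" using a by (auto simp: h_def y_def)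
  have xh: "x * h = h * x" if "x \<in> carrier_mat n n" "x * a = a * x" for x
    unfolding h_def using horner_commute[OF a that] .
  have ah: "h * a = a * h" using xh[OF a refl] by simp
  have xy: "x * y = y * x" if "x \<in> carrier_mat n n" "x * a = a * x" for x
    using that a h xh[OF that] unfolding y_def by (simp add: mult_ext[OF that(2)] mult_assoc_dim)
  have am: "a ^\<^sub>m m * y ^\<^sub>m j = a ^\<^sub>m m" for j
  proof (induction j)
    case 0 then show ?case using a y by simp
  next
    case (Suc j)
    have "a ^\<^sub>m m * (y ^\<^sub>m j * y) = a ^\<^sub>m m * y" using a y by (simp add: mult_ext[OF Suc])
    then show ?case using m unfolding h_def[symmetric] y_def[symmetric] by simp
  qed
  have yk: "y ^\<^sub>m k = h ^\<^sub>m k * a ^\<^sub>m k" for k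
  proof (induction k)
    case 0 then show ?case using a h y by simp
  next
    case (Suc k)
    have "a ^\<^sub>m k * y = y * a ^\<^sub>m k" using pow_mat_commute[OF a y xy[OF a refl, symmetric]] by simp
    have c1: "h * a ^\<^sub>m k = a ^\<^sub>m k * h" using pow_mat_commute[OF a h ah] .
    have "y ^\<^sub>m Suc k = h ^\<^sub>m k * (a ^\<^sub>m k * (h * a))" using Suc a h ah by (simp add: y_def mult_assoc_dim)
    also have "\<dots> = h ^\<^sub>m k * (h * (a ^\<^sub>m k * a))"
      using a h by (simp add: mult_ext[OF c1] mult_assoc_dim)
    finally show ?case using a h by (simp add: mult_assoc_dim)
  qed
  \<comment> \<open>As \<open>a\<close> and \<open>h\<close> commute,
    \<open>y^m = h^m * a^m\<close>, which absorbs further factors \<open>y\<close> and so is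
    idempotent. It is nonzero, for otherwise \<open>a^m = a^m * y^m = 0\<close>, against the trace
    of \<open>a\<close>.\<close>
  define e where "e = y ^\<^sub>m m"
  have e: "e \<in> carrier_mat n n" using y by (simp add: e_def)
  have ey: "e * y ^\<^sub>m j = e" for j
    unfolding e_def yk[of m] using a h y by (simp add: mult_assoc_dim am)
  have ee: "e * e = e" using ey[of m] by (simp add: e_def)
  have e0: "e \<noteq> 0\<^sub>m n n"
  proof
    assume "e = 0\<^sub>m n n"
    then have "a ^\<^sub>m m = 0\<^sub>m n n" using am[of m] a unfolding e_def by simp
    with nilpotent_tr_zero[OF a] tra show False by blast
  qed
  define b where "b = e * h"
  have ba: "b * a = e"
    using ey[of 1] e h a y ah unfolding b_def by (simp add: y_def mult_assoc_dim)
  have "x * b = b * x" if x: "x \<in> carrier_mat n n" "x * a = a * x" for x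
  proof -
    have xe: "x * e = e * x" unfolding e_def by (rule pow_mat_commute[OF y x(1) xy[OF x]])
    show ?thesis unfolding b_def using x e h xh[OF x] by (simp add: mult_ext[OF xe] mult_assoc_dim)
  qed
  moreover have "b \<in> carrier_mat n n" using e h by (simp add: b_def)
  ultimately show ?thesis using ba ee e0 by (intro bexI[of _ b]) auto
qed


section \<open>Intertwiners modulo negligible ones\<close>

text \<open>A square matrix stands for a representation of the one-dimensional Lie algebra. A morphism is negligible
  if its composite with every morphism in the opposite direction has trace zero; \<open>treq\<close> is equality modulo
  negligible morphisms.\<close>

definition intw :: "'a::field mat \<Rightarrow> 'a mat \<Rightarrow> 'a mat set" where
  "intw E F = {f \<in> carrier_mat (dim_row F) (dim_row E). f * E = F * f}"

definition treq :: "'a::field mat \<Rightarrow> 'a mat \<Rightarrow> 'a mat \<Rightarrow> 'a mat \<Rightarrow> bool" where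
  "treq E F f g \<longleftrightarrow> (\<forall>h\<in>intw F E. tr (h * f) = tr (h * g))"

lemma intw_dim:
  assumes "f \<in> intw E F"
  shows "dim_row f = dim_row F" "dim_col f = dim_row E" "f * E = F * f"
  using assms by (auto simp: intw_def)

lemma intwI: "\<lbrakk>dim_row f = dim_row F; dim_col f = dim_row E; f * E = F * f\<rbrakk> \<Longrightarrow> f \<in> intw E F"
  unfolding intw_def by auto

lemma intw_mult:
  assumes "square_mat E" "square_mat F" "square_mat G" "f \<in> intw E F" "g \<in> intw F G"
  shows "g * f \<in> intw E G"
proof (rule intwI)
  show "g * f * E = G * (g * f)"
    using assms(1-3) intw_dim[OF assms(4)] intw_dim(1,2)[OF assms(5)]
    by (simp add: mult_assoc_dim mult_ext[OF intw_dim(3)[OF assms(5)]])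
qed (use intw_dim[OF assms(4)] intw_dim[OF assms(5)] in auto)

lemma intw_one: "square_mat E \<Longrightarrow> 1\<^sub>m (dim_row E) \<in> intw E E"
  by (rule intwI) auto

lemma intw_zero: "\<lbrakk>square_mat E; square_mat F\<rbrakk> \<Longrightarrow> 0\<^sub>m (dim_row F) (dim_row E) \<in> intw E F"
  by (rule intwI) auto

lemma intw_add:
  assumes "square_mat E" "square_mat F" "f \<in> intw E F" "g \<in> intw E F"
  shows "f + g \<in> intw E F"
  using assms(1,2) intw_dim[OF assms(3)] intw_dim[OF assms(4)] by (intro intwI) (auto simp: mat_dim_simps)

lemma intw_minus:
  assumes "square_mat E" "square_mat F" "f \<in> intw E F" "g \<in> intw E F"
  shows "f - g \<in> intw E F"
  using assms(1,2) intw_dim[OF assms(3)] intw_dim[OF assms(4)] by (intro intwI) (auto simp: mat_dim_simps)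

lemma intw_smult:
  assumes "square_mat E" "square_mat F" "f \<in> intw E F"
  shows "c \<cdot>\<^sub>m f \<in> intw E F"
  using assms(1,2) intw_dim[OF assms(3)] by (intro intwI) (auto simp: mat_dim_simps)

lemma treq_refl [simp]: "treq E F f f"
  by (simp add: treq_def)

lemma treq_sym: "treq E F f g \<Longrightarrow> treq E F g f"
  by (simp add: treq_def)

lemma treq_trans [trans]: "treq E F f g \<Longrightarrow> treq E F g h \<Longrightarrow> treq E F f h"
  by (simp add: treq_def)

text \<open>Negligible morphisms form a two-sided ideal: by cyclicity of the trace, factors on
  either side can be absorbed into the test morphism \<open>h\<close>.\<close>

lemma treq_mult:
  assumes sq: "square_mat E" "square_mat F" "square_mat G"
    and f: "f \<in> intw E F" "f' \<in> intw E F" "treq E F f f'"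
    and g: "g \<in> intw F G" "g' \<in> intw F G" "treq F G g g'"
  shows "treq E G (g * f) (g' * f')"
  unfolding treq_def
proof
  fix h assume h: "h \<in> intw G E"
  note d = intw_dim(1,2)[OF h] intw_dim(1,2)[OF f(1)] intw_dim(1,2)[OF f(2)]
    intw_dim(1,2)[OF g(1)] intw_dim(1,2)[OF g(2)] sq
  have "tr (h * (g * f)) = tr ((h * g) * f)" using d by (simp add: mult_assoc_dim)
  also have "\<dots> = tr ((h * g) * f')"
    using f(3) intw_mult[OF sq(2,3,1) g(1) h] unfolding treq_def by blast
  also have "\<dots> = tr ((f' * h) * g)" using d tr_comm[of "h * g" f'] by (simp add: mult_assoc_dim)
  also have "\<dots> = tr ((f' * h) * g')"
    using g(3) intw_mult[OF sq(3,1,2) h f(2)] unfolding treq_def by blast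
  also have "\<dots> = tr (h * (g' * f'))" using d tr_comm[of f' "h * g'"] by (simp add: mult_assoc_dim)
  finally show "tr (h * (g * f)) = tr (h * (g' * f'))" .
qed

lemma treq_add:
  assumes "f \<in> intw E F" "f' \<in> intw E F" "treq E F f f'"
    and "g \<in> intw E F" "g' \<in> intw E F" "treq E F g g'"
  shows "treq E F (f + g) (f' + g')"
  unfolding treq_def
proof
  fix h assume h: "h \<in> intw F E"
  show "tr (h * (f + g)) = tr (h * (f' + g'))"
    using assms(3,6) h intw_dim(1,2)[OF h] intw_dim(1,2)[OF assms(1)] intw_dim(1,2)[OF assms(2)]
      intw_dim(1,2)[OF assms(4)] intw_dim(1,2)[OF assms(5)]
    by (simp add: treq_def mult_add_dim tr_add)
qed

lemma treq_smult:
  assumes "f \<in> intw E F" "f' \<in> intw E F" "treq E F f f'"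
  shows "treq E F (c \<cdot>\<^sub>m f) (c \<cdot>\<^sub>m f')"
  unfolding treq_def
proof
  fix h assume h: "h \<in> intw F E"
  show "tr (h * (c \<cdot>\<^sub>m f)) = tr (h * (c \<cdot>\<^sub>m f'))"
    using assms(3) h intw_dim(1,2)[OF h] intw_dim(1,2)[OF assms(1)] intw_dim(1,2)[OF assms(2)]
    by (simp add: treq_def mult_smult_dim tr_smult)
qed

text \<open>Among the idempotents of the form \<open>g * f\<close>, one of maximal rank splits off all of \<open>f\<close> that is not
  negligible: a part of \<open>f\<close> left over would pair to a nonzero trace with some intertwiner, and the
  product would give a further orthogonal idempotent.\<close>

theorem intw_regular:
  fixes E F :: "'a::field mat"
  assumes sq: "square_mat E" "square_mat F" and f: "f \<in> intw E F"
  shows "\<exists>R i q. square_mat R \<and> i \<in> intw R E \<and> q \<in> intw F R \<and> q * (f * i) = 1\<^sub>m (dim_row R) \<and>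
    treq E F (f * (i * (q * f))) f \<and> dim_row R \<le> dim_row E \<and>
    (dim_row R = dim_row E \<longrightarrow> i * (q * f) = 1\<^sub>m (dim_row E))"
proof -
  define n where "n = dim_row E"
  define m where "m = dim_row F"
  have E: "E \<in> carrier_mat n n" and F: "F \<in> carrier_mat m m" using sq by (auto simp: n_def m_def)
  have fc: "f \<in> carrier_mat m n" using f by (auto simp: intw_def n_def m_def)
  \<comment> \<open>The ranks of idempotents of the form \<open>g * f\<close>; they are bounded by
    the size of \<open>E\<close>.\<close>
  define P where "P r \<longleftrightarrow> (\<exists>g\<in>intw F E. splits n r (g * f))" for r
  have P0: "P 0" unfolding P_def splits_zero_rank using fc intw_zero[OF sq(2,1)]
    by (intro bexI[of _ "0\<^sub>m n m"]) (auto simp: n_def m_def)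
  obtain r where "P r" and max: "\<And>s. r < s \<Longrightarrow> \<not> P s"
    using ex_max_nat[of P 0 n] P0 splits_le unfolding P_def by blast
  then obtain g where g: "g \<in> intw F E" and sp: "splits n r (g * f)" unfolding P_def by blast
  have gc: "g \<in> carrier_mat n m" using g by (auto simp: intw_def n_def m_def)
  have gF: "g * F = E * g" using g by (rule intw_dim)
  define e where "e = g * f"
  have eI: "e \<in> intw E E" unfolding e_def by (rule intw_mult[OF sq(1,2,1) f g])
  have ec: "e \<in> carrier_mat n n" and eE: "e * E = E * e" using eI by (auto simp: intw_def n_def)
  obtain i q where iq: "i \<in> carrier_mat n r" "q \<in> carrier_mat r n" "q * i = 1\<^sub>m r" "i * q = e"
    using sp unfolding splits_def e_def by blast
  have qe: "q * e = q" using iq(1,2,3) unfolding iq(4)[symmetric] by (simp add: mult_ext[OF iq(3)])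
  have ei: "e * i = i" using iq(1,2,3) unfolding iq(4)[symmetric] by (simp add: mult_assoc_dim)
  have ee: "e * e = e" using iq(1,2) qe ec by (simp add: mult_assoc_dim flip: iq(4))
  have key: "treq E F (f * e) f"
  proof (rule ccontr)
    assume "\<not> treq E F (f * e) f"
    then obtain h where h: "h \<in> intw F E" and ne: "tr (h * (f * e)) \<noteq> tr (h * f)"
      unfolding treq_def by blast
    have hc: "h \<in> carrier_mat n m" using h by (auto simp: intw_def n_def m_def)
    define d where "d = 1\<^sub>m n - e"
    have dI: "d \<in> intw E E" unfolding d_def n_def by (rule intw_minus[OF sq(1,1) intw_one[OF sq(1)] eI])
    have dc: "d \<in> carrier_mat n n" unfolding d_def by (rule minus_carrier_mat[OF ec])
    have dd: "d * d = d" "e * d = 0\<^sub>m n n" "d * e = 0\<^sub>m n n"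
      using ec ee by (auto simp: d_def mat_dim_simps mat_minus_self intro!: eq_matI)
    \<comment> \<open>The part of \<open>h * f\<close> in the corner cut out by
      \<open>d = 1 - e\<close>. Its trace is \<open>tr (h * f) - tr (h * (f * e))\<close>, nonzero
      by the choice of \<open>h\<close>.\<close>
    define a where "a = d * (h * (f * d))"
    have aI: "a \<in> intw E E"
      unfolding a_def by (intro intw_mult[OF sq(1,1,1) _ dI] intw_mult[OF sq(1,2,1) _ h] intw_mult[OF sq(1,1,2) dI f])
    have ac: "a \<in> carrier_mat n n" using aI by (auto simp: intw_def n_def)
    have "tr a = tr ((h * (f * d)) * d)" unfolding a_def using dc hc fc by (intro tr_comm) auto
    also have "\<dots> = tr (h * (f * d))" using dc hc fc dd by (simp add: mult_assoc_dim)
    also have "\<dots> = tr (h * f) - tr (h * (f * e))"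
      using hc fc ec by (simp add: d_def mult_minus_dim tr_minus)
    finally have "tr a \<noteq> 0" using ne by simp
    then obtain b where b: "b \<in> carrier_mat n n" "\<And>x. \<lbrakk>x \<in> carrier_mat n n; x * a = a * x\<rbrakk> \<Longrightarrow> x * b = b * x"
        "(b * a) * (b * a) = b * a" "b * a \<noteq> 0\<^sub>m n n"
      using idempotent_multiple[OF ac] by blast
    \<comment> \<open>The factor \<open>b\<close> commutes with whatever commutes with
      \<open>a\<close>. Applied to \<open>E\<close> this makes \<open>b\<close> an intertwiner;
      applied to \<open>e\<close> it makes \<open>b * a\<close> orthogonal to
      \<open>e\<close>.\<close>
    have "E * b = b * E" using b(2)[OF E] intw_dim(3)[OF aI] by simp
    then have bI: "b \<in> intw E E" using b(1) by (intro intwI) (auto simp: n_def)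
    have ea: "e * a = 0\<^sub>m n n" using ec dc hc fc by (simp add: a_def mult_ext[OF dd(2)])
    have ae: "a * e = 0\<^sub>m n n" using ec dc hc fc by (simp add: a_def mult_assoc_dim dd(3))
    have eb: "e * b = b * e" using b(2)[OF ec] ea ae by simp
    have o1: "e * (b * a) = 0\<^sub>m n n"
      using ec ac b(1) ea by (simp add: mult_ext[OF eb] mult_assoc_dim)
    have o2: "b * a * e = 0\<^sub>m n n"
      using ec ac b(1) ae by (simp add: mult_assoc_dim)
    obtain r' where r': "splits n r' (b * a)" using idempotent_splits[of "b * a" n] b(1,3) ac by auto
    have "r' \<noteq> 0"
    proof
      assume "r' = 0"
      then have "b * a = 0\<^sub>m n n" using r' splits_zero_rank by blast
      with b(4) show False by simp
    qed
    \<comment> \<open>The correction of \<open>g\<close> is \<open>b d h (1 - f g)\<close>.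
      Multiplied by \<open>f\<close> it becomes \<open>b d h f (1 - e) = b a\<close>, so the larger
      idempotent again has the form \<open>g' * f\<close>.\<close>
    have gsum: "(g + (b * (d * h) - b * (d * (h * (f * g))))) * f = e + b * a"
      using gc fc hc dc b(1) ec by (simp add: mat_dim_simps a_def d_def e_def)
    have bdh: "b * (d * h) \<in> intw F E"
      by (intro intw_mult[OF sq(2,1,1) _ bI] intw_mult[OF sq(2,1,1) h dI])
    have bdhfg: "b * (d * (h * (f * g))) \<in> intw F E"
      by (intro intw_mult[OF sq(2,1,1) _ bI] intw_mult[OF sq(2,1,1) _ dI] intw_mult[OF sq(2,2,1) _ h]
          intw_mult[OF sq(2,1,2) g f])
    have "splits n (r + r') ((g + (b * (d * h) - b * (d * (h * (f * g))))) * f)"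
      unfolding gsum using splits_add[OF sp r'] o1 o2 unfolding e_def by simp
    then have "P (r + r')" unfolding P_def
      using intw_add[OF sq(2,1) g intw_minus[OF sq(2,1) bdh bdhfg]] by blast
    with max[of "r + r'"] \<open>r' \<noteq> 0\<close> show False by simp
  qed
  \<comment> \<open>The structure matrix compressed to the image of \<open>e\<close>; since
    \<open>e\<close> commutes with \<open>E\<close>, both \<open>i\<close> and \<open>q * g\<close>
    are intertwiners for it.\<close>
  define R where "R = q * (E * i)"
  have R: "square_mat R" "dim_row R = r" "dim_col R = r" using iq E by (auto simp: R_def)
  have iI: "i \<in> intw R E"
  proof (rule intwI)
    have "i * R = e * (E * i)" using iq(1,2) E by (simp add: R_def mult_ext[OF iq(4)])
    also have "\<dots> = E * (e * i)" using iq(1,2) E ec by (simp add: mult_ext[OF eE] mult_assoc_dim)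
    finally show "i * R = E * i" unfolding ei .
  qed (use iq R in \<open>auto simp: n_def\<close>)
  have qgI: "q * g \<in> intw F R"
  proof (rule intwI)
    have "R * (q * g) = q * (E * (e * g))" using iq(1,2) E gc by (simp add: R_def mult_assoc_dim mult_ext[OF iq(4)])
    also have "\<dots> = (q * e) * (E * g)" using iq(1,2) E gc ec by (simp add: mult_assoc_dim mult_ext[OF eE[symmetric]])
    also have "\<dots> = q * g * F" unfolding qe using iq(2) gc F E gF by (simp add: mult_assoc_dim)
    finally show "q * g * F = R * (q * g)" by simp
  qed (use iq R gc in \<open>auto simp: m_def\<close>)
  have 1: "q * g * (f * i) = 1\<^sub>m r"
    using iq(1,2,3) gc fc qe by (simp add: mult_assoc_dim mult_ext[OF e_def[symmetric]] ei)
  have 2: "i * (q * g * f) = e"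
    using iq(1,2) gc fc qe by (simp add: mult_assoc_dim e_def[symmetric] iq(4))
  have 3: "r \<le> n" using splits_le[OF sp] .
  have 4: "e = 1\<^sub>m n" if "r = n"
    using mat_mult_left_right_inverse[of q n i] iq that by auto
  show ?thesis
    by (intro exI[of _ R] exI[of _ i] exI[of _ "q * g"] conjI)
      (use R iI qgI 1 2 3 4 key in \<open>auto simp: n_def\<close>)
qed


section \<open>Linear categories in which every morphism splits\<close>

context linear_category
begin

text \<open>Carrying the membership of source and target along with the morphism lets composites be
  typed by resolution alone.\<close>

definition arr :: "'o \<Rightarrow> 'o \<Rightarrow> 'm \<Rightarrow> bool" where
  "arr X Y f \<longleftrightarrow> X \<in> Obj C \<and> Y \<in> Obj C \<and> f \<in> Hom C X Y"

lemma arr_Comp [intro]: "\<lbrakk>arr Y Z g; arr X Y f\<rbrakk> \<Longrightarrow> arr X Z (g \<cdot> f)"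
  unfolding arr_def using Comp_in_Hom by blast

lemma arr_Id [intro]: "X \<in> Obj C \<Longrightarrow> arr X X (Id C X)"
  unfolding arr_def using Id_in_Hom by blast

lemma arr_assoc: "\<lbrakk>arr Y Z h; arr X Y g; arr W X f\<rbrakk> \<Longrightarrow> (h \<cdot> g) \<cdot> f = h \<cdot> (g \<cdot> f)"
  unfolding arr_def using Comp_assoc by blast

lemma arr_ext: "\<lbrakk>h \<cdot> g = k; arr Y Z h; arr X Y g; arr W X f\<rbrakk> \<Longrightarrow> h \<cdot> (g \<cdot> f) = k \<cdot> f"
  using arr_assoc by metis

lemma arr_Id_left: "arr X Y f \<Longrightarrow> Id C Y \<cdot> f = f"
  unfolding arr_def using Id_Comp by blast

lemma arr_Id_right: "arr X Y f \<Longrightarrow> f \<cdot> Id C X = f"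
  unfolding arr_def using Comp_Id by blast

lemma Add_right_cancel:
  assumes "arr X Y f" "arr X Y g" "arr X Y h" "f \<boxplus> h = g \<boxplus> h"
  shows "f = g"
proof -
  note XY = assms(1)[unfolded arr_def]
  obtain k where k: "k \<in> Hom C X Y" "h \<boxplus> k = Zero C X Y"
    using Add_inverse[of X Y h] assms(3) unfolding arr_def by blast
  have "f = (f \<boxplus> h) \<boxplus> k" using assms k XY Add_assoc Add_Zero unfolding arr_def by metis
  also have "\<dots> = g" unfolding assms(4) using assms k XY Add_assoc Add_Zero unfolding arr_def by metis
  finally show ?thesis .
qed

lemma arr_Zero [intro]: "\<lbrakk>X \<in> Obj C; Y \<in> Obj C\<rbrakk> \<Longrightarrow> arr X Y (Zero C X Y)"
  unfolding arr_def using Zero_in_Hom by blast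

lemma arr_Add [intro]: "\<lbrakk>arr X Y f; arr X Y g\<rbrakk> \<Longrightarrow> arr X Y (f \<boxplus> g)"
  unfolding arr_def using Add_in_Hom by blast

lemma arr_Scale [intro]: "arr X Y f \<Longrightarrow> arr X Y (Scale C a f)"
  unfolding arr_def using Scale_in_Hom by blast

lemma arr_Obj: "arr X Y f \<Longrightarrow> X \<in> Obj C" "arr X Y f \<Longrightarrow> Y \<in> Obj C" "arr X Y f \<Longrightarrow> f \<in> Hom C X Y"
  unfolding arr_def by auto

lemma arr_Add_Zero: "arr X Y f \<Longrightarrow> f \<boxplus> Zero C X Y = f" "arr X Y f \<Longrightarrow> Zero C X Y \<boxplus> f = f"
  unfolding arr_def using Add_Zero Add_commute Zero_in_Hom by metis+

lemma Add_self_zero: "\<lbrakk>arr X Y f; f \<boxplus> f = f\<rbrakk> \<Longrightarrow> f = Zero C X Y"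
  using Add_right_cancel[of X Y f "Zero C X Y" f] arr_Add_Zero arr_Zero arr_Obj by metis

lemma Comp_Zero:
  assumes "arr X Y f" "W \<in> Obj C"
  shows "f \<cdot> Zero C W X = Zero C W Y" "Zero C Y W \<cdot> f = Zero C X W"
proof -
  note o = arr_Obj[OF assms(1)]
  show "f \<cdot> Zero C W X = Zero C W Y"
    by (rule Add_self_zero)
      (use Comp_Add[OF assms(2) o(1,2) Zero_in_Hom Zero_in_Hom o(3)] assms o
        arr_Add_Zero(1)[OF arr_Zero[OF assms(2) o(1)]] in auto)
  show "Zero C Y W \<cdot> f = Zero C X W"
    by (rule Add_self_zero)
      (use Add_Comp[OF o(1,2) assms(2) o(3) Zero_in_Hom Zero_in_Hom] assms o
        arr_Add_Zero(1)[OF arr_Zero[OF o(2) assms(2)]] in auto)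
qed

lemma Scale_zero: "arr X Y f \<Longrightarrow> Scale C 0 f = Zero C X Y"
  by (rule Add_self_zero) (use add_Scale[of X Y f 0 0] in \<open>auto simp: arr_def Scale_in_Hom\<close>)

definition Diff :: "'m \<Rightarrow> 'm \<Rightarrow> 'm" where
  "Diff f g = f \<boxplus> Scale C (- 1) g"

lemma arr_Diff [intro]: "\<lbrakk>arr X Y f; arr X Y g\<rbrakk> \<Longrightarrow> arr X Y (Diff f g)"
  unfolding Diff_def by blast

lemma Diff_self: "arr X Y f \<Longrightarrow> Diff f f = Zero C X Y"
  using add_Scale[of X Y f 1 "- 1"] one_Scale[of X Y f] Scale_zero[of X Y f]
  by (auto simp: Diff_def arr_def)

lemma Diff_Zero: "arr X Y f \<Longrightarrow> Diff f (Zero C X Y) = f"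
proof -
  assume f: "arr X Y f"
  note o = arr_Obj[OF f]
  have "Scale C (- 1) (Zero C X Y) = Zero C X Y"
    using Diff_self[OF arr_Zero[OF o(1,2)]] arr_Add_Zero(2)[OF arr_Scale[OF arr_Zero[OF o(1,2)]]]
    unfolding Diff_def by simp
  then show ?thesis unfolding Diff_def using arr_Add_Zero(1)[OF f] by simp
qed

lemma Diff_eq_Zero: "\<lbrakk>arr X Y f; arr X Y g; Diff f g = Zero C X Y\<rbrakk> \<Longrightarrow> f = g"
  using Add_right_cancel[of X Y f g "Scale C (- 1) g"] Diff_self[of X Y g] unfolding Diff_def by auto

lemma Comp_Diff: "\<lbrakk>arr Y Z h; arr X Y f; arr X Y g\<rbrakk> \<Longrightarrow> h \<cdot> Diff f g = Diff (h \<cdot> f) (h \<cdot> g)"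
  unfolding Diff_def arr_def using Comp_Add[of X Y Z f "Scale C (- 1) g" h] Comp_Scale[of X Y Z g h]
  by (simp add: Scale_in_Hom)

lemma Diff_Comp: "\<lbrakk>arr X Y h; arr Y Z f; arr Y Z g\<rbrakk> \<Longrightarrow> Diff f g \<cdot> h = Diff (f \<cdot> h) (g \<cdot> h)"
  unfolding Diff_def arr_def using Add_Comp[of X Y Z h f "Scale C (- 1) g"] Scale_Comp[of X Y Z h g]
  by (simp add: Scale_in_Hom)

text \<open>The last four claims say that a map killed by one of two complementary idempotents is
  fixed by the other. Kernels and cokernels below are obtained from this.\<close>

lemma complement_idempotent:
  assumes e: "arr X X e" and ee: "e \<cdot> e = e"
  defines "d \<equiv> Diff (Id C X) e"
  shows "arr X X d" "d \<cdot> d = d" "e \<cdot> d = Zero C X X" "d \<cdot> e = Zero C X X"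
    "\<And>W g. \<lbrakk>arr W X g; e \<cdot> g = Zero C W X\<rbrakk> \<Longrightarrow> d \<cdot> g = g"
    "\<And>W g. \<lbrakk>arr X W g; g \<cdot> e = Zero C X W\<rbrakk> \<Longrightarrow> g \<cdot> d = g"
    "\<And>W g. \<lbrakk>arr W X g; d \<cdot> g = Zero C W X\<rbrakk> \<Longrightarrow> e \<cdot> g = g"
    "\<And>W g. \<lbrakk>arr X W g; g \<cdot> d = Zero C X W\<rbrakk> \<Longrightarrow> g \<cdot> e = g"
proof -
  have X: "X \<in> Obj C" using e by (rule arr_Obj)
  note i = arr_Id[OF X]
  show d: "arr X X d" using i e unfolding d_def by blast
  show ed: "e \<cdot> d = Zero C X X" "d \<cdot> e = Zero C X X"
    using e i ee by (simp_all add: d_def Comp_Diff[of X X] Diff_Comp[of X X] arr_Id_left[of X X] arr_Id_right[of X X] Diff_self[of X X])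
  show g1: "d \<cdot> g = g" if "arr W X g" "e \<cdot> g = Zero C W X" for W g
    using that e i by (simp add: d_def Diff_Comp[of W X] arr_Id_left[of W X] Diff_Zero[of W X])
  show "g \<cdot> d = g" if "arr X W g" "g \<cdot> e = Zero C X W" for W g
    using that e i by (simp add: d_def Comp_Diff[of X W] arr_Id_right[of X W] Diff_Zero[of X W])
  show "d \<cdot> d = d" using g1[OF d] ed by simp
  show "e \<cdot> g = g" if g: "arr W X g" "d \<cdot> g = Zero C W X" for W g
    using g e i arr_Comp[OF e g(1)] Diff_eq_Zero[of W X g "e \<cdot> g"]
    by (simp add: d_def Diff_Comp[of W X] arr_Id_left[of W X])
  show "g \<cdot> e = g" if g: "arr X W g" "g \<cdot> d = Zero C X W" for W g
    using g e i arr_Comp[OF g(1) e] Diff_eq_Zero[of X W g "g \<cdot> e"]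
    by (simp add: d_def Comp_Diff[of X W] arr_Id_right[of X W])
qed

lemma split_mono:
  assumes i: "arr R X i" and q: "arr X R q" and qi: "q \<cdot> i = Id C R"
  shows "is_mono C R X i"
  unfolding is_mono_def
proof (intro conjI ballI impI)
  show "i \<in> Hom C R X" using i by (rule arr_Obj)
  fix W g h assume "W \<in> Obj C" "g \<in> Hom C W R" "h \<in> Hom C W R" and eq: "i \<cdot> g = i \<cdot> h"
  then have g: "arr W R g" and h: "arr W R h" using i unfolding arr_def by auto
  have "g = q \<cdot> (i \<cdot> g)" using arr_ext[OF qi q i g] arr_Id_left[OF g] by simp
  also have "\<dots> = h" unfolding eq using arr_ext[OF qi q i h] arr_Id_left[OF h] by simp
  finally show "g = h" .
qed

lemma zero_object_if_Id_Zero: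
  assumes X: "X \<in> Obj C" and z: "Id C X = Zero C X X"
  shows "is_zero_object C X"
  unfolding is_zero_object_def
proof (intro conjI ballI X)
  fix Y assume Y: "Y \<in> Obj C"
  have "f = Zero C Y X" if "f \<in> Hom C Y X" for f
    using arr_Id_left[of Y X f] Comp_Zero(2)[of Y X f X] that X Y z by (auto simp: arr_def)
  then show "\<exists>!f. f \<in> Hom C Y X" using Zero_in_Hom[OF Y X] by blast
  have "f = Zero C X Y" if "f \<in> Hom C X Y" for f
    using arr_Id_right[of X Y f] Comp_Zero(1)[of X Y f X] that X Y z by (auto simp: arr_def)
  then show "\<exists>!f. f \<in> Hom C X Y" using Zero_in_Hom[OF X Y] by blast
qed

end

text \<open>\<open>R\<close> is the image of \<open>f\<close>, realized as a retract of both source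
  and target, so every morphism is von Neumann regular. \<open>size\<close> need not be invariant
  under isomorphisms; it only detects when the idempotent on the source is the identity, and this
  gives finite length.\<close>

locale split_regular_category = linear_category C
  for C :: "('o, 'm, 'k::field, 'z) lincat_scheme" (structure) +
  fixes size :: "'o \<Rightarrow> nat"
  assumes ex_zero_object: "\<exists>Z. is_zero_object C Z"
    and ex_biproduct: "\<lbrakk>X \<in> Obj C; Y \<in> Obj C\<rbrakk> \<Longrightarrow> \<exists>S i j p q. is_biproduct C X Y S i j p q"
    and regular: "\<lbrakk>X \<in> Obj C; Y \<in> Obj C; f \<in> Hom C X Y\<rbrakk> \<Longrightarrow>
      \<exists>R\<in>Obj C. \<exists>i\<in>Hom C R X. \<exists>q\<in>Hom C Y R. q \<cdot> (f \<cdot> i) = Id C R \<and> f \<cdot> (i \<cdot> (q \<cdot> f)) = f \<and>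
        size R \<le> size X \<and> (size R = size X \<longrightarrow> i \<cdot> (q \<cdot> f) = Id C X)"
begin

lemma arr_regular:
  assumes "arr X Y f"
  obtains R i q where "arr R X i" "arr Y R q" "q \<cdot> (f \<cdot> i) = Id C R" "f \<cdot> (i \<cdot> (q \<cdot> f)) = f"
    "size R \<le> size X" "size R = size X \<Longrightarrow> i \<cdot> (q \<cdot> f) = Id C X"
  using regular[of X Y f] assms unfolding arr_def by blast

text \<open>Regularity of \<open>e\<close> itself gives the splitting, with
  \<open>e \<cdot> i\<close> and \<open>q \<cdot> e\<close> as its two halves.\<close>

lemma idempotent_split:
  assumes e: "arr X X e" and ee: "e \<cdot> e = e"
  obtains R i q where "arr R X i" "arr X R q" "q \<cdot> i = Id C R" "i \<cdot> q = e"
    "size R \<le> size X" "size R = size X \<Longrightarrow> e = Id C X"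
proof -
  obtain R i q where r: "arr R X i" "arr X R q" "q \<cdot> (e \<cdot> i) = Id C R" "e \<cdot> (i \<cdot> (q \<cdot> e)) = e"
    "size R \<le> size X" "size R = size X \<Longrightarrow> i \<cdot> (q \<cdot> e) = Id C X"
    using arr_regular[OF e] by blast
  note qe = arr_Comp[OF r(2) e] and ei = arr_Comp[OF e r(1)]
  have 1: "(q \<cdot> e) \<cdot> (e \<cdot> i) = Id C R"
    using arr_assoc[OF r(2) e ei] arr_ext[OF ee e e r(1)] r(3) by simp
  have 2: "(e \<cdot> i) \<cdot> (q \<cdot> e) = e" using arr_assoc[OF e r(1) qe] r(4) by simp
  have 3: "e = Id C X" if "size R = size X"
  proof -
    note h = r(6)[OF that]
    have X: "X \<in> Obj C" using e by (rule arr_Obj)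
    have "e = (i \<cdot> (q \<cdot> e)) \<cdot> e" unfolding h using arr_Id_left[OF e] by simp
    also have "\<dots> = i \<cdot> (q \<cdot> e)" using arr_assoc[OF r(1) qe e] arr_assoc[OF r(2) e e] ee by simp
    finally show ?thesis using h by simp
  qed
  show ?thesis by (rule that[OF ei qe 1 2 r(5) 3])
qed

text \<open>One idempotent on each side of \<open>f\<close>: the complement of the first has the
  kernel of \<open>f\<close> as image, the complement of the second the cokernel.\<close>

lemma regular_idempotents:
  assumes f: "arr X Y f" and i: "arr R X i" and q: "arr Y R q"
    and qfi: "q \<cdot> (f \<cdot> i) = Id C R" and fiqf: "f \<cdot> (i \<cdot> (q \<cdot> f)) = f"
  shows "arr X X (i \<cdot> (q \<cdot> f))" "(i \<cdot> (q \<cdot> f)) \<cdot> (i \<cdot> (q \<cdot> f)) = i \<cdot> (q \<cdot> f)"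
    "arr Y Y (f \<cdot> (i \<cdot> q))" "(f \<cdot> (i \<cdot> q)) \<cdot> (f \<cdot> (i \<cdot> q)) = f \<cdot> (i \<cdot> q)" "(f \<cdot> (i \<cdot> q)) \<cdot> f = f"
proof -
  note qf = arr_Comp[OF q f] and iq = arr_Comp[OF i q]
  show e: "arr X X (i \<cdot> (q \<cdot> f))" using arr_Comp[OF i qf] .
  show e': "arr Y Y (f \<cdot> (i \<cdot> q))" using arr_Comp[OF f iq] .
  show "(i \<cdot> (q \<cdot> f)) \<cdot> (i \<cdot> (q \<cdot> f)) = i \<cdot> (q \<cdot> f)"
    using arr_assoc[OF i qf e] arr_assoc[OF q f e] fiqf by simp
  show 5: "(f \<cdot> (i \<cdot> q)) \<cdot> f = f" using arr_assoc[OF f iq f] arr_assoc[OF i q f] fiqf by simp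
  show "(f \<cdot> (i \<cdot> q)) \<cdot> (f \<cdot> (i \<cdot> q)) = f \<cdot> (i \<cdot> q)" using arr_ext[OF 5 e' f iq] .
qed

text \<open>The kernel is the split image of \<open>1 - e\<close> for \<open>e = i q f\<close>: a
  map \<open>g\<close> with \<open>f g = 0\<close> satisfies \<open>e g = 0\<close>, hence is fixed
  by \<open>1 - e\<close>.\<close>

lemma ex_kernel:
  assumes f: "arr X Y f"
  shows "\<exists>K k. is_kernel C X Y f K k"
proof -
  obtain R i q where r: "arr R X i" "arr Y R q" "q \<cdot> (f \<cdot> i) = Id C R" "f \<cdot> (i \<cdot> (q \<cdot> f)) = f"
    using arr_regular[OF f] by metis
  define e where "e = i \<cdot> (q \<cdot> f)"
  note ide = regular_idempotents(1,2)[OF f r(1-4), folded e_def]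
  note d = complement_idempotent[OF ide]
  obtain K k p where k: "arr K X k" "arr X K p" "p \<cdot> k = Id C K" "k \<cdot> p = Diff (Id C X) e"
    using idempotent_split[OF d(1,2)] by metis
  have "k = Diff (Id C X) e \<cdot> k"
    using arr_assoc[OF k(1,2,1)] k(3,4) arr_Id_right[OF k(1)] by simp
  then have "e \<cdot> k = Zero C X X \<cdot> k" using arr_ext[OF d(3) ide(1) d(1) k(1)] by simp
  then have ek: "e \<cdot> k = Zero C K X" using Comp_Zero(2)[OF k(1)] arr_Obj[OF k(1)] by simp
  have fk: "f \<cdot> k = Zero C K Y"
    using arr_assoc[OF f ide(1) k(1)] r(4)[folded e_def] ek Comp_Zero(1)[OF f] arr_Obj[OF k(1)] by simp
  have "\<exists>!h. h \<in> Hom C W K \<and> k \<cdot> h = g"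
    if W: "W \<in> Obj C" and g: "g \<in> Hom C W X" and fg: "f \<cdot> g = Zero C W Y" for W g
  proof -
    have g: "arr W X g" using W g f unfolding arr_def by blast
    have "e \<cdot> g = i \<cdot> (q \<cdot> (f \<cdot> g))"
      using arr_assoc[OF r(1) arr_Comp[OF r(2) f] g] arr_assoc[OF r(2) f g] by (simp add: e_def)
    then have "e \<cdot> g = Zero C W X" unfolding fg using Comp_Zero(1)[OF r(2) W] Comp_Zero(1)[OF r(1) W] by simp
    then have "k \<cdot> (p \<cdot> g) = g" using d(5)[OF g] arr_assoc[OF k(1,2) g] k(4) by simp
    moreover have "h = p \<cdot> g" if "h \<in> Hom C W K" "k \<cdot> h = g" for h
    proof -
      have h: "arr W K h" using that W k unfolding arr_def by blast
      show ?thesis using arr_ext[OF k(3) k(2,1) h] arr_Id_left[OF h] that(2) by simp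
    qed
    ultimately show ?thesis using arr_Obj(3)[OF arr_Comp[OF k(2) g]] by blast
  qed
  then show ?thesis unfolding is_kernel_def using fk arr_Obj[OF k(1)] by blast
qed

text \<open>Dual to the kernel, with the idempotent \<open>f i q\<close> on the target.\<close>

lemma ex_cokernel:
  assumes f: "arr X Y f"
  shows "\<exists>Q q. is_cokernel C X Y f Q q"
proof -
  obtain R i q where r: "arr R X i" "arr Y R q" "q \<cdot> (f \<cdot> i) = Id C R" "f \<cdot> (i \<cdot> (q \<cdot> f)) = f"
    using arr_regular[OF f] by metis
  define e where "e = f \<cdot> (i \<cdot> q)"
  note ide = regular_idempotents(3-5)[OF f r(1-4), folded e_def]
  note d = complement_idempotent[OF ide(1,2)]
  obtain K k p where k: "arr K Y k" "arr Y K p" "p \<cdot> k = Id C K" "k \<cdot> p = Diff (Id C Y) e"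
    using idempotent_split[OF d(1,2)] by metis
  have "p = p \<cdot> Diff (Id C Y) e"
    using arr_assoc[OF k(2,1,2)] k(3,4) arr_Id_left[OF k(2)] by simp
  then have "p \<cdot> e = p \<cdot> Zero C Y Y" using arr_assoc[OF k(2) d(1) ide(1)] d(4) by simp
  then have pe: "p \<cdot> e = Zero C Y K" using Comp_Zero(1)[OF k(2)] arr_Obj[OF k(1)] by simp
  have pf: "p \<cdot> f = Zero C X K"
    using arr_assoc[OF k(2) ide(1) f] ide(3) pe Comp_Zero(2)[OF f] arr_Obj[OF k(1)] by simp
  have "\<exists>!h. h \<in> Hom C K W \<and> h \<cdot> p = g"
    if W: "W \<in> Obj C" and g: "g \<in> Hom C Y W" and fg: "g \<cdot> f = Zero C X W" for W g
  proof -
    have g: "arr Y W g" using W g f unfolding arr_def by blast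
    have "g \<cdot> e = Zero C X W \<cdot> (i \<cdot> q)"
      using arr_ext[OF fg g f arr_Comp[OF r(1,2)]] by (simp add: e_def)
    then have "g \<cdot> e = Zero C Y W" using Comp_Zero(2)[OF arr_Comp[OF r(1,2)] W] by simp
    then have "(g \<cdot> k) \<cdot> p = g" using d(6)[OF g] arr_assoc[OF g k(1,2)] k(4) by simp
    moreover have "h = g \<cdot> k" if "h \<in> Hom C K W" "h \<cdot> p = g" for h
    proof -
      have h: "arr K W h" using that W k unfolding arr_def by blast
      show ?thesis using arr_assoc[OF h k(2,1)] k(3) arr_Id_right[OF h] that(2) by simp
    qed
    ultimately show ?thesis using arr_Obj(3)[OF arr_Comp[OF g k(1)]] by blast
  qed
  then show ?thesis unfolding is_cokernel_def using pf arr_Obj[OF k(1)] arr_Obj[OF k(2)] by blast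
qed

text \<open>In \<open>f (i q f) = f\<close> a monomorphism can be cancelled, so \<open>i q\<close>
  is a left inverse.\<close>

lemma mono_left_inverse:
  assumes m: "arr X Y m" and mono: "is_mono C X Y m"
  obtains g where "arr Y X g" "g \<cdot> m = Id C X"
proof -
  obtain R i q where r: "arr R X i" "arr Y R q" "m \<cdot> (i \<cdot> (q \<cdot> m)) = m"
    using arr_regular[OF m] by metis
  have X: "X \<in> Obj C" using m by (rule arr_Obj)
  have "m \<cdot> (i \<cdot> (q \<cdot> m)) = m \<cdot> Id C X" using r(3) arr_Id_right[OF m] by simp
  then have "i \<cdot> (q \<cdot> m) = Id C X"
    using mono X arr_Obj(3)[OF arr_Comp[OF r(1) arr_Comp[OF r(2) m]]] Id_in_Hom[OF X] unfolding is_mono_def by blast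
  then show ?thesis using that[OF arr_Comp[OF r(1,2)]] arr_assoc[OF r(1,2) m] by simp
qed

lemma epi_right_inverse:
  assumes f: "arr X Y f" and epi: "is_epi C X Y f"
  obtains g where "arr Y X g" "f \<cdot> g = Id C Y"
proof -
  obtain R i q where r: "arr R X i" "arr Y R q" "f \<cdot> (i \<cdot> (q \<cdot> f)) = f"
    using arr_regular[OF f] by metis
  have Y: "Y \<in> Obj C" using f by (rule arr_Obj)
  note iq = arr_Comp[OF r(1,2)]
  have "(f \<cdot> (i \<cdot> q)) \<cdot> f = Id C Y \<cdot> f"
    using r(3) arr_Id_left[OF f] arr_assoc[OF f iq f] arr_assoc[OF r(1,2) f] by simp
  then have "f \<cdot> (i \<cdot> q) = Id C Y"
    using epi Y arr_Obj(3)[OF arr_Comp[OF f iq]] Id_in_Hom[OF Y] unfolding is_epi_def by blast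
  then show ?thesis using that[OF iq] by simp
qed

lemma one_sided_inverse_idempotent:
  assumes m: "arr X Y m" and g: "arr Y X g" and gm: "g \<cdot> m = Id C X"
  shows "arr Y Y (m \<cdot> g)" "(m \<cdot> g) \<cdot> (m \<cdot> g) = m \<cdot> g" "(m \<cdot> g) \<cdot> m = m" "g \<cdot> (m \<cdot> g) = g"
proof -
  note mg = arr_Comp[OF m g]
  show "arr Y Y (m \<cdot> g)" by (rule mg)
  show 4: "g \<cdot> (m \<cdot> g) = g" using arr_ext[OF gm g m g] arr_Id_left[OF g] by simp
  show "(m \<cdot> g) \<cdot> (m \<cdot> g) = m \<cdot> g" using arr_assoc[OF m g mg] 4 by simp
  show "(m \<cdot> g) \<cdot> m = m" using arr_assoc[OF m g m] gm arr_Id_right[OF m] by simp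
qed

text \<open>A monomorphism \<open>f\<close> with left inverse \<open>g\<close> is a kernel of
  \<open>1 - f g\<close>, and an epimorphism \<open>f\<close> with right inverse \<open>g\<close> is
  a cokernel of \<open>1 - g f\<close>.\<close>

sublocale abelian_linear_category C
proof
  show "\<exists>Z. is_zero_object C Z" by (rule ex_zero_object)
  fix X Y assume XY: "X \<in> Obj C" "Y \<in> Obj C"
  show "\<exists>S i j p q. is_biproduct C X Y S i j p q" using XY by (rule ex_biproduct)
  fix f
  show "f \<in> Hom C X Y \<Longrightarrow> \<exists>K k. is_kernel C X Y f K k"
    using ex_kernel XY unfolding arr_def by blast
  show "f \<in> Hom C X Y \<Longrightarrow> \<exists>Q q. is_cokernel C X Y f Q q"
    using ex_cokernel XY unfolding arr_def by blast
  show "\<exists>Z g. Z \<in> Obj C \<and> g \<in> Hom C Y Z \<and> is_kernel C Y Z g X f" if mono: "is_mono C X Y f"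
  proof -
    have f: "arr X Y f" using mono XY unfolding is_mono_def arr_def by blast
    obtain g where g: "arr Y X g" "g \<cdot> f = Id C X" using mono_left_inverse[OF f mono] .
    note e = one_sided_inverse_idempotent[OF f g]
    note d = complement_idempotent[OF e(1,2)]
    define c where "c = Diff (Id C Y) (f \<cdot> g)"
    note d = d[folded c_def]
    have "c \<cdot> f = (c \<cdot> (f \<cdot> g)) \<cdot> f" using arr_assoc[OF d(1) e(1) f] e(3) by simp
    then have cf: "c \<cdot> f = Zero C X Y" using d(4) Comp_Zero(2)[OF f] XY by simp
    have "\<exists>!h. h \<in> Hom C W X \<and> f \<cdot> h = k"
      if W: "W \<in> Obj C" and k: "k \<in> Hom C W Y" and ck: "c \<cdot> k = Zero C W Y" for W k
    proof -
      have k: "arr W Y k" using W k XY unfolding arr_def by blast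
      have "f \<cdot> (g \<cdot> k) = k" using d(7)[OF k ck] arr_assoc[OF f g(1) k] by simp
      moreover have "h = g \<cdot> k" if "h \<in> Hom C W X" "f \<cdot> h = k" for h
      proof -
        have h: "arr W X h" using that W XY unfolding arr_def by blast
        show ?thesis using arr_ext[OF g(2,1) f h] arr_Id_left[OF h] that(2) by simp
      qed
      ultimately show ?thesis using arr_Obj(3)[OF arr_Comp[OF g(1) k]] by blast
    qed
    then show ?thesis unfolding is_kernel_def using cf arr_Obj[OF f] arr_Obj[OF d(1)] by blast
  qed
  show "\<exists>W g. W \<in> Obj C \<and> g \<in> Hom C W X \<and> is_cokernel C W X g Y f" if epi: "is_epi C X Y f"
  proof -
    have f: "arr X Y f" using epi XY unfolding is_epi_def arr_def by blast
    obtain g where g: "arr Y X g" "f \<cdot> g = Id C Y" using epi_right_inverse[OF f epi] .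
    note e = one_sided_inverse_idempotent[OF g(1) f g(2)]
    note d = complement_idempotent[OF e(1,2)]
    define c where "c = Diff (Id C X) (g \<cdot> f)"
    note d = d[folded c_def]
    have "f \<cdot> c = f \<cdot> ((g \<cdot> f) \<cdot> c)" using arr_ext[OF e(4) f e(1) d(1)] by simp
    then have cf: "f \<cdot> c = Zero C X Y" using d(3) Comp_Zero(1)[OF f] XY by simp
    have "\<exists>!h. h \<in> Hom C Y W \<and> h \<cdot> f = k"
      if W: "W \<in> Obj C" and k: "k \<in> Hom C X W" and ck: "k \<cdot> c = Zero C X W" for W k
    proof -
      have k: "arr X W k" using W k XY unfolding arr_def by blast
      have "(k \<cdot> g) \<cdot> f = k" using d(8)[OF k ck] arr_assoc[OF k g(1) f] by simp
      moreover have "h = k \<cdot> g" if "h \<in> Hom C Y W" "h \<cdot> f = k" for h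
      proof -
        have h: "arr Y W h" using that W XY unfolding arr_def by blast
        show ?thesis using arr_assoc[OF h f g(1)] arr_Id_right[OF h] that(2) g(2) by simp
      qed
      ultimately show ?thesis using arr_Obj(3)[OF arr_Comp[OF k g(1)]] by blast
    qed
    then show ?thesis unfolding is_cokernel_def using cf arr_Obj[OF f] arr_Obj[OF d(1)] by blast
  qed
qed

lemma zero_object_Id: "is_zero_object C X \<Longrightarrow> Id C X = Zero C X X"
  unfolding is_zero_object_def using Id_in_Hom Zero_in_Hom by blast

definition retract :: "'o \<Rightarrow> 'o \<Rightarrow> bool" where
  "retract R X \<longleftrightarrow> (\<exists>i q. arr R X i \<and> arr X R q \<and> q \<cdot> i = Id C R)"

lemma retract_refl: "X \<in> Obj C \<Longrightarrow> retract X X"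
  unfolding retract_def using arr_Id arr_Id_left by blast

lemma retract_trans:
  assumes "retract X Y" "retract Y Z"
  shows "retract X Z"
proof -
  obtain i q where a: "arr X Y i" "arr Y X q" "q \<cdot> i = Id C X" using assms(1) unfolding retract_def by blast
  obtain j p where b: "arr Y Z j" "arr Z Y p" "p \<cdot> j = Id C Y" using assms(2) unfolding retract_def by blast
  have "(q \<cdot> p) \<cdot> (j \<cdot> i) = Id C X"
    using arr_assoc[OF a(2) b(2) arr_Comp[OF b(1) a(1)]] arr_ext[OF b(3,2,1) a(1)] arr_Id_left[OF a(1)] a(3)
    by simp
  then show ?thesis unfolding retract_def using arr_Comp[OF b(1) a(1)] arr_Comp[OF a(2) b(2)] by blast
qed

text \<open>A nonzero retract of minimal size is simple: every nonzero subobject splits off, and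
  minimality forces the idempotent belonging to it to be the identity.\<close>

lemma ex_simple_retract:
  assumes X: "X \<in> Obj C" and nz: "\<not> is_zero_object C X"
  obtains S where "is_simple C S" "retract S X"
proof -
  define P where "P S \<longleftrightarrow> retract S X \<and> \<not> is_zero_object C S" for S
  have "P X" unfolding P_def using retract_refl[OF X] nz by blast
  then obtain S where PS: "P S" and min: "\<And>T. P T \<Longrightarrow> size S \<le> size T"
    using ex_has_least_nat[of P X size] by blast
  have S: "S \<in> Obj C" using PS unfolding P_def retract_def using arr_Obj by blast
  have "is_zero_object C Y \<or> is_iso C Y S m" if Y: "Y \<in> Obj C" and mono: "is_mono C Y S m" for Y m
  proof (cases "is_zero_object C Y")
    case False
    have m: "arr Y S m" using mono Y S unfolding is_mono_def arr_def by blast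
    obtain g where g: "arr S Y g" "g \<cdot> m = Id C Y" using mono_left_inverse[OF m mono] .
    note e = one_sided_inverse_idempotent[OF m g]
    \<comment> \<open>The subobject \<open>Y\<close> may have any size. The comparison is made with
      a splitting \<open>R\<close> of the idempotent \<open>m \<cdot> g\<close>, whose size is
      bounded by that of \<open>S\<close>.\<close>
    obtain R i q where r: "arr R S i" "arr S R q" "q \<cdot> i = Id C R" "i \<cdot> q = m \<cdot> g"
      "size R \<le> size S" "size R = size S \<Longrightarrow> m \<cdot> g = Id C S"
      using idempotent_split[OF e(1,2)] by metis
    have "\<not> is_zero_object C R"
    proof
      assume z: "is_zero_object C R"
      have R: "R \<in> Obj C" using r(1) by (rule arr_Obj)
      have "i = Zero C R S"
        using arr_Id_right[OF r(1)] zero_object_Id[OF z] Comp_Zero(1)[OF r(1) R] by simp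
      then have "m \<cdot> g = Zero C S S" using r(4) Comp_Zero(2)[OF r(2) S] by simp
      then have "m = Zero C Y S" using e(3) Comp_Zero(2)[OF m S] by simp
      then have "Id C Y = Zero C Y Y" using g(2) Comp_Zero(1)[OF g(1) Y] by simp
      then show False using zero_object_if_Id_Zero[OF Y] False by blast
    qed
    moreover have "retract R X" using PS r(1-3) retract_trans[of R S X] unfolding P_def retract_def[of R S] by blast
    ultimately have "size S \<le> size R" using min unfolding P_def by blast
    then have "m \<cdot> g = Id C S" using r(5,6) by simp
    then have "inverse_mor C Y S m g" unfolding inverse_mor_def using g arr_Obj[OF m] arr_Obj[OF g(1)] by blast
    then show ?thesis unfolding is_iso_def by blast
  qed blast
  then have "is_simple C S" unfolding is_simple_def using S PS unfolding P_def by blast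
  then show ?thesis using that PS unfolding P_def by blast
qed

text \<open>Splitting off a simple retract \<open>S\<close> leaves a complement \<open>R\<close> of
  strictly smaller size, and \<open>S\<close> is the cokernel of the inclusion of
  \<open>R\<close>.\<close>

lemma ex_finite_length: "X \<in> Obj C \<Longrightarrow> finite_length C X"
proof (induction "size X" arbitrary: X rule: less_induct)
  case less
  show ?case
  proof (cases "is_zero_object C X")
    case True then show ?thesis by (rule finite_length.zero)
  next
    case False
    obtain S where S: "is_simple C S" "retract S X" using ex_simple_retract[OF less.prems False] .
    obtain i q where iq: "arr S X i" "arr X S q" "q \<cdot> i = Id C S" using S(2) unfolding retract_def by blast
    note e = one_sided_inverse_idempotent[OF iq]
    note d = complement_idempotent[OF e(1,2)]
    have SO: "S \<in> Obj C" using iq(1) by (rule arr_Obj)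
    obtain R k p where r: "arr R X k" "arr X R p" "p \<cdot> k = Id C R" "k \<cdot> p = Diff (Id C X) (i \<cdot> q)"
      "size R \<le> size X" "size R = size X \<Longrightarrow> Diff (Id C X) (i \<cdot> q) = Id C X"
      using idempotent_split[OF d(1,2)] by metis
    have "size R \<noteq> size X"
    proof
      assume "size R = size X"
      then have "i \<cdot> q = Zero C X X" using r(6) d(4) arr_Id_left[OF e(1)] by simp
      then have "i = Zero C S X" using e(3) Comp_Zero(2)[OF iq(1) less.prems] by simp
      then have "Id C S = Zero C S S" using iq(3) Comp_Zero(1)[OF iq(2) SO] by simp
      then show False using zero_object_if_Id_Zero[OF SO] S(1) unfolding is_simple_def by blast
    qed
    then have "finite_length C R" using less.hyps r(5) arr_Obj[OF r(1)] by simp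
    moreover have "is_mono C R X k" using split_mono[OF r(1-3)] .
    moreover have "is_cokernel C R X k S q"
      unfolding is_cokernel_def
    proof (intro conjI ballI impI)
      have R: "R \<in> Obj C" using r(1) by (rule arr_Obj)
      have qd: "q \<cdot> Diff (Id C X) (i \<cdot> q) = Zero C X S"
        using Comp_Diff[OF iq(2) arr_Id[OF less.prems] e(1)] arr_Id_right[OF iq(2)] e(4) Diff_self[OF iq(2)] by simp
      have "q \<cdot> k = (q \<cdot> Diff (Id C X) (i \<cdot> q)) \<cdot> k"
        using arr_assoc[OF iq(2) d(1) r(1)] arr_assoc[OF r(1,2,1)] r(3,4) arr_Id_right[OF r(1)] by simp
      then show "q \<cdot> k = Zero C R S" using qd Comp_Zero(2)[OF r(1) SO] by simp
      fix W g assume W: "W \<in> Obj C" and g: "g \<in> Hom C X W" and gk: "g \<cdot> k = Zero C R W"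
      have g: "arr X W g" using W g less.prems unfolding arr_def by blast
      have "g \<cdot> Diff (Id C X) (i \<cdot> q) = Zero C X W"
        using arr_ext[OF gk g r(1,2)] r(4) Comp_Zero(2)[OF r(2) W] by simp
      then have "(g \<cdot> i) \<cdot> q = g" using d(8)[OF g] arr_assoc[OF g iq(1,2)] by simp
      moreover have "h = g \<cdot> i" if "h \<in> Hom C S W" "h \<cdot> q = g" for h
      proof -
        have h: "arr S W h" using that W SO unfolding arr_def by blast
        show ?thesis using arr_assoc[OF h iq(2,1)] iq(3) arr_Id_right[OF h] that(2) by simp
      qed
      ultimately show "\<exists>!h. h \<in> Hom C S W \<and> h \<cdot> q = g" using arr_Obj(3)[OF arr_Comp[OF g iq(1)]] by blast
    qed (use SO arr_Obj[OF iq(2)] in auto)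
    ultimately show ?thesis using finite_length.extend[of C R X k S q] less.prems S(1) by simp
  qed
qed

end


subsection \<open>Quotients by sums of images\<close>

context abelian_linear_category
begin

lemma kernel_mono:
  assumes f: "arr X Y f" and k: "is_kernel C X Y f K k"
  shows "is_mono C K X k"
  unfolding is_mono_def
proof (intro conjI ballI impI)
  show "k \<in> Hom C K X" using k unfolding is_kernel_def by blast
  fix W g h assume W: "W \<in> Obj C" and g: "g \<in> Hom C W K" and h: "h \<in> Hom C W K" and eq: "k \<cdot> g = k \<cdot> h"
  have K: "arr K X k" using k f unfolding is_kernel_def arr_def by blast
  have ga: "arr W K g" using W g K unfolding arr_def by blast
  have "f \<cdot> (k \<cdot> g) = Zero C W Y"
    using arr_ext[OF _ f K ga, of "Zero C K Y"] k Comp_Zero(2)[OF ga] arr_Obj[OF f] unfolding is_kernel_def by simp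
  then have "\<exists>!h. h \<in> Hom C W K \<and> k \<cdot> h = k \<cdot> g"
    using k W arr_Obj(3)[OF arr_Comp[OF K ga]] unfolding is_kernel_def by blast
  then show "g = h" using g h eq by metis
qed

text \<open>All members of \<open>F\<close> factor through the kernel of \<open>s\<close>; by
  minimality the sum of their images does too.\<close>

lemma image_sum_killed:
  assumes s: "arr T U s"
    and F: "\<And>V f. (V, f) \<in> F \<Longrightarrow> arr V T f \<and> s \<cdot> f = Zero C V U"
    and J: "is_image_sum C T F J m"
  shows "s \<cdot> m = Zero C J U"
proof -
  have T: "T \<in> Obj C" "U \<in> Obj C" using s by (auto dest: arr_Obj)
  have Jo: "J \<in> Obj C" using J unfolding is_image_sum_def by blast
  obtain K k where k: "is_kernel C T U s K k" using kernel_exists[of T U s] s unfolding arr_def by blast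
  have K: "arr K T k" using k T unfolding is_kernel_def arr_def by blast
  have sk: "s \<cdot> k = Zero C K U" using k unfolding is_kernel_def by blast
  have "factors_through C V f K k" if "(V, f) \<in> F" for V f
    using k F[OF that] unfolding is_kernel_def factors_through_def arr_def by blast
  then have "factors_through C J m K k"
    using J kernel_mono[OF s k] arr_Obj[OF K] unfolding is_image_sum_def by blast
  then obtain h where h: "arr J K h" "m = k \<cdot> h"
    using Jo arr_Obj[OF K] unfolding factors_through_def arr_def by blast
  show ?thesis unfolding h(2) using arr_ext[OF sk s K h(1)] Comp_Zero(2)[OF h(1) T(2)] by simp
qed

text \<open>\<open>F\<close> and \<open>G\<close> say that \<open>s\<close> is a projection along
  the sum of the images. Applied to the cokernel map, \<open>G\<close> gives \<open>q s = q\<close>,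
  which identifies any cokernel, for any choice of \<open>J\<close>, with the image of
  \<open>s\<close>.\<close>

lemma cokernel_splits_idempotent:
  assumes s: "arr T T s"
    and F: "\<And>V f. (V, f) \<in> F \<Longrightarrow> arr V T f \<and> s \<cdot> f = Zero C V T"
    and G: "\<And>W g. \<lbrakk>arr T W g; \<And>V f. (V, f) \<in> F \<Longrightarrow> g \<cdot> f = Zero C V W\<rbrakk> \<Longrightarrow> g \<cdot> s = g"
    and J: "is_image_sum C T F J m" and Q: "is_cokernel C J T m Q q"
  shows "\<exists>u. arr Q T u \<and> arr T Q q \<and> q \<cdot> u = Id C Q \<and> u \<cdot> q = s"
proof -
  have T: "T \<in> Obj C" using s by (rule arr_Obj)
  have Jo: "J \<in> Obj C" using J unfolding is_image_sum_def by blast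
  have m: "arr J T m" using J T unfolding is_image_sum_def is_mono_def arr_def by blast
  have q: "arr T Q q" using Q T unfolding is_cokernel_def arr_def by blast
  have Qo: "Q \<in> Obj C" using q by (rule arr_Obj)
  have qm: "q \<cdot> m = Zero C J Q" using Q unfolding is_cokernel_def by blast
  have "s \<cdot> m = Zero C J T" by (rule image_sum_killed[OF s F J])
  then obtain u where u: "u \<in> Hom C Q T" "u \<cdot> q = s" using Q T s unfolding is_cokernel_def arr_def by blast
  have ua: "arr Q T u" using u T Qo unfolding arr_def by blast
  have "q \<cdot> f = Zero C V Q" if Vf: "(V, f) \<in> F" for V f
  proof -
    obtain h where h: "h \<in> Hom C V J" "f = m \<cdot> h"
      using J Vf unfolding is_image_sum_def factors_through_def by blast
    have ha: "arr V J h" using h F[OF Vf] Jo unfolding arr_def by blast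
    show ?thesis unfolding h(2) using arr_ext[OF qm q m ha] Comp_Zero(2)[OF ha Qo] by simp
  qed
  then have qs: "q \<cdot> s = q" using G[OF q] by blast
  have "(q \<cdot> u) \<cdot> q = q" using arr_assoc[OF q ua q] u(2) qs by simp
  moreover have "Id C Q \<cdot> q = q" using arr_Id_left[OF q] .
  moreover have "\<exists>!h. h \<in> Hom C Q Q \<and> h \<cdot> q = q"
    using Q Qo qm arr_Obj[OF q] unfolding is_cokernel_def by blast
  ultimately have "q \<cdot> u = Id C Q" using arr_Obj(3)[OF arr_Comp[OF q ua]] Id_in_Hom[OF Qo] by blast
  then show ?thesis using ua q u(2) by blast
qed

end

context split_regular_category
begin

text \<open>The sum of images is the split image of \<open>1 - s\<close>. For minimality, a
  competing subobject is the kernel of some \<open>g\<close>; this \<open>g\<close> kills the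
  family, so \<open>g = g s\<close>, and hence it kills the image of \<open>1 - s\<close>.\<close>

lemma ex_image_sum_cokernel:
  assumes s: "arr T T s"
    and F: "\<And>V f. (V, f) \<in> F \<Longrightarrow> arr V T f \<and> s \<cdot> f = Zero C V T"
    and G: "\<And>W g. \<lbrakk>arr T W g; \<And>V f. (V, f) \<in> F \<Longrightarrow> g \<cdot> f = Zero C V W\<rbrakk> \<Longrightarrow> g \<cdot> s = g"
  shows "\<exists>J m Q q. is_image_sum C T F J m \<and> is_cokernel C J T m Q q"
proof -
  have T: "T \<in> Obj C" using s by (rule arr_Obj)
  have ss: "s \<cdot> s = s" using G[OF s] F by blast
  note d = complement_idempotent[OF s ss]
  obtain J m p where m: "arr J T m" "arr T J p" "p \<cdot> m = Id C J" "m \<cdot> p = Diff (Id C T) s"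
    using idempotent_split[OF d(1,2)] by metis
  have J: "J \<in> Obj C" using m(1) by (rule arr_Obj)
  have sm: "s \<cdot> m = Zero C J T"
  proof -
    have "s \<cdot> m = (s \<cdot> Diff (Id C T) s) \<cdot> m"
      using arr_assoc[OF s d(1) m(1)] arr_assoc[OF m(1,2,1)] m(3,4) arr_Id_right[OF m(1)] by simp
    then show ?thesis using d(3) Comp_Zero(2)[OF m(1) T] by simp
  qed
  have "is_image_sum C T F J m"
    unfolding is_image_sum_def
  proof (intro conjI ballI allI impI)
    show "is_mono C J T m" by (rule split_mono[OF m(1-3)])
    fix x assume "x \<in> F"
    then obtain V f where x: "x = (V, f)" and Vf: "(V, f) \<in> F" by (cases x) auto
    have f: "arr V T f" and sf: "s \<cdot> f = Zero C V T" using F[OF Vf] by auto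
    have "f = m \<cdot> (p \<cdot> f)" using d(5)[OF f sf] arr_assoc[OF m(1,2) f] m(4) by simp
    then show "case x of (W, f) \<Rightarrow> factors_through C W f J m"
      unfolding x factors_through_def using arr_Obj(3)[OF arr_Comp[OF m(2) f]] by auto
  next
    fix J' m' assume J': "J' \<in> Obj C" and a: "is_mono C J' T m' \<and> (\<forall>(W, f)\<in>F. factors_through C W f J' m')"
    obtain Z g where g: "Z \<in> Obj C" "g \<in> Hom C T Z" "is_kernel C T Z g J' m'"
      using mono_is_kernel[OF J' T] a by blast
    have ga: "arr T Z g" using g T unfolding arr_def by blast
    have m': "arr J' T m'" using a J' T unfolding is_mono_def arr_def by blast
    have gm': "g \<cdot> m' = Zero C J' Z" using g(3) unfolding is_kernel_def by blast
    have "g \<cdot> f = Zero C V Z" if Vf: "(V, f) \<in> F" for V f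
    proof -
      obtain h where h: "h \<in> Hom C V J'" "f = m' \<cdot> h" using a Vf unfolding factors_through_def by blast
      have ha: "arr V J' h" using h F[OF Vf] J' unfolding arr_def by blast
      show ?thesis unfolding h(2) using arr_ext[OF gm' ga m' ha] Comp_Zero(2)[OF ha g(1)] by simp
    qed
    then have "g \<cdot> s = g" using G[OF ga] by blast
    then have "g \<cdot> m = Zero C J Z" using arr_assoc[OF ga s m(1)] sm Comp_Zero(1)[OF ga J] by simp
    then show "factors_through C J m J' m'"
      using g(3) J arr_Obj[OF m(1)] unfolding is_kernel_def factors_through_def by blast
  qed (use J in auto)
  moreover obtain Q q where "is_cokernel C J T m Q q" using ex_cokernel[OF m(1)] by blast
  ultimately show ?thesis by blast
qed

end


section \<open>Kronecker products\<close>

text \<open>The index \<open>i * m + k\<close> stands for the tensor product of the i-th and the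
  k-th basis vector. With this lexicographic order associativity is an equality of matrices.\<close>

definition kron :: "'a::semiring_0 mat \<Rightarrow> 'a mat \<Rightarrow> 'a mat" where
  "kron A B = mat (dim_row A * dim_row B) (dim_col A * dim_col B)
     (\<lambda>(i, j). A $$ (i div dim_row B, j div dim_col B) * B $$ (i mod dim_row B, j mod dim_col B))"

lemma kron_dim [simp]: "dim_row (kron A B) = dim_row A * dim_row B" "dim_col (kron A B) = dim_col A * dim_col B"
  by (auto simp: kron_def)

lemma kron_index:
  "\<lbrakk>i < dim_row A * dim_row B; j < dim_col A * dim_col B\<rbrakk> \<Longrightarrow> kron A B $$ (i, j) =
    A $$ (i div dim_row B, j div dim_col B) * B $$ (i mod dim_row B, j mod dim_col B)"
  by (simp add: kron_def)

lemma kron_pair: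
  assumes "i < dim_row A" "k < r" "j < dim_col A" "l < c" "dim_row B = r" "dim_col B = c"
  shows "kron A B $$ (i * r + k, j * c + l) = A $$ (i, j) * B $$ (k, l)"
  using assms by (subst kron_index) (auto simp: pair_index_less)

lemma sum_pair: "(\<Sum>k<n * m. f k) = (\<Sum>i<n. \<Sum>j<m. f (i * m + j :: nat) :: 'a::comm_monoid_add)"
proof (induction n)
  case (Suc n)
  have "{..<Suc n * m} = {..<n * m} \<union> (\<lambda>j. n * m + j) ` {..<m}"
  proof (intro equalityI subsetI)
    fix x assume "x \<in> {..<Suc n * m}"
    then show "x \<in> {..<n * m} \<union> (\<lambda>j. n * m + j) ` {..<m}"
      by (cases "x < n * m") (auto intro!: image_eqI[of _ _ "x - n * m"])
  qed auto
  then have "(\<Sum>k<Suc n * m. f k) = (\<Sum>k\<in>{..<n * m} \<union> (\<lambda>j. n * m + j) ` {..<m}. f k)" by (rule arg_cong)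
  also have "\<dots> = (\<Sum>k<n * m. f k) + (\<Sum>k\<in>(\<lambda>j. n * m + j) ` {..<m}. f k)"
    by (rule sum.union_disjoint) auto
  also have "(\<Sum>k\<in>(\<lambda>j. n * m + j) ` {..<m}. f k) = (\<Sum>j<m. f (n * m + j))"
    by (subst sum.reindex) auto
  finally show ?case using Suc by simp
qed simp

lemma delta_sums:
  fixes g :: "nat \<Rightarrow> 'a::semiring_1"
  shows "(\<Sum>y<n. (if x = y then 1 else 0) * g y) = (if x < n then g x else 0)"
    "(\<Sum>y<n. (if y = x then 1 else 0) * g y) = (if x < n then g x else 0)"
    "(\<Sum>y<n. g y * (if x = y then 1 else 0)) = (if x < n then g x else 0)"
    "(\<Sum>y<n. g y * (if y = x then 1 else 0)) = (if x < n then g x else 0)"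
  by (simp_all add: if_distrib[of "\<lambda>z. _ * z"] if_distrib[of "\<lambda>z. z * _"] cong: if_cong)

lemma eq_mat_pairI:
  assumes "A \<in> carrier_mat (a * b) (c * d)" "B \<in> carrier_mat (a * b) (c * d)"
    and "\<And>i k j l. \<lbrakk>i < a; k < b; j < c; l < d\<rbrakk> \<Longrightarrow> A $$ (i * b + k, j * d + l) = B $$ (i * b + k, j * d + l)"
  shows "A = B"
proof (rule eq_matI)
  fix x y assume xy: "x < dim_row B" "y < dim_col B"
  then have "x < a * b" "y < c * d" using assms by auto
  then have "b > 0" "d > 0" "x div b < a" "y div d < c"
    by (auto simp: less_mult_imp_div_less) (use not_gr_zero in fastforce)+
  then have "A $$ ((x div b) * b + x mod b, (y div d) * d + y mod d) = B $$ ((x div b) * b + x mod b, (y div d) * d + y mod d)"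
    by (intro assms(3)) auto
  then show "A $$ (x, y) = B $$ (x, y)" by simp
qed (use assms in auto)

lemma kron_mult:
  fixes A B :: "'a::comm_semiring_0 mat"
  assumes "dim_col A = dim_row C" "dim_col B = dim_row D"
  shows "kron A B * kron C D = kron (A * C) (B * D)"
proof (rule eq_mat_pairI[of _ "dim_row A" "dim_row B" "dim_col C" "dim_col D"])
  fix i k j l assume b: "i < dim_row A" "k < dim_row B" "j < dim_col C" "l < dim_col D"
  have "(kron A B * kron C D) $$ (i * dim_row B + k, j * dim_col D + l) =
      (\<Sum>x<dim_row C. \<Sum>y<dim_row D. (A $$ (i, x) * B $$ (k, y)) * (C $$ (x, j) * D $$ (y, l)))"
    using assms b by (subst mult_index) (auto simp: pair_index_less sum_pair kron_pair intro!: sum.cong)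
  also have "\<dots> = (\<Sum>x<dim_row C. A $$ (i, x) * C $$ (x, j)) * (\<Sum>y<dim_row D. B $$ (k, y) * D $$ (y, l))"
    by (simp add: sum_product mult_ac)
  also have "\<dots> = kron (A * C) (B * D) $$ (i * dim_row B + k, j * dim_col D + l)"
    using assms b by (subst kron_pair) (auto simp: mult_index simp del: index_mult_mat(1))
  finally show "(kron A B * kron C D) $$ (i * dim_row B + k, j * dim_col D + l) =
    kron (A * C) (B * D) $$ (i * dim_row B + k, j * dim_col D + l)" .
qed auto

text \<open>Either bracketing extracts the same three mixed-radix digits from an index.\<close>

lemma kron_assoc: "kron (kron A B) C = kron A (kron B (C :: 'a::comm_semiring_0 mat))"
proof (rule eq_matI)
  fix i j assume "i < dim_row (kron A (kron B C))" "j < dim_col (kron A (kron B C))"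
  then have ij: "i < dim_row A * dim_row B * dim_row C" "j < dim_col A * dim_col B * dim_col C"
    by (simp_all add: mult_ac)
  have *: "(x div c) div b = x div (b * c)" "(x div c) mod b = (x mod (b * c)) div c"
      "(x mod (b * c)) mod c = x mod c" "x div c < a * b" "x mod (b * c) < b * c"
    if "x < a * b * (c :: nat)" for x a b c
  proof -
    have pos: "c > 0" "b > 0" using that by (auto intro: gr0I)
    show "(x div c) div b = x div (b * c)" by (metis div_mult2_eq mult.commute)
    show "(x div c) mod b = (x mod (b * c)) div c" using pos by (simp add: mult.commute[of b] mod_mult2_eq)
    show "(x mod (b * c)) mod c = x mod c" by (simp add: mod_mod_cancel)
    show "x div c < a * b" using that by (simp add: less_mult_imp_div_less)
    show "x mod (b * c) < b * c" using pos by simp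
  qed
  show "kron (kron A B) C $$ (i, j) = kron A (kron B C) $$ (i, j)"
    using ij *[OF ij(1)] *[OF ij(2)] by (simp add: kron_index mult_ac)
qed (simp_all add: mult_ac)

lemma kron_one [simp]: "kron (1\<^sub>m n) (1\<^sub>m m) = (1\<^sub>m (n * m) :: 'a::semiring_1 mat)"
proof (rule eq_mat_pairI[of _ n m n m])
  fix i k j l assume b: "i < n" "k < m" "j < n" "l < m"
  have "i = j \<and> k = l" if "i * m + k = j * m + l"
    using arg_cong[OF that, of "\<lambda>x. x div m"] arg_cong[OF that, of "\<lambda>x. x mod m"] b by simp
  then show "kron (1\<^sub>m n) (1\<^sub>m m) $$ (i * m + k, j * m + l) = (1\<^sub>m (n * m) :: 'a mat) $$ (i * m + k, j * m + l)"
    using b by (subst kron_pair) (auto simp: pair_index_less)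
qed auto

lemma kron_unit [simp]: "kron (1\<^sub>m 1) A = A" "kron A (1\<^sub>m 1) = (A :: 'a::semiring_1 mat)"
  by (auto intro!: eq_matI simp: kron_index)

lemma kron_add:
  fixes A B C :: "'a::comm_semiring_0 mat"
  shows "\<lbrakk>dim_row A = dim_row B; dim_col A = dim_col B\<rbrakk> \<Longrightarrow> kron (A + B) C = kron A C + kron B C"
    "\<lbrakk>dim_row A = dim_row B; dim_col A = dim_col B\<rbrakk> \<Longrightarrow> kron C (A + B) = kron C A + kron C B"
proof -
  assume d: "dim_row A = dim_row B" "dim_col A = dim_col B"
  show "kron (A + B) C = kron A C + kron B C"
    using d by (intro eq_mat_pairI[of _ "dim_row B" "dim_row C" "dim_col B" "dim_col C"])
      (auto simp: kron_pair pair_index_less distrib_left distrib_right)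
  show "kron C (A + B) = kron C A + kron C B"
    using d by (intro eq_mat_pairI[of _ "dim_row C" "dim_row B" "dim_col C" "dim_col B"])
      (auto simp: kron_pair pair_index_less distrib_left distrib_right)
qed

lemma kron_smult:
  fixes A B :: "'a::comm_semiring_0 mat"
  shows "kron (c \<cdot>\<^sub>m A) B = c \<cdot>\<^sub>m kron A B" "kron A (c \<cdot>\<^sub>m B) = c \<cdot>\<^sub>m kron A B"
proof -
  show "kron (c \<cdot>\<^sub>m A) B = c \<cdot>\<^sub>m kron A B"
    by (rule eq_mat_pairI[of _ "dim_row A" "dim_row B" "dim_col A" "dim_col B"])
      (auto simp: kron_pair pair_index_less mult_ac)
  show "kron A (c \<cdot>\<^sub>m B) = c \<cdot>\<^sub>m kron A B"
    by (rule eq_mat_pairI[of _ "dim_row A" "dim_row B" "dim_col A" "dim_col B"])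
      (auto simp: kron_pair pair_index_less mult_ac)
qed

lemma kron_zero [simp]:
  fixes A :: "'a::comm_semiring_0 mat"
  shows "kron (0\<^sub>m n m) A = 0\<^sub>m (n * dim_row A) (m * dim_col A)"
    "kron A (0\<^sub>m n m) = 0\<^sub>m (dim_row A * n) (dim_col A * m)"
proof -
  show "kron (0\<^sub>m n m) A = 0\<^sub>m (n * dim_row A) (m * dim_col A)"
    by (rule eq_mat_pairI[of _ n "dim_row A" m "dim_col A"]) (auto simp: kron_pair pair_index_less)
  show "kron A (0\<^sub>m n m) = 0\<^sub>m (dim_row A * n) (dim_col A * m)"
    by (rule eq_mat_pairI[of _ "dim_row A" n "dim_col A" m]) (auto simp: kron_pair pair_index_less)
qed


subsection \<open>The partial trace\<close>

text \<open>The trace over a last tensor factor of size m of a map from size \<open>b * m\<close> to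
  size \<open>a * m\<close>.\<close>

definition ptr :: "nat \<Rightarrow> nat \<Rightarrow> nat \<Rightarrow> 'a::comm_monoid_add mat \<Rightarrow> 'a mat" where
  "ptr a b m M = mat a b (\<lambda>(i, j). \<Sum>k<m. M $$ (i * m + k, j * m + k))"

lemma ptr_dim [simp]: "dim_row (ptr a b m M) = a" "dim_col (ptr a b m M) = b"
  by (simp_all add: ptr_def)

lemma mult_kron_pair:
  fixes M A B :: "'a::comm_semiring_1 mat"
  assumes "dim_col M = dim_row A * dim_row B" "r < dim_row M" "j < dim_col A" "k < c" "c = dim_col B"
  shows "(M * kron A B) $$ (r, j * c + k) =
    (\<Sum>x<dim_row A. \<Sum>y<dim_row B. M $$ (r, x * dim_row B + y) * (A $$ (x, j) * B $$ (y, k)))"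
  using assms by (subst mult_index) (auto simp: sum_pair kron_pair pair_index_less intro!: sum.cong)

lemma kron_mult_pair:
  fixes M A B :: "'a::comm_semiring_1 mat"
  assumes "dim_row M = dim_col A * dim_col B" "c < dim_col M" "i < dim_row A" "k < r" "r = dim_row B"
  shows "(kron A B * M) $$ (i * r + k, c) =
    (\<Sum>x<dim_col A. \<Sum>y<dim_col B. A $$ (i, x) * B $$ (k, y) * M $$ (x * dim_col B + y, c))"
  using assms by (subst mult_index) (auto simp: sum_pair kron_pair pair_index_less intro!: sum.cong)

lemma ptr_mult_right:
  fixes M A :: "'a::comm_semiring_1 mat"
  assumes "M \<in> carrier_mat (a * m) (b * m)" "A \<in> carrier_mat b c"
  shows "ptr a c m (M * kron A (1\<^sub>m m)) = ptr a b m M * A"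
proof (rule eq_matI)
  fix i j assume "i < dim_row (ptr a b m M * A)" "j < dim_col (ptr a b m M * A)"
  then have ij: "i < a" "j < c" using assms by auto
  have "ptr a c m (M * kron A (1\<^sub>m m)) $$ (i, j) = (\<Sum>k<m. \<Sum>x<b. \<Sum>y<m. M $$ (i * m + k, x * m + y) * (A $$ (x, j) * 1\<^sub>m m $$ (y, k)))"
    using ij assms by (auto simp: ptr_def mult_kron_pair pair_index_less simp del: index_mult_mat(1) intro!: sum.cong)
  also have "\<dots> = (\<Sum>k<m. \<Sum>x<b. M $$ (i * m + k, x * m + k) * A $$ (x, j))"
    by (intro sum.cong refl) (simp add: if_distrib[of "\<lambda>x. _ * x"] cong: if_cong)
  also have "\<dots> = (\<Sum>x<b. \<Sum>k<m. M $$ (i * m + k, x * m + k) * A $$ (x, j))"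
    by (rule sum.swap)
  also have "\<dots> = (ptr a b m M * A) $$ (i, j)"
    using ij assms by (subst mult_index) (auto simp: ptr_def sum_distrib_right)
  finally show "ptr a c m (M * kron A (1\<^sub>m m)) $$ (i, j) = (ptr a b m M * A) $$ (i, j)" .
qed (use assms in auto)

lemma ptr_mult_left:
  fixes M A :: "'a::comm_semiring_1 mat"
  assumes "M \<in> carrier_mat (a * m) (b * m)" "A \<in> carrier_mat c a"
  shows "ptr c b m (kron A (1\<^sub>m m) * M) = A * ptr a b m M"
proof (rule eq_matI)
  fix i j assume "i < dim_row (A * ptr a b m M)" "j < dim_col (A * ptr a b m M)"
  then have ij: "i < c" "j < b" using assms by auto
  have "ptr c b m (kron A (1\<^sub>m m) * M) $$ (i, j) = (\<Sum>k<m. \<Sum>x<a. \<Sum>y<m. A $$ (i, x) * 1\<^sub>m m $$ (k, y) * M $$ (x * m + y, j * m + k))"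
    using ij assms by (auto simp: ptr_def kron_mult_pair pair_index_less simp del: index_mult_mat(1) intro!: sum.cong)
  also have "\<dots> = (\<Sum>k<m. \<Sum>x<a. A $$ (i, x) * M $$ (x * m + k, j * m + k))"
    by (intro sum.cong refl) (simp add: if_distrib[of "\<lambda>x. _ * x"] if_distrib[of "\<lambda>x. x * _"] cong: if_cong)
  also have "\<dots> = (\<Sum>x<a. \<Sum>k<m. A $$ (i, x) * M $$ (x * m + k, j * m + k))"
    by (rule sum.swap)
  also have "\<dots> = (A * ptr a b m M) $$ (i, j)"
    using ij assms by (subst mult_index) (auto simp: ptr_def sum_distrib_left)
  finally show "ptr c b m (kron A (1\<^sub>m m) * M) $$ (i, j) = (A * ptr a b m M) $$ (i, j)" .
qed (use assms in auto)

text \<open>Cyclicity of the trace in the factor that is traced out; no such rule holds in the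
  remaining factor, where the partial trace is linear instead.\<close>

lemma ptr_cyclic:
  fixes M B :: "'a::comm_semiring_1 mat"
  assumes "M \<in> carrier_mat (a * m) (b * m)" "B \<in> carrier_mat m m"
  shows "ptr a b m (M * kron (1\<^sub>m b) B) = ptr a b m (kron (1\<^sub>m a) B * M)"
proof (rule eq_matI)
  fix i j assume "i < dim_row (ptr a b m (kron (1\<^sub>m a) B * M))" "j < dim_col (ptr a b m (kron (1\<^sub>m a) B * M))"
  then have ij: "i < a" "j < b" by auto
  have "ptr a b m (M * kron (1\<^sub>m b) B) $$ (i, j) = (\<Sum>k<m. \<Sum>x<b. \<Sum>y<m. M $$ (i * m + k, x * m + y) * (1\<^sub>m b $$ (x, j) * B $$ (y, k)))"
    using ij assms by (auto simp: ptr_def mult_kron_pair pair_index_less simp del: index_mult_mat(1) intro!: sum.cong)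
  also have "\<dots> = (\<Sum>k<m. \<Sum>x<b. if x = j then \<Sum>y<m. M $$ (i * m + k, j * m + y) * B $$ (y, k) else 0)"
    using ij by (intro sum.cong refl) auto
  also have "\<dots> = (\<Sum>k<m. \<Sum>y<m. B $$ (y, k) * M $$ (i * m + k, j * m + y))"
    using ij by (simp add: mult.commute)
  also have "\<dots> = (\<Sum>y<m. \<Sum>k<m. B $$ (y, k) * M $$ (i * m + k, j * m + y))"
    by (rule sum.swap)
  also have "\<dots> = (\<Sum>y<m. \<Sum>x<a. if x = i then \<Sum>k<m. B $$ (y, k) * M $$ (i * m + k, j * m + y) else 0)"
    using ij by simp
  also have "\<dots> = (\<Sum>y<m. \<Sum>x<a. \<Sum>k<m. 1\<^sub>m a $$ (i, x) * B $$ (y, k) * M $$ (x * m + k, j * m + y))"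
    using ij by (intro sum.cong refl) auto
  also have "\<dots> = ptr a b m (kron (1\<^sub>m a) B * M) $$ (i, j)"
    using ij assms by (auto simp: ptr_def kron_mult_pair pair_index_less simp del: index_mult_mat(1) intro!: sum.cong)
  finally show "ptr a b m (M * kron (1\<^sub>m b) B) $$ (i, j) = ptr a b m (kron (1\<^sub>m a) B * M) $$ (i, j)" .
qed auto

lemma tr_ptr: "M \<in> carrier_mat (a * m) (a * m) \<Longrightarrow> tr (ptr a a m M) = tr M"
  by (auto simp: tr_def ptr_def sum_pair)

lemma ptr_add:
  "\<lbrakk>M \<in> carrier_mat (a * m) (b * m); N \<in> carrier_mat (a * m) (b * m)\<rbrakk>
    \<Longrightarrow> ptr a b m (M + N) = ptr a b m M + ptr a b m N"
  by (intro eq_matI) (auto simp: ptr_def sum.distrib pair_index_less)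


subsection \<open>The symmetry\<close>

text \<open>The permutation matrix of the flip of a tensor product of spaces of sizes n and
  m.\<close>

definition braid :: "nat \<Rightarrow> nat \<Rightarrow> 'a::zero_neq_one mat" where
  "braid n m = mat (m * n) (n * m) (\<lambda>(r, c). if r div n = c mod m \<and> r mod n = c div m then 1 else 0)"

lemma braid_dim [simp]: "dim_row (braid n m) = m * n" "dim_col (braid n m) = n * m"
  by (simp_all add: braid_def)

lemma braid_pair:
  "\<lbrakk>i < m; k < n; j < n; l < m\<rbrakk> \<Longrightarrow> braid n m $$ (i * n + k, j * m + l) = (if i = l \<and> k = j then 1 else 0)"
  by (simp add: braid_def pair_index_less)

lemma braid_mult_pair:
  fixes M :: "'a::comm_semiring_1 mat"
  assumes "dim_row M = n * m" "c < dim_col M" "i < m" "k < n"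
  shows "(braid n m * M) $$ (i * n + k, c) = M $$ (k * m + i, c)"
proof -
  have "(braid n m * M) $$ (i * n + k, c) = (\<Sum>x<n. \<Sum>y<m. braid n m $$ (i * n + k, x * m + y) * M $$ (x * m + y, c))"
    using assms by (subst mult_index) (auto simp: pair_index_less sum_pair)
  also have "\<dots> = (\<Sum>x<n. if x = k then \<Sum>y<m. if y = i then M $$ (k * m + i, c) else 0 else 0)"
    using assms by (intro sum.cong refl) (auto simp: braid_pair delta_sums)
  also have "\<dots> = M $$ (k * m + i, c)" using assms by simp
  finally show ?thesis .
qed

lemma mult_braid_pair:
  fixes M :: "'a::comm_semiring_1 mat"
  assumes "dim_col M = m * n" "r < dim_row M" "j < n" "l < m"
  shows "(M * braid n m) $$ (r, j * m + l) = M $$ (r, l * n + j)"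
proof -
  have "(M * braid n m) $$ (r, j * m + l) = (\<Sum>x<m. \<Sum>y<n. M $$ (r, x * n + y) * braid n m $$ (x * n + y, j * m + l))"
    using assms by (subst mult_index) (auto simp: pair_index_less sum_pair)
  also have "\<dots> = (\<Sum>x<m. if x = l then \<Sum>y<n. if y = j then M $$ (r, l * n + j) else 0 else 0)"
    using assms by (intro sum.cong refl) (auto simp: braid_pair delta_sums)
  also have "\<dots> = M $$ (r, l * n + j)" using assms by simp
  finally show ?thesis .
qed

lemma braid_natural:
  fixes f g :: "'a::comm_semiring_1 mat"
  assumes "f \<in> carrier_mat n' n" "g \<in> carrier_mat m' m"
  shows "braid n' m' * kron f g = kron g f * braid n m"
proof (rule eq_mat_pairI[of _ m' n' n m])
  fix i k j l assume "i < m'" "k < n'" "j < n" "l < m"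
  then show "(braid n' m' * kron f g) $$ (i * n' + k, j * m + l) = (kron g f * braid n m) $$ (i * n' + k, j * m + l)"
    using assms
    by (simp add: braid_mult_pair mult_braid_pair pair_index_less kron_pair mult.commute[of "f $$ _"] del: index_mult_mat(1))
qed (use assms in auto)

lemma braid_symmetric: "braid m n * braid n m = (1\<^sub>m (n * m) :: 'a::comm_semiring_1 mat)"
proof (rule eq_mat_pairI[of _ n m n m])
  fix i k j l assume b: "i < n" "k < m" "j < n" "l < m"
  have "i = j \<and> k = l" if "i * m + k = j * m + l"
    using arg_cong[OF that, of "\<lambda>x. x div m"] arg_cong[OF that, of "\<lambda>x. x mod m"] b by simp
  with b show "(braid m n * braid n m) $$ (i * m + k, j * m + l) = (1\<^sub>m (n * m) :: 'a mat) $$ (i * m + k, j * m + l)"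
    by (simp add: braid_mult_pair braid_pair pair_index_less del: index_mult_mat(1))
qed auto

lemma braid_hexagon:
  "braid n (m * l) = kron (1\<^sub>m m) (braid n l) * kron (braid n m) (1\<^sub>m l :: 'a::comm_semiring_1 mat)"
proof (rule eq_mat_pairI[of _ m "l * n" "n * m" l])
  fix y r c z assume b: "y < m" "r < l * n" "c < n * m" "z < l"
  \<comment> \<open>Rows are words \<open>(y, z', x')\<close> and columns are words
    \<open>(x, y', z)\<close>; both sides have entry 1 exactly when the letters agree.\<close>
  define z' where "z' = r div n"
  define x' where "x' = r mod n"
  define x where "x = c div m"
  define y' where "y' = c mod m"
  have nm: "n > 0" "m > 0" using b by (auto intro: gr0I)
  have r: "r = z' * n + x'" "z' < l" "x' < n"
    using b nm by (auto simp: z'_def x'_def less_mult_imp_div_less)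
  have c: "c = x * m + y'" "x < n" "y' < m"
    using b nm by (auto simp: x_def y'_def less_mult_imp_div_less)
  have e1: "y * (l * n) + (z' * n + x') = (y * l + z') * n + x'" by (simp add: algebra_simps)
  have e2: "(x * m + y') * l + z = x * (m * l) + (y' * l + z)" by (simp add: algebra_simps)
  have e3: "y * l + z' = y' * l + z \<longleftrightarrow> y = y' \<and> z' = z"
  proof
    assume a: "y * l + z' = y' * l + z"
    show "y = y' \<and> z' = z"
      using arg_cong[OF a, of "\<lambda>x. x div l"] arg_cong[OF a, of "\<lambda>x. x mod l"] b r by simp
  qed auto
  have "braid n (m * l) $$ (y * (l * n) + r, c * l + z) = (if (y = y' \<and> z' = z) \<and> x' = x then 1 else 0 :: 'a)"
    unfolding r(1) c(1) e1 e2 e3[symmetric] using b r c by (intro braid_pair) (auto simp: pair_index_less)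
  moreover have "(kron (1\<^sub>m m) (braid n l) * kron (braid n m) (1\<^sub>m l :: 'a mat)) $$ (y * (l * n) + r, c * l + z) =
    (if (y = y' \<and> z' = z) \<and> x' = x then 1 else 0)"
  proof -
    have "(kron (1\<^sub>m m) (braid n l) * kron (braid n m) (1\<^sub>m l :: 'a mat)) $$ (y * (l * n) + r, c * l + z) =
      (\<Sum>u<m. \<Sum>v<n * l. (1\<^sub>m m $$ (y, u) * braid n l $$ (r, v)) * kron (braid n m) (1\<^sub>m l) $$ (u * (n * l) + v, c * l + z))"
      using b pair_index_less[OF b(3,4)] by (subst kron_mult_pair) (auto simp: pair_index_less mult_ac)
    also have "\<dots> = (\<Sum>u<m. if u = y then (\<Sum>v<n * l. braid n l $$ (r, v) * kron (braid n m) (1\<^sub>m l) $$ (y * (n * l) + v, c * l + z)) else 0)"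
      using b by (intro sum.cong refl) auto
    also have "\<dots> = (\<Sum>v<n * l. braid n l $$ (r, v) * kron (braid n m) (1\<^sub>m l) $$ (y * (n * l) + v, c * l + z))"
      using b by simp
    also have "\<dots> = (\<Sum>p<n. \<Sum>q<l. braid n l $$ (z' * n + x', p * l + q) * kron (braid n m) (1\<^sub>m l) $$ ((y * n + p) * l + q, (x * m + y') * l + z))"
      unfolding sum_pair r(1) c(1) by (simp add: algebra_simps)
    also have "\<dots> = (\<Sum>p<n. \<Sum>q<l. (if z' = q \<and> x' = p then 1 else 0) * ((if y = y' \<and> p = x then 1 else 0) * (if q = z then 1 else 0)))"
      using b r(2,3) c(2,3) by (intro sum.cong refl) (simp add: braid_pair kron_pair pair_index_less)
    also have "\<dots> = (\<Sum>p<n. if p = x' then (\<Sum>q<l. if q = z' then (if y = y' \<and> x' = x then 1 else 0) * (if z' = z then 1 else 0) else 0) else 0)"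
      using r by (intro sum.cong refl) (auto simp: delta_sums)
    also have "\<dots> = (if (y = y' \<and> z' = z) \<and> x' = x then 1 else 0)" using r by simp
    finally show ?thesis .
  qed
  ultimately show "braid n (m * l) $$ (y * (l * n) + r, c * l + z) =
    (kron (1\<^sub>m m) (braid n l) * kron (braid n m) (1\<^sub>m l :: 'a mat)) $$ (y * (l * n) + r, c * l + z)"
    by simp
qed (auto simp: mult_ac)


subsection \<open>Evaluation and coevaluation\<close>

definition ev :: "nat \<Rightarrow> 'a::zero_neq_one mat" where
  "ev n = mat 1 (n * n) (\<lambda>(_, c). if c div n = c mod n then 1 else 0)"

definition coev :: "nat \<Rightarrow> 'a::zero_neq_one mat" where
  "coev n = mat (n * n) 1 (\<lambda>(r, _). if r div n = r mod n then 1 else 0)"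

lemma ev_dim [simp]: "dim_row (ev n) = 1" "dim_col (ev n) = n * n" "dim_row (coev n) = n * n" "dim_col (coev n) = 1"
  by (simp_all add: ev_def coev_def)

lemma ev_pair:
  "\<lbrakk>i < n; j < n\<rbrakk> \<Longrightarrow> ev n $$ (0, i * n + j) = (if i = j then 1 else 0)"
  "\<lbrakk>i < n; j < n\<rbrakk> \<Longrightarrow> coev n $$ (i * n + j, 0) = (if i = j then 1 else 0)"
  by (simp_all add: ev_def coev_def pair_index_less)

lemma ev_mult_kron:
  fixes A B :: "'a::comm_semiring_1 mat"
  assumes "A \<in> carrier_mat n n" "B \<in> carrier_mat n n" "i < n" "j < n"
  shows "(ev n * kron A B) $$ (0, i * n + j) = (\<Sum>x<n. A $$ (x, i) * B $$ (x, j))"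
proof -
  have "(ev n * kron A B) $$ (0, i * n + j) = (\<Sum>x<n. \<Sum>y<n. if y = x then A $$ (x, i) * B $$ (x, j) else 0)"
    using assms by (subst mult_kron_pair) (auto simp: ev_pair delta_sums intro!: sum.cong)
  then show ?thesis by simp
qed

lemma kron_mult_coev:
  fixes A B :: "'a::comm_semiring_1 mat"
  assumes "A \<in> carrier_mat n n" "B \<in> carrier_mat n n" "i < n" "j < n"
  shows "(kron A B * coev n) $$ (i * n + j, 0) = (\<Sum>x<n. A $$ (i, x) * B $$ (j, x))"
proof -
  have "(kron A B * coev n) $$ (i * n + j, 0) = (\<Sum>x<n. \<Sum>y<n. if y = x then A $$ (i, x) * B $$ (j, x) else 0)"
    using assms by (subst kron_mult_pair) (auto simp: ev_pair delta_sums intro!: sum.cong)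
  then show ?thesis by simp
qed

text \<open>The adjunction between a matrix and its transpose; it makes the evaluation an
  intertwiner once the dual carries minus the transpose.\<close>

lemma ev_transpose:
  fixes A :: "'a::comm_semiring_1 mat"
  assumes A: "A \<in> carrier_mat n n"
  shows "ev n * kron (transpose_mat A) (1\<^sub>m n) = ev n * kron (1\<^sub>m n) A"
proof (rule eq_mat_pairI[of _ 1 1 n n])
  fix i k j l :: nat assume b: "i < 1" "k < 1" "j < n" "l < n"
  then have "i = 0" "k = 0" by auto
  then show "(ev n * kron (transpose_mat A) (1\<^sub>m n)) $$ (i * 1 + k, j * n + l) = (ev n * kron (1\<^sub>m n) A) $$ (i * 1 + k, j * n + l)"
    using A b by (simp add: ev_mult_kron if_distrib[of "\<lambda>x. _ * x"] if_distrib[of "\<lambda>x. x * _"] del: index_mult_mat(1) cong: if_cong)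
qed (use A in auto)

lemma coev_transpose:
  fixes A :: "'a::comm_semiring_1 mat"
  assumes A: "A \<in> carrier_mat n n"
  shows "kron (1\<^sub>m n) (transpose_mat A) * coev n = kron A (1\<^sub>m n) * coev n"
proof (rule eq_mat_pairI[of _ n n 1 1])
  fix i k j l :: nat assume b: "i < n" "k < n" "j < 1" "l < 1"
  then have "j = 0" "l = 0" by auto
  then show "(kron (1\<^sub>m n) (transpose_mat A) * coev n) $$ (i * n + k, j * 1 + l) = (kron A (1\<^sub>m n) * coev n) $$ (i * n + k, j * 1 + l)"
    using A b by (simp add: kron_mult_coev if_distrib[of "\<lambda>x. _ * x"] if_distrib[of "\<lambda>x. x * _"] del: index_mult_mat(1) cong: if_cong)
qed (use A in auto)

lemma zigzag_left: "kron (1\<^sub>m n) (ev n) * kron (coev n) (1\<^sub>m n) = (1\<^sub>m n :: 'a::comm_semiring_1 mat)"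
proof (rule eq_matI)
  fix i j assume "i < dim_row (1\<^sub>m n :: 'a mat)" "j < dim_col (1\<^sub>m n :: 'a mat)"
  then have ij: "i < n" "j < n" by auto
  have "(kron (1\<^sub>m n) (ev n) * kron (coev n) (1\<^sub>m n :: 'a mat)) $$ (i * 1 + 0, j) =
     (\<Sum>x<n. \<Sum>y<n * n. 1\<^sub>m n $$ (i, x) * ev n $$ (0, y) * kron (coev n) (1\<^sub>m n) $$ (x * (n * n) + y, j))"
    using ij by (subst kron_mult_pair) (auto simp: mult_ac)
  also have "\<dots> = (\<Sum>x<n. if x = i then (\<Sum>y<n * n. ev n $$ (0, y) * kron (coev n) (1\<^sub>m n) $$ (i * (n * n) + y, j)) else 0)"
    using ij by (intro sum.cong refl) auto
  also have "\<dots> = (\<Sum>y<n * n. ev n $$ (0, y) * kron (coev n) (1\<^sub>m n) $$ (i * (n * n) + y, j))" using ij by simp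
  also have "\<dots> = (\<Sum>p<n. \<Sum>q<n. ev n $$ (0, p * n + q) * kron (coev n) (1\<^sub>m n) $$ ((i * n + p) * n + q, 0 * n + j))"
    unfolding sum_pair by (simp add: algebra_simps)
  also have "\<dots> = (\<Sum>p<n. \<Sum>q<n. (if p = q then 1 else 0) * ((if i = p then 1 else 0) * (if q = j then 1 else 0)))"
    using ij by (intro sum.cong refl, subst kron_pair) (auto simp: ev_pair pair_index_less)
  also have "\<dots> = (\<Sum>p<n. if p = i then (\<Sum>q<n. if q = i then (if i = j then 1 else 0) else 0) else 0)"
    using ij by (intro sum.cong refl) (auto simp: delta_sums)
  also have "\<dots> = (if i = j then 1 else 0)" using ij by simp
  finally show "(kron (1\<^sub>m n) (ev n) * kron (coev n) (1\<^sub>m n :: 'a mat)) $$ (i, j) = 1\<^sub>m n $$ (i, j)"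
    using ij by simp
qed auto

lemma zigzag_right: "kron (ev n) (1\<^sub>m n) * kron (1\<^sub>m n) (coev n) = (1\<^sub>m n :: 'a::comm_semiring_1 mat)"
proof (rule eq_matI)
  fix i j assume "i < dim_row (1\<^sub>m n :: 'a mat)" "j < dim_col (1\<^sub>m n :: 'a mat)"
  then have ij: "i < n" "j < n" by auto
  have "(kron (ev n) (1\<^sub>m n) * kron (1\<^sub>m n :: 'a mat) (coev n)) $$ (i, j * 1 + 0) =
     (\<Sum>x<n. \<Sum>y<n * n. kron (ev n) (1\<^sub>m n) $$ (i, x * (n * n) + y) * (1\<^sub>m n $$ (x, j) * coev n $$ (y, 0)))"
    using ij by (subst mult_kron_pair) (auto simp: mult_ac)
  also have "\<dots> = (\<Sum>x<n. if x = j then (\<Sum>y<n * n. kron (ev n) (1\<^sub>m n) $$ (i, j * (n * n) + y) * coev n $$ (y, 0)) else 0)"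
    using ij by (intro sum.cong refl) auto
  also have "\<dots> = (\<Sum>y<n * n. kron (ev n) (1\<^sub>m n) $$ (i, j * (n * n) + y) * coev n $$ (y, 0))" using ij by simp
  also have "\<dots> = (\<Sum>p<n. \<Sum>q<n. kron (ev n) (1\<^sub>m n) $$ (0 * n + i, (j * n + p) * n + q) * coev n $$ (p * n + q, 0))"
    unfolding sum_pair by (simp add: algebra_simps)
  also have "\<dots> = (\<Sum>p<n. \<Sum>q<n. ((if j = p then 1 else 0) * (if i = q then 1 else 0)) * (if p = q then 1 else 0))"
    using ij by (intro sum.cong refl, subst kron_pair) (auto simp: ev_pair pair_index_less)
  also have "\<dots> = (\<Sum>p<n. if p = j then (\<Sum>q<n. if q = j then (if i = j then 1 else 0) else 0) else 0)"
    using ij by (intro sum.cong refl) (auto simp: delta_sums)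
  also have "\<dots> = (if i = j then 1 else 0)" using ij by simp
  finally show "(kron (ev n) (1\<^sub>m n) * kron (1\<^sub>m n :: 'a mat) (coev n)) $$ (i, j) = 1\<^sub>m n $$ (i, j)"
    using ij by simp
qed auto

text \<open>The coevaluation is the symmetric tensor with terms \<open>e_i \<otimes> e_i\<close>, so
  the flip fixes it and the evaluation counts its n terms.\<close>

lemma ev_braid_coev: "ev n * (braid n n * coev n) = (of_nat n :: 'a::comm_semiring_1) \<cdot>\<^sub>m 1\<^sub>m 1"
proof -
  have bc: "braid n n * coev n = (coev n :: 'a mat)"
  proof (rule eq_mat_pairI[of _ n n 1 1])
    fix i k j l :: nat assume b: "i < n" "k < n" "j < 1" "l < 1"
    then have "j = 0" "l = 0" by auto
    then show "(braid n n * coev n) $$ (i * n + k, j * 1 + l) = (coev n :: 'a mat) $$ (i * n + k, j * 1 + l)"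
      using b by (simp add: braid_mult_pair ev_pair del: index_mult_mat(1))
  qed auto
  have "(ev n * coev n) $$ (0, 0) = (\<Sum>x<n. \<Sum>y<n. (if x = y then 1 else 0) * (if x = y then 1 else 0 :: 'a))"
    by (subst mult_index) (auto simp: sum_pair ev_pair intro!: sum.cong)
  also have "\<dots> = (\<Sum>x<n. 1)" by (intro sum.cong refl) (simp add: delta_sums)
  finally have "(ev n * coev n) $$ (0, 0) = (of_nat n :: 'a)" by simp
  then show ?thesis unfolding bc by (intro eq_matI) (auto simp del: index_mult_mat(1))
qed


section \<open>The tensor category\<close>

text \<open>The action of the Lie algebra on a tensor product. With Kronecker products in place of abstract tensor
  products the operation is strictly associative and unital.\<close>

definition tsum :: "'a::field mat \<Rightarrow> 'a mat \<Rightarrow> 'a mat" where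
  "tsum E F = kron E (1\<^sub>m (dim_row F)) + kron (1\<^sub>m (dim_row E)) F"

lemma tsum_dim [simp]:
  "dim_row (tsum E F) = dim_row E * dim_row F" "dim_col (tsum E F) = dim_row E * dim_col F"
  by (simp_all add: tsum_def)

lemma tsum_square [simp]: "square_mat F \<Longrightarrow> square_mat (tsum E F)"
  by simp

lemma tsum_assoc:
  assumes "square_mat E" "square_mat F" "square_mat G"
  shows "tsum (tsum E F) G = tsum E (tsum F G)"
proof -
  let ?n = "dim_row E" and ?m = "dim_row F" and ?l = "dim_row G"
  have "tsum (tsum E F) G = kron (tsum E F) (1\<^sub>m ?l) + kron (1\<^sub>m (?n * ?m)) G"
    by (simp add: tsum_def)
  also have "kron (1\<^sub>m (?n * ?m)) G = kron (1\<^sub>m ?n) (kron (1\<^sub>m ?m) G)"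
    using kron_assoc[of "1\<^sub>m ?n" "1\<^sub>m ?m" G] by simp
  also have "kron (tsum E F) (1\<^sub>m ?l) = kron E (1\<^sub>m (?m * ?l)) + kron (1\<^sub>m ?n) (kron F (1\<^sub>m ?l))"
    using assms by (simp add: tsum_def kron_add kron_assoc)
  also have "\<dots> + kron (1\<^sub>m ?n) (kron (1\<^sub>m ?m) G) =
    kron E (1\<^sub>m (?m * ?l)) + (kron (1\<^sub>m ?n) (kron F (1\<^sub>m ?l)) + kron (1\<^sub>m ?n) (kron (1\<^sub>m ?m) G))"
    using assms by (intro assoc_add_mat) auto
  also have "kron (1\<^sub>m ?n) (kron F (1\<^sub>m ?l)) + kron (1\<^sub>m ?n) (kron (1\<^sub>m ?m) G) = kron (1\<^sub>m ?n) (tsum F G)"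
    using assms by (simp add: tsum_def kron_add)
  finally show ?thesis by (simp add: tsum_def)
qed

lemma tsum_unit:
  assumes "square_mat E"
  shows "tsum (0\<^sub>m 1 1) E = E" "tsum E (0\<^sub>m 1 1) = E"
proof -
  have E: "E \<in> carrier_mat (dim_row E) (dim_row E)" using assms by auto
  show "tsum (0\<^sub>m 1 1) E = E" "tsum E (0\<^sub>m 1 1) = E"
    using assms left_add_zero_mat[OF E] right_add_zero_mat[OF E]
    by (simp_all add: tsum_def kron_unit[unfolded One_nat_def])
qed

lemma intw_kron:
  assumes sq: "square_mat E" "square_mat E'" "square_mat F" "square_mat F'"
    and f: "f \<in> intw E E'" and g: "g \<in> intw F F'"
  shows "kron f g \<in> intw (tsum E F) (tsum E' F')"
proof (rule intwI)
  note d = intw_dim[OF f] intw_dim[OF g]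
  show "kron f g * tsum E F = tsum E' F' * kron f g"
    using sq d by (simp add: tsum_def mult_add_dim add_mult_dim kron_mult)
qed (use sq intw_dim[OF f] intw_dim[OF g] in auto)

text \<open>In the intertwining identity the terms with \<open>F\<close> have equal partial traces
  by cyclicity and cancel; linearity in the first factor turns the rest into the claim.\<close>

lemma intw_ptr:
  assumes sq: "square_mat E" "square_mat E'" "square_mat F" and M: "M \<in> intw (tsum E F) (tsum E' F)"
  shows "ptr (dim_row E') (dim_row E) (dim_row F) M \<in> intw E E'"
proof (rule intwI)
  let ?a = "dim_row E'" and ?b = "dim_row E" and ?m = "dim_row F"
  have Mc: "M \<in> carrier_mat (?a * ?m) (?b * ?m)" using intw_dim[OF M] sq by auto
  have c: "E \<in> carrier_mat ?b ?b" "E' \<in> carrier_mat ?a ?a" "F \<in> carrier_mat ?m ?m" using sq by auto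
  have c': "M * kron E (1\<^sub>m ?m) \<in> carrier_mat (?a * ?m) (?b * ?m)"
    "M * kron (1\<^sub>m ?b) F \<in> carrier_mat (?a * ?m) (?b * ?m)"
    "kron E' (1\<^sub>m ?m) * M \<in> carrier_mat (?a * ?m) (?b * ?m)"
    "kron (1\<^sub>m ?a) F * M \<in> carrier_mat (?a * ?m) (?b * ?m)" using Mc sq by auto
  have "M * kron E (1\<^sub>m ?m) + M * kron (1\<^sub>m ?b) F = kron E' (1\<^sub>m ?m) * M + kron (1\<^sub>m ?a) F * M"
    using intw_dim(3)[OF M] Mc sq by (simp add: tsum_def mult_add_dim add_mult_dim)
  then have "ptr ?a ?b ?m M * E + ptr ?a ?b ?m (M * kron (1\<^sub>m ?b) F) = E' * ptr ?a ?b ?m M + ptr ?a ?b ?m (kron (1\<^sub>m ?a) F * M)"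
    using ptr_add[OF c'(1,2)] ptr_add[OF c'(3,4)] ptr_mult_right[OF Mc c(1)] ptr_mult_left[OF Mc c(2)] by metis
  then have *: "ptr ?a ?b ?m M * E + ptr ?a ?b ?m (kron (1\<^sub>m ?a) F * M) = E' * ptr ?a ?b ?m M + ptr ?a ?b ?m (kron (1\<^sub>m ?a) F * M)"
    unfolding ptr_cyclic[OF Mc c(3)] .
  show "ptr ?a ?b ?m M * E = E' * ptr ?a ?b ?m M"
  proof (rule eq_matI)
    fix i j assume "i < dim_row (E' * ptr ?a ?b ?m M)" "j < dim_col (E' * ptr ?a ?b ?m M)"
    then show "(ptr ?a ?b ?m M * E) $$ (i, j) = (E' * ptr ?a ?b ?m M) $$ (i, j)"
      using arg_cong[OF *, of "\<lambda>A. A $$ (i, j)"] sq by (simp del: index_mult_mat(1))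
  qed (use sq in auto)
qed (use sq in auto)

text \<open>Tracing out the second factor rewrites \<open>tr (h * kron k g)\<close> as a trace
  pairing of \<open>k\<close> with one fixed intertwiner, so it only depends on the class of
  \<open>k\<close>. With symmetry this makes negligible morphisms a tensor ideal.\<close>

lemma treq_kron_left:
  assumes sq: "square_mat E" "square_mat E'" "square_mat F" "square_mat F'"
    and f: "f \<in> intw E E'" "f' \<in> intw E E'" "treq E E' f f'" and g: "g \<in> intw F F'"
  shows "treq (tsum E F) (tsum E' F') (kron f g) (kron f' g)"
  unfolding treq_def
proof
  fix h assume h: "h \<in> intw (tsum E' F') (tsum E F)"
  define M where "M = h * kron (1\<^sub>m (dim_row E')) g"
  have M: "M \<in> intw (tsum E' F) (tsum E F)"
    unfolding M_def by (rule intw_mult[OF _ _ _ intw_kron[OF sq(2,2,3,4) intw_one[OF sq(2)] g] h]) (use sq in auto)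
  have Mc: "M \<in> carrier_mat (dim_row E * dim_row F) (dim_row E' * dim_row F)" using intw_dim[OF M] sq by auto
  have *: "tr (h * kron k g) = tr (ptr (dim_row E) (dim_row E') (dim_row F) M * k)" if k: "k \<in> intw E E'" for k
  proof -
    have kc: "k \<in> carrier_mat (dim_row E') (dim_row E)" using intw_dim[OF k] by auto
    have "kron k g = kron (1\<^sub>m (dim_row E')) g * kron k (1\<^sub>m (dim_row F))"
      using intw_dim(1,2)[OF g] intw_dim(1,2)[OF k] by (simp add: kron_mult)
    then have "h * kron k g = M * kron k (1\<^sub>m (dim_row F))"
      using intw_dim(1,2)[OF g] intw_dim(1,2)[OF k] intw_dim(1,2)[OF h] sq by (simp add: M_def mult_assoc_dim)
    then have "tr (h * kron k g) = tr (ptr (dim_row E) (dim_row E) (dim_row F) (M * kron k (1\<^sub>m (dim_row F))))"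
      using Mc kc by (simp add: tr_ptr[of "M * kron k (1\<^sub>m (dim_row F))" "dim_row E" "dim_row F", OF carrier_matI])
    then show ?thesis using ptr_mult_right[OF Mc kc] by simp
  qed
  have "ptr (dim_row E) (dim_row E') (dim_row F) M \<in> intw E' E" by (rule intw_ptr[OF sq(2,1,3) M])
  then show "tr (h * kron f g) = tr (h * kron f' g)"
    using *[OF f(1)] *[OF f(2)] f(3) unfolding treq_def by simp
qed

lemma intw_braid:
  assumes sq: "square_mat E" "square_mat F"
  shows "braid (dim_row E) (dim_row F) \<in> intw (tsum E F) (tsum F E)"
proof (rule intwI)
  let ?n = "dim_row E" and ?m = "dim_row F"
  have c: "E \<in> carrier_mat ?n ?n" "F \<in> carrier_mat ?m ?m" "1\<^sub>m ?n \<in> carrier_mat ?n ?n" "1\<^sub>m ?m \<in> carrier_mat ?m ?m"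
    using sq by auto
  have "braid ?n ?m * tsum E F = braid ?n ?m * kron E (1\<^sub>m ?m) + braid ?n ?m * kron (1\<^sub>m ?n) F"
    using sq by (simp add: tsum_def mult_add_dim)
  also have "\<dots> = kron (1\<^sub>m ?m) E * braid ?n ?m + kron F (1\<^sub>m ?n) * braid ?n ?m"
    unfolding braid_natural[OF c(1,4)] braid_natural[OF c(3,2)] ..
  also have "\<dots> = kron F (1\<^sub>m ?n) * braid ?n ?m + kron (1\<^sub>m ?m) E * braid ?n ?m"
    using sq by (intro comm_add_mat) auto
  also have "\<dots> = tsum F E * braid ?n ?m" using sq by (simp add: tsum_def add_mult_dim)
  finally show "braid ?n ?m * tsum E F = tsum F E * braid ?n ?m" .
qed (use sq in auto)

text \<open>The second argument is changed by conjugating with the flip, which moves it to the first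
  place.\<close>

lemma treq_kron:
  assumes sq: "square_mat E" "square_mat E'" "square_mat F" "square_mat F'"
    and f: "f \<in> intw E E'" "f' \<in> intw E E'" "treq E E' f f'"
    and g: "g \<in> intw F F'" "g' \<in> intw F F'" "treq F F' g g'"
  shows "treq (tsum E F) (tsum E' F') (kron f g) (kron f' g')"
proof -
  have sqt: "square_mat (tsum E F)" "square_mat (tsum E' F')" "square_mat (tsum F E)" "square_mat (tsum F' E')"
    using sq by auto
  note b = intw_braid[OF sq(1,3)] intw_braid[OF sq(4,2)]
  have *: "kron f' k = braid (dim_row F') (dim_row E') * (kron k f' * braid (dim_row E) (dim_row F))"
    if k: "k \<in> intw F F'" for k
  proof -
    have c: "f' \<in> carrier_mat (dim_row E') (dim_row E)" "k \<in> carrier_mat (dim_row F') (dim_row F)"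
      using intw_dim[OF f(2)] intw_dim[OF k] by auto
    have "braid (dim_row F') (dim_row E') * (kron k f' * braid (dim_row E) (dim_row F)) =
      braid (dim_row F') (dim_row E') * (braid (dim_row E') (dim_row F') * kron f' k)"
      unfolding braid_natural[OF c] ..
    also have "\<dots> = kron f' k" using c by (simp add: mult_ext[OF braid_symmetric])
    finally show ?thesis by simp
  qed
  have "treq (tsum E F) (tsum E' F') (kron f g) (kron f' g)" by (rule treq_kron_left[OF sq f g(1)])
  also have "treq (tsum E F) (tsum E' F') (kron f' g) (kron f' g')"
    unfolding *[OF g(1)] *[OF g(2)]
    by (rule treq_mult[OF sqt(1,4,2) intw_mult[OF sqt(1,3,4) b(1) intw_kron[OF sq(3,4,1,2) g(1) f(2)]]
        intw_mult[OF sqt(1,3,4) b(1) intw_kron[OF sq(3,4,1,2) g(2) f(2)]]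
        treq_mult[OF sqt(1,3,4) b(1,1) treq_refl intw_kron[OF sq(3,4,1,2) g(1) f(2)]
          intw_kron[OF sq(3,4,1,2) g(2) f(2)] treq_kron_left[OF sq(3,4,1,2) g f(2)]] b(2,2) treq_refl])
  finally show ?thesis .
qed


subsection \<open>Morphisms as classes of intertwiners\<close>

text \<open>Composition receives bare morphisms, so source and target are stored with the class. The
  matrices are wrapped as singleton lists to fit the prescribed type.\<close>

definition cls :: "'a::field mat \<Rightarrow> 'a mat \<Rightarrow> 'a mat \<Rightarrow> 'a concrete_mor" where
  "cls E F f = ([E], [F], {[g] |g. g \<in> intw E F \<and> treq E F g f})"

definition mrep :: "'a::field concrete_mor \<Rightarrow> 'a mat" where
  "mrep m = (SOME g. [g] \<in> snd (snd m))"

definition msrc :: "'a::field concrete_mor \<Rightarrow> 'a mat" where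
  "msrc m = hd (fst m)"

definition mtgt :: "'a::field concrete_mor \<Rightarrow> 'a mat" where
  "mtgt m = hd (fst (snd m))"

lemma cls_src_tgt [simp]: "msrc (cls E F f) = E" "mtgt (cls E F f) = F"
  by (simp_all add: cls_def msrc_def mtgt_def)

lemma cls_eq_iff:
  assumes "f \<in> intw E F" "g \<in> intw E F"
  shows "cls E F f = cls E F g \<longleftrightarrow> treq E F f g"
proof
  assume "cls E F f = cls E F g"
  then have "[f] \<in> {[g'] |g'. g' \<in> intw E F \<and> treq E F g' g}"
    unfolding cls_def using assms by auto
  then show "treq E F f g" by auto
next
  assume "treq E F f g"
  then show "cls E F f = cls E F g" unfolding cls_def using treq_trans treq_sym by blast
qed

lemma mrep_cls:
  assumes "f \<in> intw E F"
  shows "mrep (cls E F f) \<in> intw E F" "treq E F (mrep (cls E F f)) f"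
proof -
  have "[mrep (cls E F f)] \<in> snd (snd (cls E F f))"
    unfolding mrep_def by (rule someI[of _ f]) (use assms in \<open>auto simp: cls_def\<close>)
  then show "mrep (cls E F f) \<in> intw E F" "treq E F (mrep (cls E F f)) f" by (auto simp: cls_def)
qed

text \<open>Operations act on chosen representatives. Associators and unit maps are identities,
  since \<open>tsum\<close> is strictly associative and unital on square matrices.\<close>

definition vcat :: "'a::field concrete_tensor_data" where
  "vcat = \<lparr>Obj = {[E] |E. square_mat E},
    Hom = (\<lambda>X Y. cls (hd X) (hd Y) ` intw (hd X) (hd Y)),
    Id = (\<lambda>X. cls (hd X) (hd X) (1\<^sub>m (dim_row (hd X)))),
    Comp = (\<lambda>g f. cls (msrc f) (mtgt g) (mrep g * mrep f)),
    Zero = (\<lambda>X Y. cls (hd X) (hd Y) (0\<^sub>m (dim_row (hd Y)) (dim_row (hd X)))),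
    Add = (\<lambda>f g. cls (msrc f) (mtgt f) (mrep f + mrep g)),
    Scale = (\<lambda>a f. cls (msrc f) (mtgt f) (a \<cdot>\<^sub>m mrep f)),
    Tensor = (\<lambda>X Y. [tsum (hd X) (hd Y)]),
    TensorM = (\<lambda>f g. cls (tsum (msrc f) (msrc g)) (tsum (mtgt f) (mtgt g)) (kron (mrep f) (mrep g))),
    Unit = [0\<^sub>m 1 1],
    Assoc = (\<lambda>X Y Z. cls (tsum (tsum (hd X) (hd Y)) (hd Z)) (tsum (tsum (hd X) (hd Y)) (hd Z))
      (1\<^sub>m (dim_row (hd X) * dim_row (hd Y) * dim_row (hd Z)))),
    LUnit = (\<lambda>X. cls (hd X) (hd X) (1\<^sub>m (dim_row (hd X)))),
    RUnit = (\<lambda>X. cls (hd X) (hd X) (1\<^sub>m (dim_row (hd X)))),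
    Braid = (\<lambda>X Y. cls (tsum (hd X) (hd Y)) (tsum (hd Y) (hd X)) (braid (dim_row (hd X)) (dim_row (hd Y))))\<rparr>"

lemma vcat_obj [simp]:
  "X \<in> Obj vcat \<longleftrightarrow> (\<exists>E. X = [E] \<and> square_mat E)"
  "Tensor vcat [E] [F] = [tsum E F]" "Unit vcat = [0\<^sub>m 1 1]"
  by (auto simp: vcat_def)

lemma vcat_Hom: "m \<in> Hom vcat [E] [F] \<longleftrightarrow> (\<exists>f\<in>intw E F. m = cls E F f)"
  by (auto simp: vcat_def)

lemma vcat_HomI: "f \<in> intw E F \<Longrightarrow> cls E F f \<in> Hom vcat [E] [F]"
  unfolding vcat_Hom by blast

lemma vcat_const:
  "lincat.Id vcat [E] = cls E E (1\<^sub>m (dim_row E))"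
  "Zero vcat [E] [F] = cls E F (0\<^sub>m (dim_row F) (dim_row E))"
  "LUnit vcat [E] = lincat.Id vcat [E]"
  "RUnit vcat [E] = lincat.Id vcat [E]"
  "Braid vcat [E] [F] = cls (tsum E F) (tsum F E) (braid (dim_row E) (dim_row F))"
  by (simp_all add: vcat_def)

lemma vcat_Assoc: "Assoc vcat [E] [F] [G] = lincat.Id vcat [tsum (tsum E F) G]"
  by (simp add: vcat_def)

lemma vcat_Comp:
  assumes "square_mat E" "square_mat F" "square_mat G" "g \<in> intw F G" "f \<in> intw E F"
  shows "Comp vcat (cls F G g) (cls E F f) = cls E G (g * f)"
proof -
  have "Comp vcat (cls F G g) (cls E F f) = cls E G (mrep (cls F G g) * mrep (cls E F f))"
    by (simp add: vcat_def)
  also have "\<dots> = cls E G (g * f)"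
    using assms mrep_cls[OF assms(4)] mrep_cls[OF assms(5)]
    by (subst cls_eq_iff) (auto intro!: treq_mult[of E F G] intw_mult[of E F G] simp del: square_mat.simps)
  finally show ?thesis .
qed

lemma vcat_Add:
  assumes "square_mat E" "square_mat F" "f \<in> intw E F" "g \<in> intw E F"
  shows "Add vcat (cls E F f) (cls E F g) = cls E F (f + g)"
proof -
  have "Add vcat (cls E F f) (cls E F g) = cls E F (mrep (cls E F f) + mrep (cls E F g))"
    by (simp add: vcat_def)
  also have "\<dots> = cls E F (f + g)"
    using assms mrep_cls[OF assms(3)] mrep_cls[OF assms(4)]
    by (subst cls_eq_iff) (auto intro!: treq_add intw_add simp del: square_mat.simps)
  finally show ?thesis .
qed

lemma vcat_Scale:
  assumes "square_mat E" "square_mat F" "f \<in> intw E F"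
  shows "Scale vcat a (cls E F f) = cls E F (a \<cdot>\<^sub>m f)"
proof -
  have "Scale vcat a (cls E F f) = cls E F (a \<cdot>\<^sub>m mrep (cls E F f))"
    by (simp add: vcat_def)
  also have "\<dots> = cls E F (a \<cdot>\<^sub>m f)"
    using assms mrep_cls[OF assms(3)]
    by (subst cls_eq_iff) (auto intro!: treq_smult intw_smult simp del: square_mat.simps)
  finally show ?thesis .
qed

lemma vcat_TensorM:
  assumes "square_mat E" "square_mat E'" "square_mat F" "square_mat F'" "f \<in> intw E E'" "g \<in> intw F F'"
  shows "TensorM vcat (cls E E' f) (cls F F' g) = cls (tsum E F) (tsum E' F') (kron f g)"
proof -
  have "TensorM vcat (cls E E' f) (cls F F' g) =
    cls (tsum E F) (tsum E' F') (kron (mrep (cls E E' f)) (mrep (cls F F' g)))"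
    by (simp add: vcat_def)
  also have "\<dots> = cls (tsum E F) (tsum E' F') (kron f g)"
    using assms mrep_cls[OF assms(5)] mrep_cls[OF assms(6)]
    by (subst cls_eq_iff) (auto intro!: treq_kron intw_kron simp del: square_mat.simps)
  finally show ?thesis .
qed

lemmas vcat_ops = vcat_Comp vcat_Add vcat_Scale vcat_TensorM

lemma vcat_linear_category: "linear_category (vcat :: 'a::field concrete_tensor_data)"
proof
  fix X assume "X \<in> Obj (vcat :: 'a concrete_tensor_data)"
  then show "lincat.Id vcat X \<in> Hom vcat X X"
    by (auto simp: vcat_const simp del: square_mat.simps intro!: vcat_HomI intw_one)
next
  fix X Y Z f g
  assume "X \<in> Obj (vcat :: 'a concrete_tensor_data)" "Y \<in> Obj (vcat :: 'a concrete_tensor_data)"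
    "Z \<in> Obj (vcat :: 'a concrete_tensor_data)"
    "f \<in> Hom vcat X Y" "g \<in> Hom vcat Y Z"
  then obtain E F G f' g' where 1: "X = [E]" "Y = [F]" "Z = [G]"
    and sq: "square_mat E" "square_mat F" "square_mat G"
    and fg: "f' \<in> intw E F" "g' \<in> intw F G" "f = cls E F f'" "g = cls F G g'"
    by (auto simp: vcat_Hom simp del: square_mat.simps)
  note gf = intw_mult[OF sq fg(1,2)]
  show "Comp vcat g f \<in> Hom vcat X Z" unfolding 1 fg vcat_Comp[OF sq fg(2,1)] by (rule vcat_HomI[OF gf])
  fix a
  show "Comp vcat g (Scale vcat a f) = Scale vcat a (Comp vcat g f)"
    using sq fg gf intw_smult[OF sq(1,2) fg(1)] intw_dim[OF fg(1)] intw_dim[OF fg(2)]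
    by (simp add: 1 vcat_ops mult_smult_dim del: square_mat.simps)
  show "Comp vcat (Scale vcat a g) f = Scale vcat a (Comp vcat g f)"
    using sq fg gf intw_smult[OF sq(2,3) fg(2)] intw_dim[OF fg(1)] intw_dim[OF fg(2)]
    by (simp add: 1 vcat_ops smult_mult_dim del: square_mat.simps)
next
  fix X Y f
  assume "X \<in> Obj (vcat :: 'a concrete_tensor_data)" "Y \<in> Obj (vcat :: 'a concrete_tensor_data)" "f \<in> Hom vcat X Y"
  then obtain E F f' where 1: "X = [E]" "Y = [F]"
    and sq: "square_mat E" "square_mat F" and f: "f' \<in> intw E F" "f = cls E F f'"
    by (auto simp: vcat_Hom simp del: square_mat.simps)
  note d = intw_dim(1,2)[OF f(1)] and s = intw_smult[OF sq f(1)] and z = intw_zero[OF sq]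
  show "Comp vcat f (lincat.Id vcat X) = f" "Comp vcat (lincat.Id vcat Y) f = f"
    using sq f d intw_one[OF sq(1)] intw_one[OF sq(2)] by (simp_all add: 1 vcat_const vcat_ops del: square_mat.simps)
  show "Add vcat f (Zero vcat X Y) = f"
  proof -
    have "f' + 0\<^sub>m (dim_row F) (dim_row E) = f'" using d by (intro right_add_zero_mat) auto
    then show ?thesis using sq f z by (simp add: 1 vcat_const vcat_ops del: square_mat.simps)
  qed
  show "\<exists>g\<in>Hom vcat X Y. Add vcat f g = Zero vcat X Y"
  proof (rule bexI)
    show "cls E F ((- 1) \<cdot>\<^sub>m f') \<in> Hom vcat X Y" unfolding 1 using s by (rule vcat_HomI)
    have "f' + (- 1) \<cdot>\<^sub>m f' = 0\<^sub>m (dim_row F) (dim_row E)" using d by (intro eq_matI) auto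
    then show "Add vcat f (cls E F ((- 1) \<cdot>\<^sub>m f')) = Zero vcat X Y"
      using sq f s by (simp add: 1 vcat_const vcat_ops del: square_mat.simps)
  qed
  fix a b
  show "Scale vcat a f \<in> Hom vcat X Y" unfolding 1 f(2) vcat_Scale[OF sq f(1)] by (rule vcat_HomI[OF s])
  show "Scale vcat (a + b) f = Add vcat (Scale vcat a f) (Scale vcat b f)"
    using sq f s by (simp add: vcat_ops add_smult_distrib_right_mat[of _ "dim_row f'" "dim_col f'"] del: square_mat.simps)
  have "(a * b) \<cdot>\<^sub>m f' = a \<cdot>\<^sub>m (b \<cdot>\<^sub>m f')" by (intro eq_matI) (auto simp: mult.assoc)
  then show "Scale vcat (a * b) f = Scale vcat a (Scale vcat b f)"
    using sq f s by (simp add: vcat_ops del: square_mat.simps)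
  have "1 \<cdot>\<^sub>m f' = f'" by (intro eq_matI) auto
  then show "Scale vcat 1 f = f"
    using sq f s by (simp add: vcat_ops del: square_mat.simps)
  fix g assume "g \<in> Hom vcat X Y"
  then obtain g' where g: "g' \<in> intw E F" "g = cls E F g'" by (auto simp: 1 vcat_Hom)
  note e = intw_dim(1,2)[OF g(1)] and fg = intw_add[OF sq f(1) g(1)] and t = intw_smult[OF sq g(1)]
  show "Add vcat f g \<in> Hom vcat X Y" unfolding 1 f(2) g(2) vcat_Add[OF sq f(1) g(1)] by (rule vcat_HomI[OF fg])
  have "f' + g' = g' + f'" using d e by (intro comm_add_mat[of _ "dim_row F" "dim_row E"]) auto
  then show "Add vcat f g = Add vcat g f"
    using sq f g by (simp add: vcat_ops del: square_mat.simps)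
  have "a \<cdot>\<^sub>m (f' + g') = a \<cdot>\<^sub>m f' + a \<cdot>\<^sub>m g'"
    using d e by (intro add_smult_distrib_left_mat[of _ "dim_row F" "dim_row E"]) auto
  then show "Scale vcat a (Add vcat f g) = Add vcat (Scale vcat a f) (Scale vcat a g)"
    using sq f g s t fg by (simp add: vcat_ops del: square_mat.simps)
  fix h assume "h \<in> Hom vcat X Y"
  then obtain h' where h: "h' \<in> intw E F" "h = cls E F h'" by (auto simp: 1 vcat_Hom)
  have "(f' + g') + h' = f' + (g' + h')" using d e intw_dim(1,2)[OF h(1)]
    by (intro assoc_add_mat[of _ "dim_row F" "dim_row E"]) auto
  then show "Add vcat (Add vcat f g) h = Add vcat f (Add vcat g h)"
    using sq f g h fg intw_add[OF sq g(1) h(1)] by (simp add: vcat_ops del: square_mat.simps)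
next
  fix X Y Z f g h
  assume "X \<in> Obj (vcat :: 'a concrete_tensor_data)" "Y \<in> Obj (vcat :: 'a concrete_tensor_data)"
    "Z \<in> Obj (vcat :: 'a concrete_tensor_data)"
    "f \<in> Hom vcat X Y" "g \<in> Hom vcat X Y" "h \<in> Hom vcat Y Z"
  then obtain E F G f' g' h' where 1: "X = [E]" "Y = [F]" "Z = [G]"
    and sq: "square_mat E" "square_mat F" "square_mat G"
    and fg: "f' \<in> intw E F" "g' \<in> intw E F" "h' \<in> intw F G" "f = cls E F f'" "g = cls E F g'" "h = cls F G h'"
    by (auto simp: vcat_Hom simp del: square_mat.simps)
  then show "Comp vcat h (Add vcat f g) = Add vcat (Comp vcat h f) (Comp vcat h g)"
    using intw_add[OF sq(1,2) fg(1,2)] intw_mult[OF sq fg(1,3)] intw_mult[OF sq fg(2,3)]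
      intw_dim[OF fg(1)] intw_dim[OF fg(2)] intw_dim[OF fg(3)]
    by (simp add: vcat_ops mult_add_dim del: square_mat.simps)
next
  fix X Y Z f g h
  assume "X \<in> Obj (vcat :: 'a concrete_tensor_data)" "Y \<in> Obj (vcat :: 'a concrete_tensor_data)"
    "Z \<in> Obj (vcat :: 'a concrete_tensor_data)"
    "f \<in> Hom vcat X Y" "g \<in> Hom vcat Y Z" "h \<in> Hom vcat Y Z"
  then obtain E F G f' g' h' where 1: "X = [E]" "Y = [F]" "Z = [G]"
    and sq: "square_mat E" "square_mat F" "square_mat G"
    and fg: "f' \<in> intw E F" "g' \<in> intw F G" "h' \<in> intw F G" "f = cls E F f'" "g = cls F G g'" "h = cls F G h'"
    by (auto simp: vcat_Hom simp del: square_mat.simps)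
  then show "Comp vcat (Add vcat g h) f = Add vcat (Comp vcat g f) (Comp vcat h f)"
    using intw_add[OF sq(2,3) fg(2,3)] intw_mult[OF sq fg(1,3)] intw_mult[OF sq fg(1,2)]
      intw_dim[OF fg(1)] intw_dim[OF fg(2)] intw_dim[OF fg(3)]
    by (simp add: vcat_ops add_mult_dim del: square_mat.simps)
next
  fix W X Y Z f g h
  assume "W \<in> Obj (vcat :: 'a concrete_tensor_data)" "X \<in> Obj (vcat :: 'a concrete_tensor_data)"
    "Y \<in> Obj (vcat :: 'a concrete_tensor_data)" "Z \<in> Obj (vcat :: 'a concrete_tensor_data)"
    "f \<in> Hom vcat W X" "g \<in> Hom vcat X Y" "h \<in> Hom vcat Y Z"
  then obtain D E F G f' g' h' where 1: "W = [D]" "X = [E]" "Y = [F]" "Z = [G]"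
    and sq: "square_mat D" "square_mat E" "square_mat F" "square_mat G"
    and fg: "f' \<in> intw D E" "g' \<in> intw E F" "h' \<in> intw F G" "f = cls D E f'" "g = cls E F g'" "h = cls F G h'"
    by (auto simp: vcat_Hom simp del: square_mat.simps)
  then show "Comp vcat (Comp vcat h g) f = Comp vcat h (Comp vcat g f)"
    using intw_mult[OF sq(2-4) fg(2,3)] intw_mult[OF sq(1-3) fg(1,2)]
      intw_dim[OF fg(1)] intw_dim[OF fg(2)] intw_dim[OF fg(3)]
    by (simp add: vcat_ops mult_assoc_dim del: square_mat.simps)
next
  fix X Y
  assume "X \<in> Obj (vcat :: 'a concrete_tensor_data)" "Y \<in> Obj (vcat :: 'a concrete_tensor_data)"
  then show "Zero vcat X Y \<in> Hom vcat X Y"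
    by (auto simp: vcat_const simp del: square_mat.simps intro!: vcat_HomI intw_zero)
qed


text \<open>The block diagonal matrix of \<open>E\<close> and \<open>F\<close>, assembled from the
  coordinate inclusions and projections.\<close>

lemma vcat_biproduct:
  fixes E F :: "'a::field mat"
  assumes sq: "square_mat E" "square_mat F"
  shows "\<exists>S i j p q. is_biproduct vcat [E] [F] S i j p q"
proof -
  let ?n = "dim_row E" and ?m = "dim_row F"
  define i :: "'a mat" where "i = mat (?n + ?m) ?n (\<lambda>(r, c). if r = c then 1 else 0)"
  define j :: "'a mat" where "j = mat (?n + ?m) ?m (\<lambda>(r, c). if r = ?n + c then 1 else 0)"
  define p :: "'a mat" where "p = mat ?n (?n + ?m) (\<lambda>(r, c). if r = c then 1 else 0)"
  define q :: "'a mat" where "q = mat ?m (?n + ?m) (\<lambda>(r, c). if ?n + r = c then 1 else 0)"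
  have d: "dim_row i = ?n + ?m" "dim_col i = ?n" "dim_row j = ?n + ?m" "dim_col j = ?m"
    "dim_row p = ?n" "dim_col p = ?n + ?m" "dim_row q = ?m" "dim_col q = ?n + ?m"
    by (simp_all add: i_def j_def p_def q_def)
  have pi: "p * i = 1\<^sub>m ?n" and qj: "q * j = 1\<^sub>m ?m" and qi: "q * i = 0\<^sub>m ?m ?n" and pj: "p * j = 0\<^sub>m ?n ?m"
    by (rule eq_matI; simp add: d mult_index delta_sums del: index_mult_mat(1); simp add: i_def j_def p_def q_def delta_sums)+
  have ipjq: "i * p + j * q = 1\<^sub>m (?n + ?m)"
  proof (rule eq_matI)
    fix r c assume "r < dim_row (1\<^sub>m (?n + ?m) :: 'a mat)" "c < dim_col (1\<^sub>m (?n + ?m) :: 'a mat)"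
    then have rc: "r < ?n + ?m" "c < ?n + ?m" by auto
    have "(i * p) $$ (r, c) = (if r < ?n \<and> r = c then 1 else 0)"
      using rc by (simp add: d mult_index del: index_mult_mat(1)) (simp add: i_def p_def delta_sums)
    moreover have "(j * q) $$ (r, c) = (if ?n \<le> r \<and> r = c then 1 else 0)"
    proof -
      have "(j * q) $$ (r, c) = (\<Sum>k<?m. (if r = ?n + k then 1 else 0) * (if ?n + k = c then 1 else 0))"
        using rc by (simp add: d mult_index del: index_mult_mat(1)) (simp add: j_def q_def)
      also have "\<dots> = (\<Sum>k<?m. if k = r - ?n then (if ?n \<le> r \<and> r = c then 1 else 0) else 0)"
        by (intro sum.cong refl) auto
      also have "\<dots> = (if ?n \<le> r \<and> r = c then 1 else 0)" using rc by auto
      finally show ?thesis .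
    qed
    ultimately show "(i * p + j * q) $$ (r, c) = 1\<^sub>m (?n + ?m) $$ (r, c)"
      using rc by (auto simp: d simp del: index_mult_mat(1))
  qed (auto simp: d)
  define S where "S = i * (E * p) + j * (F * q)"
  have S: "square_mat S" "dim_row S = ?n + ?m" "dim_col S = ?n + ?m" using d by (auto simp: S_def)
  have iI: "i \<in> intw E S" and jI: "j \<in> intw F S" and pI: "p \<in> intw S E" and qI: "q \<in> intw S F"
  proof -
    have a: "i * E + 0\<^sub>m (?n + ?m) ?n = i * E" "0\<^sub>m (?n + ?m) ?m + j * F = j * F"
      "E * p + 0\<^sub>m ?n (?n + ?m) = E * p" "0\<^sub>m ?m (?n + ?m) + F * q = F * q"
      using d sq by (auto intro!: eq_matI simp del: index_mult_mat(1))
    show "i \<in> intw E S" using sq a by (intro intwI) (simp_all add: S d, simp add: S_def d mat_dim_simps pi qi)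
    show "j \<in> intw F S" using sq a by (intro intwI) (simp_all add: S d, simp add: S_def d mat_dim_simps pj qj)
    show "p \<in> intw S E"
      using sq a by (intro intwI) (simp_all add: S d, simp add: S_def d mat_dim_simps mult_ext[OF pi] mult_ext[OF pj])
    show "q \<in> intw S F"
      using sq a by (intro intwI) (simp_all add: S d, simp add: S_def d mat_dim_simps mult_ext[OF qi] mult_ext[OF qj])
  qed
  have "is_biproduct vcat [E] [F] [S] (cls E S i) (cls F S j) (cls S E p) (cls S F q)"
    unfolding is_biproduct_def
    using sq S(1) iI jI pI qI intw_mult[OF S(1) sq(1) S(1) pI iI] intw_mult[OF S(1) sq(2) S(1) qI jI]
    by (auto simp: vcat_ops vcat_const pi qj qi pj ipjq S(2,3) vcat_HomI simp del: square_mat.simps)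
  then show ?thesis by blast
qed

text \<open>This transfers \<open>intw_regular\<close> to classes. The equation
  \<open>q (f i) = 1\<close> and the clause on equal sizes hold for matrices already; only the
  regularity equation is modulo negligible morphisms.\<close>

lemma vcat_split_regular: "split_regular_category (vcat :: 'a::field concrete_tensor_data) (\<lambda>X. dim_row (hd X))"
proof -
  interpret linear_category "vcat :: 'a concrete_tensor_data" by (rule vcat_linear_category)
  show ?thesis
  proof
    show "\<exists>Z. is_zero_object (vcat :: 'a concrete_tensor_data) Z"
    proof
      show "is_zero_object (vcat :: 'a concrete_tensor_data) [0\<^sub>m 0 0]"
      proof (rule zero_object_if_Id_Zero)
        have "1\<^sub>m 0 = (0\<^sub>m 0 0 :: 'a mat)" by (rule eq_matI) auto
        then show "lincat.Id vcat [0\<^sub>m 0 0] = Zero vcat [0\<^sub>m 0 0] [0\<^sub>m 0 0 :: 'a mat]" by (simp add: vcat_const)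
      qed auto
    qed
    fix X Y assume "X \<in> Obj (vcat :: 'a concrete_tensor_data)" "Y \<in> Obj (vcat :: 'a concrete_tensor_data)"
    then obtain E F where 1: "X = [E]" "Y = [F]" and sq: "square_mat E" "square_mat F"
      by (auto simp del: square_mat.simps)
    show "\<exists>S i j p q. is_biproduct vcat X Y S i j p q" unfolding 1 by (rule vcat_biproduct[OF sq])
    fix f assume "f \<in> Hom vcat X Y"
    then obtain f' where f: "f' \<in> intw E F" "f = cls E F f'" by (auto simp: 1 vcat_Hom)
    obtain R i q where r: "square_mat R" "i \<in> intw R E" "q \<in> intw F R" "q * (f' * i) = 1\<^sub>m (dim_row R)"
      "treq E F (f' * (i * (q * f'))) f'" "dim_row R \<le> dim_row E"
      "dim_row R = dim_row E \<longrightarrow> i * (q * f') = 1\<^sub>m (dim_row E)"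
      using intw_regular[OF sq f(1)] by blast
    note fi = intw_mult[OF r(1) sq r(2) f(1)] and qf = intw_mult[OF sq r(1) f(1) r(3)]
    note iqf = intw_mult[OF sq(1) r(1) sq(1) qf r(2)]
    note fiqf = intw_mult[OF sq(1,1,2) iqf f(1)]
    have "cls E F (f' * (i * (q * f'))) = cls E F f'" using r(5) cls_eq_iff[OF fiqf f(1)] by simp
    then show "\<exists>R\<in>Obj vcat. \<exists>i\<in>Hom vcat R X. \<exists>q\<in>Hom vcat Y R.
      Comp vcat q (Comp vcat f i) = lincat.Id vcat R \<and> Comp vcat f (Comp vcat i (Comp vcat q f)) = f \<and>
      dim_row (hd R) \<le> dim_row (hd X) \<and>
      (dim_row (hd R) = dim_row (hd X) \<longrightarrow> Comp vcat i (Comp vcat q f) = lincat.Id vcat X)"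
      unfolding 1 f(2)
      by (intro bexI[of _ "[R]"] bexI[of _ "cls R E i"] bexI[of _ "cls F R q"] conjI impI)
        (use sq r f(1) fi qf iqf in \<open>auto simp: vcat_ops vcat_const vcat_HomI simp del: square_mat.simps\<close>)
  qed
qed


subsection \<open>Finite dimension of the spaces of morphisms\<close>

definition mat_comb :: "nat \<Rightarrow> nat \<Rightarrow> 'a::field list \<Rightarrow> 'a mat list \<Rightarrow> 'a mat" where
  "mat_comb n m cs fs = foldr (+) (map2 (\<cdot>\<^sub>m) cs fs) (0\<^sub>m n m)"

lemma mat_comb_intw:
  assumes "square_mat E" "square_mat F" "length cs = length fs" "set fs \<subseteq> intw E F"
  shows "mat_comb (dim_row F) (dim_row E) cs fs \<in> intw E F"
  using assms(3,4)
proof (induction cs fs rule: list_induct2)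
  case Nil then show ?case using intw_zero[OF assms(1,2)] by (simp add: mat_comb_def)
next
  case (Cons c cs f fs)
  then show ?case using intw_add[OF assms(1,2) intw_smult[OF assms(1,2), of f c]] by (simp add: mat_comb_def)
qed

lemma lin_comb_cls:
  assumes "square_mat E" "square_mat F" "length cs = length fs" "set fs \<subseteq> intw E F"
  shows "lin_comb vcat [E] [F] cs (map (cls E F) fs) = cls E F (mat_comb (dim_row F) (dim_row E) cs fs)"
  using assms(3,4)
proof (induction cs fs rule: list_induct2)
  case Nil then show ?case by (simp add: lin_comb_def mat_comb_def vcat_const)
next
  case (Cons c cs f fs)
  then have "lin_comb vcat [E] [F] (c # cs) (map (cls E F) (f # fs)) =
    Add vcat (cls E F (c \<cdot>\<^sub>m f)) (cls E F (mat_comb (dim_row F) (dim_row E) cs fs))"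
    using assms(1,2) by (simp add: lin_comb_def vcat_ops del: square_mat.simps)
  also have "\<dots> = cls E F (c \<cdot>\<^sub>m f + mat_comb (dim_row F) (dim_row E) cs fs)"
    using Cons mat_comb_intw[OF assms(1,2) Cons(1)] by (intro vcat_Add assms intw_smult) auto
  finally show ?case by (simp add: mat_comb_def)
qed

lemma tr_mat_comb:
  assumes "square_mat E" "square_mat F" "length cs = length fs" "set fs \<subseteq> intw E F" "g \<in> intw F E"
  shows "tr (g * mat_comb (dim_row F) (dim_row E) cs fs) = (\<Sum>j<length fs. cs ! j * tr (g * fs ! j))"
  using assms(3,4)
proof (induction cs fs rule: list_induct2)
  case Nil then show ?case using intw_dim[OF assms(5)] by (simp add: mat_comb_def)
next
  case (Cons c cs f fs)
  have f: "f \<in> intw E F" using Cons by simp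
  have k: "mat_comb (dim_row F) (dim_row E) cs fs \<in> intw E F" using mat_comb_intw[OF assms(1,2) Cons(1)] Cons(3) by simp
  have "tr (g * mat_comb (dim_row F) (dim_row E) (c # cs) (f # fs)) =
    tr (g * (c \<cdot>\<^sub>m f + mat_comb (dim_row F) (dim_row E) cs fs))" by (simp add: mat_comb_def)
  also have "\<dots> = c * tr (g * f) + tr (g * mat_comb (dim_row F) (dim_row E) cs fs)"
    using intw_dim(1,2)[OF assms(5)] intw_dim(1,2)[OF f] intw_dim(1,2)[OF k]
    by (simp add: mult_add_dim mult_smult_dim tr_add tr_smult)
  finally show ?case using Cons by (simp add: sum.lessThan_Suc_shift del: sum.lessThan_Suc)
qed

text \<open>The dimension bound comes from a maximal pair of dual families for the trace pairing: flattened, they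
  form two matrices with product the identity.\<close>

lemma dual_family_length:
  fixes E F :: "'a::field mat"
  assumes "square_mat E" "square_mat F" "length fs = r" "length gs = r" "set fs \<subseteq> intw E F" "set gs \<subseteq> intw F E"
    and dual: "\<And>i j. \<lbrakk>i < r; j < r\<rbrakk> \<Longrightarrow> tr (gs ! i * fs ! j) = (if i = j then 1 else 0)"
  shows "r \<le> dim_row E * dim_row F"
proof -
  let ?n = "dim_row E" and ?m = "dim_row F"
  define A where "A = mat r (?n * ?m) (\<lambda>(i, c). (gs ! i) $$ (c div ?m, c mod ?m))"
  define B where "B = mat (?n * ?m) r (\<lambda>(c, j). (fs ! j) $$ (c mod ?m, c div ?m))"
  have AB: "A \<in> carrier_mat r (?n * ?m)" "B \<in> carrier_mat (?n * ?m) r" by (simp_all add: A_def B_def)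
  have "A * B = 1\<^sub>m r"
  proof (rule eq_matI)
    fix i j assume "i < dim_row (1\<^sub>m r :: 'a mat)" "j < dim_col (1\<^sub>m r :: 'a mat)"
    then have ij: "i < r" "j < r" by auto
    have g: "gs ! i \<in> intw F E" and f: "fs ! j \<in> intw E F" using assms(3-6) ij by auto
    have "(A * B) $$ (i, j) = (\<Sum>a<?n. \<Sum>b<?m. (gs ! i) $$ (a, b) * (fs ! j) $$ (b, a))"
      using ij AB by (subst mult_index) (auto simp: A_def B_def sum_pair pair_index_less)
    also have "\<dots> = tr (gs ! i * fs ! j)"
      using intw_dim(1,2)[OF f] intw_dim(1,2)[OF g]
      by (auto simp: tr_def mult_index simp del: index_mult_mat(1) intro!: sum.cong)
    finally show "(A * B) $$ (i, j) = 1\<^sub>m r $$ (i, j)" using dual[OF ij] ij by simp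
  qed (use AB in auto)
  then show ?thesis by (rule left_inverse_le[OF AB])
qed

text \<open>A maximal dual pair of families spans modulo negligible morphisms: what remains of
  \<open>f\<close> after subtracting its expansion pairs to zero with all \<open>gs\<close>, and if
  it were not negligible the families could be enlarged as in the Gram-Schmidt process.\<close>

lemma vcat_fin_dim:
  fixes E F :: "'a::field mat"
  assumes sq: "square_mat E" "square_mat F"
  shows "fin_dim_Hom vcat [E] [F]"
proof -
  define dual where "dual r fs gs \<longleftrightarrow> length fs = r \<and> length gs = r \<and> set fs \<subseteq> intw E F \<and> set gs \<subseteq> intw F E \<and>
    (\<forall>i<r. \<forall>j<r. tr (gs ! i * fs ! j) = (if i = j then 1 else 0))" for r fs gs
  define P where "P r \<longleftrightarrow> (\<exists>fs gs. dual r fs gs)" for r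
  have "P 0" by (auto simp: P_def dual_def)
  moreover have "r \<le> dim_row E * dim_row F" if r: "P r" for r
  proof -
    obtain fs gs where "dual r fs gs" using r unfolding P_def by blast
    then show ?thesis unfolding dual_def by (intro dual_family_length[OF sq, of fs r gs]) auto
  qed
  ultimately obtain r where "P r" and max: "\<And>s. r < s \<Longrightarrow> \<not> P s" using ex_max_nat by metis
  then obtain fs gs where fg: "dual r fs gs" unfolding P_def by blast
  have l: "length fs = r" "length gs = r" and s: "set fs \<subseteq> intw E F" "set gs \<subseteq> intw F E"
    and d: "\<And>i j. \<lbrakk>i < r; j < r\<rbrakk> \<Longrightarrow> tr (gs ! i * fs ! j) = (if i = j then 1 else 0)"
    using fg unfolding dual_def by auto
  have gi: "gs ! i \<in> intw F E" and fi: "fs ! i \<in> intw E F" if "i < r" for i using that l s by auto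
  have span: "treq E F f (mat_comb (dim_row F) (dim_row E) (map (\<lambda>g. tr (g * f)) gs) fs)" if f: "f \<in> intw E F" for f
  proof (rule ccontr)
    define cs where "cs = map (\<lambda>g. tr (g * f)) gs"
    define f0 where "f0 = mat_comb (dim_row F) (dim_row E) cs fs"
    assume "\<not> treq E F f (mat_comb (dim_row F) (dim_row E) (map (\<lambda>g. tr (g * f)) gs) fs)"
    then obtain g where g: "g \<in> intw F E" and ne: "tr (g * f) \<noteq> tr (g * f0)"
      unfolding treq_def f0_def cs_def by blast
    have lc: "length cs = length fs" using l by (simp add: cs_def)
    have f0: "f0 \<in> intw E F" unfolding f0_def by (rule mat_comb_intw[OF sq lc s(1)])
    define f1 where "f1 = f - f0"
    have f1: "f1 \<in> intw E F" unfolding f1_def by (rule intw_minus[OF sq f f0])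
    have tf1: "tr (h * f1) = tr (h * f) - tr (h * f0)" if "h \<in> intw F E" for h
      using intw_dim(1,2)[OF f] intw_dim(1,2)[OF f0] intw_dim(1,2)[OF that]
      by (simp add: f1_def mult_minus_dim tr_minus)
    have gf1: "tr (gs ! i * f1) = 0" if i: "i < r" for i
    proof -
      have "tr (gs ! i * f0) = (\<Sum>j<r. cs ! j * (if j = i then 1 else 0))"
        unfolding f0_def tr_mat_comb[OF sq lc s(1) gi[OF i]] using l d i by (intro sum.cong) auto
      also have "\<dots> = cs ! i" using i by (simp add: delta_sums)
      also have "\<dots> = tr (gs ! i * f)" using i l by (simp add: cs_def)
      finally show ?thesis using tf1[OF gi[OF i]] by simp
    qed
    define c where "c = tr (g * f1)"
    have c: "c \<noteq> 0" using ne tf1[OF g] by (simp add: c_def)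
    define ds where "ds = map (\<lambda>f. tr (g * f)) fs"
    define g0 where "g0 = mat_comb (dim_row E) (dim_row F) ds gs"
    have ld: "length ds = length gs" using l by (simp add: ds_def)
    have g0: "g0 \<in> intw F E" unfolding g0_def by (rule mat_comb_intw[OF sq(2,1) ld s(2)])
    \<comment> \<open>Subtracting \<open>g0\<close> makes the new functional vanish on all old
      \<open>fs\<close>; the factor normalizes its value on \<open>f1\<close> to 1.\<close>
    define g1 where "g1 = (1 / c) \<cdot>\<^sub>m (g - g0)"
    have g1: "g1 \<in> intw F E" unfolding g1_def by (intro intw_smult intw_minus sq g g0)
    have tg1: "tr (g1 * k) = (tr (g * k) - (\<Sum>j<r. ds ! j * tr (gs ! j * k))) / c" if k: "k \<in> intw E F" for k
    proof -
      have "tr (g1 * k) = (tr (g * k) - tr (g0 * k)) / c"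
        using intw_dim(1,2)[OF g] intw_dim(1,2)[OF g0] intw_dim(1,2)[OF k]
        by (simp add: g1_def smult_mult_dim minus_mult_dim tr_smult tr_minus)
      also have "tr (g0 * k) = tr (k * g0)" using intw_dim(1,2)[OF g0] intw_dim(1,2)[OF k] by (intro tr_comm) auto
      also have "\<dots> = (\<Sum>j<r. ds ! j * tr (k * gs ! j))" unfolding g0_def tr_mat_comb[OF sq(2,1) ld s(2) k] l ..
      also have "\<dots> = (\<Sum>j<r. ds ! j * tr (gs ! j * k))"
      proof (intro sum.cong refl)
        fix j assume "j \<in> {..<r}"
        then have gj: "gs ! j \<in> intw F E" using gi by simp
        have "tr (k * gs ! j) = tr (gs ! j * k)"
          using intw_dim(1,2)[OF gj] intw_dim(1,2)[OF k] by (intro tr_comm) auto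
        then show "ds ! j * tr (k * gs ! j) = ds ! j * tr (gs ! j * k)" by simp
      qed
      finally show ?thesis .
    qed
    have "tr (g1 * f1) = 1" using tg1[OF f1] gf1 c by (simp add: c_def)
    moreover have "tr (g1 * fs ! j) = 0" if j: "j < r" for j
    proof -
      have "(\<Sum>i<r. ds ! i * tr (gs ! i * fs ! j)) = (\<Sum>i<r. ds ! i * (if i = j then 1 else 0))"
        using d j by (intro sum.cong) auto
      also have "\<dots> = tr (g * fs ! j)" using j l by (simp add: delta_sums ds_def)
      finally show ?thesis using tg1[OF fi[OF j]] by simp
    qed
    ultimately have "dual (Suc r) (fs @ [f1]) (gs @ [g1])"
      unfolding dual_def using l s f1 g1 gf1 d by (auto simp: nth_append less_Suc_eq)
    then show False using max[of "Suc r"] unfolding P_def by blast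
  qed
  show ?thesis
    unfolding fin_dim_Hom_def
  proof (intro exI[of _ "map (cls E F) fs"] conjI ballI)
    show "set (map (cls E F) fs) \<subseteq> Hom vcat [E] [F]" using s by (auto intro!: vcat_HomI)
    fix h assume "h \<in> Hom vcat [E] [F]"
    then obtain f where f: "f \<in> intw E F" "h = cls E F f" by (auto simp: vcat_Hom)
    let ?cs = "map (\<lambda>g. tr (g * f)) gs"
    have lc: "length ?cs = length fs" using l by simp
    have "h = cls E F (mat_comb (dim_row F) (dim_row E) ?cs fs)"
      unfolding f(2) using cls_eq_iff[OF f(1) mat_comb_intw[OF sq lc s(1)]] span[OF f(1)] by simp
    then have "h = lin_comb vcat [E] [F] ?cs (map (cls E F) fs)"
      unfolding lin_comb_cls[OF sq lc s(1)] .
    then show "\<exists>as. length as = length (map (cls E F) fs) \<and> h = lin_comb vcat [E] [F] as (map (cls E F) fs)"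
      using l by (intro exI[of _ ?cs]) auto
  qed
qed

lemma vcat_locally_finite: "locally_finite_abelian_category (vcat :: 'a::field concrete_tensor_data)"
proof -
  interpret split_regular_category "vcat :: 'a concrete_tensor_data" "\<lambda>X. dim_row (hd X)"
    by (rule vcat_split_regular)
  show ?thesis
  proof (intro locally_finite_abelian_category.intro locally_finite_abelian_category_axioms.intro)
    show "abelian_linear_category (vcat :: 'a concrete_tensor_data)" by unfold_locales
    fix X assume X: "X \<in> Obj (vcat :: 'a concrete_tensor_data)"
    show "finite_length vcat X" by (rule ex_finite_length[OF X])
    fix Y assume "Y \<in> Obj (vcat :: 'a concrete_tensor_data)"
    then show "fin_dim_Hom vcat X Y" using X vcat_fin_dim by (auto simp del: square_mat.simps)
  qed
qed


subsection \<open>The monoidal structure\<close>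

lemma (in category) inverse_mor_Id: "X \<in> Obj C \<Longrightarrow> inverse_mor C X X (lincat.Id C X) (lincat.Id C X)"
  unfolding inverse_mor_def using Id_in_Hom[of X] Comp_Id[of X X] by auto

lemma (in category) Inv_Id: "X \<in> Obj C \<Longrightarrow> Inv C X X (lincat.Id C X) = lincat.Id C X"
  unfolding Inv_def
  by (rule the_equality) (use inverse_mor_Id Comp_Id Id_Comp in \<open>auto simp: inverse_mor_def\<close>)

lemma unit_square [simp]: "square_mat (0\<^sub>m n n :: 'a::zero mat)"
  by simp

text \<open>With all structure maps equal to identities, the coherence axioms reduce to equalities
  between sources and targets, which \<open>tsum_assoc\<close> and \<open>tsum_unit\<close>
  supply.\<close>

lemma vcat_monoidal: "monoidal_linear_category (vcat :: 'a::field concrete_tensor_data)"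
proof -
  interpret linear_category "vcat :: 'a concrete_tensor_data" by (rule vcat_linear_category)
  have id_iso: "is_iso vcat X X (lincat.Id vcat X)" if "X \<in> Obj (vcat :: 'a concrete_tensor_data)" for X
    unfolding is_iso_def using inverse_mor_Id[OF that] by blast
  show ?thesis
  proof
    show "Unit vcat \<in> Obj (vcat :: 'a concrete_tensor_data)" by simp
  next
    fix X Y assume "X \<in> Obj (vcat :: 'a concrete_tensor_data)" "Y \<in> Obj (vcat :: 'a concrete_tensor_data)"
    then obtain E F where 1: "X = [E]" "Y = [F]" and sq: "square_mat E" "square_mat F"
      by (auto simp del: square_mat.simps)
    show "Tensor vcat X Y \<in> Obj vcat" using sq by (simp add: 1)
    show "TensorM vcat (lincat.Id vcat X) (lincat.Id vcat Y) = lincat.Id vcat (Tensor vcat X Y)"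
      using sq by (simp add: 1 vcat_const vcat_TensorM intw_one del: square_mat.simps)
    have u: "tsum (tsum E (0\<^sub>m 1 1)) F = tsum E F" using tsum_unit(2)[OF sq(1)] by simp
    have sqt: "square_mat (tsum E F)" using sq by simp
    show "Comp vcat (TensorM vcat (lincat.Id vcat X) (LUnit vcat Y)) (Assoc vcat X (Unit vcat) Y) =
      TensorM vcat (RUnit vcat X) (lincat.Id vcat Y)"
      unfolding 1 vcat_obj vcat_Assoc u
      using sq sqt intw_one[OF sqt]
      by (simp add: vcat_const vcat_TensorM vcat_Comp intw_one del: square_mat.simps)
    fix f assume "f \<in> Hom vcat X Y"
    then obtain f' where f: "f' \<in> intw E F" "f = cls E F f'" by (auto simp: 1 vcat_Hom)
    note d = intw_dim(1,2)[OF f(1)]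
    have uI: "1\<^sub>m 1 \<in> intw (0\<^sub>m 1 1) (0\<^sub>m 1 1 :: 'a mat)" using intw_one[of "0\<^sub>m 1 1 :: 'a mat"] by simp
    show "Comp vcat (LUnit vcat Y) (TensorM vcat (lincat.Id vcat (Unit vcat)) f) = Comp vcat f (LUnit vcat X)"
      using sq f d intw_one[OF sq(1)] intw_one[OF sq(2)]
      by (simp add: 1 vcat_const vcat_TensorM[OF _ _ sq uI f(1)] tsum_unit vcat_Comp del: square_mat.simps One_nat_def)
    show "Comp vcat (RUnit vcat Y) (TensorM vcat f (lincat.Id vcat (Unit vcat))) = Comp vcat f (RUnit vcat X)"
      using sq f d intw_one[OF sq(1)] intw_one[OF sq(2)]
      by (simp add: 1 vcat_const vcat_TensorM[OF sq _ _ f(1) uI] tsum_unit vcat_Comp del: square_mat.simps One_nat_def)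
  next
    fix X X' Y Y' f g
    assume "X \<in> Obj (vcat :: 'a concrete_tensor_data)" "X' \<in> Obj (vcat :: 'a concrete_tensor_data)"
      "Y \<in> Obj (vcat :: 'a concrete_tensor_data)" "Y' \<in> Obj (vcat :: 'a concrete_tensor_data)"
      "f \<in> Hom vcat X X'" "g \<in> Hom vcat Y Y'"
    then obtain E E' F F' f' g' where 1: "X = [E]" "X' = [E']" "Y = [F]" "Y' = [F']"
      and sq: "square_mat E" "square_mat E'" "square_mat F" "square_mat F'"
      and fg: "f' \<in> intw E E'" "g' \<in> intw F F'" "f = cls E E' f'" "g = cls F F' g'"
      by (auto simp: vcat_Hom simp del: square_mat.simps)
    note k = intw_kron[OF sq fg(1,2)]
    show "TensorM vcat f g \<in> Hom vcat (Tensor vcat X Y) (Tensor vcat X' Y')"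
      unfolding 1 fg(3,4) vcat_obj vcat_TensorM[OF sq fg(1,2)] by (rule vcat_HomI[OF k])
    fix a
    show "TensorM vcat (Scale vcat a f) g = Scale vcat a (TensorM vcat f g)"
      "TensorM vcat f (Scale vcat a g) = Scale vcat a (TensorM vcat f g)"
      using sq fg k intw_smult[OF sq(1,2) fg(1), of a] intw_smult[OF sq(3,4) fg(2), of a]
      by (simp_all add: vcat_ops kron_smult del: square_mat.simps)
  next
    fix X X' Y Y' f f' g
    assume "X \<in> Obj (vcat :: 'a concrete_tensor_data)" "X' \<in> Obj (vcat :: 'a concrete_tensor_data)"
      "Y \<in> Obj (vcat :: 'a concrete_tensor_data)" "Y' \<in> Obj (vcat :: 'a concrete_tensor_data)"
      "f \<in> Hom vcat X X'" "f' \<in> Hom vcat X X'" "g \<in> Hom vcat Y Y'"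
    then obtain E E' F F' f1 f2 g1 where 1: "X = [E]" "X' = [E']" "Y = [F]" "Y' = [F']"
      and sq: "square_mat E" "square_mat E'" "square_mat F" "square_mat F'"
      and fg: "f1 \<in> intw E E'" "f2 \<in> intw E E'" "g1 \<in> intw F F'" "f = cls E E' f1" "f' = cls E E' f2" "g = cls F F' g1"
      by (auto simp: vcat_Hom simp del: square_mat.simps)
    show "TensorM vcat (Add vcat f f') g = Add vcat (TensorM vcat f g) (TensorM vcat f' g)"
      using sq fg intw_kron[OF sq fg(1,3)] intw_kron[OF sq fg(2,3)] intw_add[OF sq(1,2) fg(1,2)]
        intw_dim(1,2)[OF fg(1)] intw_dim(1,2)[OF fg(2)]
      by (simp add: vcat_ops kron_add del: square_mat.simps)
  next
    fix X X' Y Y' f g g'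
    assume "X \<in> Obj (vcat :: 'a concrete_tensor_data)" "X' \<in> Obj (vcat :: 'a concrete_tensor_data)"
      "Y \<in> Obj (vcat :: 'a concrete_tensor_data)" "Y' \<in> Obj (vcat :: 'a concrete_tensor_data)"
      "f \<in> Hom vcat X X'" "g \<in> Hom vcat Y Y'" "g' \<in> Hom vcat Y Y'"
    then obtain E E' F F' f1 g1 g2 where 1: "X = [E]" "X' = [E']" "Y = [F]" "Y' = [F']"
      and sq: "square_mat E" "square_mat E'" "square_mat F" "square_mat F'"
      and fg: "f1 \<in> intw E E'" "g1 \<in> intw F F'" "g2 \<in> intw F F'" "f = cls E E' f1" "g = cls F F' g1" "g' = cls F F' g2"
      by (auto simp: vcat_Hom simp del: square_mat.simps)
    show "TensorM vcat f (Add vcat g g') = Add vcat (TensorM vcat f g) (TensorM vcat f g')"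
      using sq fg intw_kron[OF sq fg(1,2)] intw_kron[OF sq fg(1,3)] intw_add[OF sq(3,4) fg(2,3)]
        intw_dim(1,2)[OF fg(2)] intw_dim(1,2)[OF fg(3)]
      by (simp add: vcat_ops kron_add del: square_mat.simps)
  next
    fix X X' X'' Y Y' Y'' f f' g g'
    assume "X \<in> Obj (vcat :: 'a concrete_tensor_data)" "X' \<in> Obj (vcat :: 'a concrete_tensor_data)"
      "X'' \<in> Obj (vcat :: 'a concrete_tensor_data)"
      "Y \<in> Obj (vcat :: 'a concrete_tensor_data)" "Y' \<in> Obj (vcat :: 'a concrete_tensor_data)"
      "Y'' \<in> Obj (vcat :: 'a concrete_tensor_data)"
      "f \<in> Hom vcat X X'" "f' \<in> Hom vcat X' X''" "g \<in> Hom vcat Y Y'" "g' \<in> Hom vcat Y' Y''"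
    then obtain E E' E'' F F' F'' f1 f2 g1 g2 where 1: "X = [E]" "X' = [E']" "X'' = [E'']" "Y = [F]" "Y' = [F']" "Y'' = [F'']"
      and sq: "square_mat E" "square_mat E'" "square_mat E''" "square_mat F" "square_mat F'" "square_mat F''"
      and fg: "f1 \<in> intw E E'" "f2 \<in> intw E' E''" "g1 \<in> intw F F'" "g2 \<in> intw F' F''"
        "f = cls E E' f1" "f' = cls E' E'' f2" "g = cls F F' g1" "g' = cls F' F'' g2"
      by (auto simp: vcat_Hom simp del: square_mat.simps)
    have sqt: "square_mat (tsum E F)" "square_mat (tsum E' F')" "square_mat (tsum E'' F'')" using sq by auto
    show "TensorM vcat (Comp vcat f' f) (Comp vcat g' g) = Comp vcat (TensorM vcat f' g') (TensorM vcat f g)"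
      using sq sqt fg intw_kron[OF sq(1,2,4,5) fg(1,3)] intw_kron[OF sq(2,3,5,6) fg(2,4)]
        intw_mult[OF sq(1-3) fg(1,2)] intw_mult[OF sq(4-6) fg(3,4)]
        intw_dim(1,2)[OF fg(1)] intw_dim(1,2)[OF fg(2)] intw_dim(1,2)[OF fg(3)] intw_dim(1,2)[OF fg(4)]
      by (simp add: vcat_ops kron_mult del: square_mat.simps)
  next
    fix X Y Z
    assume "X \<in> Obj (vcat :: 'a concrete_tensor_data)" "Y \<in> Obj (vcat :: 'a concrete_tensor_data)"
      "Z \<in> Obj (vcat :: 'a concrete_tensor_data)"
    then obtain E F G where 1: "X = [E]" "Y = [F]" "Z = [G]"
      and sq: "square_mat E" "square_mat F" "square_mat G" by (auto simp del: square_mat.simps)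
    have "is_iso vcat [tsum (tsum E F) G] [tsum (tsum E F) G] (lincat.Id vcat [tsum (tsum E F) G])"
      by (rule id_iso) (use sq in simp)
    then show "is_iso vcat (Tensor vcat (Tensor vcat X Y) Z) (Tensor vcat X (Tensor vcat Y Z)) (Assoc vcat X Y Z)"
      by (simp add: 1 vcat_Assoc tsum_assoc[OF sq])
    have "tsum (0\<^sub>m 1 1) E = E" "tsum E (0\<^sub>m 1 1) = E" using tsum_unit[OF sq(1)] .
    then show "is_iso vcat (Tensor vcat (Unit vcat) X) X (LUnit vcat X)" "is_iso vcat (Tensor vcat X (Unit vcat)) X (RUnit vcat X)"
      using id_iso[of "[E]"] sq(1) by (simp_all add: 1 vcat_const(3,4))
  next
    fix X X' Y Y' Z Z' f g h
    assume "X \<in> Obj (vcat :: 'a concrete_tensor_data)" "X' \<in> Obj (vcat :: 'a concrete_tensor_data)"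
      "Y \<in> Obj (vcat :: 'a concrete_tensor_data)" "Y' \<in> Obj (vcat :: 'a concrete_tensor_data)"
      "Z \<in> Obj (vcat :: 'a concrete_tensor_data)" "Z' \<in> Obj (vcat :: 'a concrete_tensor_data)"
      "f \<in> Hom vcat X X'" "g \<in> Hom vcat Y Y'" "h \<in> Hom vcat Z Z'"
    then obtain E E' F F' G G' f' g' h' where 1: "X = [E]" "X' = [E']" "Y = [F]" "Y' = [F']" "Z = [G]" "Z' = [G']"
      and sq: "square_mat E" "square_mat E'" "square_mat F" "square_mat F'" "square_mat G" "square_mat G'"
      and fg: "f' \<in> intw E E'" "g' \<in> intw F F'" "h' \<in> intw G G'" "f = cls E E' f'" "g = cls F F' g'" "h = cls G G' h'"
      by (auto simp: vcat_Hom simp del: square_mat.simps)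
    have sqt: "square_mat (tsum E F)" "square_mat (tsum E' F')" "square_mat (tsum F G)" "square_mat (tsum F' G')"
      using sq by auto
    note gh = intw_kron[OF sq(3-6) fg(2,3)]
    have fgh: "kron f' (kron g' h') \<in> intw (tsum E (tsum F G)) (tsum E' (tsum F' G'))"
      by (rule intw_kron[OF sq(1,2) sqt(3,4) fg(1) gh])
    have "TensorM vcat (TensorM vcat f g) h = cls (tsum E (tsum F G)) (tsum E' (tsum F' G')) (kron f' (kron g' h'))"
      using sq sqt fg intw_kron[OF sq(1-4) fg(1,2)]
      by (simp add: vcat_TensorM kron_assoc tsum_assoc del: square_mat.simps)
    moreover have "TensorM vcat f (TensorM vcat g h) = cls (tsum E (tsum F G)) (tsum E' (tsum F' G')) (kron f' (kron g' h'))"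
      using sq sqt fg gh by (simp add: vcat_TensorM del: square_mat.simps)
    moreover have "cls (tsum E (tsum F G)) (tsum E' (tsum F' G')) (kron f' (kron g' h'))
      \<in> Hom vcat [tsum E (tsum F G)] [tsum E' (tsum F' G')]" by (rule vcat_HomI[OF fgh])
    moreover have "[tsum E (tsum F G)] \<in> Obj vcat" "[tsum E' (tsum F' G')] \<in> Obj vcat" using sq by auto
    ultimately show "Comp vcat (Assoc vcat X' Y' Z') (TensorM vcat (TensorM vcat f g) h) =
      Comp vcat (TensorM vcat f (TensorM vcat g h)) (Assoc vcat X Y Z)"
      using sq unfolding 1 vcat_Assoc
      by (simp add: tsum_assoc Comp_Id Id_Comp del: square_mat.simps vcat_obj)
  next
    fix W X Y Z
    assume "W \<in> Obj (vcat :: 'a concrete_tensor_data)" "X \<in> Obj (vcat :: 'a concrete_tensor_data)"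
      "Y \<in> Obj (vcat :: 'a concrete_tensor_data)" "Z \<in> Obj (vcat :: 'a concrete_tensor_data)"
    then obtain D E F G where 1: "W = [D]" "X = [E]" "Y = [F]" "Z = [G]"
      and sq: "square_mat D" "square_mat E" "square_mat F" "square_mat G" by (auto simp del: square_mat.simps)
    let ?T = "tsum D (tsum E (tsum F G))"
    have sqt: "square_mat ?T" "square_mat (tsum D (tsum E F))" "square_mat (tsum E (tsum F G))" "square_mat (tsum F G)"
      "square_mat (tsum E F)" "square_mat (tsum D E)"
      using sq by auto
    have T: "[?T] \<in> Obj vcat" using sq by simp
    have t: "TensorM vcat (lincat.Id vcat [A]) (lincat.Id vcat [B]) = lincat.Id vcat [tsum A B]"
      if "square_mat A" "square_mat B" for A B :: "'a mat"
      using that by (simp add: vcat_const vcat_TensorM intw_one del: square_mat.simps)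
    show "Comp vcat (Assoc vcat W X (Tensor vcat Y Z)) (Assoc vcat (Tensor vcat W X) Y Z) =
      Comp vcat (TensorM vcat (lincat.Id vcat W) (Assoc vcat X Y Z))
        (Comp vcat (Assoc vcat W (Tensor vcat X Y) Z) (TensorM vcat (Assoc vcat W X Y) (lincat.Id vcat Z)))"
      unfolding 1 vcat_obj vcat_Assoc
      using sq sqt Comp_Id[OF T T Id_in_Hom[OF T]] by (simp add: t tsum_assoc del: square_mat.simps)
  qed
qed

lemma vcat_symmetric: "symmetric_monoidal_linear_category (vcat :: 'a::field concrete_tensor_data)"
proof -
  interpret monoidal_linear_category "vcat :: 'a concrete_tensor_data" by (rule vcat_monoidal)
  show ?thesis
  proof
    fix X Y assume "X \<in> Obj (vcat :: 'a concrete_tensor_data)" "Y \<in> Obj (vcat :: 'a concrete_tensor_data)"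
    then obtain E F where 1: "X = [E]" "Y = [F]" and sq: "square_mat E" "square_mat F"
      by (auto simp del: square_mat.simps)
    have sqt: "square_mat (tsum E F)" "square_mat (tsum F E)" using sq by auto
    show "Braid vcat X Y \<in> Hom vcat (Tensor vcat X Y) (Tensor vcat Y X)"
      unfolding 1 vcat_const vcat_obj by (rule vcat_HomI[OF intw_braid[OF sq]])
    show "Comp vcat (Braid vcat Y X) (Braid vcat X Y) = lincat.Id vcat (Tensor vcat X Y)"
      using vcat_Comp[OF sqt(1,2,1) intw_braid[OF sq(2,1)] intw_braid[OF sq]]
      by (simp add: 1 vcat_const braid_symmetric del: square_mat.simps)
  next
    fix X X' Y Y' f g
    assume "X \<in> Obj (vcat :: 'a concrete_tensor_data)" "X' \<in> Obj (vcat :: 'a concrete_tensor_data)"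
      "Y \<in> Obj (vcat :: 'a concrete_tensor_data)" "Y' \<in> Obj (vcat :: 'a concrete_tensor_data)"
      "f \<in> Hom vcat X X'" "g \<in> Hom vcat Y Y'"
    then obtain E E' F F' f' g' where 1: "X = [E]" "X' = [E']" "Y = [F]" "Y' = [F']"
      and sq: "square_mat E" "square_mat E'" "square_mat F" "square_mat F'"
      and fg: "f' \<in> intw E E'" "g' \<in> intw F F'" "f = cls E E' f'" "g = cls F F' g'"
      by (auto simp: vcat_Hom simp del: square_mat.simps)
    have sqt: "square_mat (tsum E F)" "square_mat (tsum E' F')" "square_mat (tsum F E)" "square_mat (tsum F' E')"
      using sq by auto
    have c: "f' \<in> carrier_mat (dim_row E') (dim_row E)" "g' \<in> carrier_mat (dim_row F') (dim_row F)"
      using intw_dim[OF fg(1)] intw_dim[OF fg(2)] by auto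
    show "Comp vcat (Braid vcat X' Y') (TensorM vcat f g) = Comp vcat (TensorM vcat g f) (Braid vcat X Y)"
      using vcat_Comp[OF sqt(1,2,4) intw_braid[OF sq(2,4)] intw_kron[OF sq fg(1,2)]]
        vcat_Comp[OF sqt(1,3,4) intw_kron[OF sq(3,4,1,2) fg(2,1)] intw_braid[OF sq(1,3)]]
        sq fg by (simp add: 1 vcat_const vcat_TensorM braid_natural[OF c] del: square_mat.simps)
  next
    fix X Y Z
    assume "X \<in> Obj (vcat :: 'a concrete_tensor_data)" "Y \<in> Obj (vcat :: 'a concrete_tensor_data)"
      "Z \<in> Obj (vcat :: 'a concrete_tensor_data)"
    then obtain E F G where 1: "X = [E]" "Y = [F]" "Z = [G]"
      and sq: "square_mat E" "square_mat F" "square_mat G" by (auto simp del: square_mat.simps)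
    have sqt: "square_mat (tsum E (tsum F G))" "square_mat (tsum F (tsum E G))" "square_mat (tsum F (tsum G E))"
      "square_mat (tsum E G)" "square_mat (tsum G E)" "square_mat (tsum F G)" "square_mat (tsum E F)" "square_mat (tsum F E)"
      using sq by auto
    have T: "[tsum E (tsum F G)] \<in> Obj vcat" "[tsum F (tsum E G)] \<in> Obj vcat" "[tsum F (tsum G E)] \<in> Obj vcat"
      using sq by auto
    have B: "Braid vcat [E] [tsum F G] = cls (tsum E (tsum F G)) (tsum F (tsum G E)) (braid (dim_row E) (dim_row F * dim_row G))"
      using sq by (simp add: vcat_const tsum_assoc)
    have BH: "Braid vcat [E] [tsum F G] \<in> Hom vcat [tsum E (tsum F G)] [tsum F (tsum G E)]"
      unfolding B using intw_braid[OF sq(1) sqt(6)] sq by (intro vcat_HomI) (simp add: tsum_assoc)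
    have k1: "kron (1\<^sub>m (dim_row F)) (braid (dim_row E) (dim_row G)) \<in> intw (tsum F (tsum E G)) (tsum F (tsum G E))"
      by (rule intw_kron[OF sq(2,2) sqt(4,5) intw_one[OF sq(2)] intw_braid[OF sq(1,3)]])
    have k2: "kron (braid (dim_row E) (dim_row F)) (1\<^sub>m (dim_row G)) \<in> intw (tsum E (tsum F G)) (tsum F (tsum E G))"
      using intw_kron[OF sqt(7,8) sq(3,3) intw_braid[OF sq(1,2)] intw_one[OF sq(3)]] sq by (simp add: tsum_assoc)
    have e1: "TensorM vcat (lincat.Id vcat [F]) (Braid vcat [E] [G]) =
      cls (tsum F (tsum E G)) (tsum F (tsum G E)) (kron (1\<^sub>m (dim_row F)) (braid (dim_row E) (dim_row G)))"
      unfolding vcat_const by (rule vcat_TensorM[OF sq(2,2) sqt(4,5) intw_one[OF sq(2)] intw_braid[OF sq(1,3)]])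
    have e2: "TensorM vcat (Braid vcat [E] [F]) (lincat.Id vcat [G]) =
      cls (tsum E (tsum F G)) (tsum F (tsum E G)) (kron (braid (dim_row E) (dim_row F)) (1\<^sub>m (dim_row G)))"
      using vcat_TensorM[OF sqt(7,8) sq(3,3) intw_braid[OF sq(1,2)] intw_one[OF sq(3)]] sq
      by (simp add: vcat_const tsum_assoc del: square_mat.simps)
    have "Comp vcat (TensorM vcat (lincat.Id vcat [F]) (Braid vcat [E] [G])) (TensorM vcat (Braid vcat [E] [F]) (lincat.Id vcat [G])) =
      Braid vcat [E] [tsum F G]"
      unfolding e1 e2 B vcat_Comp[OF sqt(1-3) k1 k2] braid_hexagon ..
    moreover have "TensorM vcat (Braid vcat [E] [F]) (lincat.Id vcat [G]) \<in> Hom vcat [tsum E (tsum F G)] [tsum F (tsum E G)]"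
      unfolding e2 by (rule vcat_HomI[OF k2])
    ultimately show "Comp vcat (Assoc vcat Y Z X) (Comp vcat (Braid vcat X (Tensor vcat Y Z)) (Assoc vcat X Y Z)) =
      Comp vcat (TensorM vcat (lincat.Id vcat Y) (Braid vcat X Z))
        (Comp vcat (Assoc vcat Y X Z) (TensorM vcat (Braid vcat X Y) (lincat.Id vcat Z)))"
      unfolding 1 vcat_obj vcat_Assoc using sq BH T
      by (simp add: tsum_assoc Comp_Id Id_Comp del: square_mat.simps vcat_obj)
  qed
qed


subsection \<open>Duals and dimensions\<close>

text \<open>The dual representation of a Lie algebra acts by minus the transpose. The operation is
  an involution, so right duals come from left duals.\<close>

definition mdual :: "'a::field mat \<Rightarrow> 'a mat" where
  "mdual E = (- 1) \<cdot>\<^sub>m transpose_mat E"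

lemma mdual_dim [simp]: "dim_row (mdual E) = dim_col E" "dim_col (mdual E) = dim_row E"
  by (simp_all add: mdual_def)

lemma mdual_square [simp]: "square_mat E \<Longrightarrow> square_mat (mdual E)"
  by simp

lemma mdual_mdual [simp]: "mdual (mdual E) = E"
  by (intro eq_matI) (auto simp: mdual_def)

lemma intw_ev:
  assumes "square_mat E"
  shows "ev (dim_row E) \<in> intw (tsum (mdual E) E) (0\<^sub>m 1 1)"
proof (rule intwI)
  have E: "E \<in> carrier_mat (dim_row E) (dim_row E)" using assms by auto
  have "ev (dim_row E) * tsum (mdual E) E =
    (- 1) \<cdot>\<^sub>m (ev (dim_row E) * kron (1\<^sub>m (dim_row E)) E) + ev (dim_row E) * kron (1\<^sub>m (dim_row E)) E"
    using assms ev_transpose[OF E] by (simp add: tsum_def mult_add_dim mdual_def kron_smult mult_smult_dim)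
  also have "\<dots> = 0\<^sub>m 1 1 * ev (dim_row E)" using assms by (intro eq_matI) auto
  finally show "ev (dim_row E) * tsum (mdual E) E = 0\<^sub>m 1 1 * ev (dim_row E)" .
qed (use assms in auto)

lemma intw_coev:
  assumes "square_mat E"
  shows "coev (dim_row E) \<in> intw (0\<^sub>m 1 1) (tsum E (mdual E))"
proof (rule intwI)
  have E: "E \<in> carrier_mat (dim_row E) (dim_row E)" using assms by auto
  have "tsum E (mdual E) * coev (dim_row E) =
    kron E (1\<^sub>m (dim_row E)) * coev (dim_row E) + (- 1) \<cdot>\<^sub>m (kron E (1\<^sub>m (dim_row E)) * coev (dim_row E))"
    using assms coev_transpose[OF E] by (simp add: tsum_def add_mult_dim mdual_def kron_smult smult_mult_dim)
  also have "\<dots> = coev (dim_row E) * 0\<^sub>m 1 1" using assms by (intro eq_matI) auto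
  finally show "coev (dim_row E) * 0\<^sub>m 1 1 = tsum E (mdual E) * coev (dim_row E)" by simp
qed (use assms in auto)

text \<open>As all associators and unit isomorphisms are identities, the zigzag identities only involve the two
  Kronecker products.\<close>

lemma vcat_left_dual_iff:
  fixes E F :: "'a::field mat"
  assumes sq: "square_mat E" "square_mat F"
    and e: "e \<in> intw (tsum F E) (0\<^sub>m 1 1)" and c: "c \<in> intw (0\<^sub>m 1 1) (tsum E F)"
  shows "is_left_dual vcat [E] [F] (cls (tsum F E) (0\<^sub>m 1 1) e) (cls (0\<^sub>m 1 1) (tsum E F) c) \<longleftrightarrow>
    treq E E (kron (1\<^sub>m (dim_row E)) e * kron c (1\<^sub>m (dim_row E))) (1\<^sub>m (dim_row E)) \<and>
    treq F F (kron e (1\<^sub>m (dim_row F)) * kron (1\<^sub>m (dim_row F)) c) (1\<^sub>m (dim_row F))"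
proof -
  interpret symmetric_monoidal_linear_category "vcat :: 'a concrete_tensor_data" by (rule vcat_symmetric)
  have sqt: "square_mat (tsum E F)" "square_mat (tsum F E)" "square_mat (tsum E (tsum F E))" "square_mat (tsum F (tsum E F))"
    using sq by auto
  have u: "square_mat (0\<^sub>m 1 1 :: 'a mat)" by simp
  note iE = intw_one[OF sq(1)] and iF = intw_one[OF sq(2)]
  have k1: "kron (1\<^sub>m (dim_row E)) e \<in> intw (tsum E (tsum F E)) E"
    using intw_kron[OF sq(1,1) sqt(2) u iE e] tsum_unit[OF sq(1)] by (simp del: One_nat_def)
  have k2: "kron c (1\<^sub>m (dim_row E)) \<in> intw E (tsum E (tsum F E))"
    using intw_kron[OF u sqt(1) sq(1,1) c iE] tsum_unit[OF sq(1)] tsum_assoc[OF sq sq(1)] by (simp del: One_nat_def)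
  have k3: "kron e (1\<^sub>m (dim_row F)) \<in> intw (tsum F (tsum E F)) F"
    using intw_kron[OF sqt(2) u sq(2,2) e iF] tsum_unit[OF sq(2)] tsum_assoc[OF sq(2,1,2)] by (simp del: One_nat_def)
  have k4: "kron (1\<^sub>m (dim_row F)) c \<in> intw F (tsum F (tsum E F))"
    using intw_kron[OF sq(2,2) u sqt(1) iF c] tsum_unit[OF sq(2)] by (simp del: One_nat_def)
  have e1: "TensorM vcat (lincat.Id vcat [E]) (cls (tsum F E) (0\<^sub>m 1 1) e) = cls (tsum E (tsum F E)) E (kron (1\<^sub>m (dim_row E)) e)"
    using vcat_TensorM[OF sq(1,1) sqt(2) u iE e] tsum_unit[OF sq(1)] by (simp add: vcat_const del: One_nat_def)
  have e2: "TensorM vcat (cls (0\<^sub>m 1 1) (tsum E F) c) (lincat.Id vcat [E]) = cls E (tsum E (tsum F E)) (kron c (1\<^sub>m (dim_row E)))"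
    using vcat_TensorM[OF u sqt(1) sq(1,1) c iE] tsum_unit[OF sq(1)] tsum_assoc[OF sq sq(1)] by (simp add: vcat_const del: One_nat_def)
  have e3: "TensorM vcat (cls (tsum F E) (0\<^sub>m 1 1) e) (lincat.Id vcat [F]) = cls (tsum F (tsum E F)) F (kron e (1\<^sub>m (dim_row F)))"
    using vcat_TensorM[OF sqt(2) u sq(2,2) e iF] tsum_unit[OF sq(2)] tsum_assoc[OF sq(2,1,2)] by (simp add: vcat_const del: One_nat_def)
  have e4: "TensorM vcat (lincat.Id vcat [F]) (cls (0\<^sub>m 1 1) (tsum E F) c) = cls F (tsum F (tsum E F)) (kron (1\<^sub>m (dim_row F)) c)"
    using vcat_TensorM[OF sq(2,2) u sqt(1) iF c] tsum_unit[OF sq(2)] by (simp add: vcat_const del: One_nat_def)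
  have o: "[E] \<in> Obj vcat" "[F] \<in> Obj vcat" "[tsum E (tsum F E)] \<in> Obj vcat" "[tsum F (tsum E F)] \<in> Obj vcat"
    using sq by auto
  note h = vcat_HomI[OF k1] vcat_HomI[OF k2] vcat_HomI[OF k3] vcat_HomI[OF k4]
  note m1 = intw_mult[OF sq(1) sqt(3) sq(1) k2 k1] and m2 = intw_mult[OF sq(2) sqt(4) sq(2) k4 k3]
  have "Comp vcat (RUnit vcat [E]) (Comp vcat (TensorM vcat (lincat.Id vcat [E]) (cls (tsum F E) (0\<^sub>m 1 1) e))
      (Comp vcat (Assoc vcat [E] [F] [E]) (TensorM vcat (cls (0\<^sub>m 1 1) (tsum E F) c) (lincat.Id vcat [E])))) =
    cls E E (kron (1\<^sub>m (dim_row E)) e * kron c (1\<^sub>m (dim_row E)))"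
    unfolding e1 e2 vcat_Assoc vcat_const(4) tsum_assoc[OF sq sq(1)] Id_Comp[OF o(1,3) h(2)] vcat_Comp[OF sq(1) sqt(3) sq(1) k1 k2]
    by (rule Id_Comp[OF o(1,1) vcat_HomI[OF m1]])
  moreover have "Comp vcat (LUnit vcat [F]) (Comp vcat (TensorM vcat (cls (tsum F E) (0\<^sub>m 1 1) e) (lincat.Id vcat [F]))
      (Comp vcat (Inv vcat (Tensor vcat (Tensor vcat [F] [E]) [F]) (Tensor vcat [F] (Tensor vcat [E] [F])) (Assoc vcat [F] [E] [F]))
        (TensorM vcat (lincat.Id vcat [F]) (cls (0\<^sub>m 1 1) (tsum E F) c)))) =
    cls F F (kron e (1\<^sub>m (dim_row F)) * kron (1\<^sub>m (dim_row F)) c)"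
    unfolding e3 e4 vcat_Assoc vcat_obj vcat_const(3) tsum_assoc[OF sq(2,1,2)] Inv_Id[OF o(4)] Id_Comp[OF o(2,4) h(4)]
      vcat_Comp[OF sq(2) sqt(4) sq(2) k3 k4]
    by (rule Id_Comp[OF o(2,2) vcat_HomI[OF m2]])
  ultimately show ?thesis
    unfolding is_left_dual_def using sq o vcat_HomI[OF e] vcat_HomI[OF c] cls_eq_iff[OF m1 iE] cls_eq_iff[OF m2 iF]
    by (simp add: vcat_const(1,3,4) del: square_mat.simps One_nat_def)
qed

lemma vcat_left_dual:
  assumes "square_mat E"
  shows "is_left_dual vcat [E] [mdual E] (cls (tsum (mdual E) E) (0\<^sub>m 1 1) (ev (dim_row E)))
    (cls (0\<^sub>m 1 1) (tsum E (mdual E)) (coev (dim_row E)))"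
  using vcat_left_dual_iff[OF assms mdual_square[OF assms] intw_ev[OF assms] intw_coev[OF assms]] assms
  by (simp add: zigzag_left zigzag_right)

text \<open>A matrix of size 1 is its own trace, so the unit has no nonzero negligible
  endomorphism.\<close>

lemma cls_scalar_eq:
  fixes f g :: "'a::field mat"
  assumes "f \<in> carrier_mat 1 1" "g \<in> carrier_mat 1 1"
  shows "cls (0\<^sub>m 1 1) (0\<^sub>m 1 1) f = cls (0\<^sub>m 1 1) (0\<^sub>m 1 1) g \<longleftrightarrow> f = g"
proof
  have i: "h \<in> intw (0\<^sub>m 1 1) (0\<^sub>m 1 1)" if "h \<in> carrier_mat 1 1" for h :: "'a mat"
    using that by (intro intwI) auto
  assume "cls (0\<^sub>m 1 1) (0\<^sub>m 1 1) f = cls (0\<^sub>m 1 1) (0\<^sub>m 1 1) g"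
  then have "treq (0\<^sub>m 1 1) (0\<^sub>m 1 1) f g" using cls_eq_iff[OF i[OF assms(1)] i[OF assms(2)]] by simp
  then have "tr (1\<^sub>m 1 * f) = tr (1\<^sub>m 1 * g)" unfolding treq_def using i[of "1\<^sub>m 1"] by auto
  then show "f = g" using assms by (intro eq_matI) (auto simp: tr_def)
qed simp

lemma vcat_End_Unit:
  "bij_betw (\<lambda>a. Scale vcat a (lincat.Id vcat (Unit vcat))) UNIV (Hom vcat (Unit vcat) (Unit vcat :: 'a::field concrete_obj))"
proof -
  have i: "h \<in> intw (0\<^sub>m 1 1) (0\<^sub>m 1 1)" if "h \<in> carrier_mat 1 1" for h :: "'a mat"
    using that by (intro intwI) auto
  have u: "square_mat (0\<^sub>m 1 1 :: 'a mat)" by simp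
  have s: "Scale vcat a (lincat.Id vcat (Unit vcat)) = cls (0\<^sub>m 1 1) (0\<^sub>m 1 1) (a \<cdot>\<^sub>m 1\<^sub>m 1)" for a :: 'a
    using vcat_Scale[OF u u i[of "1\<^sub>m 1"]] by (simp add: vcat_const)
  have inj: "a = b" if "a \<cdot>\<^sub>m 1\<^sub>m 1 = b \<cdot>\<^sub>m (1\<^sub>m 1 :: 'a mat)" for a b
    using arg_cong[OF that, of "\<lambda>A. A $$ (0, 0)"] by simp
  have ex: "f = (f $$ (0, 0)) \<cdot>\<^sub>m 1\<^sub>m 1" if "f \<in> carrier_mat 1 1" for f :: "'a mat"
    using that by (intro eq_matI) auto
  show ?thesis
    unfolding bij_betw_def
  proof
    show "inj (\<lambda>a. Scale vcat a (lincat.Id vcat (Unit vcat :: 'a concrete_obj)))"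
      by (intro injI inj) (simp only: s cls_scalar_eq[OF smult_carrier_mat[OF one_carrier_mat] smult_carrier_mat[OF one_carrier_mat]])
    show "range (\<lambda>a. Scale vcat a (lincat.Id vcat (Unit vcat))) = Hom vcat (Unit vcat) (Unit vcat :: 'a concrete_obj)"
    proof (intro equalityI subsetI)
      fix m assume "m \<in> Hom vcat (Unit vcat) (Unit vcat :: 'a concrete_obj)"
      then obtain f where f: "f \<in> intw (0\<^sub>m 1 1) (0\<^sub>m 1 1)" "m = cls (0\<^sub>m 1 1) (0\<^sub>m 1 1) f"
        unfolding vcat_obj vcat_Hom by blast
      have "f \<in> carrier_mat 1 1" using intw_dim[OF f(1)] by (intro carrier_matI) auto
      then have "m = Scale vcat (f $$ (0, 0)) (lincat.Id vcat (Unit vcat))" unfolding s f(2) using ex by metis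
      then show "m \<in> range (\<lambda>a. Scale vcat a (lincat.Id vcat (Unit vcat)))" by blast
    next
      fix m assume "m \<in> range (\<lambda>a. Scale vcat a (lincat.Id vcat (Unit vcat :: 'a concrete_obj)))"
      then obtain a where "m = cls (0\<^sub>m 1 1) (0\<^sub>m 1 1) (a \<cdot>\<^sub>m 1\<^sub>m 1)" unfolding s by blast
      then show "m \<in> Hom vcat (Unit vcat) (Unit vcat :: 'a concrete_obj)"
        unfolding vcat_obj by (simp only: vcat_HomI[OF i[OF smult_carrier_mat[OF one_carrier_mat]]])
    qed
  qed
qed

theorem vcat_symmetric_tensor_category: "symmetric_tensor_category (vcat :: 'a::field concrete_tensor_data)"
proof (intro symmetric_tensor_category.intro symmetric_tensor_category_axioms.intro)
  show "locally_finite_abelian_category (vcat :: 'a concrete_tensor_data)" by (rule vcat_locally_finite)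
  show "symmetric_monoidal_linear_category (vcat :: 'a concrete_tensor_data)" by (rule vcat_symmetric)
  show "bij_betw (\<lambda>a. Scale vcat a (lincat.Id vcat (Unit vcat))) UNIV (Hom vcat (Unit vcat) (Unit vcat :: 'a concrete_obj))"
    by (rule vcat_End_Unit)
  fix X assume "X \<in> Obj (vcat :: 'a concrete_tensor_data)"
  then obtain E where E: "X = [E]" "square_mat E" by (auto simp del: square_mat.simps)
  show "\<exists>D e c. is_left_dual vcat X D e c" unfolding E(1) using vcat_left_dual[OF E(2)] by blast
  show "\<exists>D e c. is_left_dual vcat D X e c"
    unfolding E(1) using vcat_left_dual[OF mdual_square[OF E(2)]] unfolding mdual_mdual by blast
qed

text \<open>A second dual \<open>F\<close> of \<open>E\<close> is compared with the standard one by
  \<open>\<phi> = (ev \<otimes> 1) (1 \<otimes> c)\<close>, which carries \<open>coev\<close> to \<open>c\<close> and \<open>e\<close> to \<open>ev\<close>.\<close>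

lemma left_dual_dimension:
  fixes E F :: "'a::field mat"
  assumes sq: "square_mat E" "square_mat F"
    and e: "e \<in> intw (tsum F E) (0\<^sub>m 1 1)" and c: "c \<in> intw (0\<^sub>m 1 1) (tsum E F)"
    and zz: "treq E E (kron (1\<^sub>m (dim_row E)) e * kron c (1\<^sub>m (dim_row E))) (1\<^sub>m (dim_row E))"
  shows "e * (braid (dim_row E) (dim_row F) * c) = of_nat (dim_row E) \<cdot>\<^sub>m 1\<^sub>m 1"
proof -
  define n where "n = dim_row E"
  define m where "m = dim_row F"
  define G where "G = mdual E"
  have G: "square_mat G" "dim_row G = n" using sq by (auto simp: G_def n_def)
  have E: "dim_row E = n" "dim_row F = m" by (simp_all add: n_def m_def)
  have sqt: "square_mat (tsum E F)" "square_mat (tsum F E)" "square_mat (tsum G E)" "square_mat (tsum E (tsum F E))"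
    "square_mat (tsum G (tsum E F))" using sq G by auto
  have u: "square_mat (0\<^sub>m 1 1 :: 'a mat)" by simp
  have de: "e \<in> carrier_mat 1 (m * n)" using intw_dim[OF e] by (intro carrier_matI) (auto simp: E)
  have dc: "c \<in> carrier_mat (n * m) 1" using intw_dim[OF c] by (intro carrier_matI) (auto simp: E)
  have evI: "ev n \<in> intw (tsum G E) (0\<^sub>m 1 1)" using intw_ev[OF sq(1)] by (simp add: G_def n_def)
  define \<phi> where "\<phi> = kron (ev n) (1\<^sub>m m) * kron (1\<^sub>m n) c"
  have p: "\<phi> \<in> carrier_mat m n" using dc by (auto simp: \<phi>_def)
  have phi: "\<phi> \<in> intw G F"
  proof -
    have 1: "kron (1\<^sub>m n) c \<in> intw G (tsum G (tsum E F))"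
      using intw_kron[OF G(1,1) u sqt(1) _ c, of "1\<^sub>m n"] intw_one[OF G(1)] G tsum_unit[OF G(1)] by simp
    have 2: "kron (ev n) (1\<^sub>m m) \<in> intw (tsum G (tsum E F)) F"
      using intw_kron[OF sqt(3) u sq(2,2) evI, of "1\<^sub>m m"] intw_one[OF sq(2)] G sq tsum_unit[OF sq(2)] tsum_assoc[OF G(1) sq]
      by (simp add: E)
    show ?thesis unfolding \<phi>_def by (rule intw_mult[OF G(1) sqt(5) sq(2) 1 2])
  qed
  have unit: "kron (1\<^sub>m (Suc 0)) A = A" "kron A (1\<^sub>m (Suc 0)) = A" for A :: "'a mat"
    using kron_unit[of A] by simp_all
  \<comment> \<open>This holds exactly, because the zigzag identity of the standard dual
    does.\<close>
  have c_eq: "kron (1\<^sub>m n) \<phi> * coev n = c"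
  proof -
    have "kron (1\<^sub>m n) \<phi> = kron (1\<^sub>m n) (kron (ev n) (1\<^sub>m m)) * kron (1\<^sub>m n) (kron (1\<^sub>m n) c)"
      using dc by (simp add: \<phi>_def kron_mult)
    also have "kron (1\<^sub>m n) (kron (ev n) (1\<^sub>m m)) = kron (kron (1\<^sub>m n) (ev n)) (1\<^sub>m m :: 'a mat)" by (simp add: kron_assoc)
    also have "kron (1\<^sub>m n) (kron (1\<^sub>m n) c) = kron (1\<^sub>m (n * n)) c" by (simp flip: kron_assoc)
    finally have "kron (1\<^sub>m n) \<phi> * coev n = kron (kron (1\<^sub>m n) (ev n)) (1\<^sub>m m) * (kron (1\<^sub>m (n * n)) c * coev n)"
      using dc by (simp add: mult_assoc_dim)
    also have "kron (1\<^sub>m (n * n)) c * coev n = kron (1\<^sub>m (n * n)) c * kron (coev n) (1\<^sub>m 1)" unfolding kron_unit ..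
    also have "\<dots> = kron (coev n) (1\<^sub>m (n * m)) * kron (1\<^sub>m 1) c"
      using dc by (subst (1 2) kron_mult) auto
    also have "\<dots> = kron (kron (coev n) (1\<^sub>m n)) (1\<^sub>m m) * c" by (simp add: kron_assoc unit)
    also have "kron (kron (1\<^sub>m n) (ev n)) (1\<^sub>m m) * (kron (kron (coev n) (1\<^sub>m n)) (1\<^sub>m m) * c) =
      kron (kron (1\<^sub>m n) (ev n) * kron (coev n) (1\<^sub>m n)) (1\<^sub>m m) * c"
      using dc by (simp add: kron_mult mult_assoc_dim[symmetric])
    finally show ?thesis unfolding zigzag_left using dc by simp
  qed
  \<comment> \<open>The zigzag composite of the second dual appears here. It is the identity only
    modulo negligible morphisms, so \<open>e * kron \<phi> 1\<close> agrees with \<open>ev n\<close>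
    only in that sense.\<close>
  have e_eq: "e * kron \<phi> (1\<^sub>m n) = ev n * kron (1\<^sub>m n) (kron (1\<^sub>m n) e * kron c (1\<^sub>m n))"
  proof -
    have "kron \<phi> (1\<^sub>m n) = kron (kron (ev n) (1\<^sub>m m)) (1\<^sub>m n) * kron (kron (1\<^sub>m n) c) (1\<^sub>m n)"
      using dc by (simp add: \<phi>_def kron_mult)
    also have "\<dots> = kron (ev n) (1\<^sub>m (m * n)) * kron (1\<^sub>m n) (kron c (1\<^sub>m n))" by (simp add: kron_assoc)
    finally have "e * kron \<phi> (1\<^sub>m n) = (kron (1\<^sub>m 1) e * kron (ev n) (1\<^sub>m (m * n))) * kron (1\<^sub>m n) (kron c (1\<^sub>m n))"
      using dc de by (simp add: mult_assoc_dim unit)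
    also have "kron (1\<^sub>m 1) e * kron (ev n) (1\<^sub>m (m * n)) = kron (ev n) (1\<^sub>m 1) * kron (1\<^sub>m (n * n)) e"
      using de by (subst (1 2) kron_mult) auto
    also have "\<dots> = ev n * kron (1\<^sub>m n) (kron (1\<^sub>m n) e)" by (simp add: unit flip: kron_assoc)
    finally show ?thesis using dc de by (simp add: mult_assoc_dim kron_mult)
  qed
  have k: "kron (1\<^sub>m n) e * kron c (1\<^sub>m n) \<in> intw E E"
    using intw_mult[OF sq(1) sqt(4) sq(1), of "kron c (1\<^sub>m n)" "kron (1\<^sub>m n) e"]
      intw_kron[OF sq(1,1) sqt(2) u intw_one[OF sq(1)] e] intw_kron[OF u sqt(1) sq(1,1) c intw_one[OF sq(1)]]
      tsum_unit[OF sq(1)] tsum_assoc[OF sq sq(1)] by (simp add: E)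
  have 1: "1\<^sub>m n \<in> intw E E" "1\<^sub>m n \<in> intw G G" using intw_one[OF sq(1)] intw_one[OF G(1)] G by (simp_all add: E)
  have "treq (tsum G E) (tsum G E) (kron (1\<^sub>m n) (kron (1\<^sub>m n) e * kron c (1\<^sub>m n))) (kron (1\<^sub>m n) (1\<^sub>m n))"
    by (rule treq_kron[OF G(1,1) sq(1,1) 1(2,2) treq_refl k 1(1)]) (use zz in \<open>simp add: E\<close>)
  then have "treq (tsum G E) (0\<^sub>m 1 1) (ev n * kron (1\<^sub>m n) (kron (1\<^sub>m n) e * kron c (1\<^sub>m n))) (ev n * kron (1\<^sub>m n) (1\<^sub>m n))"
    by (rule treq_mult[OF sqt(3,3) u intw_kron[OF G(1,1) sq(1,1) 1(2) k] intw_kron[OF G(1,1) sq(1,1) 1(2,1)] _ evI evI treq_refl])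
  then have t: "treq (tsum G E) (0\<^sub>m 1 1) (e * kron \<phi> (1\<^sub>m n)) (ev n)" unfolding e_eq by simp
  \<comment> \<open>The test morphism against which the equality modulo negligible morphisms becomes
    an equality of traces.\<close>
  have bI: "braid n n * coev n \<in> intw (0\<^sub>m 1 1) (tsum G E)"
    using intw_mult[OF u _ sqt(3) intw_coev[OF sq(1)], of "braid n n"] intw_braid[OF sq(1) G(1)] G sq by (simp add: E G_def)
  have "tr (e * kron \<phi> (1\<^sub>m n) * (braid n n * coev n)) = tr ((braid n n * coev n) * (e * kron \<phi> (1\<^sub>m n)))"
    using de p by (intro tr_comm) auto
  also have "\<dots> = tr ((braid n n * coev n) * ev n)" using t bI unfolding treq_def by blast
  also have "\<dots> = tr (ev n * (braid n n * coev n))" by (intro tr_comm) auto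
  also have "\<dots> = of_nat n" unfolding ev_braid_coev by (simp add: tr_def)
  finally have T: "tr (e * kron \<phi> (1\<^sub>m n) * (braid n n * coev n)) = of_nat n" .
  have "e * (braid n m * c) = e * (braid n m * kron (1\<^sub>m n) \<phi> * coev n)"
    using dc p by (simp add: mult_assoc_dim c_eq)
  also have "\<dots> = e * kron \<phi> (1\<^sub>m n) * (braid n n * coev n)"
    unfolding braid_natural[OF one_carrier_mat p] using de p by (simp add: mult_assoc_dim)
  finally have "tr (e * (braid n m * c)) = of_nat n" using T by simp
  then show ?thesis unfolding E using de dc by (intro eq_matI) (auto simp: tr_def simp del: index_mult_mat(1))
qed

text \<open>The description in \<open>dimension\<close> ranges over all duals, so the value is
  computed for an arbitrary one; injectivity of scalars on the unit then gives uniqueness.\<close>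

theorem vcat_dimension:
  fixes E :: "'a::field mat"
  assumes sq: "square_mat E"
  shows "dimension vcat [E] = of_nat (dim_row E)"
  unfolding dimension_def
proof (rule the_equality)
  have u: "square_mat (0\<^sub>m 1 1 :: 'a mat)" by simp
  have i1: "1\<^sub>m 1 \<in> intw (0\<^sub>m 1 1) (0\<^sub>m 1 1 :: 'a mat)" using intw_one[OF u] by simp
  have s: "Scale vcat a (lincat.Id vcat (Unit vcat)) = cls (0\<^sub>m 1 1) (0\<^sub>m 1 1) (a \<cdot>\<^sub>m 1\<^sub>m 1)" for a :: 'a
    using vcat_Scale[OF u u i1] by (simp add: vcat_const)
  have key: "Comp vcat e (Comp vcat (Braid vcat [E] D) c) = Scale vcat (of_nat (dim_row E)) (lincat.Id vcat (Unit vcat))"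
    if d: "is_left_dual vcat [E] D e c" for D e c
  proof -
    obtain F where F: "D = [F]" "square_mat F" using d by (auto simp: is_left_dual_def)
    obtain e' c' where ec: "e' \<in> intw (tsum F E) (0\<^sub>m 1 1)" "c' \<in> intw (0\<^sub>m 1 1) (tsum E F)"
      "e = cls (tsum F E) (0\<^sub>m 1 1) e'" "c = cls (0\<^sub>m 1 1) (tsum E F) c'"
      using d unfolding is_left_dual_def F(1) vcat_obj vcat_Hom by blast
    have sqt: "square_mat (tsum E F)" "square_mat (tsum F E)" using sq F by auto
    note b = intw_braid[OF sq F(2)]
    have "e' * (braid (dim_row E) (dim_row F) * c') = of_nat (dim_row E) \<cdot>\<^sub>m 1\<^sub>m 1"
      by (rule left_dual_dimension[OF sq F(2) ec(1,2)])
        (use vcat_left_dual_iff[OF sq F(2) ec(1,2)] d in \<open>simp add: F ec\<close>)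
    then show ?thesis
      unfolding s F(1) ec(3,4) vcat_const vcat_Comp[OF u sqt b ec(2)]
        vcat_Comp[OF u sqt(2) u ec(1) intw_mult[OF u sqt ec(2) b]] by simp
  qed
  show "\<exists>D e c. is_left_dual vcat [E] D e c \<and>
      Comp vcat e (Comp vcat (Braid vcat [E] D) c) = Scale vcat (of_nat (dim_row E)) (lincat.Id vcat (Unit vcat))"
    using vcat_left_dual[OF sq] key by blast
  fix a assume "\<exists>D e c. is_left_dual vcat [E] D e c \<and>
      Comp vcat e (Comp vcat (Braid vcat [E] D) c) = Scale vcat a (lincat.Id vcat (Unit vcat))"
  then have "Scale vcat a (lincat.Id vcat (Unit vcat)) = Scale vcat (of_nat (dim_row E)) (lincat.Id vcat (Unit vcat :: 'a concrete_obj))"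
    using key by auto
  then show "a = of_nat (dim_row E)"
    using vcat_End_Unit unfolding bij_betw_def inj_def by blast
qed


section \<open>Tensor powers of a nilpotent Jordan block of size two\<close>

text \<open>The number of ones in the binary expansion. Basis vectors of the n-th tensor power of a
  plane are binary words of length n, read as numbers below 2^n.\<close>

fun weight :: "nat \<Rightarrow> nat" where
  "weight n = (if n = 0 then 0 else n mod 2 + weight (n div 2))"

declare weight.simps [simp del]

lemma weight_zero [simp]: "weight 0 = 0"
  by (simp add: weight.simps)

lemma weight_step: "b < 2 \<Longrightarrow> weight (n * 2 + b) = weight n + b"
  by (subst weight.simps) auto

lemma weight_pair: "y < 2 ^ j \<Longrightarrow> weight (x * 2 ^ j + y) = weight x + weight y"
proof (induction j arbitrary: y)
  case (Suc j)
  have y: "y = (y div 2) * 2 + y mod 2" by simp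
  have "x * 2 ^ Suc j + y = (x * 2 ^ j + y div 2) * 2 + y mod 2" by simp
  then have "weight (x * 2 ^ Suc j + y) = weight (x * 2 ^ j + y div 2) + y mod 2" by (metis weight_step mod_less_divisor zero_less_numeral)
  also have "\<dots> = weight x + (weight (y div 2) + y mod 2)" using Suc by simp
  also have "weight (y div 2) + y mod 2 = weight y" using weight_step[of "y mod 2" "y div 2"] y by simp
  finally show ?case .
qed simp

lemma weight_le: "x < 2 ^ n \<Longrightarrow> weight x \<le> n"
proof (induction n arbitrary: x)
  case (Suc n)
  have "weight x = weight (x div 2) + x mod 2" using weight_step[of "x mod 2" "x div 2"] by simp
  moreover have "weight (x div 2) \<le> n" using Suc by simp
  ultimately show ?case by simp
qed simp

lemma sum_two: "(\<Sum>b<2. f b) = f 0 + f (1::nat)"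
  by (simp add: numeral_2_eq_2)

text \<open>There are \<open>n choose j\<close> words of length n with j ones; the induction on the
  last letter is Pascal's rule.\<close>

lemma sum_weight:
  fixes \<phi> :: "nat \<Rightarrow> 'a::comm_semiring_1"
  shows "(\<Sum>x<2 ^ n. \<phi> (weight x)) = (\<Sum>j\<le>n. of_nat (n choose j) * \<phi> j)"
proof (induction n arbitrary: \<phi>)
  case (Suc n)
  have "(\<Sum>x<2 ^ Suc n. \<phi> (weight x)) = (\<Sum>x<2 ^ n * 2. \<phi> (weight x))" by (simp add: mult.commute)
  also have "\<dots> = (\<Sum>x<2 ^ n. \<phi> (weight x) + \<phi> (Suc (weight x)))"
  proof -
    have "weight (x * 2 + 0) = weight x" "weight (x * 2 + 1) = Suc (weight x)" for x using weight_step[of 0 x] weight_step[of 1 x] by simp_all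
    then show ?thesis unfolding sum_pair sum_two by presburger
  qed
  also have "\<dots> = (\<Sum>j\<le>n. of_nat (n choose j) * (\<phi> j + \<phi> (Suc j)))"
    using Suc[of "\<lambda>j. \<phi> j + \<phi> (Suc j)"] .
  also have "\<dots> = (\<Sum>j\<le>n. of_nat (n choose j) * \<phi> j) + (\<Sum>j\<le>n. of_nat (n choose j) * \<phi> (Suc j))"
    by (simp add: sum.distrib distrib_left)
  also have "(\<Sum>j\<le>n. of_nat (n choose j) * \<phi> j) = \<phi> 0 + (\<Sum>j\<le>n. of_nat (n choose Suc j) * \<phi> (Suc j))"
  proof -
    have "(\<Sum>j\<le>n. of_nat (n choose j) * \<phi> j) = (\<Sum>j\<le>Suc n. of_nat (n choose j) * \<phi> j)"
      by (simp add: binomial_eq_0)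
    also have "\<dots> = \<phi> 0 + (\<Sum>j\<le>n. of_nat (n choose Suc j) * \<phi> (Suc j))" by (subst sum.atMost_Suc_shift) simp
    finally show ?thesis .
  qed
  also have "\<phi> 0 + (\<Sum>j\<le>n. of_nat (n choose Suc j) * \<phi> (Suc j)) + (\<Sum>j\<le>n. of_nat (n choose j) * \<phi> (Suc j)) =
    \<phi> 0 + (\<Sum>j\<le>n. of_nat (Suc n choose Suc j) * \<phi> (Suc j))"
    by (simp add: sum.distrib distrib_right add_ac)
  also have "\<dots> = (\<Sum>j\<le>Suc n. of_nat (Suc n choose j) * \<phi> j)" by (subst sum.atMost_Suc_shift) simp
  finally show ?case .
qed simp

text \<open>The nilpotent Jordan block: it turns the letter 1 into the letter 0. On words,
  \<open>Vn n\<close> is the sum over all ways of turning one 1 into a 0.\<close>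

definition Vmat :: "'a::field mat" where
  "Vmat = mat 2 2 (\<lambda>(i, j). if i = 0 \<and> j = 1 then 1 else 0)"

fun Vn :: "nat \<Rightarrow> 'a::field mat" where
  "Vn 0 = 0\<^sub>m 1 1"
| "Vn (Suc n) = tsum (Vn n) Vmat"

lemma Vmat_dim [simp]: "dim_row Vmat = 2" "dim_col Vmat = 2"
  by (simp_all add: Vmat_def)

lemma Vn_dim [simp]: "dim_row (Vn n :: 'a::field mat) = 2 ^ n" "dim_col (Vn n :: 'a mat) = 2 ^ n"
  by (induction n) (auto simp: mult.commute)

lemma Vn_square: "square_mat (Vn n)" "square_mat Vmat"
  by simp_all

lemma Vn_one: "Vn (Suc 0) = Vmat"
  using tsum_unit(1)[OF Vn_square(2)] by simp

lemma Vn_add: "Vn (i + j) = tsum (Vn i) (Vn j)"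
proof (induction j)
  case 0 then show ?case by (simp add: tsum_unit(2)[OF Vn_square(1)] del: One_nat_def)
next
  case (Suc j) then show ?case using tsum_assoc[OF Vn_square(1,1,2)] by simp
qed

lemma Vn_step:
  assumes "x < 2 ^ n" "y < 2 ^ n" "a < 2" "b < 2"
  shows "Vn (Suc n) $$ (x * 2 + a, y * 2 + b) =
    (if a = b then Vn n $$ (x, y) else 0) + (if x = y \<and> a = 0 \<and> b = 1 then 1 else 0 :: 'a::field)"
proof -
  have "Vn (Suc n) $$ (x * 2 + a, y * 2 + b) =
    kron (Vn n) (1\<^sub>m 2) $$ (x * 2 + a, y * 2 + b) + kron (1\<^sub>m (2 ^ n)) (Vmat :: 'a mat) $$ (x * 2 + a, y * 2 + b)"
    using assms pair_index_less[OF assms(1,3)] pair_index_less[OF assms(2,4)] by (simp add: tsum_def mult.commute)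
  also have "kron (Vn n) (1\<^sub>m 2) $$ (x * 2 + a, y * 2 + b) = (if a = b then Vn n $$ (x, y) else 0 :: 'a)"
    using assms by (subst kron_pair) auto
  also have "kron (1\<^sub>m (2 ^ n)) (Vmat :: 'a mat) $$ (x * 2 + a, y * 2 + b) = (if x = y \<and> a = 0 \<and> b = 1 then 1 else 0)"
    using assms by (subst kron_pair) (auto simp: Vmat_def)
  finally show ?thesis .
qed

text \<open>The word x arises from the words in which one of its \<open>n - weight x\<close> zeros
  is replaced by a one.\<close>

lemma Vn_row_sum:
  fixes \<phi> :: "nat \<Rightarrow> 'a::field"
  shows "x < 2 ^ n \<Longrightarrow> (\<Sum>u<2 ^ n. Vn n $$ (x, u) * \<phi> (weight u)) = (of_nat n - of_nat (weight x)) * \<phi> (Suc (weight x))"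
proof (induction n arbitrary: x \<phi>)
  case (Suc n)
  define y where "y = x div 2"
  define a where "a = x mod 2"
  have x: "x = y * 2 + a" and ya: "y < 2 ^ n" "a < 2" using Suc.prems by (auto simp: y_def a_def)
  have "(\<Sum>u<2 ^ Suc n. Vn (Suc n) $$ (x, u) * \<phi> (weight u)) =
    (\<Sum>u<2 ^ n. \<Sum>b<2. Vn (Suc n) $$ (y * 2 + a, u * 2 + b) * \<phi> (weight u + b))"
    unfolding x power_Suc2 sum_pair by (intro sum.cong refl) (simp add: weight_step del: Vn.simps)
  also have "\<dots> = (\<Sum>u<2 ^ n. Vn n $$ (y, u) * \<phi> (weight u + a) + (if u = y then (if a = 0 then \<phi> (Suc (weight y)) else 0) else 0))"
    using ya by (intro sum.cong refl) (auto simp: Vn_step sum_two less_2_cases_iff simp del: Vn.simps)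
  also have "\<dots> = (\<Sum>u<2 ^ n. Vn n $$ (y, u) * \<phi> (weight u + a)) + (if a = 0 then \<phi> (Suc (weight y)) else 0)"
    using ya by (simp add: sum.distrib)
  also have "\<dots> = (of_nat n - of_nat (weight y)) * \<phi> (Suc (weight y) + a) + (if a = 0 then \<phi> (Suc (weight y)) else 0)"
    using Suc.IH[OF ya(1), of "\<lambda>j. \<phi> (j + a)"] by simp
  also have "\<dots> = (of_nat (Suc n) - of_nat (weight x)) * \<phi> (Suc (weight x))"
    using ya(2) unfolding x weight_step[OF ya(2)] less_2_cases_iff by (auto simp: algebra_simps)
  finally show ?case .
qed (simp add: One_nat_def)

text \<open>The word x is sent to the words in which one of its ones is replaced by a zero. For
  weight 0 the truncated \<open>weight x - 1\<close> is multiplied by 0.\<close>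

lemma Vn_col_sum:
  fixes \<phi> :: "nat \<Rightarrow> 'a::field"
  shows "x < 2 ^ n \<Longrightarrow> (\<Sum>u<2 ^ n. \<phi> (weight u) * Vn n $$ (u, x)) = of_nat (weight x) * \<phi> (weight x - 1)"
proof (induction n arbitrary: x \<phi>)
  case (Suc n)
  define y where "y = x div 2"
  define a where "a = x mod 2"
  have x: "x = y * 2 + a" and ya: "y < 2 ^ n" "a < 2" using Suc.prems by (auto simp: y_def a_def)
  have "(\<Sum>u<2 ^ Suc n. \<phi> (weight u) * Vn (Suc n) $$ (u, x)) =
    (\<Sum>u<2 ^ n. \<Sum>b<2. \<phi> (weight u + b) * Vn (Suc n) $$ (u * 2 + b, y * 2 + a))"
    unfolding x power_Suc2 sum_pair by (intro sum.cong refl) (simp add: weight_step del: Vn.simps)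
  also have "\<dots> = (\<Sum>u<2 ^ n. \<phi> (weight u + a) * Vn n $$ (u, y) + (if u = y then (if a = 1 then \<phi> (weight y) else 0) else 0))"
    using ya by (intro sum.cong refl) (auto simp: Vn_step sum_two less_2_cases_iff simp del: Vn.simps)
  also have "\<dots> = (\<Sum>u<2 ^ n. \<phi> (weight u + a) * Vn n $$ (u, y)) + (if a = 1 then \<phi> (weight y) else 0)"
    using ya by (simp add: sum.distrib)
  also have "\<dots> = of_nat (weight y) * \<phi> (weight y - 1 + a) + (if a = 1 then \<phi> (weight y) else 0)"
    using Suc.IH[OF ya(1), of "\<lambda>j. \<phi> (j + a)"] by simp
  also have "\<dots> = of_nat (weight x) * \<phi> (weight x - 1)"
    using ya(2) unfolding x weight_step[OF ya(2)] less_2_cases_iff by (cases "weight y") (auto simp: algebra_simps)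
  finally show ?case .
qed simp


subsection \<open>The symmetrizers\<close>

text \<open>In the basis of words, the average over all permutations sends a word to the average of the words of
  the same weight.\<close>

definition symm :: "nat \<Rightarrow> 'a::field mat" where
  "symm n = mat (2 ^ n) (2 ^ n) (\<lambda>(r, c). if weight r = weight c then 1 / of_nat (n choose weight c) else 0)"

lemma symm_dim [simp]: "dim_row (symm n) = 2 ^ n" "dim_col (symm n) = 2 ^ n"
  by (simp_all add: symm_def)

lemma symm_index: "\<lbrakk>r < 2 ^ n; c < 2 ^ n\<rbrakk> \<Longrightarrow> symm n $$ (r, c) = (if weight r = weight c then 1 / of_nat (n choose weight c) else 0)"
  by (simp add: symm_def)

lemma of_nat_nonzero:
  assumes "0 < k" "k < CHAR('a::field)"
  shows "(of_nat k :: 'a) \<noteq> 0"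
  using assms by (metis nat_dvd_not_less of_nat_eq_0_iff_char_dvd)

text \<open>The binomial coefficient divides \<open>fact n\<close>, which is prime to the
  characteristic.\<close>

lemma choose_nonzero:
  assumes "k \<le> n" "n < CHAR('a::field)"
  shows "(of_nat (n choose k) :: 'a) \<noteq> 0"
proof
  assume "(of_nat (n choose k) :: 'a) = 0"
  then have d: "CHAR('a) dvd (n choose k)" by (simp add: of_nat_eq_0_iff_char_dvd)
  have p: "prime CHAR('a)" using assms by (intro prime_CHAR_semidom) simp
  have "CHAR('a) dvd fact n" using d binomial_fact_lemma[OF assms(1)] by (metis dvd_mult)
  then show False using p assms by (simp add: prime_dvd_fact_iff)
qed

text \<open>Multiplication from the left by the flip of the last two letters permutes the rows in
  the same way.\<close>

lemma braid_mid_mult: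
  fixes N :: "'a::comm_semiring_1 mat"
  assumes "dim_row N = 2 ^ k * 4" "c < dim_col N" "x < 2 ^ k" "b < 2" "a < 2"
  shows "(kron (1\<^sub>m (2 ^ k)) (braid 2 2) * N) $$ ((x * 2 + b) * 2 + a, c) = N $$ ((x * 2 + a) * 2 + b, c)"
proof -
  have i: "(x * 2 + b) * 2 + a = x * 4 + (b * 2 + a)" "(x * 2 + a) * 2 + b = x * 4 + (a * 2 + b)" by simp_all
  have ba: "b * 2 + a < 4" using assms by simp
  have "(kron (1\<^sub>m (2 ^ k)) (braid 2 2) * N) $$ (x * 4 + (b * 2 + a), c) =
    (\<Sum>u<2 ^ k. \<Sum>v<4. 1\<^sub>m (2 ^ k) $$ (x, u) * braid 2 2 $$ (b * 2 + a, v) * N $$ (u * 4 + v, c))"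
    using assms ba by (subst kron_mult_pair) auto
  also have "\<dots> = (\<Sum>u<2 ^ k. (if x = u then 1 else 0) * (\<Sum>v<2 * 2. braid 2 2 $$ (b * 2 + a, v) * N $$ (u * 4 + v, c)))"
    using assms by (intro sum.cong refl) simp
  also have "\<dots> = (\<Sum>v<2 * 2. braid 2 2 $$ (b * 2 + a, v) * N $$ (x * 4 + v, c))"
    unfolding delta_sums using assms by simp
  also have "\<dots> = (\<Sum>p<2. \<Sum>q<2. (if b = q \<and> a = p then 1 else 0) * N $$ (x * 4 + (p * 2 + q), c))"
    unfolding sum_pair using assms by (intro sum.cong refl) (simp add: braid_pair)
  also have "\<dots> = N $$ (x * 4 + (a * 2 + b), c)"
    using assms(4,5) unfolding less_2_cases_iff sum_two by auto
  finally show ?thesis unfolding i .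
qed

lemma kron_one_mult_row:
  fixes S M :: "'a::comm_semiring_1 mat"
  assumes "S \<in> carrier_mat n n" "M \<in> carrier_mat (n * 2) l" "u < n" "a < 2" "c < l"
  shows "(kron S (1\<^sub>m 2) * M) $$ (u * 2 + a, c) = (\<Sum>v<n. S $$ (u, v) * M $$ (v * 2 + a, c))"
proof -
  have "(kron S (1\<^sub>m 2) * M) $$ (u * 2 + a, c) = (\<Sum>v<n. \<Sum>b<2. S $$ (u, v) * 1\<^sub>m 2 $$ (a, b) * M $$ (v * 2 + b, c))"
    using assms by (subst kron_mult_pair) auto
  also have "\<dots> = (\<Sum>v<n. S $$ (u, v) * M $$ (v * 2 + a, c))"
    using assms(4) unfolding less_2_cases_iff sum_two by (intro sum.cong refl) auto
  finally show ?thesis .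
qed

text \<open>The factors \<open>S\<close> leave the last letter alone and the flip exchanges the last
  two, so the paths from row \<open>u a\<close> to column \<open>w b\<close> run through words
  \<open>x b a\<close> and \<open>x a b\<close>. Grouping the words x by weight j gives the
  sum.\<close>

lemma symm_sandwich:
  fixes u w a b :: nat
  assumes b: "u < 2 ^ Suc k" "w < 2 ^ Suc k" "a < 2" "b < 2"
  defines "S \<equiv> kron (symm (Suc k)) (1\<^sub>m 2 :: 'a::field mat)"
  shows "(S * (kron (1\<^sub>m (2 ^ k)) (braid 2 2) * S)) $$ (u * 2 + a, w * 2 + b) =
    (\<Sum>j\<le>k. of_nat (k choose j) * (if j + b = weight u \<and> j + a = weight w
       then 1 / (of_nat (Suc k choose (j + b)) * of_nat (Suc k choose weight w)) else 0))"
proof -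
  have S: "S \<in> carrier_mat (2 ^ k * 4) (2 ^ k * 4)" by (auto simp: S_def)
  have wb: "w * 2 + b < 2 ^ k * 4" using pair_index_less[OF b(2,4)] by simp
  have S_entry: "S $$ (p * 2 + s, q * 2 + t) = (if s = t then symm (Suc k) $$ (p, q) else 0)"
    if "p < 2 ^ Suc k" "q < 2 ^ Suc k" "s < 2" "t < 2" for p q s t
    unfolding S_def using that by (subst kron_pair) auto
  have "(S * (kron (1\<^sub>m (2 ^ k)) (braid 2 2) * S)) $$ (u * 2 + a, w * 2 + b) =
    (\<Sum>v<2 ^ k * 2. symm (Suc k) $$ (u, v) * (kron (1\<^sub>m (2 ^ k)) (braid 2 2) * S) $$ (v * 2 + a, w * 2 + b))"
    unfolding S_def
    by (subst kron_one_mult_row[of _ "2 ^ Suc k" _ "2 ^ k * 4"]) (use b wb S S_def in \<open>auto simp: mult.commute\<close>)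
  also have "\<dots> = (\<Sum>x<2 ^ k. \<Sum>t<2. symm (Suc k) $$ (u, x * 2 + t) * S $$ ((x * 2 + a) * 2 + t, w * 2 + b))"
    unfolding sum_pair using b wb S by (intro sum.cong refl) (subst braid_mid_mult, auto)
  also have "\<dots> = (\<Sum>x<2 ^ k. \<Sum>t<2. if t = b then symm (Suc k) $$ (u, x * 2 + b) * symm (Suc k) $$ (x * 2 + a, w) else 0)"
  proof (intro sum.cong refl)
    fix x t assume xt: "x \<in> {..<2 ^ k :: nat}" "t \<in> {..<2 :: nat}"
    have "x * 2 + a < 2 ^ Suc k" using xt b pair_index_less[of x "2 ^ k" a 2] by simp
    then show "symm (Suc k) $$ (u, x * 2 + t) * S $$ ((x * 2 + a) * 2 + t, w * 2 + b) =
      (if t = b then symm (Suc k) $$ (u, x * 2 + b) * symm (Suc k) $$ (x * 2 + a, w) else 0)"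
      using xt b by (subst S_entry) auto
  qed
  also have "\<dots> = (\<Sum>x<2 ^ k. symm (Suc k) $$ (u, x * 2 + b) * symm (Suc k) $$ (x * 2 + a, w))"
    using b by simp
  also have "\<dots> = (\<Sum>x<2 ^ k. if weight x + b = weight u \<and> weight x + a = weight w
       then 1 / (of_nat (Suc k choose (weight x + b)) * of_nat (Suc k choose weight w)) else 0)"
  proof (intro sum.cong refl)
    fix x assume x: "x \<in> {..<2 ^ k :: nat}"
    have "x * 2 + a < 2 ^ Suc k" "x * 2 + b < 2 ^ Suc k"
      using x b pair_index_less[of x "2 ^ k" a 2] pair_index_less[of x "2 ^ k" b 2] by simp_all
    then show "symm (Suc k) $$ (u, x * 2 + b) * symm (Suc k) $$ (x * 2 + a, w) = (if weight x + b = weight u \<and> weight x + a = weight w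
       then 1 / (of_nat (Suc k choose (weight x + b)) * of_nat (Suc k choose weight w)) else 0 :: 'a)"
      using b by (simp add: symm_index weight_step)
  qed
  finally show ?thesis
    using sum_weight[of "\<lambda>j. if j + b = weight u \<and> j + a = weight w
       then 1 / (of_nat (Suc k choose (j + b)) * of_nat (Suc k choose weight w)) else 0 :: 'a" k] by simp
qed

lemma sum_delta_le:
  "(\<Sum>j\<le>k. if j = (i::nat) then f j else 0) = (if i \<le> k then f i else (0 :: 'a::comm_monoid_add))"
  by simp

text \<open>With n = k + 1, the symmetric group on n + 1 letters is the union of two double cosets
  of the group on n letters, with n! and n * n! elements; averaging over each gives the two
  summands. The proof compares entries.\<close>

lemma symm_Suc:
  assumes char: "Suc (Suc k) < CHAR('a::field)"
  defines "S \<equiv> kron (symm (Suc k)) (1\<^sub>m 2 :: 'a mat)"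
  shows "of_nat (Suc (Suc k)) \<cdot>\<^sub>m symm (Suc (Suc k)) = S + of_nat (Suc k) \<cdot>\<^sub>m (S * (kron (1\<^sub>m (2 ^ k)) (braid 2 2) * S))"
proof (rule eq_mat_pairI[of _ "2 ^ Suc k" 2 "2 ^ Suc k" 2])
  define n where "n = Suc k"
  fix u a w b :: nat assume uw: "u < 2 ^ Suc k" "a < (2::nat)" "w < 2 ^ Suc k" "b < (2::nat)"
  let ?i = "u * 2 + a" and ?j = "w * 2 + b"
  let ?B = "\<lambda>n k. of_nat (n choose k) :: 'a"
  have ij: "?i < 2 ^ Suc (Suc k)" "?j < 2 ^ Suc (Suc k)"
    using pair_index_less[OF uw(1,2)] pair_index_less[OF uw(3,4)] by (simp_all add: mult.commute)
  have pw: "weight w \<le> n" "weight u \<le> n" using weight_le uw by (auto simp: n_def simp del: power_Suc)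
  have Bn: "?B n j \<noteq> 0" if "j \<le> n" for j using that char by (intro choose_nonzero) (auto simp: n_def)
  have BSn: "?B (Suc n) j \<noteq> 0" if "j \<le> Suc n" for j using that char by (intro choose_nonzero) (auto simp: n_def)
  define T where "T = (\<Sum>j\<le>k. ?B k j * (if j + b = weight u \<and> j + a = weight w then 1 / (?B n (j + b) * ?B n (weight w)) else 0))"
  have S: "S $$ (?i, ?j) = (if a = b \<and> weight u = weight w then 1 / ?B n (weight w) else 0)"
    unfolding S_def n_def using uw by (subst kron_pair) (auto simp: symm_index simp del: power_Suc)
  \<comment> \<open>The identity of entries. If the words \<open>u a\<close> and \<open>w b\<close>
    have different weights, both sides vanish; otherwise it is an identity of binomial
    coefficients.\<close>
  have goal: "of_nat (Suc n) * (if weight u + a = weight w + b then 1 / ?B (Suc n) (weight w + b) else 0) =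
    (if a = b \<and> weight u = weight w then 1 / ?B n (weight w) else 0) + of_nat n * T"
  proof (cases "weight u + a = weight w + b")
    case False
    then have "T = 0" unfolding T_def by (intro sum.neutral) auto
    then show ?thesis using False by auto
  next
    case True
    have absorb: "of_nat n * ?B k j = (of_nat n - of_nat j) * ?B n j" if "j \<le> n" for j
    proof -
      have "(n - j) * (n choose j) = n * (k choose j)" using binomial_absorb_comp[of n j] by (simp add: n_def)
      then have "(of_nat (n - j) :: 'a) * ?B n j = of_nat n * ?B k j" by (metis of_nat_mult)
      then show ?thesis using that by (simp add: of_nat_diff)
    qed
    have absorb1: "of_nat n * ?B k j = of_nat (Suc j) * ?B n (Suc j)" for j
      unfolding n_def of_nat_mult[symmetric] Suc_times_binomial ..
    have absorb2: "of_nat (Suc n) * ?B n j = of_nat (Suc j) * ?B (Suc n) (Suc j)" for j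
      unfolding of_nat_mult[symmetric] Suc_times_binomial ..
    have absorb3: "of_nat (Suc n) * ?B n j = (of_nat (Suc n) - of_nat j) * ?B (Suc n) j" if "j \<le> Suc n" for j
    proof -
      have "(Suc n - j) * (Suc n choose j) = Suc n * (n choose j)" using binomial_absorb_comp[of "Suc n" j] by simp
      then have "(of_nat (Suc n - j) :: 'a) * ?B (Suc n) j = of_nat (Suc n) * ?B n j" by (metis of_nat_mult)
      then show ?thesis using that by (simp add: of_nat_diff)
    qed
    \<comment> \<open>The last letters of row and column determine the j that contributes to
      \<open>T\<close>. The first summand is present only if they agree, and an absorption identity
      for binomials closes each case.\<close>
    consider "a = 0" "b = 0" | "a = 1" "b = 1" | "a = 0" "b = 1" | "a = 1" "b = 0"
      using uw(2,4) by (auto simp: less_2_cases_iff)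
    then show ?thesis
    proof cases
      case 1
      then have P: "weight u = weight w" using True by simp
      define P where "P = weight w"
      have "T = (\<Sum>j\<le>k. if j = P then ?B k j / (?B n j * ?B n P) else 0)"
        unfolding T_def by (intro sum.cong refl) (use 1 P in \<open>auto simp: P_def\<close>)
      also have "\<dots> = ?B k P / (?B n P * ?B n P)"
        unfolding sum_delta_le by (auto simp: binomial_eq_0)
      finally have T: "T = ?B k P / (?B n P * ?B n P)" .
      have Pn: "P \<le> n" using pw by (simp add: P_def)
      have "of_nat n * T = (of_nat n * ?B k P) / (?B n P * ?B n P)" unfolding T by simp
      also have "\<dots> = (of_nat n - of_nat P) / ?B n P" unfolding absorb[OF Pn] using Bn[OF Pn] by simp
      finally have "1 / ?B n P + of_nat n * T = 1 / ?B n P + (of_nat n - of_nat P) / ?B n P" by simp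
      also have "\<dots> = (of_nat (Suc n) - of_nat P) / ?B n P" by (simp add: add_divide_distrib diff_divide_distrib)
      also have "\<dots> = of_nat (Suc n) / ?B (Suc n) P"
        using absorb3[of P] Pn Bn[OF Pn] BSn[of P] by (simp add: frac_eq_eq mult.commute)
      finally show ?thesis using 1 P by (simp add: P_def)
    next
      case 2
      then have P: "weight u = weight w" using True by simp
      define P where "P = weight w"
      have T: "of_nat n * T = of_nat P / ?B n P"
      proof (cases P)
        case 0
        then have "T = 0" unfolding T_def using 2 by (intro sum.neutral) (auto simp: P_def)
        then show ?thesis using 0 by simp
      next
        case (Suc Q)
        have Q: "Q \<le> k" using pw Suc by (simp add: P_def n_def)
        have "T = (\<Sum>j\<le>k. if j = Q then ?B k j / (?B n P * ?B n P) else 0)"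
          unfolding T_def by (intro sum.cong refl) (use 2 P Suc in \<open>auto simp: P_def\<close>)
        also have "\<dots> = ?B k Q / (?B n P * ?B n P)" unfolding sum_delta_le using Q by simp
        finally have "of_nat n * T = (of_nat n * ?B k Q) / (?B n P * ?B n P)" by simp
        also have "\<dots> = of_nat P / ?B n P" unfolding absorb1 Suc using Bn[of P] Suc Q by (simp add: n_def)
        finally show ?thesis .
      qed
      have Pn: "P \<le> n" using pw by (simp add: P_def)
      have "1 / ?B n P + of_nat n * T = of_nat (Suc P) / ?B n P" unfolding T by (simp add: add_divide_distrib)
      also have "\<dots> = of_nat (Suc n) / ?B (Suc n) (Suc P)"
        using absorb2[of P] Bn[OF Pn] BSn[of "Suc P"] Pn by (simp add: frac_eq_eq mult.commute del: of_nat_Suc binomial_Suc_Suc)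
      finally show ?thesis using 2 P by (simp add: P_def del: of_nat_Suc binomial_Suc_Suc)
    next
      case 3
      then have P: "weight u = Suc (weight w)" using True by simp
      define P where "P = weight w"
      have Pk: "P \<le> k" using pw P by (simp add: P_def n_def)
      have "T = (\<Sum>j\<le>k. if j = P then ?B k j / (?B n (Suc P) * ?B n P) else 0)"
        unfolding T_def by (intro sum.cong refl) (use 3 P in \<open>auto simp: P_def\<close>)
      also have "\<dots> = ?B k P / (?B n (Suc P) * ?B n P)" unfolding sum_delta_le using Pk by simp
      finally have "of_nat n * T = (of_nat n * ?B k P) / (?B n (Suc P) * ?B n P)" by simp
      also have "\<dots> = of_nat (Suc P) / ?B n P" unfolding absorb1 using Bn[of "Suc P"] Pk by (simp add: n_def del: of_nat_Suc)
      also have "\<dots> = of_nat (Suc n) / ?B (Suc n) (Suc P)"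
        using absorb2[of P] Bn[of P] BSn[of "Suc P"] Pk by (simp add: frac_eq_eq mult.commute n_def del: of_nat_Suc binomial_Suc_Suc)
      finally show ?thesis using 3 P by (simp add: P_def del: of_nat_Suc binomial_Suc_Suc)
    next
      case 4
      then have P: "weight w = Suc (weight u)" using True by simp
      define P where "P = weight u"
      have Pk: "P \<le> k" using pw P by (simp add: P_def n_def)
      have "T = (\<Sum>j\<le>k. if j = P then ?B k j / (?B n P * ?B n (Suc P)) else 0)"
        unfolding T_def by (intro sum.cong refl) (use 4 P in \<open>auto simp: P_def\<close>)
      also have "\<dots> = ?B k P / (?B n P * ?B n (Suc P))" unfolding sum_delta_le using Pk by simp
      finally have "of_nat n * T = (of_nat n * ?B k P) / (?B n P * ?B n (Suc P))" by simp
      also have "\<dots> = of_nat (Suc P) / ?B n P" unfolding absorb1 using Bn[of "Suc P"] Pk by (simp add: n_def del: of_nat_Suc)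
      also have "\<dots> = of_nat (Suc n) / ?B (Suc n) (Suc P)"
        using absorb2[of P] Bn[of P] BSn[of "Suc P"] Pk by (simp add: frac_eq_eq mult.commute n_def del: of_nat_Suc binomial_Suc_Suc)
      finally show ?thesis using 4 P by (simp add: P_def del: of_nat_Suc binomial_Suc_Suc)
    qed
  qed
  have l: "(of_nat (Suc (Suc k)) \<cdot>\<^sub>m symm (Suc (Suc k))) $$ (?i, ?j) =
    of_nat (Suc n) * (if weight u + a = weight w + b then 1 / ?B (Suc n) (weight w + b) else 0)"
    using ij uw by (simp add: symm_index weight_step n_def del: power_Suc of_nat_Suc binomial_Suc_Suc)
  have r: "(S + of_nat (Suc k) \<cdot>\<^sub>m (S * (kron (1\<^sub>m (2 ^ k)) (braid 2 2) * S))) $$ (?i, ?j) =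
    S $$ (?i, ?j) + of_nat n * (S * (kron (1\<^sub>m (2 ^ k)) (braid 2 2) * S)) $$ (?i, ?j)"
    using ij by (simp add: S_def n_def mult.commute del: index_mult_mat(1) of_nat_Suc)
  show "(of_nat (Suc (Suc k)) \<cdot>\<^sub>m symm (Suc (Suc k))) $$ (?i, ?j) =
    (S + of_nat (Suc k) \<cdot>\<^sub>m (S * (kron (1\<^sub>m (2 ^ k)) (braid 2 2) * S))) $$ (?i, ?j)"
    unfolding l r S goal unfolding S_def symm_sandwich[OF uw(1,3,2,4)] T_def n_def ..
qed (auto simp: S_def)

lemma symm_small: "symm 0 = (1\<^sub>m 1 :: 'a::field mat)" "symm (Suc 0) = (1\<^sub>m 2 :: 'a mat)"
proof -
  show "symm 0 = (1\<^sub>m 1 :: 'a mat)" by (intro eq_matI) (auto simp: symm_def)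
  have "weight 1 = 1" using weight_step[of 1 0] by simp
  then show "symm (Suc 0) = (1\<^sub>m 2 :: 'a mat)" by (intro eq_matI) (auto simp: symm_def less_2_cases_iff)
qed

text \<open>Each of the n + 1 weights contributes 1 to the trace.\<close>

lemma tr_symm:
  assumes "n < CHAR('a::field)"
  shows "tr (symm n :: 'a mat) = of_nat (Suc n)"
proof -
  have "tr (symm n :: 'a mat) = (\<Sum>x<2 ^ n. 1 / of_nat (n choose weight x))"
    by (auto simp: tr_def symm_index intro!: sum.cong)
  also have "\<dots> = (\<Sum>j\<le>n. of_nat (n choose j) * (1 / of_nat (n choose j)))" by (rule sum_weight)
  also have "\<dots> = (\<Sum>j\<le>n. 1)" using choose_nonzero[OF _ assms] by (intro sum.cong) auto
  finally show ?thesis by simp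
qed

text \<open>Two consecutive binomial coefficients of p - 1 add up to one of p, which vanishes in
  characteristic p.\<close>

lemma choose_char_minus_one:
  assumes "k < CHAR('a::field)"
  shows "(of_nat (CHAR('a) - 1 choose k) :: 'a) = (- 1) ^ k"
  using assms
proof (induction k)
  case (Suc k)
  have p: "prime CHAR('a)" using Suc.prems by (intro prime_CHAR_semidom) simp
  have "CHAR('a) dvd (CHAR('a) choose Suc k)" using Suc.prems p by (intro dvd_choose_prime) auto
  then have "(of_nat (CHAR('a) choose Suc k) :: 'a) = 0" by (simp add: of_nat_eq_0_iff_char_dvd)
  moreover have "CHAR('a) choose Suc k = (CHAR('a) - 1 choose k) + (CHAR('a) - 1 choose Suc k)"
    using Suc.prems by (cases "CHAR('a)") auto
  ultimately have "of_nat (CHAR('a) - 1 choose k) + (of_nat (CHAR('a) - 1 choose Suc k) :: 'a) = 0"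
    by (metis of_nat_add)
  then have "(of_nat (CHAR('a) - 1 choose Suc k) :: 'a) = - of_nat (CHAR('a) - 1 choose k)"
    by (metis add.commute eq_neg_iff_add_eq_0)
  then show ?case using Suc by simp
qed simp

text \<open>In degree \<open>p - 1\<close> the symmetrizer is a commutator with the structure matrix, hence negligible. The
  symmetric power is \<open>k[t]/(t\<^sup>p)\<close> with \<open>d/dt\<close> as structure matrix, and the commutator of \<open>d/dt\<close> with
  multiplication by \<open>t\<close> is the identity.\<close>

lemma symm_negligible:
  assumes p: "0 < CHAR('a::field)"
  defines "n \<equiv> CHAR('a) - 1"
  shows "treq (Vn n) (Vn n) (symm n :: 'a mat) (0\<^sub>m (2 ^ n) (2 ^ n))"
proof -
  \<comment> \<open>\<open>A\<close> raises the weight by one; its sign is the inverse of the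
    binomial coefficient of the target weight in degree p - 1. On weight w the commutator is
    \<open>(-1)^w (- n)\<close>, which equals \<open>(-1)^w\<close> because n = -1 in the
    field.\<close>
  define A where "A = mat (2 ^ n) (2 ^ n) (\<lambda>(r, c). if weight r = Suc (weight c) then (- 1) ^ Suc (weight c) else 0 :: 'a)"
  have A: "A \<in> carrier_mat (2 ^ n) (2 ^ n)" by (simp add: A_def)
  have pn: "(of_nat n :: 'a) = - 1" using p by (simp add: n_def of_nat_diff Suc_leI)
  have "symm n = Vn n * A - A * Vn n"
  proof (rule eq_matI)
    fix r c assume "r < dim_row (Vn n * A - A * Vn n)" "c < dim_col (Vn n * A - A * Vn n)"
    then have rc: "r < 2 ^ n" "c < 2 ^ n" using A by auto
    have "(Vn n * A) $$ (r, c) = (\<Sum>u<2 ^ n. Vn n $$ (r, u) * (if weight u = Suc (weight c) then (- 1) ^ Suc (weight c) else 0))"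
      using rc A by (subst mult_index) (auto simp: A_def intro!: sum.cong)
    also have "\<dots> = (of_nat n - of_nat (weight r)) * (if weight r = weight c then (- 1) ^ Suc (weight c) else 0)"
      by (subst Vn_row_sum[OF rc(1), of "\<lambda>j. if j = Suc (weight c) then (- 1) ^ Suc (weight c) else 0"]) simp
    finally have 1: "(Vn n * A) $$ (r, c) = (of_nat n - of_nat (weight r)) * (if weight r = weight c then (- 1) ^ Suc (weight c) else 0)" .
    have "(A * Vn n) $$ (r, c) = (\<Sum>u<2 ^ n. (if weight r = Suc (weight u) then (- 1) ^ Suc (weight u) else 0) * Vn n $$ (u, c))"
      using rc A by (subst mult_index) (auto simp: A_def intro!: sum.cong)
    \<comment> \<open>For weight 0 the truncated subtraction gives a wrong comparison, which is
      harmless since the factor in front is 0.\<close>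
    also have "\<dots> = of_nat (weight c) * (if weight r = Suc (weight c - 1) then (- 1) ^ Suc (weight c - 1) else 0)"
      by (rule Vn_col_sum[OF rc(2), of "\<lambda>j. if weight r = Suc j then (- 1) ^ Suc j else 0"])
    finally have 2: "(A * Vn n) $$ (r, c) = of_nat (weight c) * (if weight r = weight c then (- 1) ^ weight c else 0)"
      by (cases "weight c") auto
    have "weight c < CHAR('a)" using weight_le[OF rc(2)] p by (simp add: n_def)
    then have "(of_nat (n choose weight c) :: 'a) = (- 1) ^ weight c" unfolding n_def by (rule choose_char_minus_one)
    then have "symm n $$ (r, c) = (if weight r = weight c then (- 1) ^ weight c else 0 :: 'a)"
      using rc by (simp add: symm_index) (simp add: divide_eq_eq power_mult_distrib[symmetric] flip: power_mult_distrib)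
    then show "symm n $$ (r, c) = (Vn n * A - A * Vn n) $$ (r, c)"
      using rc A 1 2 pn by (cases "weight r = weight c") (simp_all del: index_mult_mat(1) add: algebra_simps)
  qed (use A in auto)
  then have S: "symm n = Vn n * A - A * Vn n" .
  show ?thesis
    unfolding treq_def
  proof
    fix h :: "'a mat" assume h: "h \<in> intw (Vn n) (Vn n)"
    have hc: "h \<in> carrier_mat (2 ^ n) (2 ^ n)" using intw_dim[OF h] by (intro carrier_matI) auto
    \<comment> \<open>As \<open>h\<close> commutes with \<open>Vn n\<close>, cyclicity makes the two
      halves of the commutator cancel under the trace.\<close>
    have "tr (h * (Vn n * A)) = tr ((Vn n * h) * A)"
      using hc A intw_dim(3)[OF h] by (simp flip: mult_assoc_dim)
    also have "\<dots> = tr ((h * A) * Vn n)" using hc A tr_comm[of "Vn n" "h * A"] by (simp add: mult_assoc_dim)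
    finally have "tr (h * symm n) = 0"
      unfolding S using hc A by (simp add: mult_minus_dim tr_minus mult_assoc_dim)
    then show "tr (h * symm n) = tr (h * 0\<^sub>m (2 ^ n) (2 ^ n))" using hc by simp
  qed
qed


subsection \<open>Negligible intertwiners\<close>

definition negl :: "'a::field mat \<Rightarrow> 'a mat \<Rightarrow> 'a mat \<Rightarrow> bool" where
  "negl E F f \<longleftrightarrow> (\<forall>h\<in>intw F E. tr (h * f) = 0)"

lemma negl_iff_treq:
  "negl E F f \<longleftrightarrow> treq E F f (0\<^sub>m (dim_row F) (dim_row E))"
proof -
  have "tr (h * 0\<^sub>m (dim_row F) (dim_row E)) = 0" if "h \<in> intw F E" for h
    using intw_dim(1,2)[OF that] by simp
  then show ?thesis unfolding negl_def treq_def by simp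
qed

lemma cls_Zero_iff:
  assumes "square_mat E" "square_mat F" "f \<in> intw E F"
  shows "cls E F f = Zero vcat [E] [F] \<longleftrightarrow> negl E F f"
  unfolding vcat_const negl_iff_treq by (rule cls_eq_iff[OF assms(3) intw_zero[OF assms(1,2)]])

lemma negl_mult_right:
  assumes sq: "square_mat D" "square_mat E" "square_mat F" and f: "f \<in> intw D E" and g: "g \<in> intw E F" "negl E F g"
  shows "negl D F (g * f)"
  unfolding negl_def
proof
  fix h assume h: "h \<in> intw F D"
  have "tr (h * (g * f)) = tr ((f * h) * g)"
    using tr_comm[of "h * g" f] intw_dim(1,2)[OF f] intw_dim(1,2)[OF g(1)] intw_dim(1,2)[OF h]
    by (simp add: mult_assoc_dim)
  then show "tr (h * (g * f)) = 0" using g(2) intw_mult[OF sq(3,1,2) h f] unfolding negl_def by simp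
qed

lemma treq_negl: "treq E F f g \<Longrightarrow> negl E F f \<longleftrightarrow> negl E F g"
  unfolding treq_def negl_def by auto


subsection \<open>Relations between the letters of a word\<close>

text \<open>\<open>r\<close> applied to two adjacent letters, with i letters before them and j after
  them.\<close>

definition ins :: "nat \<Rightarrow> nat \<Rightarrow> 'a::field mat \<Rightarrow> 'a mat" where
  "ins i j r = kron (kron (1\<^sub>m (2 ^ i)) r) (1\<^sub>m (2 ^ j))"

abbreviation VV :: "'a::field mat" where
  "VV \<equiv> tsum Vmat Vmat"

lemma VV_square: "square_mat VV"
  by simp

lemma Vn_VV: "tsum (tsum (Vn i) VV) (Vn j) = Vn (i + j + 2)"
proof -
  have "Vn 2 = (VV :: 'a mat)" by (simp only: numeral_2_eq_2 Vn.simps(2)[of "Suc 0"] Vn_one)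
  then show ?thesis using Vn_add[of i 2] Vn_add[of "i + 2" j] by (metis add.assoc add.commute)
qed

lemma tensor_power_vcat: "tensor_power vcat [Vmat] n = [Vn n]"
  by (induction n) auto

lemma relation_obj_vcat:
  assumes "square_mat R"
  shows "relation_obj vcat [Vmat] [R] i j = [tsum (tsum (Vn i) R) (Vn j)]"
proof (induction j)
  case 0
  have "square_mat (tsum (Vn i) R)" using assms by simp
  then show ?case using tsum_unit(2)[of "tsum (Vn i) R"] by (simp add: tensor_power_vcat del: One_nat_def square_mat.simps)
next
  case (Suc j)
  have "square_mat (tsum (Vn i) R)" using assms by simp
  then show ?case using Suc tsum_assoc[of "tsum (Vn i) R" "Vn j" Vmat] by simp
qed

lemma intw_ins:
  assumes "square_mat R" "square_mat R'" "r \<in> intw R R'"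
  shows "ins i j r \<in> intw (tsum (tsum (Vn i) R) (Vn j)) (tsum (tsum (Vn i) R') (Vn j))"
  unfolding ins_def
  using assms intw_one[OF Vn_square(1), of i] intw_one[OF Vn_square(1), of j]
  by (intro intw_kron) simp_all

lemma intw_ins_VV: "\<lbrakk>square_mat R; r \<in> intw R VV\<rbrakk> \<Longrightarrow> ins i j r \<in> intw (tsum (tsum (Vn i) R) (Vn j)) (Vn (i + j + 2))"
  using intw_ins[of R VV r i j] VV_square unfolding Vn_VV by blast

lemma treq_ins:
  assumes "square_mat R" "square_mat R'" "r \<in> intw R R'" "r' \<in> intw R R'" "treq R R' r r'"
  shows "treq (tsum (tsum (Vn i) R) (Vn j)) (tsum (tsum (Vn i) R') (Vn j)) (ins i j r) (ins i j r')"
  unfolding ins_def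
  using assms intw_one[OF Vn_square(1), of i] intw_one[OF Vn_square(1), of j]
  by (intro treq_kron intw_kron treq_refl) simp_all

lemma ins_mult: "dim_col a = dim_row b \<Longrightarrow> ins i j (a * b) = ins i j a * ins i j b"
  by (simp add: ins_def kron_mult)

lemma ins_dim [simp]: "dim_row (ins i j r) = 2 ^ i * dim_row r * 2 ^ j" "dim_col (ins i j r) = 2 ^ i * dim_col r * 2 ^ j"
  by (simp_all add: ins_def)

text \<open>All associators are identities, so only Kronecker products with identities
  remain.\<close>

lemma relation_mor_vcat:
  fixes r :: "'a::field mat"
  assumes R: "square_mat R" and r: "r \<in> intw R VV"
  shows "relation_mor vcat [Vmat] [R] (cls R VV r) i j =
    cls (tsum (tsum (Vn i) R) (Vn j)) (Vn (i + j + 2)) (ins i j r)"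
proof (induction j)
  case 0
  interpret symmetric_monoidal_linear_category "vcat :: 'a concrete_tensor_data" by (rule vcat_symmetric)
  have sq: "square_mat (tsum (Vn i) R)" "square_mat (tsum (Vn i) VV)" using R by simp_all
  have i1: "1\<^sub>m (2 ^ i) \<in> intw (Vn i) (Vn i :: 'a mat)" using intw_one[OF Vn_square(1), of i] by simp
  have k: "kron (1\<^sub>m (2 ^ i)) r \<in> intw (tsum (Vn i) R) (tsum (Vn i) VV)"
    by (rule intw_kron[OF Vn_square(1,1) R VV_square i1 r])
  have o: "[tsum (Vn i) VV] \<in> Obj vcat" "[tsum (Vn i) R] \<in> Obj vcat" using sq by (simp_all del: square_mat.simps)
  have "relation_mor vcat [Vmat] [R] (cls R VV r) i 0 =
    Comp vcat (lincat.Id vcat [tsum (Vn i) VV]) (cls (tsum (Vn i) R) (tsum (Vn i) VV) (kron (1\<^sub>m (2 ^ i)) r))"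
    using Inv_Id[OF o(1)] vcat_TensorM[OF Vn_square(1,1) R VV_square i1 r]
    by (simp add: tensor_power_vcat vcat_Assoc vcat_const(1) tsum_assoc[OF Vn_square(1,2,2)] del: square_mat.simps)
  also have "\<dots> = cls (tsum (Vn i) R) (tsum (Vn i) VV) (kron (1\<^sub>m (2 ^ i)) r)"
    by (rule Id_Comp[OF o(2,1) vcat_HomI[OF k]])
  also have "tsum (Vn i) VV = Vn (i + 0 + 2)" by (simp only: Vn_VV[of i 0, symmetric] Vn.simps(1) tsum_unit(2)[OF sq(2)])
  also have "tsum (Vn i) R = tsum (tsum (Vn i) R) (Vn 0)" by (simp only: Vn.simps(1) tsum_unit(2)[OF sq(1)])
  also have "kron (1\<^sub>m (2 ^ i)) r = ins i 0 r" unfolding ins_def power_0 kron_unit ..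
  finally show ?case .
next
  case (Suc j)
  have sq: "square_mat (tsum (Vn i) R)" "square_mat (tsum (tsum (Vn i) R) (Vn j))" using R by simp_all
  have i1: "1\<^sub>m 2 \<in> intw Vmat (Vmat :: 'a mat)" using intw_one[OF Vn_square(2)] by simp
  have "relation_mor vcat [Vmat] [R] (cls R VV r) i (Suc j) =
    TensorM vcat (cls (tsum (tsum (Vn i) R) (Vn j)) (Vn (i + j + 2)) (ins i j r)) (cls Vmat Vmat (1\<^sub>m 2))"
    using Suc by (simp add: vcat_const)
  also have "\<dots> = cls (tsum (tsum (tsum (Vn i) R) (Vn j)) Vmat) (tsum (Vn (i + j + 2)) Vmat) (kron (ins i j r) (1\<^sub>m 2))"
    by (rule vcat_TensorM[OF sq(2) Vn_square(1) Vn_square(2,2) intw_ins_VV[OF R r] i1])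
  also have "tsum (tsum (tsum (Vn i) R) (Vn j)) Vmat = tsum (tsum (Vn i) R) (Vn (Suc j))"
    using tsum_assoc[OF sq(1) Vn_square] by simp
  also have "kron (ins i j r) (1\<^sub>m 2) = ins i (Suc j) r"
    by (simp add: ins_def kron_assoc mult.commute)
  finally show ?case by simp
qed

text \<open>The image of \<open>P\<close> is the object of relations \<open>r\<close>; the idempotent \<open>s\<close> is characterized by killing all
  relations and fixing every morphism that kills them.\<close>

lemma quadratic_quotient_dimension:
  fixes R r P h s :: "'a::field mat"
  assumes R: "square_mat R" and r: "r \<in> intw R VV" and P: "P \<in> intw VV VV" and h: "h \<in> intw VV R"
    and Pr: "treq R VV (P * r) r" and rh: "treq VV VV (r * h) P" and s: "s \<in> intw (Vn n) (Vn n)"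
    and sP: "\<And>i j. i + j + 2 = n \<Longrightarrow> negl (Vn n) (Vn n) (s * ins i j P)"
    and gP: "\<And>W g. \<lbrakk>square_mat W; g \<in> intw (Vn n) W; \<And>i j. i + j + 2 = n \<Longrightarrow> negl (Vn n) W (g * ins i j P)\<rbrakk>
      \<Longrightarrow> treq (Vn n) W (g * s) g"
  shows "\<exists>Q. is_quadratic_quotient vcat [Vmat] [R] (cls R VV r) n Q"
    "is_quadratic_quotient vcat [Vmat] [R] (cls R VV r) n Q \<Longrightarrow> dimension vcat Q = tr s"
proof -
  interpret split_regular_category "vcat :: 'a concrete_tensor_data" "\<lambda>X. dim_row (hd X)"
    by (rule vcat_split_regular)
  let ?T = "Vn n :: 'a mat"
  let ?RO = "\<lambda>i j. tsum (tsum (Vn i) R) (Vn j)"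
  define F where "F = {(relation_obj vcat [Vmat] [R] i j, relation_mor vcat [Vmat] [R] (cls R VV r) i j) |i j. i + j + 2 = n}"
  have F_iff: "(V, f) \<in> F \<longleftrightarrow> (\<exists>i j. i + j + 2 = n \<and> V = [?RO i j] \<and> f = cls (?RO i j) ?T (ins i j r))" for V f
  proof -
    have "(V, f) \<in> F \<longleftrightarrow> (\<exists>i j. V = [?RO i j] \<and> f = cls (?RO i j) (Vn (i + j + 2)) (ins i j r) \<and> i + j + 2 = n)"
      unfolding F_def relation_obj_vcat[OF R] relation_mor_vcat[OF R r] by blast
    also have "\<dots> \<longleftrightarrow> (\<exists>i j. i + j + 2 = n \<and> V = [?RO i j] \<and> f = cls (?RO i j) ?T (ins i j r))" by metis
    finally show ?thesis .
  qed
  have T: "square_mat ?T" by (rule Vn_square)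
  have RO: "square_mat (?RO i j)" for i j by simp
  note ir = intw_ins_VV[OF R r] and iP = intw_ins_VV[OF VV_square P, unfolded Vn_VV]
  have ih: "ins i j h \<in> intw (Vn (i + j + 2)) (?RO i j)" for i j
    using intw_ins[OF VV_square R h, of i j] unfolding Vn_VV .
  \<comment> \<open>Modulo negligible morphisms \<open>ins i j r\<close> and
    \<open>ins i j P\<close> factor through each other. Killing the relations is thus the same as
    killing all \<open>ins i j P\<close>, which mention neither \<open>R\<close> nor
    \<open>r\<close>.\<close>
  have insr: "treq (?RO i j) (Vn (i + j + 2)) (ins i j P * ins i j r) (ins i j r)" for i j
    using treq_ins[OF R VV_square intw_mult[OF R VV_square VV_square r P] r Pr, of i j]
      intw_dim(1,2)[OF P] intw_dim(1,2)[OF r] unfolding Vn_VV by (simp add: ins_mult)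
  have insP: "treq (Vn (i + j + 2)) (Vn (i + j + 2)) (ins i j r * ins i j h) (ins i j P)" for i j
    using treq_ins[OF VV_square VV_square intw_mult[OF VV_square R VV_square h r] P rh, of i j]
      intw_dim(1,2)[OF h] intw_dim(1,2)[OF r] unfolding Vn_VV by (simp add: ins_mult)
  have arr_cls: "arr [E] [F] (cls E F f)" if "square_mat E" "square_mat F" "f \<in> intw E F" for E F f :: "'a mat"
    unfolding arr_def using that by (simp add: vcat_HomI del: square_mat.simps)
  have arr_s: "arr [?T] [?T] (cls ?T ?T s)" by (rule arr_cls[OF T T s])
  have FF: "arr V [?T] f \<and> Comp vcat (cls ?T ?T s) f = Zero vcat V [?T]" if Vf: "(V, f) \<in> F" for V f
  proof -
    obtain i j where ij: "n = i + j + 2" "V = [?RO i j]" "f = cls (?RO i j) ?T (ins i j r)"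
      using Vf unfolding F_iff by auto
    have a: "arr V [?T] f" unfolding ij(2,3) by (rule arr_cls[OF RO T]) (use ir ij(1) in simp)
    have ir': "ins i j r \<in> intw (?RO i j) ?T" and iP': "ins i j P \<in> intw ?T ?T" using ir iP ij(1) by simp_all
    have "negl (?RO i j) ?T (s * ins i j P * ins i j r)"
      by (rule negl_mult_right[OF RO T T ir' intw_mult[OF T T T iP' s] sP]) (use ij in simp)
    moreover have "s * ins i j P * ins i j r = s * (ins i j P * ins i j r)"
      using intw_dim(1,2)[OF s] intw_dim(1,2)[OF ir'] intw_dim(1,2)[OF iP'] by (intro mult_assoc_dim) simp_all
    moreover have "treq (?RO i j) ?T (s * (ins i j P * ins i j r)) (s * ins i j r)"
      by (rule treq_mult[OF RO T T intw_mult[OF RO T T ir' iP'] ir' _ s s treq_refl]) (use insr ij(1) in simp)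
    ultimately have "negl (?RO i j) ?T (s * ins i j r)" using treq_negl by metis
    then have "Comp vcat (cls ?T ?T s) f = Zero vcat V [?T]"
      unfolding ij(2,3) vcat_Comp[OF RO T T s ir'] cls_Zero_iff[OF RO T intw_mult[OF RO T T ir' s]] .
    with a show ?thesis by blast
  qed
  have GG: "Comp vcat g (cls ?T ?T s) = g"
    if g: "arr [?T] W g" and gF: "\<And>V f. (V, f) \<in> F \<Longrightarrow> Comp vcat g f = Zero vcat V W" for W g
  proof -
    obtain W' where W: "W = [W']" "square_mat W'" using g unfolding arr_def by auto
    obtain g' where g': "g' \<in> intw ?T W'" "g = cls ?T W' g'" using g unfolding arr_def W(1) vcat_Hom by blast
    have "negl ?T W' (g' * ins i j P)" if n: "i + j + 2 = n" for i j
    proof -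
      have ir': "ins i j r \<in> intw (?RO i j) ?T" and iP': "ins i j P \<in> intw ?T ?T" and ih': "ins i j h \<in> intw ?T (?RO i j)"
        using ir iP ih n by auto
      have "cls (?RO i j) W' (g' * ins i j r) = Zero vcat [?RO i j] [W']"
        using gF[of "[?RO i j]" "cls (?RO i j) ?T (ins i j r)"] n F_iff
        unfolding g'(2) W(1) vcat_Comp[OF RO T W(2) g'(1) ir'] by blast
      then have "negl (?RO i j) W' (g' * ins i j r)"
        using cls_Zero_iff[OF RO W(2) intw_mult[OF RO T W(2) ir' g'(1)]] by simp
      then have "negl ?T W' (g' * ins i j r * ins i j h)"
        by (rule negl_mult_right[OF T RO W(2) ih' intw_mult[OF RO T W(2) ir' g'(1)]])
      moreover have "g' * ins i j r * ins i j h = g' * (ins i j r * ins i j h)"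
        using intw_dim(1,2)[OF g'(1)] intw_dim(1,2)[OF ir'] intw_dim(1,2)[OF ih'] by (intro mult_assoc_dim) simp_all
      moreover have "treq ?T W' (g' * (ins i j r * ins i j h)) (g' * ins i j P)"
        by (rule treq_mult[OF T T W(2) intw_mult[OF T RO T ih' ir'] iP' _ g'(1,1) treq_refl]) (rule insP[of i j, unfolded n])
      ultimately show ?thesis using treq_negl by metis
    qed
    then have "treq ?T W' (g' * s) g'" by (rule gP[OF W(2) g'(1)])
    then show ?thesis
      unfolding g'(2) vcat_Comp[OF T T W(2) g'(1) s] cls_eq_iff[OF intw_mult[OF T T W(2) s g'(1)] g'(1)] .
  qed
  have "\<exists>J m Q q. is_image_sum vcat [?T] F J m \<and> is_cokernel vcat J [?T] m Q q"
  proof (rule ex_image_sum_cokernel[OF arr_s])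
    fix V f assume "(V, f) \<in> F"
    then show "arr V [?T] f \<and> Comp vcat (cls ?T ?T s) f = Zero vcat V [?T]" by (rule FF)
  next
    fix W g assume "arr [?T] W g" "\<And>V f. (V, f) \<in> F \<Longrightarrow> Comp vcat g f = Zero vcat V W"
    then show "Comp vcat g (cls ?T ?T s) = g" by (rule GG)
  qed
  then show "\<exists>Q. is_quadratic_quotient vcat [Vmat] [R] (cls R VV r) n Q"
    unfolding is_quadratic_quotient_def tensor_power_vcat F_def[symmetric] by blast
  assume "is_quadratic_quotient vcat [Vmat] [R] (cls R VV r) n Q"
  then obtain J m q where J: "is_image_sum vcat [?T] F J m" and q: "is_cokernel vcat J [?T] m Q q"
    unfolding is_quadratic_quotient_def tensor_power_vcat F_def[symmetric] by blast
  have "\<exists>u. arr Q [?T] u \<and> arr [?T] Q q \<and> Comp vcat q u = lincat.Id vcat Q \<and> Comp vcat u q = cls ?T ?T s"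
  proof (rule cokernel_splits_idempotent[OF arr_s _ _ J q])
    fix V f assume "(V, f) \<in> F"
    then show "arr V [?T] f \<and> Comp vcat (cls ?T ?T s) f = Zero vcat V [?T]" by (rule FF)
  next
    fix W g assume "arr [?T] W g" "\<And>V f. (V, f) \<in> F \<Longrightarrow> Comp vcat g f = Zero vcat V W"
    then show "Comp vcat g (cls ?T ?T s) = g" by (rule GG)
  qed
  then obtain u where u: "arr Q [?T] u" "arr [?T] Q q" "Comp vcat q u = lincat.Id vcat Q" "Comp vcat u q = cls ?T ?T s"
    by blast
  obtain Q' where Q: "Q = [Q']" "square_mat Q'" using u(1) unfolding arr_def by auto
  obtain u' q' where u': "u' \<in> intw Q' ?T" "u = cls Q' ?T u'" and q': "q' \<in> intw ?T Q'" "q = cls ?T Q' q'"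
    using u(1,2) unfolding arr_def Q(1) vcat_Hom by blast
  \<comment> \<open>The identity of the quotient and the idempotent \<open>s\<close> are the two
    composites of \<open>q'\<close> and \<open>u'\<close>; cyclicity turns the size of
    \<open>Q'\<close> into the trace of \<open>s\<close>.\<close>
  have "treq Q' Q' (q' * u') (1\<^sub>m (dim_row Q'))"
    using u(3) cls_eq_iff[OF intw_mult[OF Q(2) T Q(2) u'(1) q'(1)] intw_one[OF Q(2)]]
    unfolding Q(1) u'(2) q'(2) vcat_Comp[OF Q(2) T Q(2) q'(1) u'(1)] vcat_const by simp
  then have "tr (1\<^sub>m (dim_row Q') * (q' * u')) = tr (1\<^sub>m (dim_row Q') * 1\<^sub>m (dim_row Q'))"
    using intw_one[OF Q(2)] unfolding treq_def by blast
  then have 1: "tr (q' * u') = of_nat (dim_row Q')" using intw_dim(1,2)[OF q'(1)] intw_dim(1,2)[OF u'(1)] by simp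
  have "treq ?T ?T (u' * q') s"
    using u(4) cls_eq_iff[OF intw_mult[OF T Q(2) T q'(1) u'(1)] s]
    unfolding Q(1) u'(2) q'(2) vcat_Comp[OF T Q(2) T u'(1) q'(1)] by simp
  then have "tr (1\<^sub>m (2 ^ n) * (u' * q')) = tr (1\<^sub>m (2 ^ n) * s)"
    using intw_one[OF T] unfolding treq_def by simp
  then have 2: "tr (u' * q') = tr s" using intw_dim(1,2)[OF q'(1)] intw_dim(1,2)[OF u'(1)] intw_dim(1,2)[OF s] by simp
  have "tr (q' * u') = tr (u' * q')"
    using intw_dim(1,2)[OF q'(1)] intw_dim(1,2)[OF u'(1)] by (intro tr_comm) simp_all
  then show "dimension vcat Q = tr s" unfolding Q(1) vcat_dimension[OF Q(2)] using 1 2 by simp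
qed


subsection \<open>The relations of the symmetric and the exterior powers\<close>

definition swap :: "'a::field mat" where
  "swap = braid 2 2"

lemma swap_dim [simp]: "dim_row swap = 4" "dim_col swap = 4"
  by (simp_all add: swap_def)

lemma swap_swap: "swap * swap = (1\<^sub>m 4 :: 'a::field mat)"
  using braid_symmetric[of 2 2] by (simp add: swap_def)

lemma intw_swap: "swap \<in> intw VV (VV :: 'a::field mat)"
  using intw_braid[OF Vn_square(2,2)] by (simp add: swap_def)

lemma intw_one_VV: "1\<^sub>m 4 \<in> intw VV (VV :: 'a::field mat)"
  using intw_one[OF VV_square] by simp

text \<open>The symmetrizer of two letters for \<open>\<epsilon> = 1\<close> and the antisymmetrizer
  for \<open>\<epsilon> = -1\<close>.\<close>

definition half_swap :: "'a::field \<Rightarrow> 'a mat" where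
  "half_swap \<epsilon> = (1 / 2) \<cdot>\<^sub>m (1\<^sub>m 4 + \<epsilon> \<cdot>\<^sub>m swap)"

lemma half_swap_dim [simp]: "dim_row (half_swap \<epsilon>) = 4" "dim_col (half_swap \<epsilon>) = 4"
  by (simp_all add: half_swap_def)

lemma intw_half_swap: "half_swap \<epsilon> \<in> intw VV VV"
  unfolding half_swap_def using VV_square intw_swap intw_one_VV by (intro intw_smult intw_add)

abbreviation swap_minus_one :: "'a::field mat" where
  "swap_minus_one \<equiv> swap + (- 1) \<cdot>\<^sub>m 1\<^sub>m 4"

lemma intw_swap_minus_one: "swap_minus_one \<in> intw VV VV"
  using VV_square intw_swap intw_one_VV by (intro intw_smult intw_add)

lemma braid_minus_id_vcat:
  "braid_minus_id vcat [Vmat] = cls VV VV (swap_minus_one :: 'a::field mat)"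
proof -
  have "Scale vcat (- 1) (cls VV VV (1\<^sub>m 4)) = cls VV VV ((- 1) \<cdot>\<^sub>m 1\<^sub>m 4 :: 'a mat)"
    by (rule vcat_Scale[OF VV_square VV_square intw_one_VV])
  then show ?thesis
    using vcat_Add[OF VV_square VV_square intw_swap intw_smult[OF VV_square VV_square intw_one_VV, of "- 1"]]
    by (simp add: braid_minus_id_def vcat_const swap_def)
qed

lemma half_swap_identities:
  assumes "(2 :: 'a::field) \<noteq> 0"
  shows "half_swap 1 * swap_minus_one = (0\<^sub>m 4 4 :: 'a mat)" "swap_minus_one * half_swap 1 = (0\<^sub>m 4 4 :: 'a mat)"
    "half_swap 1 = 1\<^sub>m 4 + (1 / 2) \<cdot>\<^sub>m (swap_minus_one :: 'a mat)"
    "half_swap (- 1) = (- 1 / 2) \<cdot>\<^sub>m (swap_minus_one :: 'a mat)"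
    "half_swap (- 1) = 1\<^sub>m 4 - (half_swap 1 :: 'a mat)"
    "half_swap (- 1) * half_swap 1 = (0\<^sub>m 4 4 :: 'a mat)"
proof -
  have half: "(1 :: 'a) - 1 / 2 = 1 / 2" using assms by (simp add: field_simps)
  show 1: "half_swap 1 * swap_minus_one = (0\<^sub>m 4 4 :: 'a mat)" "swap_minus_one * half_swap 1 = (0\<^sub>m 4 4 :: 'a mat)"
    by (simp_all add: half_swap_def mat_dim_simps swap_swap) (auto intro!: eq_matI simp: algebra_simps)
  show "half_swap 1 = 1\<^sub>m 4 + (1 / 2) \<cdot>\<^sub>m (swap_minus_one :: 'a mat)"
    using half by (intro eq_matI) (auto simp: half_swap_def algebra_simps)
  show 4: "half_swap (- 1) = (- 1 / 2) \<cdot>\<^sub>m (swap_minus_one :: 'a mat)"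
    by (intro eq_matI) (auto simp: half_swap_def algebra_simps)
  show "half_swap (- 1) = 1\<^sub>m 4 - (half_swap 1 :: 'a mat)"
    using half by (intro eq_matI) (auto simp: half_swap_def algebra_simps)
  show "half_swap (- 1) * half_swap 1 = (0\<^sub>m 4 4 :: 'a mat)"
    unfolding 4 using 1(2) by (simp add: smult_mult_dim)
qed

lemma treq_diff_negl:
  assumes "f \<in> intw E F" "g \<in> intw E F" "negl E F g"
  shows "treq E F (f - g) f" "treq E F (f + c \<cdot>\<^sub>m g) f"
proof -
  have "tr (h * (f - g)) = tr (h * f)" "tr (h * (f + c \<cdot>\<^sub>m g)) = tr (h * f)" if h: "h \<in> intw F E" for h
    using assms(3) h intw_dim(1,2)[OF h] intw_dim(1,2)[OF assms(1)] intw_dim(1,2)[OF assms(2)]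
    by (simp_all add: negl_def mult_minus_dim mult_add_dim mult_smult_dim tr_minus tr_add tr_smult)
  then show "treq E F (f - g) f" "treq E F (f + c \<cdot>\<^sub>m g) f" by (simp_all add: treq_def)
qed

lemma sym_relations_killed:
  fixes g :: "'a::field mat"
  assumes two: "(2 :: 'a) \<noteq> 0" and W: "square_mat W" and g: "g \<in> intw VV W" and n: "negl VV W (g * swap_minus_one)"
  shows "treq VV W (g * half_swap 1) g"
proof -
  have "g * half_swap 1 = g + (1 / 2) \<cdot>\<^sub>m (g * swap_minus_one)"
    unfolding half_swap_identities(3)[OF two] using intw_dim(1,2)[OF g] by (simp add: mult_add_dim mult_smult_dim)
  then show ?thesis
    using treq_diff_negl(2)[OF g intw_mult[OF VV_square VV_square W intw_swap_minus_one g] n] by simp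
qed

text \<open>The image of c - 1 is that of the antisymmetrizer. The symmetrizer kills c - 1, hence
  also the subobject \<open>m\<close>, so the antisymmetrizer fixes \<open>m\<close>; conversely c -
  1 factors through \<open>m\<close>.\<close>

lemma sym_relation_data:
  fixes R :: "'a::field concrete_obj"
  assumes two: "(2 :: 'a) \<noteq> 0"
    and R: "is_image_sum vcat [VV] {([VV], braid_minus_id vcat [Vmat])} R m"
  shows "\<exists>R' r h. R = [R'] \<and> square_mat R' \<and> m = cls R' VV r \<and> r \<in> intw R' VV \<and> h \<in> intw VV R' \<and>
    treq R' VV (half_swap (- 1) * r) r \<and> treq VV VV (r * h) (half_swap (- 1))"
proof -
  interpret split_regular_category "vcat :: 'a concrete_tensor_data" "\<lambda>X. dim_row (hd X)"
    by (rule vcat_split_regular)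
  have arr_cls: "arr [E] [F] (cls E F f)" if "square_mat E" "square_mat F" "f \<in> intw E F" for E F f :: "'a mat"
    unfolding arr_def using that by (simp add: vcat_HomI del: square_mat.simps)
  note V = VV_square and sm = intw_swap_minus_one and hs = intw_half_swap
  note R = R[unfolded braid_minus_id_vcat]
  obtain R' where R': "R = [R']" "square_mat R'" using R unfolding is_image_sum_def by auto
  obtain r where r: "r \<in> intw R' VV" "m = cls R' VV r"
    using R unfolding is_image_sum_def is_mono_def R'(1) vcat_Hom by blast
  have "Comp vcat (cls VV VV (half_swap 1)) m = Zero vcat R [VV]"
  proof (rule image_sum_killed[OF _ _ R])
    show "arr [VV] [VV] (cls VV VV (half_swap 1))" by (rule arr_cls[OF V V hs])
    fix U :: "'a concrete_obj" and f :: "'a concrete_mor" assume "(U, f) \<in> {([VV], cls VV VV swap_minus_one)}"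
    then have f: "U = [VV]" "f = cls VV VV swap_minus_one" by auto
    show "arr U [VV] f \<and> Comp vcat (cls VV VV (half_swap 1)) f = Zero vcat U [VV]"
      unfolding f vcat_Comp[OF V V V hs sm] half_swap_identities(1)[OF two] vcat_const
      using arr_cls[OF V V sm] by simp
  qed
  then have z: "negl R' VV (half_swap 1 * r)"
    unfolding R'(1) r(2) vcat_Comp[OF R'(2) V V hs r(1)] cls_Zero_iff[OF R'(2) V intw_mult[OF R'(2) V V r(1) hs]] .
  have "half_swap (- 1) * r = r - half_swap 1 * r"
    unfolding half_swap_identities(5)[OF two] using intw_dim(1,2)[OF r(1)] by (simp add: minus_mult_dim)
  then have 1: "treq R' VV (half_swap (- 1) * r) r"
    using treq_diff_negl(1)[OF r(1) intw_mult[OF R'(2) V V r(1) hs] z] by simp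
  have "factors_through vcat [VV] (cls VV VV swap_minus_one) R m" using R unfolding is_image_sum_def by blast
  then obtain h1 where "h1 \<in> Hom vcat [VV] [R']" and h1: "cls VV VV swap_minus_one = Comp vcat m h1"
    unfolding factors_through_def R'(1) by blast
  then obtain h0 where h0: "h0 \<in> intw VV R'" "h1 = cls VV R' h0" unfolding vcat_Hom by blast
  have rh0: "treq VV VV (r * h0) swap_minus_one"
    using h1 cls_eq_iff[OF sm intw_mult[OF V R'(2) V h0(1) r(1)]]
    unfolding h0(2) r(2) vcat_Comp[OF V R'(2) V r(1) h0(1)] by (simp add: treq_sym)
  \<comment> \<open>The antisymmetrizer is -1/2 times c - 1, so the factorization of c - 1 is scaled
    accordingly.\<close>
  define h where "h = (- 1 / 2) \<cdot>\<^sub>m h0"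
  have h: "h \<in> intw VV R'" unfolding h_def by (rule intw_smult[OF V R'(2) h0(1)])
  have "r * h = (- 1 / 2) \<cdot>\<^sub>m (r * h0)"
    using intw_dim(1,2)[OF r(1)] intw_dim(1,2)[OF h0(1)] by (simp add: h_def mult_smult_dim)
  then have "treq VV VV (r * h) (half_swap (- 1))"
    unfolding half_swap_identities(4)[OF two]
    using treq_smult[OF intw_mult[OF V R'(2) V h0(1) r(1)] sm rh0] by simp
  then show ?thesis using R' r h 1 by blast
qed

text \<open>The symmetrizer is the projection along the image of c - 1, as
  \<open>ex_image_sum_cokernel\<close> requires.\<close>

lemma sym_relations_exist:
  assumes two: "(2 :: 'a::field) \<noteq> 0"
  shows "\<exists>R m. is_image_sum (vcat :: 'a concrete_tensor_data) [VV] {([VV], braid_minus_id vcat [Vmat])} R m"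
proof -
  interpret split_regular_category "vcat :: 'a concrete_tensor_data" "\<lambda>X. dim_row (hd X)"
    by (rule vcat_split_regular)
  have arr_cls: "arr [E] [F] (cls E F f)" if "square_mat E" "square_mat F" "f \<in> intw E F" for E F f :: "'a mat"
    unfolding arr_def using that by (simp add: vcat_HomI del: square_mat.simps)
  note V = VV_square and sm = intw_swap_minus_one and hs = intw_half_swap
  have "\<exists>J m Q q. is_image_sum (vcat :: 'a concrete_tensor_data) [VV] {([VV], cls VV VV swap_minus_one)} J m \<and> is_cokernel vcat J [VV] m Q q"
  proof (rule ex_image_sum_cokernel[of "[VV]" "cls VV VV (half_swap 1)"])
    show "arr [VV] [VV] (cls VV VV (half_swap 1))" by (rule arr_cls[OF V V hs])
    fix U :: "'a concrete_obj" and f :: "'a concrete_mor" assume "(U, f) \<in> {([VV], cls VV VV swap_minus_one)}"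
    then have f: "U = [VV]" "f = cls VV VV swap_minus_one" by auto
    show "arr U [VV] f \<and> Comp vcat (cls VV VV (half_swap 1)) f = Zero vcat U [VV]"
      unfolding f vcat_Comp[OF V V V hs sm] half_swap_identities(1)[OF two] vcat_const
      using arr_cls[OF V V sm] by simp
  next
    fix W g assume g: "arr [VV :: 'a mat] W g"
      and gf: "\<And>U f. (U, f) \<in> {([VV], cls VV VV swap_minus_one)} \<Longrightarrow> Comp vcat g f = Zero vcat U W"
    obtain W' where W: "W = [W']" "square_mat W'" using g unfolding arr_def by auto
    obtain g' where g': "g' \<in> intw VV W'" "g = cls VV W' g'" using g unfolding arr_def W(1) vcat_Hom by blast
    have "Comp vcat g (cls VV VV swap_minus_one) = Zero vcat [VV] W" using gf by blast
    then have "negl VV W' (g' * swap_minus_one)"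
      unfolding W(1) g'(2) vcat_Comp[OF V V W(2) g'(1) sm] cls_Zero_iff[OF V W(2) intw_mult[OF V V W(2) sm g'(1)]] .
    then have "treq VV W' (g' * half_swap 1) g'" by (rule sym_relations_killed[OF two W(2) g'(1)])
    then show "Comp vcat g (cls VV VV (half_swap 1)) = g"
      unfolding g'(2) vcat_Comp[OF V V W(2) g'(1) hs] cls_eq_iff[OF intw_mult[OF V V W(2) hs g'(1)] g'(1)] .
  qed
  then show ?thesis unfolding braid_minus_id_vcat by blast
qed

text \<open>The kernel of c - 1 is the image of the symmetrizer: the symmetrizer factors through the
  kernel because c - 1 kills it, and it fixes the kernel because it is 1 plus a multiple of c -
  1.\<close>

lemma ext_relation_data:
  fixes R :: "'a::field concrete_obj"
  assumes two: "(2 :: 'a) \<noteq> 0"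
    and R: "is_kernel vcat [VV] [VV] (braid_minus_id vcat [Vmat]) R m"
  shows "\<exists>R' r h. R = [R'] \<and> square_mat R' \<and> m = cls R' VV r \<and> r \<in> intw R' VV \<and> h \<in> intw VV R' \<and>
    treq R' VV (half_swap 1 * r) r \<and> treq VV VV (r * h) (half_swap 1)"
proof -
  note V = VV_square and sm = intw_swap_minus_one and hs = intw_half_swap
  note R = R[unfolded braid_minus_id_vcat]
  obtain R' where R': "R = [R']" "square_mat R'" using R unfolding is_kernel_def by auto
  obtain r where r: "r \<in> intw R' VV" "m = cls R' VV r"
    using R unfolding is_kernel_def R'(1) vcat_Hom by blast
  have "Comp vcat (cls VV VV swap_minus_one) m = Zero vcat R [VV]" using R unfolding is_kernel_def by blast
  then have z: "negl R' VV (swap_minus_one * r)"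
    unfolding R'(1) r(2) vcat_Comp[OF R'(2) V V sm r(1)] cls_Zero_iff[OF R'(2) V intw_mult[OF R'(2) V V r(1) sm]] .
  have "half_swap 1 * r = r + (1 / 2) \<cdot>\<^sub>m (swap_minus_one * r)"
    unfolding half_swap_identities(3)[OF two] using intw_dim(1,2)[OF r(1)] by (simp add: add_mult_dim smult_mult_dim)
  then have 1: "treq R' VV (half_swap 1 * r) r"
    using treq_diff_negl(2)[OF r(1) intw_mult[OF R'(2) V V r(1) sm] z] by simp
  have "Comp vcat (cls VV VV swap_minus_one) (cls VV VV (half_swap 1)) = Zero vcat [VV] [VV :: 'a mat]"
    unfolding vcat_Comp[OF V V V sm hs] half_swap_identities(2)[OF two] by (simp add: vcat_const)
  moreover have "[VV :: 'a mat] \<in> Obj vcat" using V by simp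
  ultimately obtain h' where "h' \<in> Hom vcat [VV] R" "Comp vcat m h' = cls VV VV (half_swap 1)"
    using R vcat_HomI[OF hs[of "1 :: 'a"]] unfolding is_kernel_def by blast
  then obtain h where h: "h \<in> intw VV R'" "Comp vcat m (cls VV R' h) = cls VV VV (half_swap 1)"
    unfolding R'(1) vcat_Hom by blast
  have "treq VV VV (r * h) (half_swap 1)"
    using h(2) cls_eq_iff[OF intw_mult[OF V R'(2) V h(1) r(1)] hs]
    unfolding r(2) vcat_Comp[OF V R'(2) V r(1) h(1)] by simp
  then show ?thesis using R' r h(1) 1 by blast
qed

lemma ext_relations_exist:
  "\<exists>R m. is_kernel (vcat :: 'a::field concrete_tensor_data) [VV] [VV] (braid_minus_id vcat [Vmat]) R m"
proof -
  interpret split_regular_category "vcat :: 'a concrete_tensor_data" "\<lambda>X. dim_row (hd X)"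
    by (rule vcat_split_regular)
  have "[VV :: 'a mat] \<in> Obj vcat" using VV_square by simp
  then show ?thesis
    unfolding braid_minus_id_vcat by (intro kernel_exists vcat_HomI intw_swap_minus_one)
qed

text \<open>\<open>sym_power\<close> is an arbitrary choice. Existence makes the choice meaningful,
  and the value is the same for every object and every presentation of the relations.\<close>

lemma sym_power_dimension:
  fixes s :: "'a::field mat"
  assumes two: "(2 :: 'a) \<noteq> 0" and s: "s \<in> intw (Vn n) (Vn n)"
    and sP: "\<And>i j. i + j + 2 = n \<Longrightarrow> negl (Vn n) (Vn n) (s * ins i j (half_swap (- 1)))"
    and gP: "\<And>W g. \<lbrakk>square_mat W; g \<in> intw (Vn n) W;
        \<And>i j. i + j + 2 = n \<Longrightarrow> negl (Vn n) W (g * ins i j (half_swap (- 1)))\<rbrakk> \<Longrightarrow> treq (Vn n) W (g * s) g"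
  shows "dimension vcat (sym_power vcat [Vmat] n) = tr s"
proof -
  have *: "(\<exists>Q. is_quadratic_quotient vcat [Vmat] R m n Q) \<and>
      (\<forall>Q. is_quadratic_quotient vcat [Vmat] R m n Q \<longrightarrow> dimension vcat Q = tr s)"
    if Rm: "is_image_sum vcat [VV] {([VV], braid_minus_id vcat [Vmat])} R m" for R m
  proof -
    obtain R' r h where R: "R = [R']" "square_mat R'" "m = cls R' VV r" "r \<in> intw R' VV" "h \<in> intw VV R'"
      "treq R' VV (half_swap (- 1) * r) r" "treq VV VV (r * h) (half_swap (- 1))"
      using sym_relation_data[OF two Rm] by blast
    show ?thesis
      unfolding R(1,3) using quadratic_quotient_dimension[OF R(2,4) intw_half_swap R(5-7) s sP gP] by blast
  qed
  have "Tensor vcat [Vmat] [Vmat] = [VV :: 'a mat]" by simp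
  then have iff: "is_sym_power vcat [Vmat] n Q \<longleftrightarrow>
      (\<exists>R m. is_image_sum vcat [VV :: 'a mat] {([VV], braid_minus_id vcat [Vmat])} R m \<and> is_quadratic_quotient vcat [Vmat] R m n Q)" for Q
    unfolding is_sym_power_def by simp
  have "\<exists>Q. is_sym_power vcat [Vmat :: 'a mat] n Q" unfolding iff using sym_relations_exist[OF two] * by blast
  then have "is_sym_power vcat [Vmat :: 'a mat] n (sym_power vcat [Vmat] n)" unfolding sym_power_def by (rule someI_ex)
  then show ?thesis unfolding iff using * by blast
qed

lemma ext_power_dimension:
  fixes s :: "'a::field mat"
  assumes two: "(2 :: 'a) \<noteq> 0" and s: "s \<in> intw (Vn n) (Vn n)"
    and sP: "\<And>i j. i + j + 2 = n \<Longrightarrow> negl (Vn n) (Vn n) (s * ins i j (half_swap 1))"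
    and gP: "\<And>W g. \<lbrakk>square_mat W; g \<in> intw (Vn n) W;
        \<And>i j. i + j + 2 = n \<Longrightarrow> negl (Vn n) W (g * ins i j (half_swap 1))\<rbrakk> \<Longrightarrow> treq (Vn n) W (g * s) g"
  shows "dimension vcat (ext_power vcat [Vmat] n) = tr s"
proof -
  have *: "(\<exists>Q. is_quadratic_quotient vcat [Vmat] R m n Q) \<and>
      (\<forall>Q. is_quadratic_quotient vcat [Vmat] R m n Q \<longrightarrow> dimension vcat Q = tr s)"
    if Rm: "is_kernel vcat [VV] [VV] (braid_minus_id vcat [Vmat]) R m" for R m
  proof -
    obtain R' r h where R: "R = [R']" "square_mat R'" "m = cls R' VV r" "r \<in> intw R' VV" "h \<in> intw VV R'"
      "treq R' VV (half_swap 1 * r) r" "treq VV VV (r * h) (half_swap 1)"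
      using ext_relation_data[OF two Rm] by blast
    show ?thesis
      unfolding R(1,3) using quadratic_quotient_dimension[OF R(2,4) intw_half_swap R(5-7) s sP gP] by blast
  qed
  have "Tensor vcat [Vmat] [Vmat] = [VV :: 'a mat]" by simp
  then have iff: "is_ext_power vcat [Vmat] n Q \<longleftrightarrow>
      (\<exists>R m. is_kernel vcat [VV :: 'a mat] [VV] (braid_minus_id vcat [Vmat]) R m \<and> is_quadratic_quotient vcat [Vmat] R m n Q)" for Q
    unfolding is_ext_power_def by simp
  have "\<exists>Q. is_ext_power vcat [Vmat :: 'a mat] n Q" unfolding iff using ext_relations_exist * by blast
  then have "is_ext_power vcat [Vmat :: 'a mat] n (ext_power vcat [Vmat] n)" unfolding ext_power_def by (rule someI_ex)
  then show ?thesis unfolding iff using * by blast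
qed


subsection \<open>Dimensions of the symmetric and the exterior powers\<close>

text \<open>For \<open>g\<close> that kills the relations, every functional \<open>\<lambda>M. tr (h g M)\<close> absorbs transpositions of
  adjacent letters up to sign.\<close>

lemma tr_absorb_swap:
  fixes g h M :: "'a::field mat"
  assumes two: "(2 :: 'a) \<noteq> 0" and W: "square_mat W" and g: "g \<in> intw (Vn n) W" and h: "h \<in> intw W (Vn n)"
    and M: "M \<in> intw (Vn n) (Vn n)" and ij: "i + j + 2 = n" and \<epsilon>: "\<epsilon> * \<epsilon> = 1"
    and n: "negl (Vn n) W (g * ins i j (half_swap \<epsilon>))"
  shows "tr (h * (g * (ins i j swap * M))) = - \<epsilon> * tr (h * (g * M))"
proof -
  have V: "square_mat (Vn n)" by (rule Vn_square)
  have n2: "2 ^ i * 4 * 2 ^ j = (2 :: nat) ^ n" unfolding ij[symmetric] by (simp add: power_add)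
  note d = intw_dim(1,2)[OF g] intw_dim(1,2)[OF h] intw_dim(1,2)[OF M]
  have e: "ins i j (half_swap \<epsilon>) = (1 / 2) \<cdot>\<^sub>m (1\<^sub>m (2 ^ n) + \<epsilon> \<cdot>\<^sub>m ins i j swap)"
    unfolding n2[symmetric] by (simp add: half_swap_def ins_def kron_add kron_smult)
  \<comment> \<open>Moving \<open>M\<close> around the trace produces the test morphism
    \<open>M * h\<close>, to which the hypothesis of negligibility applies.\<close>
  have "tr (h * (g * (ins i j (half_swap \<epsilon>) * M))) = tr ((M * h) * (g * ins i j (half_swap \<epsilon>)))"
    using d n2 tr_comm[of "h * (g * ins i j (half_swap \<epsilon>))" M] by (simp add: mult_assoc_dim)
  also have "\<dots> = 0" using n intw_mult[OF W V V h M] unfolding negl_def by blast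
  finally have "(1 / 2) * (tr (h * (g * M)) + \<epsilon> * tr (h * (g * (ins i j swap * M)))) = 0"
    unfolding e using d n2 by (simp add: mat_dim_simps tr_smult tr_add)
  then have "tr (h * (g * M)) + \<epsilon> * tr (h * (g * (ins i j swap * M))) = 0" using two by simp
  then have "\<epsilon> * (tr (h * (g * M)) + \<epsilon> * tr (h * (g * (ins i j swap * M)))) = 0" by simp
  then have "\<epsilon> * tr (h * (g * M)) + (\<epsilon> * \<epsilon>) * tr (h * (g * (ins i j swap * M))) = 0" by (simp only: distrib_left mult.assoc)
  then show ?thesis unfolding \<epsilon> by (simp add: eq_neg_iff_add_eq_0 add.commute)
qed

lemma intw_ins_swap: "i + j + 2 = n \<Longrightarrow> ins i j swap \<in> intw (Vn n) (Vn n :: 'a::field mat)"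
  using intw_ins_VV[OF VV_square intw_swap, of i j] unfolding Vn_VV by blast

lemma symm_Suc_swap:
  assumes "Suc (Suc k) < CHAR('a::field)"
  shows "of_nat (Suc (Suc k)) \<cdot>\<^sub>m kron (symm (Suc (Suc k))) (1\<^sub>m (2 ^ j)) = kron (symm (Suc k)) (1\<^sub>m (2 ^ Suc j)) + of_nat (Suc k) \<cdot>\<^sub>m
    (kron (symm (Suc k)) (1\<^sub>m (2 ^ Suc j)) * (ins k j swap * kron (symm (Suc k)) (1\<^sub>m (2 ^ Suc j) :: 'a mat)))"
proof -
  have k: "kron (kron (symm (Suc k)) (1\<^sub>m 2)) (1\<^sub>m (2 ^ j)) = kron (symm (Suc k)) (1\<^sub>m (2 ^ Suc j) :: 'a mat)"
    by (simp add: kron_assoc)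
  have "kron (S * (B * S)) (1\<^sub>m (2 ^ j)) = kron S (1\<^sub>m (2 ^ j)) * (kron B (1\<^sub>m (2 ^ j)) * kron S (1\<^sub>m (2 ^ j)))"
    if "dim_col S = dim_row B" "dim_col B = dim_row S" for S B :: "'a mat"
    using that by (simp add: kron_mult)
  then show ?thesis
    using arg_cong[OF symm_Suc[OF assms], of "\<lambda>A. kron A (1\<^sub>m (2 ^ j))"]
    by (simp add: kron_smult kron_add k ins_def swap_def del: of_nat_Suc power_Suc)
      (simp add: power_Suc2 k[unfolded power_Suc2] del: of_nat_Suc power_Suc)
qed

text \<open>The recursion expresses the symmetrizer through transpositions of adjacent letters,
  which commute with the action; the scalar in front is invertible below the characteristic.\<close>

lemma intw_symm: "n < CHAR('a::field) \<Longrightarrow> symm n \<in> intw (Vn n) (Vn n :: 'a mat)"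
proof (induction n rule: nat_less_induct)
  case (1 n)
  consider "n = 0" | "n = Suc 0" | k where "n = Suc (Suc k)" by (cases n rule: nat.exhaust) (metis not0_implies_Suc)+
  then show ?case
  proof cases
    case 3
    let ?A = "kron (symm (Suc k)) (1\<^sub>m 2) :: 'a mat"
    have V: "square_mat (Vn n)" by (rule Vn_square)
    have "symm (Suc k) \<in> intw (Vn (Suc k)) (Vn (Suc k) :: 'a mat)" using 1 3 by auto
    then have A: "?A \<in> intw (Vn n) (Vn n)"
      using intw_kron[OF Vn_square(1,1) Vn_square(2,2) _ intw_one[OF Vn_square(2)], of "symm (Suc k)" "Suc k" "Suc k"] 3 by simp
    have "of_nat (Suc (Suc k)) \<cdot>\<^sub>m symm n = ?A + of_nat (Suc k) \<cdot>\<^sub>m (?A * (ins k 0 swap * ?A))"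
      using symm_Suc_swap[of k 0, where 'a = 'a] 1 3 kron_unit(2)[of "symm (Suc (Suc k)) :: 'a mat"] by simp
    also have "\<dots> \<in> intw (Vn n) (Vn n)"
      using 3 by (intro intw_add intw_smult intw_mult[OF V V V] A V intw_ins_swap) simp_all
    finally have "(1 / of_nat (Suc (Suc k))) \<cdot>\<^sub>m (of_nat (Suc (Suc k)) \<cdot>\<^sub>m symm n) \<in> intw (Vn n) (Vn n :: 'a mat)"
      by (rule intw_smult[OF V V])
    moreover have "(1 / of_nat (Suc (Suc k))) \<cdot>\<^sub>m (of_nat (Suc (Suc k)) \<cdot>\<^sub>m symm n) = (symm n :: 'a mat)"
      using of_nat_nonzero[of "Suc (Suc k)", where 'a = 'a] 1 3 by (intro eq_matI) (auto simp del: of_nat_Suc)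
    ultimately show ?thesis by simp
  next
    case 1
    have "1\<^sub>m 1 \<in> intw (Vn 0) (Vn 0 :: 'a mat)" using intw_one[OF Vn_square(1), of 0] by simp
    then show ?thesis unfolding 1 symm_small .
  next
    case 2
    have "1\<^sub>m 2 \<in> intw (Vn (Suc 0)) (Vn (Suc 0) :: 'a mat)"
      using intw_one[OF Vn_square(1), of "Suc 0", where 'a = 'a] unfolding Vn_dim power_Suc0_right .
    then show ?thesis unfolding 2 symm_small .
  qed
qed

text \<open>A functional that is invariant under transpositions of adjacent letters is invariant
  under the symmetrizer of the first n letters, by the recursion for it.\<close>

lemma tr_absorb_symm:
  fixes g h M :: "'a::field mat"
  assumes two: "(2 :: 'a) \<noteq> 0" and W: "square_mat W" and g: "g \<in> intw (Vn N) W" and h: "h \<in> intw W (Vn N)"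
    and n: "\<And>i j. i + j + 2 = N \<Longrightarrow> negl (Vn N) W (g * ins i j (half_swap (- 1)))"
  shows "\<lbrakk>n + j = N; n < CHAR('a); M \<in> intw (Vn N) (Vn N)\<rbrakk> \<Longrightarrow>
    tr (h * (g * (kron (symm n) (1\<^sub>m (2 ^ j)) * M))) = tr (h * (g * M))"
proof (induction n arbitrary: j M rule: nat_less_induct)
  case (1 n)
  note M = 1(4)
  have V: "square_mat (Vn N)" by (rule Vn_square)
  note d = intw_dim(1,2)[OF g] intw_dim(1,2)[OF h] intw_dim(1,2)[OF M]
  consider "n = 0" | "n = Suc 0" | k where "n = Suc (Suc k)" by (cases n rule: nat.exhaust) (metis not0_implies_Suc)+
  then show ?case
  proof cases
    case 1
    then show ?thesis using \<open>n + j = N\<close> d kron_unit(1)[of "1\<^sub>m (2 ^ j) :: 'a mat"] by (simp add: symm_small)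
  next
    case 2
    then have "(2::nat) * 2 ^ j = 2 ^ N" using \<open>n + j = N\<close> by auto
    then show ?thesis using 2 d by (simp add: symm_small)
  next
    case (3 k)
    let ?A = "kron (symm (Suc k)) (1\<^sub>m (2 ^ Suc j)) :: 'a mat"
    let ?C = "ins k j swap :: 'a mat"
    have N: "Suc k + Suc j = N" "k + j + 2 = N" using 1(2) 3 by auto
    have IH: "tr (h * (g * (?A * M'))) = tr (h * (g * M'))" if "M' \<in> intw (Vn N) (Vn N)" for M'
      using 1(1,3) 3 N that by auto
    have A: "?A \<in> intw (Vn N) (Vn N)"
      using intw_kron[OF Vn_square(1,1) Vn_square(1,1) intw_symm intw_one[OF Vn_square(1)], of "Suc k" "Suc j", where 'a = 'a] 1(3) 3
      unfolding Vn_add[symmetric] N by (simp add: mult.commute)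
    have C: "?C \<in> intw (Vn N) (Vn N)" using N by (intro intw_ins_swap)
    note AM = intw_mult[OF V V V M A] and CAM = intw_mult[OF V V V intw_mult[OF V V V M A] C]
    note dd = d intw_dim(1,2)[OF A] intw_dim(1,2)[OF C]
    have "of_nat (Suc (Suc k)) * tr (h * (g * (kron (symm n) (1\<^sub>m (2 ^ j)) * M))) =
      tr (h * (g * ((of_nat (Suc (Suc k)) \<cdot>\<^sub>m kron (symm n) (1\<^sub>m (2 ^ j))) * M)))"
      using d 3 N by (simp add: smult_mult_dim mult_smult_dim tr_smult power_add[symmetric] del: of_nat_Suc power_Suc)
    also have "\<dots> = tr (h * (g * (?A * M))) + of_nat (Suc k) * tr (h * (g * (?A * (?C * (?A * M)))))"
      unfolding 3 symm_Suc_swap[OF 1(3)[unfolded 3]] using dd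
      by (simp add: mat_dim_simps tr_add tr_smult del: of_nat_Suc power_Suc)
    \<comment> \<open>The second summand reduces by invariance under the shorter symmetrizer, then
      under the transposition, then under the shorter symmetrizer again. The total is 1 + (k + 1)
      copies, cancelled against the factor k + 2.\<close>
    also have "\<dots> = tr (h * (g * M)) + of_nat (Suc k) * tr (h * (g * M))"
      using IH[OF M] IH[OF CAM] IH[OF M] tr_absorb_swap[OF two W g h AM N(2) _ n[OF N(2)]] by simp
    also have "\<dots> = of_nat (Suc (Suc k)) * tr (h * (g * M))" by (simp add: algebra_simps)
    finally show ?thesis using of_nat_nonzero[of "Suc (Suc k)", where 'a = 'a] 1(3) 3 by (simp del: of_nat_Suc)
  qed
qed


lemma mult_ins_swap_column:
  fixes M :: "'a::field mat"
  assumes "dim_col M = 2 ^ i * (4 * 2 ^ j)" "r < dim_row M" "x < 2 ^ i" "b < 2" "a < 2" "y < 2 ^ j"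
  shows "(M * ins i j swap) $$ (r, x * (4 * 2 ^ j) + ((b * 2 + a) * 2 ^ j + y)) =
    M $$ (r, x * (4 * 2 ^ j) + ((a * 2 + b) * 2 ^ j + y))"
proof -
  let ?c = "(b * 2 + a) * 2 ^ j + y"
  let ?K = "kron swap (1\<^sub>m (2 ^ j)) :: 'a mat"
  have ba: "b * 2 + a < 4" "a * 2 + b < 4" using assms by simp_all
  have c: "?c < 4 * 2 ^ j" by (rule pair_index_less[OF ba(1) assms(6)])
  have "(M * ins i j swap) $$ (r, x * (4 * 2 ^ j) + ?c) =
    (\<Sum>u<2 ^ i. \<Sum>v<4 * 2 ^ j. M $$ (r, u * (4 * 2 ^ j) + v) * (1\<^sub>m (2 ^ i) $$ (u, x) * ?K $$ (v, ?c)))"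
    unfolding ins_def kron_assoc using assms c by (subst mult_kron_pair) auto
  also have "\<dots> = (\<Sum>u<2 ^ i. (\<Sum>v<4 * 2 ^ j. M $$ (r, u * (4 * 2 ^ j) + v) * ?K $$ (v, ?c)) * (if u = x then 1 else 0))"
    using assms by (intro sum.cong refl) auto
  also have "\<dots> = (\<Sum>v<4 * 2 ^ j. M $$ (r, x * (4 * 2 ^ j) + v) * ?K $$ (v, ?c))"
    unfolding delta_sums using assms by simp
  also have "\<dots> = (\<Sum>q<4. \<Sum>t<2 ^ j. M $$ (r, x * (4 * 2 ^ j) + (q * 2 ^ j + t)) * swap $$ (q, b * 2 + a) * (if t = y then 1 else 0))"
    unfolding sum_pair using assms ba by (intro sum.cong refl, subst kron_pair) auto
  also have "\<dots> = (\<Sum>q<4. M $$ (r, x * (4 * 2 ^ j) + (q * 2 ^ j + y)) * swap $$ (q, b * 2 + a))"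
    unfolding delta_sums using assms by simp
  also have "\<dots> = (\<Sum>q<2 * 2. M $$ (r, x * (4 * 2 ^ j) + (q * 2 ^ j + y)) * swap $$ (q, b * 2 + a))" by simp
  also have "\<dots> = (\<Sum>s<2. \<Sum>t<2. M $$ (r, x * (4 * 2 ^ j) + ((s * 2 + t) * 2 ^ j + y)) * (if s = a \<and> t = b then 1 else 0))"
    unfolding sum_pair swap_def using assms by (intro sum.cong refl) (simp add: braid_pair)
  also have "\<dots> = M $$ (r, x * (4 * 2 ^ j) + ((a * 2 + b) * 2 ^ j + y))"
    using assms(4,5) unfolding less_2_cases_iff sum_two by auto
  finally show ?thesis .
qed

text \<open>A column of the symmetrizer depends only on the weight of its word, which exchanging two
  letters preserves.\<close>

lemma symm_swap:
  assumes n: "i + j + 2 = n"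
  shows "symm n * ins i j swap = (symm n :: 'a::field mat)"
proof -
  have n2: "2 ^ n = (2 :: nat) ^ i * (4 * 2 ^ j)" unfolding n[symmetric] by (simp add: power_add)
  show ?thesis
  proof (rule eq_mat_pairI[of _ 1 "2 ^ n" "2 ^ i" "4 * 2 ^ j"])
    fix k r x c assume b: "k < (1 :: nat)" "r < (2 :: nat) ^ n" "x < (2 :: nat) ^ i" "c < (4 :: nat) * 2 ^ j"
    define y where "y = c mod 2 ^ j"
    define q where "q = c div 2 ^ j"
    have "q < 4" using b(4) by (simp add: q_def less_mult_imp_div_less)
    then have "q div 2 < 2" "q mod 2 < 2" "q = q div 2 * 2 + q mod 2" by auto
    then obtain s t where st: "s < 2" "t < 2" "q = s * 2 + t" by blast
    have "c = q * 2 ^ j + y" by (simp only: q_def y_def div_mult_mod_eq)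
    then have y: "y < 2 ^ j" "c = (s * 2 + t) * 2 ^ j + y" unfolding st(3) by (simp_all add: y_def)
    have q4: "s * 2 + t < 4" "t * 2 + s < 4" using st by simp_all
    have lt: "x * (4 * 2 ^ j) + (p * 2 ^ j + y) < 2 ^ n" if "p < 4" for p
      unfolding n2 by (rule pair_index_less[OF b(3) pair_index_less[OF that y(1)]])
    have pcw: "weight (x * (4 * 2 ^ j) + ((p * 2 + p') * 2 ^ j + y)) = weight x + p + p' + weight y" if "p < 2" "p' < 2" for p p'
    proof -
      have e: "x * (4 * 2 ^ j) + ((p * 2 + p') * 2 ^ j + y) = ((x * 2 + p) * 2 + p') * 2 ^ j + y" by (simp add: algebra_simps)
      show ?thesis unfolding e weight_pair[OF y(1)] weight_step[OF that(2)] weight_step[OF that(1)] by simp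
    qed
    have ts: "weight x + t + s + weight y = weight x + s + t + weight y" by simp
    have "(symm n * ins i j swap) $$ (r, x * (4 * 2 ^ j) + c) = (symm n :: 'a mat) $$ (r, x * (4 * 2 ^ j) + ((t * 2 + s) * 2 ^ j + y))"
      unfolding y(2) using b st y n2 by (intro mult_ins_swap_column) simp_all
    also have "\<dots> = symm n $$ (r, x * (4 * 2 ^ j) + c)"
      unfolding y(2) using lt[OF q4(1)] lt[OF q4(2)] b st by (simp add: symm_index pcw ts)
    finally show "(symm n * ins i j swap) $$ (k * 2 ^ n + r, x * (4 * 2 ^ j) + c) = (symm n :: 'a mat) $$ (k * 2 ^ n + r, x * (4 * 2 ^ j) + c)"
      using b(1) by simp
  qed (use n2 in auto)
qed

lemma ins_half_swap:
  assumes "i + j + 2 = n"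
  shows "ins i j (half_swap \<epsilon>) = (1 / 2) \<cdot>\<^sub>m (1\<^sub>m (2 ^ n) + \<epsilon> \<cdot>\<^sub>m ins i j (swap :: 'a::field mat))"
proof -
  have n2: "2 ^ i * 4 * 2 ^ j = (2 :: nat) ^ n" unfolding assms[symmetric] by (simp add: power_add)
  show ?thesis unfolding n2[symmetric] by (simp add: half_swap_def ins_def kron_add kron_smult)
qed

lemma negl_zero: "\<lbrakk>dim_row F = n; dim_row E = m\<rbrakk> \<Longrightarrow> negl E F (0\<^sub>m n m)"
  unfolding negl_iff_treq by simp

text \<open>The symmetrizer is the idempotent belonging to the symmetric power. The range includes n
  = p - 1, where the value is p = 0.\<close>

theorem dimension_sym_power:
  assumes two: "(2 :: 'a::field) \<noteq> 0" and n: "n < CHAR('a)"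
  shows "dimension vcat (sym_power vcat [Vmat :: 'a mat] n) = of_nat (Suc n)"
proof -
  have "dimension vcat (sym_power vcat [Vmat :: 'a mat] n) = tr (symm n :: 'a mat)"
  proof (rule sym_power_dimension[OF two intw_symm[OF n]])
    fix i j assume ij: "i + j + 2 = n"
    have n2: "2 ^ i * 4 * 2 ^ j = (2 :: nat) ^ n" unfolding ij[symmetric] by (simp add: power_add)
    have "symm n * ins i j (half_swap (- 1)) = (1 / 2) \<cdot>\<^sub>m (symm n + (- 1) \<cdot>\<^sub>m (symm n * ins i j (swap :: 'a mat)))"
      unfolding ins_half_swap[OF ij] using n2 by (simp add: mat_dim_simps)
    also have "\<dots> = 0\<^sub>m (2 ^ n) (2 ^ n)" unfolding symm_swap[OF ij] by (intro eq_matI) auto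
    finally show "negl (Vn n) (Vn n) (symm n * ins i j (half_swap (- 1 :: 'a)))" by (simp add: negl_zero)
  next
    fix W g :: "'a mat"
    assume W: "square_mat W" and g: "g \<in> intw (Vn n) W"
      and k: "\<And>i j. i + j + 2 = n \<Longrightarrow> negl (Vn n) W (g * ins i j (half_swap (- 1)))"
    show "treq (Vn n) W (g * symm n) g"
      unfolding treq_def
    proof
      fix h assume h: "h \<in> intw W (Vn n)"
      have one: "1\<^sub>m (2 ^ n) \<in> intw (Vn n) (Vn n :: 'a mat)" using intw_one[OF Vn_square(1), of n] by simp
      have "tr (h * (g * (kron (symm n) (1\<^sub>m (2 ^ 0)) * 1\<^sub>m (2 ^ n)))) = tr (h * (g * 1\<^sub>m (2 ^ n)))"
        by (rule tr_absorb_symm[OF two W g h k _ n one]) simp_all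
      then show "tr (h * (g * symm n)) = tr (h * g)"
        unfolding power_0 kron_unit using intw_dim(1,2)[OF g] by simp
    qed
  qed
  then show ?thesis using tr_symm[OF n] by simp
qed

text \<open>If every morphism that kills the relations is negligible, the zero matrix has the
  properties required of the idempotent.\<close>

lemma dimension_zero_criterion:
  assumes gz: "\<And>W g h. \<lbrakk>square_mat W; g \<in> intw (Vn n) W; h \<in> intw W (Vn n);
        \<And>i j. i + j + 2 = n \<Longrightarrow> negl (Vn n) W (g * ins i j (half_swap \<epsilon>))\<rbrakk> \<Longrightarrow> tr (h * g) = (0 :: 'a::field)"
  shows "0\<^sub>m (2 ^ n) (2 ^ n) \<in> intw (Vn n) (Vn n :: 'a mat)"
    "i + j + 2 = n \<Longrightarrow> negl (Vn n) (Vn n) (0\<^sub>m (2 ^ n) (2 ^ n) * ins i j (half_swap \<epsilon>))"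
    "\<lbrakk>square_mat W; g \<in> intw (Vn n) W; \<And>i j. i + j + 2 = n \<Longrightarrow> negl (Vn n) W (g * ins i j (half_swap \<epsilon>))\<rbrakk>
      \<Longrightarrow> treq (Vn n) W (g * 0\<^sub>m (2 ^ n) (2 ^ n)) g"
proof -
  show "0\<^sub>m (2 ^ n) (2 ^ n) \<in> intw (Vn n) (Vn n :: 'a mat)"
    using intw_zero[OF Vn_square(1,1), of n n] by simp
  show "negl (Vn n) (Vn n) (0\<^sub>m (2 ^ n) (2 ^ n) * ins i j (half_swap \<epsilon>))" if ij: "i + j + 2 = n"
  proof -
    have n2: "2 ^ i * 4 * 2 ^ j = (2 :: nat) ^ n" unfolding ij[symmetric] by (simp add: power_add)
    then show ?thesis by (simp add: negl_zero)
  qed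
  assume W: "square_mat W" and g: "g \<in> intw (Vn n) W"
    and k: "\<And>i j. i + j + 2 = n \<Longrightarrow> negl (Vn n) W (g * ins i j (half_swap \<epsilon>))"
  have "tr (h * (g * 0\<^sub>m (2 ^ n) (2 ^ n))) = tr (h * g)" if h: "h \<in> intw W (Vn n)" for h
    using gz[OF W g h k] intw_dim(1,2)[OF g] intw_dim(1,2)[OF h] by simp
  then show "treq (Vn n) W (g * 0\<^sub>m (2 ^ n) (2 ^ n)) g" by (simp add: treq_def)
qed

text \<open>A morphism that kills the relations absorbs the symmetrizer of the first p - 1 letters.
  That symmetrizer is negligible, and stays so after tensoring with the other letters, so the
  morphism is negligible too.\<close>

theorem dimension_sym_power_zero:
  assumes two: "(2 :: 'a::field) \<noteq> 0" and p: "0 < CHAR('a)" and n: "CHAR('a) \<le> n"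
  shows "dimension vcat (sym_power vcat [Vmat :: 'a mat] n) = 0"
proof -
  define q where "q = CHAR('a) - 1"
  define j where "j = n - q"
  have q: "q < CHAR('a)" "q + j = n" using p n by (simp_all add: q_def j_def)
  have z: "negl (Vn n) (Vn n) (kron (symm q) (1\<^sub>m (2 ^ j)) :: 'a mat)"
  proof -
    have one: "1\<^sub>m (2 ^ j) \<in> intw (Vn j) (Vn j :: 'a mat)" using intw_one[OF Vn_square(1), of j] by simp
    have zero: "0\<^sub>m (2 ^ q) (2 ^ q) \<in> intw (Vn q) (Vn q :: 'a mat)" using intw_zero[OF Vn_square(1,1), of q q] by simp
    have "treq (tsum (Vn q) (Vn j)) (tsum (Vn q) (Vn j)) (kron (symm q) (1\<^sub>m (2 ^ j))) (kron (0\<^sub>m (2 ^ q) (2 ^ q)) (1\<^sub>m (2 ^ j)) :: 'a mat)"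
      using symm_negligible[OF p] unfolding q_def[symmetric]
      by (intro treq_kron Vn_square intw_symm q zero one treq_refl)
    then have "treq (Vn n) (Vn n) (kron (symm q) (1\<^sub>m (2 ^ j))) (kron (0\<^sub>m (2 ^ q) (2 ^ q)) (1\<^sub>m (2 ^ j)) :: 'a mat)"
      unfolding Vn_add[symmetric] q(2) .
    moreover have "kron (0\<^sub>m (2 ^ q) (2 ^ q)) (1\<^sub>m (2 ^ j)) = (0\<^sub>m (2 ^ n) (2 ^ n) :: 'a mat)"
      by (simp add: q(2)[symmetric] power_add)
    ultimately show ?thesis unfolding negl_iff_treq by simp
  qed
  have gz: "tr (h * g) = 0" if W: "square_mat W" and g: "g \<in> intw (Vn n) W" and h: "h \<in> intw W (Vn n)"
      and k: "\<And>i j. i + j + 2 = n \<Longrightarrow> negl (Vn n) W (g * ins i j (half_swap (- 1)))" for W g h :: "'a mat"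
  proof -
    have one: "1\<^sub>m (2 ^ n) \<in> intw (Vn n) (Vn n :: 'a mat)" using intw_one[OF Vn_square(1), of n] by simp
    have qj: "2 ^ q * 2 ^ j = (2 :: nat) ^ n" using q(2) by (simp flip: power_add)
    note d = intw_dim(1,2)[OF g] intw_dim(1,2)[OF h]
    have "tr (h * g) = tr (h * (g * (kron (symm q) (1\<^sub>m (2 ^ j)) * 1\<^sub>m (2 ^ n))))"
      using tr_absorb_symm[OF two W g h k q(2,1) one] d by simp
    also have "\<dots> = tr ((h * g) * kron (symm q) (1\<^sub>m (2 ^ j)))" using d qj by (simp add: mult_assoc_dim)
    also have "\<dots> = 0" using z intw_mult[OF Vn_square(1) W Vn_square(1) g h] unfolding negl_def by blast
    finally show ?thesis .
  qed
  have "dimension vcat (sym_power vcat [Vmat :: 'a mat] n) = tr (0\<^sub>m (2 ^ n) (2 ^ n) :: 'a mat)"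
    by (rule sym_power_dimension[OF two dimension_zero_criterion[OF gz]]) simp_all
  then show ?thesis by simp
qed

lemma tr_swap: "tr swap = (2 :: 'a::field)"
proof -
  have "tr swap = (\<Sum>k<2 * 2. (swap :: 'a mat) $$ (k, k))" by (simp add: tr_def)
  also have "\<dots> = (\<Sum>x<2::nat. \<Sum>y<2::nat. if y = x then 1 else 0)"
    unfolding sum_pair swap_def by (intro sum.cong refl) (simp add: braid_pair)
  finally show ?thesis by simp
qed

lemma swap_row_left:
  fixes N :: "'a::field mat"
  assumes "dim_row N = 8" "c < dim_col N" "x < 2" "b < 2" "a < 2"
  shows "(kron swap (1\<^sub>m 2) * N) $$ ((x * 2 + b) * 2 + a, c) = N $$ ((b * 2 + x) * 2 + a, c)"
proof -
  have xb: "x * 2 + b < 4" using assms by simp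
  have "(kron swap (1\<^sub>m 2) * N) $$ ((x * 2 + b) * 2 + a, c) =
    (\<Sum>u<4. \<Sum>v<2. swap $$ (x * 2 + b, u) * 1\<^sub>m 2 $$ (a, v) * N $$ (u * 2 + v, c))"
    using assms xb by (subst kron_mult_pair) auto
  also have "\<dots> = (\<Sum>u<2 * 2. \<Sum>v<2. (if a = v then 1 else 0) * (swap $$ (x * 2 + b, u) * N $$ (u * 2 + v, c)))"
    using assms by (intro sum.cong) auto
  also have "\<dots> = (\<Sum>u<2 * 2. swap $$ (x * 2 + b, u) * N $$ (u * 2 + a, c))"
    unfolding delta_sums using assms by simp
  also have "\<dots> = (\<Sum>p<2. \<Sum>q<2. (if x = q \<and> b = p then 1 else 0) * N $$ ((p * 2 + q) * 2 + a, c))"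
    unfolding sum_pair swap_def using assms by (intro sum.cong refl) (simp add: braid_pair)
  also have "\<dots> = N $$ ((b * 2 + x) * 2 + a, c)"
    using assms(3,4) unfolding less_2_cases_iff sum_two by auto
  finally show ?thesis .
qed

text \<open>The alternating sum over the six permutations of three letters vanishes as there are only two letters.\<close>

lemma antisymmetrizer_zero:
  defines "c \<equiv> kron swap (1\<^sub>m 2) :: 'a::field mat" and "d \<equiv> kron (1\<^sub>m 2) swap"
  shows "1\<^sub>m 8 + (c * d + d * c) = c + (d + c * (d * c))"
proof (rule eq_mat_pairI[of _ 4 2 1 8])
  fix i k l j :: nat assume b: "i < 4" "k < 2" "l < 1" "j < 8"
  have dims: "dim_row c = 8" "dim_col c = 8" "dim_row d = 8" "dim_col d = 8" by (simp_all add: c_def d_def)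
  obtain x y where xy: "x < 2" "y < 2" "i = x * 2 + y" using b(1) by (metis div_mult_mod_eq less_mult_imp_div_less
      mod_less_divisor mult_2 numeral_Bit0 zero_less_numeral)
  have l: "(x' * 2 + y') * 2 + z' < 8" if "x' < 2" "y' < 2" "z' < 2" for x' y' z' :: nat using that by simp
  have C: "(c * N) $$ ((x' * 2 + y') * 2 + z', j) = N $$ ((y' * 2 + x') * 2 + z', j)"
    if "x' < 2" "y' < 2" "z' < 2" "dim_row N = 8" "dim_col N = 8" for x' y' z' N
    unfolding c_def using that b by (intro swap_row_left) simp_all
  have D: "(d * N) $$ ((x' * 2 + y') * 2 + z', j) = N $$ ((x' * 2 + z') * 2 + y', j)"
    if "x' < 2" "y' < 2" "z' < 2" "dim_row N = 8" "dim_col N = 8" for x' y' z' N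
    using braid_mid_mult[of N 1 j x' y' z'] that b unfolding d_def swap_def by simp
  \<comment> \<open>A fixed column of the identity; each of the six products evaluates it at a
    permutation of the letters of the row word.\<close>
  define e where "e = (\<lambda>r. (1\<^sub>m 8 :: 'a mat) $$ (r, j))"
  have C1: "c $$ ((x' * 2 + y') * 2 + z', j) = e ((y' * 2 + x') * 2 + z')" if "x' < 2" "y' < 2" "z' < 2" for x' y' z'
    using C[OF that, of "1\<^sub>m 8"] dims by (simp add: e_def)
  have D1: "d $$ ((x' * 2 + y') * 2 + z', j) = e ((x' * 2 + z') * 2 + y')" if "x' < 2" "y' < 2" "z' < 2" for x' y' z'
    using D[OF that, of "1\<^sub>m 8"] dims by (simp add: e_def)
  let ?r = "(x * 2 + y) * 2 + k"
  note k = b(2)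
  have cd: "(c * d) $$ (?r, j) = e ((y * 2 + k) * 2 + x)" "(d * c) $$ (?r, j) = e ((k * 2 + x) * 2 + y)"
    using C[OF xy(1,2) k dims(3,4)] D[OF xy(1,2) k dims(1,2)] D1[OF xy(2,1) k] C1[OF xy(1) k xy(2)] by simp_all
  have "(c * (d * c)) $$ (?r, j) = (d * c) $$ ((y * 2 + x) * 2 + k, j)"
    using dims by (intro C[OF xy(1,2) k]) simp_all
  then have cdc: "(c * (d * c)) $$ (?r, j) = e ((k * 2 + y) * 2 + x)"
    using D[OF xy(2,1) k dims(1,2)] C1[OF xy(2) k xy(1)] by simp
  have L: "(1\<^sub>m 8 + (c * d + d * c)) $$ (?r, j) =
      e ?r + (e ((y * 2 + k) * 2 + x) + e ((k * 2 + x) * 2 + y))"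
    using l[OF xy(1,2) k] b(4) dims unfolding cd[symmetric] by (simp add: e_def del: index_mult_mat(1))
  have R: "(c + (d + c * (d * c))) $$ (?r, j) =
      e ((y * 2 + x) * 2 + k) + (e ((x * 2 + k) * 2 + y) + e ((k * 2 + y) * 2 + x))"
    using l[OF xy(1,2) k] b(4) dims unfolding cdc[symmetric] C1[OF xy(1,2) k, symmetric] D1[OF xy(1,2) k, symmetric]
    by (simp del: index_mult_mat(1))
  \<comment> \<open>Among three letters from an alphabet of two, two are equal; their transposition
    matches even permutations with odd ones.\<close>
  have "(1\<^sub>m 8 + (c * d + d * c)) $$ (?r, j) = (c + (d + c * (d * c))) $$ (?r, j)"
    unfolding L R using xy(1,2) b(2) unfolding less_2_cases_iff by (elim disjE) (simp_all add: ac_simps)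
  then show "(1\<^sub>m 8 + (c * d + d * c)) $$ (i * 2 + k, l * 8 + j) = (c + (d + c * (d * c))) $$ (i * 2 + k, l * 8 + j)"
    using b(3) xy(3) by simp
qed (rule carrier_matI; simp add: c_def d_def)+

text \<open>Below degree 2 there are no relations. In degree 2 the idempotent is the
  antisymmetrizer, of trace (4 - 2) / 2 = 1. From degree 3 on, a functional that changes sign under
  transpositions vanishes by \<open>antisymmetrizer_zero\<close> for the first three
  letters.\<close>

theorem dimension_ext_power:
  assumes two: "(2 :: 'a::field) \<noteq> 0" and three: "(3 :: 'a) \<noteq> 0"
  shows "dimension vcat (ext_power vcat [Vmat :: 'a mat] n) = of_nat (2 choose n)"
proof -
  consider "n < 2" | "n = 2" | j where "n = j + 3"
    by (metis add.commute le_Suc_ex less_2_cases_iff linorder_not_less not_less_eq_eq numeral_2_eq_2 numeral_3_eq_3 le_antisym)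
  then show ?thesis
  proof cases
    case 1
    have one: "1\<^sub>m (2 ^ n) \<in> intw (Vn n) (Vn n :: 'a mat)" using intw_one[OF Vn_square(1), of n] by simp
    have "dimension vcat (ext_power vcat [Vmat :: 'a mat] n) = tr (1\<^sub>m (2 ^ n) :: 'a mat)"
      by (rule ext_power_dimension[OF two one]) (use 1 in \<open>auto dest: intw_dim(2)\<close>)
    then show ?thesis using 1 by (auto simp: less_2_cases_iff)
  next
    case 2
    have V2: "Vn 2 = (VV :: 'a mat)" by (simp only: numeral_2_eq_2 Vn.simps(2)[of "Suc 0"] Vn_one)
    have ins0: "ins 0 0 P = P" for P :: "'a mat" unfolding ins_def power_0 kron_unit ..
    have "dimension vcat (ext_power vcat [Vmat :: 'a mat] n) = tr (half_swap (- 1) :: 'a mat)"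
    proof (rule ext_power_dimension[OF two])
      show "half_swap (- 1) \<in> intw (Vn n) (Vn n :: 'a mat)" unfolding 2 V2 by (rule intw_half_swap)
      fix i j assume "i + j + 2 = n"
      then have ij: "i = 0" "j = 0" using 2 by auto
      show "negl (Vn n) (Vn n) (half_swap (- 1) * ins i j (half_swap 1) :: 'a mat)"
        unfolding ij ins0 half_swap_identities(6)[OF two] 2 by (intro negl_zero) simp_all
    next
      fix W g :: "'a mat"
      assume W: "square_mat W" and g: "g \<in> intw (Vn n) W"
        and k: "\<And>i j. i + j + 2 = n \<Longrightarrow> negl (Vn n) W (g * ins i j (half_swap 1))"
      have g': "g \<in> intw VV W" using g unfolding 2 V2 .
      have "negl VV W (g * half_swap 1)" using k[of 0 0] unfolding 2 V2 ins0 by simp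
      then have "treq VV W (g - g * half_swap 1) g"
        by (rule treq_diff_negl(1)[OF g' intw_mult[OF VV_square VV_square W intw_half_swap g']])
      moreover have "g * half_swap (- 1) = g - g * half_swap 1"
        unfolding half_swap_identities(5)[OF two] using intw_dim(1,2)[OF g'] by (simp add: mult_minus_dim)
      ultimately show "treq (Vn n) W (g * half_swap (- 1)) g" unfolding 2 V2 by simp
    qed
    also have "\<dots> = (1 / 2) * (4 - 2)" using tr_swap[where 'a = 'a] by (simp add: half_swap_def tr_smult tr_add)
    also have "\<dots> = 1" using two by simp
    finally show ?thesis using 2 by simp
  next
    case (3 j)
    have gz: "tr (h * g) = 0" if W: "square_mat W" and g: "g \<in> intw (Vn n) W" and h: "h \<in> intw W (Vn n)"
        and k: "\<And>i j. i + j + 2 = n \<Longrightarrow> negl (Vn n) W (g * ins i j (half_swap 1))" for W g h :: "'a mat"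
    proof -
      define c :: "'a mat" where "c = ins 0 (Suc j) swap"
      define d :: "'a mat" where "d = ins (Suc 0) j swap"
      have ij: "0 + Suc j + 2 = n" "Suc 0 + j + 2 = n" using 3 by auto
      have c: "c \<in> intw (Vn n) (Vn n)" and d: "d \<in> intw (Vn n) (Vn n)"
        unfolding c_def d_def by (rule intw_ins_swap[OF ij(1)], rule intw_ins_swap[OF ij(2)])
      note V = Vn_square(1)[of n, where 'a = 'a]
      have one: "1\<^sub>m (2 ^ n) \<in> intw (Vn n) (Vn n :: 'a mat)" using intw_one[OF V] by simp
      define L where "L M = tr (h * (g * M))" for M
      have Lc: "L (c * M) = - L M" and Ld: "L (d * M) = - L M" if M: "M \<in> intw (Vn n) (Vn n)" for M
        using tr_absorb_swap[OF two W g h M ij(1) _ k[OF ij(1)]] tr_absorb_swap[OF two W g h M ij(2) _ k[OF ij(2)]]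
        by (simp_all add: L_def c_def d_def)
      note di = intw_dim(1,2)[OF g] intw_dim(1,2)[OF h] intw_dim(1,2)[OF c] intw_dim(1,2)[OF d]
      have Ladd: "L (A + B) = L A + L B" if "A \<in> intw (Vn n) (Vn n)" "B \<in> intw (Vn n) (Vn n)" for A B
        using di intw_dim(1,2)[OF that(1)] intw_dim(1,2)[OF that(2)] by (simp add: L_def mult_add_dim tr_add)
      let ?k = "\<lambda>A :: 'a mat. kron A (1\<^sub>m (2 ^ j))"
      let ?c = "kron swap (1\<^sub>m 2) :: 'a mat" and ?d = "kron (1\<^sub>m 2) swap :: 'a mat"
      have cd: "c = ?k ?c" "d = ?k ?d"
        unfolding c_def d_def ins_def power_0 kron_unit by (simp_all add: kron_assoc)
      have km: "?k (A * B) = ?k A * ?k B" if "dim_col A = dim_row B" for A B using that by (simp add: kron_mult)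
      have "?k (1\<^sub>m 8) + (c * d + d * c) = c + (d + c * (d * c))"
        using arg_cong[OF antisymmetrizer_zero, of ?k] unfolding cd by (simp add: kron_add km)
      moreover have "?k (1\<^sub>m 8) = 1\<^sub>m (2 ^ n)" using 3 by (simp add: power_add mult.commute)
      ultimately have Z: "1\<^sub>m (2 ^ n) + (c * d + d * c) = c + (d + c * (d * c))" by simp
      note mu = intw_mult[OF V V V]
      have "L (1\<^sub>m (2 ^ n)) + (L (c * d) + L (d * c)) = L c + (L d + L (c * (d * c)))"
        using arg_cong[OF Z, of L]
        by (simp add: Ladd one c d mu[OF c d] mu[OF d c] mu[OF mu[OF c d] c] intw_add[OF V V mu[OF d c] mu[OF c d]]
            intw_add[OF V V d mu[OF mu[OF c d] c]])
      moreover have "L c = - L (1\<^sub>m (2 ^ n))" "L d = - L (1\<^sub>m (2 ^ n))" using Lc[OF one] Ld[OF one] di by simp_all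
      moreover have "L (c * d) = - L d" "L (d * c) = - L c" "L (c * (d * c)) = - L (d * c)"
        using Lc[OF d] Ld[OF c] Lc[OF mu[OF c d]] by simp_all
      \<comment> \<open>The even permutations contribute three times the value, the odd ones minus
        three times; this is where 6 has to be invertible.\<close>
      ultimately have "2 * (3 * L (1\<^sub>m (2 ^ n))) = 0" by (simp add: algebra_simps)
      then have "L (1\<^sub>m (2 ^ n)) = 0" using two three by (metis mult_eq_0_iff)
      then show ?thesis using di by (simp add: L_def)
    qed
    have "dimension vcat (ext_power vcat [Vmat :: 'a mat] n) = tr (0\<^sub>m (2 ^ n) (2 ^ n) :: 'a mat)"
      by (rule ext_power_dimension[OF two dimension_zero_criterion[OF gz]]) simp_all
    then show ?thesis using 3 by (simp add: binomial_eq_0)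
  qed
qed


no_notation vec_index (infixl "$" 100)

section \<open>Powers with \<open>p\<close>-adic exponents\<close>

lemma padic_digit_less:
  assumes "t \<in> padic_ints p" "1 < p"
  shows "padic_digit p t j < p"
proof -
  have "t (Suc j) < int p ^ Suc j" using assms(1) unfolding padic_ints_def by blast
  then have lt: "t (Suc j) < int p * int p ^ j" by simp
  have "t (Suc j) div int p ^ j < int p"
  proof (rule ccontr)
    assume "\<not> t (Suc j) div int p ^ j < int p"
    then have "int p * int p ^ j \<le> t (Suc j) div int p ^ j * int p ^ j" by (intro mult_right_mono) simp_all
    moreover have "0 \<le> t (Suc j) mod int p ^ j" using assms(2) by simp
    ultimately show False using lt div_mult_mod_eq[of "t (Suc j)" "int p ^ j"] by linarith
  qed
  then show ?thesis unfolding padic_digit_def using assms(2) by simp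
qed

text \<open>A p-adic integer is recovered from its digits, so two of them can be compared digit by
  digit.\<close>

lemma padic_digit_sum:
  assumes "t \<in> padic_ints p" "1 < p"
  shows "t n = (\<Sum>j<n. int (padic_digit p t j) * int p ^ j)"
proof (induction n)
  case 0
  have "0 \<le> t 0" "t 0 < int p ^ 0" using assms(1) unfolding padic_ints_def by blast+
  then show ?case by simp
next
  case (Suc n)
  have t: "0 \<le> t (Suc n)" "t (Suc n) mod int p ^ n = t n" using assms(1) unfolding padic_ints_def by blast+
  have "t (Suc n) = t (Suc n) mod int p ^ n + t (Suc n) div int p ^ n * int p ^ n"
    by (metis add.commute div_mult_mod_eq)
  also have "t (Suc n) div int p ^ n = int (padic_digit p t n)"
    using t(1) assms(2) by (simp add: padic_digit_def pos_imp_zdiv_nonneg_iff)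
  finally show ?case using Suc t(2) by simp
qed

lemma padic_ints_eqI:
  assumes "t \<in> padic_ints p" "s \<in> padic_ints p" "1 < p" "\<And>j. padic_digit p t j = padic_digit p s j"
  shows "t = s"
  using padic_digit_sum[OF assms(1,3)] padic_digit_sum[OF assms(2,3)] assms(4) by auto

section \<open>Convergence of the infinite product, and recovery of its exponent\<close>

definition partial_pow :: "nat \<Rightarrow> (nat \<Rightarrow> int) \<Rightarrow> nat \<Rightarrow> 'a::field fps" where
  "partial_pow p t N = (\<Prod>j<N. (1 + fps_X ^ (p ^ j)) ^ padic_digit p t j)"

text \<open>The expansion begins with 1 + d z^q, and no other degrees up to q occur.\<close>

lemma one_plus_pow_nth:
  fixes q :: nat
  assumes "0 < q"
  shows "n < q \<Longrightarrow> ((1 + fps_X ^ q) ^ d :: 'a::field fps) $ n = (if n = 0 then 1 else 0)"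
    "((1 + fps_X ^ q) ^ d :: 'a fps) $ q = of_nat d"
proof -
  have X: "(fps_X ^ q * f) $ n = (if n < q then 0 else f $ (n - q))" for f :: "'a fps" and n
    by (simp add: fps_X_power_mult_nth)
  have 1: "((1 + fps_X ^ q) ^ d :: 'a fps) $ n = (if n = 0 then 1 else 0)" if "n < q" for n d
    using that
  proof (induction d)
    case (Suc d) then show ?case by (simp add: distrib_right X)
  qed simp
  then show "n < q \<Longrightarrow> ((1 + fps_X ^ q) ^ d :: 'a fps) $ n = (if n = 0 then 1 else 0)" .
  show "((1 + fps_X ^ q) ^ d :: 'a fps) $ q = of_nat d"
  proof (induction d)
    case 0 then show ?case using assms by simp
  next
    case (Suc d) then show ?case using 1[of 0] assms by (simp add: distrib_right X)
  qed
qed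

lemma fps_mult_nth_small:
  fixes f g :: "'a::comm_ring_1 fps"
  assumes "\<And>i. 0 < i \<Longrightarrow> i < n \<Longrightarrow> g $ i = 0" "g $ 0 = 1" "0 < n"
  shows "(f * g) $ n = f $ n + f $ 0 * g $ n"
proof -
  have "(f * g) $ n = (\<Sum>i=0..n. f $ i * g $ (n - i))" by (rule fps_mult_nth)
  also have "\<dots> = (\<Sum>i\<in>{0, n}. f $ i * g $ (n - i))"
    using assms by (intro sum.mono_neutral_right) auto
  finally show ?thesis using assms by simp
qed

lemma partial_pow_zero [simp]: "1 < p \<Longrightarrow> partial_pow p t N $ 0 = 1"
  unfolding partial_pow_def by (induction N) (auto simp: one_plus_pow_nth)

text \<open>The N-th factor is 1 modulo z^(p^N), so it leaves lower coefficients unchanged.\<close>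

lemma partial_pow_step:
  assumes p: "1 < p" and n: "n < p ^ N"
  shows "partial_pow p t (Suc N) $ n = (partial_pow p t N $ n :: 'a::field)"
proof (cases "n = 0")
  case False
  have "((1 + fps_X ^ (p ^ N)) ^ padic_digit p t N :: 'a fps) $ n = 0"
    using one_plus_pow_nth(1)[of "p ^ N" n, where 'a = 'a] n p False by simp
  moreover have "partial_pow p t (Suc N) $ n =
    partial_pow p t N $ n + partial_pow p t N $ 0 * ((1 + fps_X ^ (p ^ N)) ^ padic_digit p t N :: 'a fps) $ n"
    unfolding partial_pow_def[of p t "Suc N"] prod.lessThan_Suc partial_pow_def[of p t N, symmetric]
    using one_plus_pow_nth(1)[of "p ^ N", where 'a = 'a] n p False by (intro fps_mult_nth_small) auto
  ultimately show ?thesis by simp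
qed (use p in simp)

lemma partial_pow_stable:
  assumes p: "1 < p" and n: "n < p ^ N" and M: "N \<le> M"
  shows "partial_pow p t M $ n = (partial_pow p t N $ n :: 'a::field)"
  using M
proof (induction M rule: dec_induct)
  case (step M)
  have "p ^ N \<le> p ^ M" using p step by (intro power_increasing) auto
  then show ?case using partial_pow_step[OF p, of n M t, where 'a = 'a] n step by simp
qed simp

text \<open>The limit in the definition exists because every coefficient stabilizes; from here on
  only finite products are needed.\<close>

lemma one_plus_z_pow_nth:
  assumes p: "1 < p" and n: "n < p ^ N"
  shows "one_plus_z_pow p t $ n = (partial_pow p t N $ n :: 'a::field)"
proof -
  \<comment> \<open>A diagonal choice: since n < p^n, the n-th coefficient is already stable in the
    n-th partial product.\<close>
  define L where "L = Abs_fps (\<lambda>n. partial_pow p t n $ n :: 'a)"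
  have np: "n < p ^ n" for n using power_gt_expt[of p] p by simp
  have "partial_pow p t \<longlonglongrightarrow> L"
  proof (rule tendsto_fpsI)
    fix n
    show "\<forall>\<^sub>F M in sequentially. partial_pow p t M $ n = L $ n"
      using partial_pow_stable[OF p np[of n]] unfolding L_def eventually_sequentially by auto
  qed
  then have "one_plus_z_pow p t = L"
    unfolding one_plus_z_pow_def partial_pow_def[symmetric] by (rule limI)
  then have "one_plus_z_pow p t $ n = (partial_pow p t n $ n :: 'a)" by (simp add: L_def)
  also have "\<dots> = partial_pow p t (max n N) $ n" using partial_pow_stable[OF p np[of n], of "max n N" t, where 'a = 'a] by simp
  also have "\<dots> = partial_pow p t N $ n" using partial_pow_stable[OF p n, of "max n N" t, where 'a = 'a] by simp
  finally show ?thesis .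
qed

lemma of_nat_eq_below_char:
  assumes "(of_nat a :: 'a::field) = of_nat b" "a < CHAR('a)" "b < CHAR('a)"
  shows "a = b"
  using assms
proof (induction a b rule: linorder_wlog)
  case (le a b)
  then have "(of_nat (b - a) :: 'a) = 0" by (simp add: of_nat_diff)
  then have "CHAR('a) dvd b - a" by (simp add: of_nat_eq_0_iff_char_dvd)
  then show ?case using le by (auto dest: dvd_imp_le)
qed simp

text \<open>The exponent can be read off: the coefficient of \<open>z ^ (p ^ N)\<close> is that of the product over the digits
  below \<open>N\<close> plus the \<open>N\<close>-th digit.\<close>

lemma one_plus_z_pow_inject:
  fixes t s :: "nat \<Rightarrow> int"
  assumes p: "CHAR('a::field) = p" "1 < p" and ts: "t \<in> padic_ints p" "s \<in> padic_ints p"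
    and eq: "one_plus_z_pow p t = (one_plus_z_pow p s :: 'a fps)"
  shows "t = s"
proof (rule padic_ints_eqI[OF ts p(2)])
  fix N
  show "padic_digit p t N = padic_digit p s N"
  proof (induction N rule: less_induct)
    case (less N)
    have same: "partial_pow p t N = (partial_pow p s N :: 'a fps)"
      unfolding partial_pow_def using less by (intro prod.cong) auto
    have c: "one_plus_z_pow p t $ (p ^ N) = partial_pow p t N $ (p ^ N) + (of_nat (padic_digit p t N) :: 'a)" for t
    proof -
      have "p ^ N < p ^ Suc N" using p(2) by simp
      then have "one_plus_z_pow p t $ (p ^ N) = (partial_pow p t (Suc N) $ (p ^ N) :: 'a)"
        by (rule one_plus_z_pow_nth[OF p(2)])
      also have "\<dots> = partial_pow p t N $ (p ^ N) + partial_pow p t N $ 0 * ((1 + fps_X ^ (p ^ N)) ^ padic_digit p t N) $ (p ^ N)"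
        unfolding partial_pow_def[of p t "Suc N"] prod.lessThan_Suc partial_pow_def[of p t N, symmetric]
        using one_plus_pow_nth(1)[of "p ^ N", where 'a = 'a] p by (intro fps_mult_nth_small) auto
      finally show ?thesis using p(2) one_plus_pow_nth(2)[of "p ^ N", where 'a = 'a] by simp
    qed
    have "(of_nat (padic_digit p t N) :: 'a) = of_nat (padic_digit p s N)"
      using c[of t] c[of s] eq same by simp
    then show ?case
      using of_nat_eq_below_char[where 'a = 'a] padic_digit_less[OF ts(1) p(2)] padic_digit_less[OF ts(2) p(2)] p(1)
      by blast
  qed
qed

lemma padic_of_int: "0 < p \<Longrightarrow> (\<lambda>n. k mod int p ^ n) \<in> padic_ints p"
  by (auto simp: padic_ints_def mod_mod_cancel le_imp_power_dvd)

lemma padic_uminus_closed: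
  assumes "t \<in> padic_ints p" "0 < p"
  shows "padic_uminus p t \<in> padic_ints p"
proof -
  have "(- t (Suc n)) mod int p ^ n = (- t n) mod int p ^ n" for n
    using assms(1) by (metis (mono_tags, lifting) mem_Collect_eq mod_minus_eq padic_ints_def)
  then have "(- t (Suc n)) mod int p ^ Suc n mod int p ^ n = (- t n) mod int p ^ n" for n
    by (simp add: mod_mod_cancel)
  then show ?thesis using assms(2) by (auto simp: padic_ints_def padic_uminus_def)
qed

lemma padic_uminus_involution:
  assumes "t \<in> padic_ints p"
  shows "padic_uminus p (padic_uminus p t) = t"
proof
  fix n
  have "0 \<le> t n" "t n < int p ^ n" using assms unfolding padic_ints_def by blast+
  then show "padic_uminus p (padic_uminus p t) n = t n"
    by (simp add: padic_uminus_def mod_minus_eq)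
qed

lemma one_plus_z_pow_digit:
  assumes p: "1 < p" and k: "k < p"
  shows "one_plus_z_pow p (\<lambda>n. int k mod int p ^ n) = ((1 + fps_X) ^ k :: 'a::field fps)"
proof -
  let ?t = "\<lambda>n. int k mod int p ^ n"
  have d0: "padic_digit p ?t 0 = k" using k by (simp add: padic_digit_def)
  have ds: "padic_digit p ?t (Suc j) = 0" for j
  proof -
    have "int k < int p ^ Suc j" using k p by (metis le_imp_power_dvd less_le_trans of_nat_less_iff of_nat_power self_le_power Suc_pred'
          One_nat_def less_imp_le zero_less_Suc)
    moreover have "int p ^ Suc j \<le> int p ^ Suc (Suc j)" using p by (intro power_increasing) auto
    ultimately show ?thesis by (simp add: padic_digit_def)
  qed
  have "partial_pow p ?t (Suc N) = ((1 + fps_X) ^ k :: 'a fps)" for N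
  proof (induction N)
    case 0 then show ?case by (simp add: partial_pow_def d0)
  next
    case (Suc N) then show ?case by (simp add: partial_pow_def ds)
  qed
  moreover have "n < p ^ Suc n" for n using power_gt_expt[of p "Suc n"] p by simp
  ultimately have "one_plus_z_pow p ?t $ n = ((1 + fps_X) ^ k :: 'a fps) $ n" for n
    using one_plus_z_pow_nth[OF p, of n "Suc n" ?t, where 'a = 'a] by simp
  then show ?thesis by (rule fps_ext)
qed

text \<open>The substitution of -z for z is an involution, so it can be undone.\<close>

lemma one_minus_z_pow_inject:
  assumes "(one_minus_z_pow p t :: 'a::field fps) = one_minus_z_pow p s"
  shows "one_plus_z_pow p t = (one_plus_z_pow p s :: 'a fps)"
proof -
  have "fps_compose (fps_compose f (- fps_X)) (- fps_X) = (f :: 'a fps)" for f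
  proof -
    have "fps_compose (fps_compose f (- fps_X)) (- fps_X) = fps_compose f (fps_compose (- fps_X) (- fps_X))"
      by (rule fps_compose_assoc[symmetric]) simp_all
    also have "fps_compose (- fps_X) (- fps_X) = (fps_X :: 'a fps)" by (simp add: fps_compose_uminus)
    finally show ?thesis by simp
  qed
  then show ?thesis using assms unfolding one_minus_z_pow_def by metis
qed

lemma one_plus_X_power_nth: "((1 + fps_X) ^ k :: 'a::field fps) $ n = of_nat (k choose n)"
proof (induction k arbitrary: n)
  case 0 then show ?case by (cases n) auto
next
  case (Suc k) then show ?case by (cases n) (auto simp: distrib_right fps_X_mult_nth)
qed

text \<open>By the binomial theorem the series is (1 + z)^k with a one-digit exponent;
  \<open>one_plus_z_pow_inject\<close> gives the uniqueness that the description asks for.\<close>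

lemma Dim_minus_eq:
  fixes C :: "('o, 'm, 'k::field, 'z) tensor_data_scheme"
  assumes p: "CHAR('k) = p" "1 < p" and k: "k < p"
    and dims: "\<And>j. dimension C (ext_power C X j) = of_nat (k choose j)"
  shows "Dim_minus C X = (\<lambda>n. int k mod int p ^ n)"
  unfolding Dim_minus_def p(1)
proof (rule the_equality)
  have "(1 + fps_X) ^ k = (Abs_fps (\<lambda>j. of_nat (k choose j)) :: 'k fps)"
    by (rule fps_ext) (simp add: one_plus_X_power_nth)
  then have e: "Abs_fps (\<lambda>j. dimension C (ext_power C X j)) = one_plus_z_pow p (\<lambda>n. int k mod int p ^ n)"
    unfolding one_plus_z_pow_digit[OF p(2) k] dims by simp
  then show "(\<lambda>n. int k mod int p ^ n) \<in> padic_ints p \<and>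
    Abs_fps (\<lambda>j. dimension C (ext_power C X j)) = one_plus_z_pow p (\<lambda>n. int k mod int p ^ n)"
    using padic_of_int p(2) by simp
  fix d assume "d \<in> padic_ints p \<and> Abs_fps (\<lambda>j. dimension C (ext_power C X j)) = one_plus_z_pow p d"
  then show "d = (\<lambda>n. int k mod int p ^ n)"
    using one_plus_z_pow_inject[OF p] padic_of_int[of p "int k"] p(2) e by auto
qed

text \<open>The definition uses the exponent -d, so a polynomial (1 - z)^k belongs to d =
  -k.\<close>

lemma Dim_plus_eq:
  fixes C :: "('o, 'm, 'k::field, 'z) tensor_data_scheme"
  assumes p: "CHAR('k) = p" "1 < p" and k: "k < p"
    and dims: "Abs_fps (\<lambda>j. dimension C (sym_power C X j)) = (1 - fps_X) ^ k"
  shows "Dim_plus C X = padic_uminus p (\<lambda>n. int k mod int p ^ n)"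
  unfolding Dim_plus_def p(1)
proof (rule the_equality)
  let ?t = "\<lambda>n. int k mod int p ^ n"
  have t: "?t \<in> padic_ints p" using padic_of_int p(2) by simp
  have "one_minus_z_pow p ?t = ((1 - fps_X) ^ k :: 'k fps)"
    unfolding one_minus_z_pow_def one_plus_z_pow_digit[OF p(2) k]
    by (simp add: fps_compose_power[symmetric] fps_compose_add_distrib)
  then have e: "Abs_fps (\<lambda>j. dimension C (sym_power C X j)) = one_minus_z_pow p ?t" unfolding dims by simp
  then show "padic_uminus p ?t \<in> padic_ints p \<and>
    Abs_fps (\<lambda>j. dimension C (sym_power C X j)) = one_minus_z_pow p (padic_uminus p (padic_uminus p ?t))"
    using padic_uminus_closed[OF t] p(2) unfolding padic_uminus_involution[OF t] by simp
  fix d assume d: "d \<in> padic_ints p \<and> Abs_fps (\<lambda>j. dimension C (sym_power C X j)) = one_minus_z_pow p (padic_uminus p d)"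
  then have "one_plus_z_pow p (padic_uminus p d) = (one_plus_z_pow p ?t :: 'k fps)"
    using e by (intro one_minus_z_pow_inject) simp
  then have "padic_uminus p d = ?t"
    using d p(2) by (intro one_plus_z_pow_inject[OF p padic_uminus_closed t]) auto
  then show "d = padic_uminus p ?t" using padic_uminus_involution[of d p] d by simp
qed

text \<open>\<open>(1 - z)\<^sup>2\<close> times the series is \<open>1 - z\<^sup>p\<close>, and \<open>1 - z\<^sup>p = (1 - z)\<^sup>p\<close> in characteristic \<open>p\<close>.\<close>

lemma truncated_derivative_series:
  assumes p: "CHAR('a::field) = p" "2 \<le> p"
  shows "Abs_fps (\<lambda>j. if j < p then of_nat (Suc j) else 0) = ((1 - fps_X) ^ (p - 2) :: 'a fps)"
proof -
  let ?f = "Abs_fps (\<lambda>j. if j < p then of_nat (Suc j) else 0) :: 'a fps"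
  have pr: "prime CHAR('a)" using p by (intro prime_CHAR_semidom) simp
  have p0: "(of_nat p :: 'a) = 0" using of_nat_CHAR[where 'a = 'a] p(1) by simp
  have "(1 - fps_X) * ?f = Abs_fps (\<lambda>j. if j < p then 1 else 0)"
  proof (rule fps_ext)
    fix n
    show "((1 - fps_X) * ?f) $ n = (Abs_fps (\<lambda>j. if j < p then 1 else 0) :: 'a fps) $ n"
    proof (cases n)
      case (Suc m)
      \<comment> \<open>At degree p the cut-off leaves minus the last coefficient, which is -p =
        0.\<close>
      have "of_nat (Suc m) = (0 :: 'a)" if "m < p" "\<not> Suc m < p"
      proof -
        have "Suc m = p" using that by simp
        then show ?thesis using p0 by simp
      qed
      then show ?thesis using Suc by (auto simp: left_diff_distrib fps_X_mult_nth simp del: of_nat_Suc) simp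
    qed (use p in \<open>simp add: left_diff_distrib\<close>)
  qed
  moreover have "(1 - fps_X) * Abs_fps (\<lambda>j. if j < p then 1 else 0) = (1 - fps_X ^ p :: 'a fps)"
  proof (rule fps_ext)
    fix n
    show "((1 - fps_X) * Abs_fps (\<lambda>j. if j < p then 1 else 0)) $ n = (1 - fps_X ^ p :: 'a fps) $ n"
      using p(2) by (cases n) (auto simp: left_diff_distrib fps_X_mult_nth)
  qed
  moreover have "(1 - fps_X ^ p :: 'a fps) = (1 - fps_X) ^ p"
  proof -
    have c: "CHAR('a fps) = CHAR('a)" by simp
    have "(1 - fps_X + fps_X) ^ p = (1 - fps_X) ^ p + (fps_X ^ p :: 'a fps)"
    proof (rule freshmans_dream)
      show "prime CHAR('a fps)" unfolding c by (rule pr)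
      show "p = CHAR('a fps)" unfolding c using p(1) by simp
    qed
    then have "1 ^ p = (1 - fps_X) ^ p + (fps_X ^ p :: 'a fps)" by (simp only: diff_add_cancel)
    then show ?thesis by (simp only: power_one diff_eq_eq)
  qed
  ultimately have "(1 - fps_X) * ((1 - fps_X) * ?f) = (1 - fps_X) ^ p" by (simp only:)
  also have "\<dots> = (1 - fps_X) * ((1 - fps_X) * (1 - fps_X) ^ (p - 2))"
  proof -
    have "f ^ p = f * (f * f ^ (p - 2))" for f :: "'a fps"
    proof -
      have "2 + (p - 2) = p" using p(2) by simp
      then have "f ^ p = f ^ (2 + (p - 2))" by (simp only:)
      then show ?thesis by (simp only: power_add power2_eq_square mult.assoc)
    qed
    then show ?thesis .
  qed
  finally have a: "(1 - fps_X) * ((1 - fps_X) * ?f) = (1 - fps_X) * ((1 - fps_X) * (1 - fps_X) ^ (p - 2))" .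
  have "(1 - fps_X :: 'a fps) $ 0 \<noteq> 0 $ 0" by simp
  then have nz: "(1 - fps_X :: 'a fps) \<noteq> 0" by metis
  show ?thesis using a unfolding mult_cancel_left using nz by blast
qed


section \<open>The example\<close>

theorem mainTheorem3:
  fixes p :: nat
  assumes "CHAR('k::alg_closed_field) = p" and "p \<ge> 5"
  shows "\<exists>(C :: 'k concrete_tensor_data) X.
    symmetric_tensor_category C \<and> X \<in> Obj C \<and> Dim_plus C X \<noteq> Dim_minus C X"
proof -
  define X :: "'k concrete_obj" where "X = [Vmat]"
  note p = assms(1)
  have p2: "1 < p" "2 \<le> p" "p - 2 < p" "2 < p" using assms(2) by auto
  have two: "(2 :: 'k) \<noteq> 0" using of_nat_nonzero[of 2, where 'a = 'k] p assms(2) by simp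
  have three: "(3 :: 'k) \<noteq> 0" using of_nat_nonzero[of 3, where 'a = 'k] p assms(2) by simp
  have minus: "Dim_minus vcat X = (\<lambda>n. int 2 mod int p ^ n)"
    unfolding X_def by (rule Dim_minus_eq[OF p p2(1,4)]) (rule dimension_ext_power[OF two three])
  \<comment> \<open>The cut at j < p agrees with the vanishing from degree p - 1 on, since the
    coefficient at p - 1 is p = 0.\<close>
  have "Abs_fps (\<lambda>j. dimension vcat (sym_power vcat X j)) = Abs_fps (\<lambda>j. if j < p then of_nat (Suc j) else 0 :: 'k)"
    using dimension_sym_power[OF two] dimension_sym_power_zero[OF two] p assms(2)
    by (intro fps_ext) (auto simp: X_def simp del: of_nat_Suc)
  then have plus: "Dim_plus vcat X = padic_uminus p (\<lambda>n. int (p - 2) mod int p ^ n)"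
    unfolding truncated_derivative_series[OF p p2(2)] by (rule Dim_plus_eq[OF p p2(1,3)])
  have "Dim_plus vcat X \<noteq> Dim_minus vcat X"
  proof
    assume "Dim_plus vcat X = Dim_minus vcat X"
    \<comment> \<open>Modulo p both exponents are 2; the comparison modulo p^2 is the first one that
      separates 2 - p from 2.\<close>
    then have "Dim_plus vcat X 2 = Dim_minus vcat X 2" by simp
    then have "(- int (p - 2)) mod int p ^ 2 = 2 mod int p ^ 2"
      unfolding plus minus padic_uminus_def by (simp add: mod_minus_eq)
    then have "int p ^ 2 dvd - int (p - 2) - 2" by (simp add: mod_eq_dvd_iff)
    also have "- int (p - 2) - 2 = - int p" using p2 by simp
    finally have "int p ^ 2 dvd int p" by simp
    then have "int p * int p \<le> int p" using p2 by (intro zdvd_imp_le) (simp_all add: power2_eq_square)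
    then show False using p2 by simp
  qed
  moreover have "X \<in> Obj vcat" using Vn_square(2) by (simp add: X_def)
  ultimately show ?thesis using vcat_symmetric_tensor_category by blast
qed

end
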